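(* Let $\Omega\subset\mathbb{R}^n$ be an $(\varepsilon,\infty)$-domain with $\varepsilon\in(0,1]$, $p\in[1,\infty)$ and $\gamma\in\mathbb{R}\setminus\{0\}$. Let $X(\mathbb{R}^n)$ be a ball Banach function space such that (i) $X^{1/p}(\mathbb{R}^n)$ is a ball Banach function space; (ii) both $X(\mathbb{R}^n)$ and $X'(\mathbb{R}^n)$ have absolutely continuous norms; (iii) the Hardy--Littlewood maximal operator $\mathcal{M}$ is bounded on $[X^{1/p}(\mathbb{R}^n)]'$; (iv) if $p=1$, then in addition $\mathcal{M}$ is bounded on $X(\mathbb{R}^n)$. Then $f\in\dot W^{1,X}(\Omega)$ if and only if $f\in L^1_{\mathrm{loc}}(\Omega)$ and $$\sup_{\lambda\in(0,\infty)}\lambda\left\|\left[\int_{\Omega}\mathbf{1}_{E_{\lambda,\gamma/p}[f]}(\cdot,y)\,|\cdot-y|^{\gamma-n}\,dy\right]^{1/p}\right\|_{X(\Omega)}<\infty;$$ moreover, for such $f$ this supremum is equivalent to $\|\,|\nabla f|\,\|_{X(\Omega)}$, with positive equivalence constants independent of $f$.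
   Context: A ball Banach function space $X(\mathbb{R}^n)$ is a Banach space of measurable functions on $\mathbb{R}^n$ whose norm is defined for all measurable functions and satisfies: (a) $\|f\|_X=0$ implies $f=0$ a.e.; (b) $|g|\le|f|$ a.e. implies $\|g\|_X\le\|f\|_X$; (c) $0\le f_m\uparrow f$ a.e. implies $\|f_m\|_X\uparrow\|f\|_X$; (d) $\mathbf 1_B\in X$ for every ball $B$; (e) triangle inequality; (f) for every ball $B$ there is $C_{(B)}$ with $\int_B|f|\le C_{(B)}\|f\|_X$. Convexification: $X^{1/p}:=\{f:\ |f|^{1/p}\in X\}$ with $\|f\|_{X^{1/p}}:=\|\,|f|^{1/p}\|_X^p$. Associate space: $\|f\|_{Y'}:=\sup\{\|fg\|_{L^1}:\ \|g\|_Y=1\}$, $Y'$ the set where this is finite. Absolutely continuous norm: $\|f\mathbf 1_{E_j}\|_Y\to0$ whenever $f\in Y$ and $\mathbf 1_{E_j}\to0$ a.e. $\mathcal{M}$ is the Hardy--Littlewood maximal operator (over balls). Restrictive space: $X(\Omega)$ is the set of measurable $f$ on $\Omega$ with $f=g|_\Omega$ for some $g\in X(\mathbb{R}^n)$, $\|f\|_{X(\Omega)}:=\inf\|g\|_{X(\mathbb{R}^n)}$ over such $g$ (equal to the $X(\mathbb{R}^n)$-norm of the extension of $f$ by zero). $\dot W^{1,X}(\Omega)$ is the set of $f\in L^1_{\mathrm{loc}}(\Omega)$ with weak gradient $\nabla f$ on $\Omega$ and $|\nabla f|\in X(\Omega)$. $E_{\lambda,\beta}[f]:=\{(x,y)\in\Omega\times\Omega:\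 x\ne y,\ |f(x)-f(y)|>\lambda|x-y|^{1+\beta}\}$. An open set $\Omega$ is an $(\varepsilon,\infty)$-domain if for all $x\ne y$ in $\Omega$ there is a rectifiable curve $\Gamma\subset\Omega$ connecting $x$ and $y$ with length $\ell(\Gamma)\le\varepsilon^{-1}|x-y|$ and $\mathrm{dist}(z,\partial\Omega)\ge\varepsilon|x-z||y-z|/|x-y|$ for every $z\in\Gamma$. *)

theory Defs
  imports "HOL-Analysis.Analysis"
begin

definition enn_powr :: "ennreal \<Rightarrow> real \<Rightarrow> ennreal" where
  "enn_powr a q = (if a = \<infinity> then \<infinity> else ennreal (enn2real a powr q))"

text \<open>A ball quasi-Banach-type function space is represented by its norm functional
  N, defined on all Lebesgue measurable real functions (value \<infinity> allowed);
  the space is the set of measurable f with N f < \<infinity>.\<close>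

definition ball_Banach_function_space :: "(('a::euclidean_space \<Rightarrow> real) \<Rightarrow> ennreal) \<Rightarrow> bool" where
  "ball_Banach_function_space N \<longleftrightarrow>
     \<comment> \<open>norm axioms: homogeneity\<close>
     (\<forall>f\<in>borel_measurable lebesgue. \<forall>c. N (\<lambda>x. c * f x) = ennreal \<bar>c\<bar> * N f) \<and>
     \<comment> \<open>(a)\<close>
     (\<forall>f\<in>borel_measurable lebesgue. N f = 0 \<longrightarrow> (AE x in lebesgue. f x = 0)) \<and>
     \<comment> \<open>(b)\<close>
     (\<forall>f\<in>borel_measurable lebesgue. \<forall>g\<in>borel_measurable lebesgue.
        (AE x in lebesgue. \<bar>g x\<bar> \<le> \<bar>f x\<bar>) \<longrightarrow> N g \<le> N f) \<and>
     \<comment> \<open>(c) Fatou property\<close>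
     (\<forall>F f. (\<forall>m. F m \<in> borel_measurable lebesgue) \<longrightarrow> f \<in> borel_measurable lebesgue \<longrightarrow>
        (AE x in lebesgue. (\<forall>m. 0 \<le> F m x) \<and> incseq (\<lambda>m. F m x) \<and> (\<lambda>m. F m x) \<longlonglongrightarrow> f x) \<longrightarrow>
        (\<lambda>m. N (F m)) \<longlonglongrightarrow> N f) \<and>
     \<comment> \<open>(d)\<close>
     (\<forall>c r. 0 < r \<longrightarrow> N (indicator (ball c r)) < \<infinity>) \<and>
     \<comment> \<open>(e)\<close>
     (\<forall>f\<in>borel_measurable lebesgue. \<forall>g\<in>borel_measurable lebesgue.
        N (\<lambda>x. f x + g x) \<le> N f + N g) \<and>
     \<comment> \<open>(f)\<close>
     (\<forall>c r. 0 < r \<longrightarrow> (\<exists>C::real. \<forall>f\<in>borel_measurable lebesgue.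
        (\<integral>\<^sup>+ x\<in>ball c r. ennreal \<bar>f x\<bar> \<partial>lebesgue) \<le> ennreal C * N f)) \<and>
     \<comment> \<open>completeness (Banach space)\<close>
     (\<forall>F. (\<forall>k. F k \<in> borel_measurable lebesgue \<and> N (F k) < \<infinity>) \<longrightarrow>
        (\<forall>e>0. \<exists>K. \<forall>k\<ge>K. \<forall>m\<ge>K. N (\<lambda>x. F k x - F m x) < ennreal e) \<longrightarrow>
        (\<exists>f\<in>borel_measurable lebesgue. N f < \<infinity> \<and> (\<lambda>k. N (\<lambda>x. F k x - f x)) \<longlonglongrightarrow> 0))"

definition convexification :: "real \<Rightarrow> (('a::euclidean_space \<Rightarrow> real) \<Rightarrow> ennreal) \<Rightarrow> ('a \<Rightarrow> real) \<Rightarrow> ennreal" where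
  "convexification p N f = enn_powr (N (\<lambda>x. \<bar>f x\<bar> powr (1 / p))) p"

definition associate_norm :: "(('a::euclidean_space \<Rightarrow> real) \<Rightarrow> ennreal) \<Rightarrow> ('a \<Rightarrow> real) \<Rightarrow> ennreal" where
  "associate_norm N f = (SUP g\<in>{g\<in>borel_measurable lebesgue. N g = 1}.
       \<integral>\<^sup>+ x. ennreal \<bar>f x * g x\<bar> \<partial>lebesgue)"

definition absolutely_continuous_norm :: "(('a::euclidean_space \<Rightarrow> real) \<Rightarrow> ennreal) \<Rightarrow> bool" where
  "absolutely_continuous_norm N \<longleftrightarrow>
     (\<forall>f\<in>borel_measurable lebesgue. N f < \<infinity> \<longrightarrow>
       (\<forall>E::nat \<Rightarrow> 'a set. (\<forall>j. E j \<in> sets lebesgue) \<longrightarrow>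
          (AE x in lebesgue. (\<lambda>j. indicator (E j) x :: real) \<longlonglongrightarrow> 0) \<longrightarrow>
          (\<lambda>j. N (\<lambda>x. f x * indicator (E j) x)) \<longlonglongrightarrow> 0))"

definition maximal_op :: "('a::euclidean_space \<Rightarrow> real) \<Rightarrow> 'a \<Rightarrow> ennreal" where
  "maximal_op f x = (SUP B\<in>{ball c r | c r. 0 < r \<and> x \<in> ball c r}.
       (\<integral>\<^sup>+ y\<in>B. ennreal \<bar>f y\<bar> \<partial>lebesgue) / emeasure lebesgue B)"

definition maximal_bounded_on :: "(('a::euclidean_space \<Rightarrow> real) \<Rightarrow> ennreal) \<Rightarrow> bool" where
  "maximal_bounded_on N \<longleftrightarrow>
     (\<exists>C::real. \<forall>f\<in>borel_measurable lebesgue. N f < \<infinity> \<longrightarrow>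
        (AE x in lebesgue. maximal_op f x < \<infinity>) \<and>
        N (\<lambda>x. enn2real (maximal_op f x)) \<le> ennreal C * N f)"

definition enorm :: "(('a::euclidean_space \<Rightarrow> real) \<Rightarrow> ennreal) \<Rightarrow> ('a \<Rightarrow> ennreal) \<Rightarrow> ennreal" where
  "enorm N g = (if AE x in lebesgue. g x \<noteq> \<infinity> then N (\<lambda>x. enn2real (g x)) else \<infinity>)"

definition curve_length :: "(real \<Rightarrow> 'a::metric_space) \<Rightarrow> ennreal" where
  "curve_length g = (SUP ts\<in>{ts. sorted ts \<and> set ts \<subseteq> {0..1}}.
      \<Sum>i<length ts - 1. ennreal (dist (g (ts ! i)) (g (ts ! Suc i))))"

definition dist_boundary :: "'a::euclidean_space set \<Rightarrow> 'a \<Rightarrow> ennreal" where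
  "dist_boundary \<Omega> z = (if frontier \<Omega> = {} then \<infinity> else ennreal (infdist z (frontier \<Omega>)))"

definition eps_infty_domain :: "real \<Rightarrow> 'a::euclidean_space set \<Rightarrow> bool" where
  "eps_infty_domain \<epsilon> \<Omega> \<longleftrightarrow> open \<Omega> \<and>
     (\<forall>x\<in>\<Omega>. \<forall>y\<in>\<Omega>. x \<noteq> y \<longrightarrow>
        (\<exists>g. path g \<and> pathstart g = x \<and> pathfinish g = y \<and> path_image g \<subseteq> \<Omega> \<and>
             curve_length g \<le> ennreal (dist x y / \<epsilon>) \<and>
             (\<forall>z\<in>path_image g. ennreal (\<epsilon> * dist x z * dist y z / dist x y) \<le> dist_boundary \<Omega> z)))"

fun Ck_on :: "nat \<Rightarrow> 'a::euclidean_space set \<Rightarrow> ('a \<Rightarrow> real) \<Rightarrow> bool" where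
  "Ck_on 0 U f = continuous_on U f"
| "Ck_on (Suc k) U f = ((\<forall>x\<in>U. f differentiable (at x)) \<and>
      (\<forall>i\<in>Basis. Ck_on k U (\<lambda>x. frechet_derivative f (at x) i)))"

definition test_function :: "'a::euclidean_space set \<Rightarrow> ('a \<Rightarrow> real) \<Rightarrow> bool" where
  "test_function \<Omega> \<phi> \<longleftrightarrow> (\<forall>k. Ck_on k UNIV \<phi>) \<and>
     compact (closure {x. \<phi> x \<noteq> 0}) \<and> closure {x. \<phi> x \<noteq> 0} \<subseteq> \<Omega>"

definition locally_integrable_on :: "('a::euclidean_space \<Rightarrow> real) \<Rightarrow> 'a set \<Rightarrow> bool" where
  "locally_integrable_on f \<Omega> \<longleftrightarrow> (\<forall>K. compact K \<and> K \<subseteq> \<Omega> \<longrightarrow> set_integrable lebesgue K f)"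

definition weak_gradient :: "'a::euclidean_space set \<Rightarrow> ('a \<Rightarrow> real) \<Rightarrow> ('a \<Rightarrow> 'a) \<Rightarrow> bool" where
  "weak_gradient \<Omega> f G \<longleftrightarrow> locally_integrable_on f \<Omega> \<and>
     (\<forall>i\<in>Basis. locally_integrable_on (\<lambda>x. G x \<bullet> i) \<Omega>) \<and>
     (\<forall>\<phi>. test_function \<Omega> \<phi> \<longrightarrow> (\<forall>i\<in>Basis.
        (LINT x:\<Omega>|lebesgue. f x * frechet_derivative \<phi> (at x) i)
          = - (LINT x:\<Omega>|lebesgue. (G x \<bullet> i) * \<phi> x)))"

definition restr_norm :: "(('a::euclidean_space \<Rightarrow> real) \<Rightarrow> ennreal) \<Rightarrow> 'a set \<Rightarrow> ('a \<Rightarrow> real) \<Rightarrow> ennreal" where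
  "restr_norm N \<Omega> f = N (\<lambda>x. if x \<in> \<Omega> then f x else 0)"

definition in_homogeneous_Sobolev :: "(('a::euclidean_space \<Rightarrow> real) \<Rightarrow> ennreal) \<Rightarrow> 'a set \<Rightarrow> ('a \<Rightarrow> real) \<Rightarrow> bool" where
  "in_homogeneous_Sobolev N \<Omega> f \<longleftrightarrow>
     (\<exists>G. weak_gradient \<Omega> f G \<and> restr_norm N \<Omega> (\<lambda>x. norm (G x)) < \<infinity>)"

definition E_set :: "'a::euclidean_space set \<Rightarrow> ('a \<Rightarrow> real) \<Rightarrow> real \<Rightarrow> real \<Rightarrow> ('a \<times> 'a) set" where
  "E_set \<Omega> f lam \<beta> = {(x, y). x \<in> \<Omega> \<and> y \<in> \<Omega> \<and> x \<noteq> y \<and>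
       \<bar>f x - f y\<bar> > lam * dist x y powr (1 + \<beta>)}"

definition level_fun :: "'a::euclidean_space set \<Rightarrow> ('a \<Rightarrow> real) \<Rightarrow> real \<Rightarrow> real \<Rightarrow> real \<Rightarrow> 'a \<Rightarrow> ennreal" where
  "level_fun \<Omega> f p \<gamma> lam x = (if x \<in> \<Omega> then
      enn_powr (\<integral>\<^sup>+ y\<in>\<Omega>. indicator (E_set \<Omega> f lam (\<gamma> / p)) (x, y)
                   * ennreal (dist x y powr (\<gamma> - real DIM('a))) \<partial>lebesgue) (1 / p)
    else 0)"

definition level_sup :: "(('a::euclidean_space \<Rightarrow> real) \<Rightarrow> ennreal) \<Rightarrow> 'a set \<Rightarrow> ('a \<Rightarrow> real) \<Rightarrow> real \<Rightarrow> real \<Rightarrow> ennreal" where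
  "level_sup N \<Omega> f p \<gamma> = (SUP lam\<in>{0<..}. ennreal lam * enorm N (level_fun \<Omega> f p \<gamma> lam))"

end

theory Submission
  imports Defs
begin

text \<open>If \<open>\<Omega>\<close> is an \<open>(\<epsilon>, \<infinity>)\<close>-domain, averages of \<open>f\<close> at the scale \<open>\<epsilon> / 8 * min (dist x z) (dist y z)\<close> along the
  curve from \<open>x\<close> to \<open>y\<close> show that \<open>\<bar>f x - f y\<bar>\<close> is at most a constant times \<open>dist x y * (M g x + M g y)\<close>,
  where \<open>g\<close> is the length of the weak gradient extended by zero and \<open>M\<close> is the maximal operator. So the level set
  at height \<open>\<lambda>\<close> lies in a set defined by \<open>M g x\<close>, whose integral over \<open>y\<close> is at most a constant times
  \<open>(M g x / \<lambda>) powr p\<close>, and a set defined by \<open>M g y\<close>, which is treated by duality with the associate space of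
  the convexification, on which \<open>M\<close> is bounded. The Fefferman-Stein inequality transfers the boundedness of \<open>M\<close>
  from that associate space to the space itself when \<open>p > 1\<close>.

  Conversely, mollify \<open>f\<close>, truncated at height \<open>2 ^ K\<close>, with the average of annular bumps at \<open>K\<close> consecutive dyadic
  scales. The gradients of the mollifications are bounded by the mean over \<open>K\<close> scales of the difference quotients,
  and only \<open>O(K)\<close> dyadic heights contribute to these, so the gradients stay bounded in the space. As the associate
  space has an absolutely continuous norm, suitable convex combinations converge to a weak gradient. Applying the
  resulting estimate to \<open>t * f\<close> and letting \<open>t\<close> tend to infinity removes its additive constant.\<close>

text \<open>The first obstacle is that (iii) speaks only of the associate space of
  \<open>convexification p N\<close>, whereas norms in the convexification itself have to be
  bounded. \<open>Lorentz_Luxemburg\<close> bridges this: such a norm is a supremum of pairings with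
  the associate unit ball. That theorem and the weak limit of the mollified gradients rest on one
  common device. An integral of sqrt (1 + |h|^2) is minimised over a set closed under midpoints, and
  the strict convexity of the integrand turns near-minimisers into an almost everywhere convergent
  sequence; the Fatou property then keeps the limit in the norm ball. The second obstacle is that
  every dyadic height contributes up to the same amount to the difference quotients, with no decay
  in the height. A mollifier at one scale would therefore lose a factor equal to the number of
  heights. Annular bumps at distinct dyadic scales have gradients with disjoint supports, so
  averaging K of them gains a factor 1 / K, which cancels that loss. The truncation height
  \<open>2 ^ K\<close> and the lower scale \<open>(1/2) ^ (2 * K)\<close> are tied together so that
  the number of heights is linear in K.\<close>

section \<open>Sigma-finiteness and measurability for Lebesgue measure and its products\<close>

lemma sigma_finite_lebesgue: "sigma_finite_measure (lebesgue :: 'a::euclidean_space measure)"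
proof
  let ?A = "range (\<lambda>n::nat. ball (0::'a) (real n))"
  have "\<exists>n. x \<in> ball (0::'a) (real n)" for x by (simp add: reals_Archimedean2)
  then have "(\<Union>?A) = space (lebesgue :: 'a measure)" by auto
  moreover have "emeasure lebesgue a \<noteq> \<infinity>" if "a \<in> ?A" for a
    using that emeasure_lborel_ball_finite by (metis (mono_tags, lifting) fmeasurableD2 infinity_ennreal_def lmeasurable_ball rangeE)
  moreover have "?A \<subseteq> sets lebesgue" by auto
  ultimately show "\<exists>A. countable A \<and> A \<subseteq> sets (lebesgue :: 'a measure) \<and> \<Union>A = space lebesgue \<and> (\<forall>a\<in>A. emeasure lebesgue a \<noteq> \<infinity>)"
    by (intro exI[of _ ?A]) auto
qed

interpretation lebesgue: sigma_finite_measure "lebesgue :: 'a::euclidean_space measure"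
  by (rule sigma_finite_lebesgue)

interpretation lebesgue_pair: pair_sigma_finite
  "lebesgue :: 'a::euclidean_space measure" "lebesgue :: 'b::euclidean_space measure" ..

lemma borel_imp_lebesgue_measurable: "f \<in> borel \<rightarrow>\<^sub>M M \<Longrightarrow> f \<in> lebesgue \<rightarrow>\<^sub>M M"
  for f :: "'a::euclidean_space \<Rightarrow> 'b"
  by (simp add: measurable_completion)

lemma ident_lebesgue_borel: "(\<lambda>x. x) \<in> lebesgue \<rightarrow>\<^sub>M (borel :: 'a::euclidean_space measure)"
  by (rule borel_imp_lebesgue_measurable) simp

lemma fst_lebesgue_borel [measurable]:
  "fst \<in> (lebesgue \<Otimes>\<^sub>M M) \<rightarrow>\<^sub>M (borel :: 'a::euclidean_space measure)"
  by (rule measurable_compose[OF measurable_fst ident_lebesgue_borel])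

lemma snd_lebesgue_borel [measurable]:
  "snd \<in> (M \<Otimes>\<^sub>M lebesgue) \<rightarrow>\<^sub>M (borel :: 'a::euclidean_space measure)"
  by (rule measurable_compose[OF measurable_snd ident_lebesgue_borel])

lemma dist_lebesgue_measurable [measurable]:
  "(\<lambda>y. dist x y) \<in> borel_measurable lebesgue" "(\<lambda>y. dist y x) \<in> borel_measurable lebesgue"
  for x :: "'a::euclidean_space"
  by (rule borel_imp_lebesgue_measurable, measurable)+

lemma ball_sets_lebesgue [measurable]: "ball c r \<in> sets lebesgue"
  for c :: "'a::euclidean_space"
  by simp

subsection \<open>Powers of extended nonnegative reals\<close>

lemma enn_powr_0 [simp]: "enn_powr 0 q = 0"
  by (simp add: enn_powr_def)

lemma enn_powr_top [simp]: "enn_powr \<infinity> q = \<infinity>" "enn_powr top q = top"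
  by (simp_all add: enn_powr_def infinity_ennreal_def)

lemma enn_powr_ennreal: "0 \<le> x \<Longrightarrow> enn_powr (ennreal x) q = ennreal (x powr q)"
  by (simp add: enn_powr_def)

lemma enn_powr_one [simp]: "enn_powr a 1 = a"
  by (cases a) (auto simp: enn_powr_ennreal)

lemma enn_powr_mono: "a \<le> b \<Longrightarrow> 0 \<le> q \<Longrightarrow> enn_powr a q \<le> enn_powr b q"
  by (cases a; cases b) (auto simp: enn_powr_ennreal powr_mono2 top_unique)

lemma enn_powr_mult: "0 < q \<Longrightarrow> enn_powr (a * b) q = enn_powr a q * enn_powr b q"
proof (cases "a = top \<or> b = top")
  case True
  assume q: "0 < q"
  have z: "enn_powr c q = 0 \<longleftrightarrow> c = 0" for c
    using q by (cases c) (auto simp: enn_powr_ennreal)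
  from True show ?thesis
    using z[of a] z[of b] by (cases "a = 0"; cases "b = 0") (auto simp: ennreal_top_mult ennreal_mult_top)
next
  case False
  then show ?thesis
    by (cases a; cases b) (auto simp: enn_powr_ennreal powr_mult simp flip: ennreal_mult)
qed

lemma enn_powr_powr: "enn_powr (enn_powr a q) r = enn_powr a (q * r)"
  by (cases a) (auto simp: enn_powr_ennreal powr_powr)

lemma enn_powr_inverse [simp]:
  "0 < q \<Longrightarrow> enn_powr (enn_powr a q) (1 / q) = a" "0 < q \<Longrightarrow> enn_powr (enn_powr a (1 / q)) q = a"
  by (simp_all add: enn_powr_powr)

lemma enn_powr_eq_top [simp]: "enn_powr a q = top \<longleftrightarrow> a = top"
  by (cases a) (auto simp: enn_powr_ennreal)

lemma enn_powr_eq_0 [simp]: "enn_powr a q = 0 \<longleftrightarrow> a = 0"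
  by (cases a) (auto simp: enn_powr_ennreal)

lemma enn_powr_le_iff: "0 < q \<Longrightarrow> enn_powr a q \<le> enn_powr b q \<longleftrightarrow> a \<le> b"
  by (metis enn_powr_inverse(1) enn_powr_mono less_imp_le zero_le_divide_1_iff)

lemma enn_powr_less_iff: "0 < q \<Longrightarrow> enn_powr a q < enn_powr b q \<longleftrightarrow> a < b"
  by (simp add: enn_powr_le_iff less_le_not_le)

lemma enn2real_enn_powr [simp]: "enn2real (enn_powr a q) = enn2real a powr q"
  by (cases a) (auto simp: enn_powr_ennreal)

lemma enn_powr_measurable [measurable]:
  assumes [measurable]: "f \<in> borel_measurable M"
  shows "(\<lambda>x. enn_powr (f x) q) \<in> borel_measurable M"
  unfolding enn_powr_def infinity_ennreal_def by measurable

subsection \<open>Ball Banach function spaces\<close>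

locale bbfs =
  fixes N :: "('a::euclidean_space \<Rightarrow> real) \<Rightarrow> ennreal"
  assumes bbfs: "ball_Banach_function_space N"
begin

lemma cmult: "f \<in> borel_measurable lebesgue \<Longrightarrow> N (\<lambda>x. c * f x) = ennreal \<bar>c\<bar> * N f"
  using bbfs by (auto simp: ball_Banach_function_space_def)

lemma eq_0_AE: "f \<in> borel_measurable lebesgue \<Longrightarrow> N f = 0 \<Longrightarrow> AE x in lebesgue. f x = 0"
  using bbfs by (auto simp: ball_Banach_function_space_def)

lemma mono: "f \<in> borel_measurable lebesgue \<Longrightarrow> g \<in> borel_measurable lebesgue \<Longrightarrow>
    (AE x in lebesgue. \<bar>g x\<bar> \<le> \<bar>f x\<bar>) \<Longrightarrow> N g \<le> N f"
  using bbfs unfolding ball_Banach_function_space_def by blast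

lemma Fatou: "(\<And>m. F m \<in> borel_measurable lebesgue) \<Longrightarrow> f \<in> borel_measurable lebesgue \<Longrightarrow>
   (AE x in lebesgue. (\<forall>m. 0 \<le> F m x) \<and> incseq (\<lambda>m. F m x) \<and> (\<lambda>m. F m x) \<longlonglongrightarrow> f x) \<Longrightarrow>
   (\<lambda>m. N (F m)) \<longlonglongrightarrow> N f"
  using bbfs unfolding ball_Banach_function_space_def by blast

lemma indicator_ball: "N (indicator (ball c r)) < \<infinity>"
proof (cases "0 < r")
  case True
  then show ?thesis using bbfs unfolding ball_Banach_function_space_def by blast
next
  case False
  have "N (\<lambda>x. 0 * indicator (ball c 1) x) = 0" by (subst cmult) auto
  then show ?thesis using False by (simp add: ball_empty indicator_def[abs_def])
qed

lemma triangle: "f \<in> borel_measurable lebesgue \<Longrightarrow> g \<in> borel_measurable lebesgue \<Longrightarrow>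
   N (\<lambda>x. f x + g x) \<le> N f + N g" using bbfs unfolding ball_Banach_function_space_def by blast

lemma local_integral:
  obtains C :: real where "0 \<le> C"
    "\<And>f. f \<in> borel_measurable lebesgue \<Longrightarrow> (\<integral>\<^sup>+ x\<in>ball c r. ennreal \<bar>f x\<bar> \<partial>lebesgue) \<le> ennreal C * N f"
proof (cases "0 < r")
  case True
  then obtain C :: real where C: "\<forall>f\<in>borel_measurable lebesgue.
        (\<integral>\<^sup>+ x\<in>ball c r. ennreal \<bar>f x\<bar> \<partial>lebesgue) \<le> ennreal C * N f"
    using bbfs unfolding ball_Banach_function_space_def by blast
  have "ennreal C \<le> ennreal (max 0 C)" by (simp add: ennreal_leI)
  then show ?thesis using C that[of "max 0 C"]
    by (meson dual_order.trans max.cobounded1 mult_right_mono zero_le)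
next
  case False
  then show ?thesis using that[of 0] by (simp add: ball_empty)
qed

lemma zero [simp]: "N (\<lambda>x. 0) = 0"
  using cmult[of "\<lambda>x. 0" 0] by simp

lemma cong_AE: "f \<in> borel_measurable lebesgue \<Longrightarrow> g \<in> borel_measurable lebesgue \<Longrightarrow>
    (AE x in lebesgue. \<bar>g x\<bar> = \<bar>f x\<bar>) \<Longrightarrow> N g = N f"
  by (rule antisym; rule mono; (assumption | (elim eventually_mono, simp)))

lemma abs: "f \<in> borel_measurable lebesgue \<Longrightarrow> N (\<lambda>x. \<bar>f x\<bar>) = N f"
  by (rule cong_AE) auto

lemma enorm_eq: "(AE x in lebesgue. g x \<noteq> \<infinity>) \<Longrightarrow> enorm N g = N (\<lambda>x. enn2real (g x))"
  by (simp add: enorm_def)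

lemma enorm_infinite: "\<not> (AE x in lebesgue. g x \<noteq> \<infinity>) \<Longrightarrow> enorm N g = \<infinity>"
  unfolding enorm_def by simp

lemma enorm_ennreal: "f \<in> borel_measurable lebesgue \<Longrightarrow> enorm N (\<lambda>x. ennreal \<bar>f x\<bar>) = N f"
  by (simp add: enorm_def abs)

lemma enorm_mono:
  assumes [measurable]: "F \<in> borel_measurable lebesgue" "G \<in> borel_measurable lebesgue"
    and le: "AE x in lebesgue. F x \<le> G x"
  shows "enorm N F \<le> enorm N G"
proof (cases "AE x in lebesgue. G x \<noteq> \<infinity>")
  case True
  then have "AE x in lebesgue. F x \<noteq> \<infinity>" using le by eventually_elim (auto simp: top_unique)
  moreover have "AE x in lebesgue. \<bar>enn2real (F x)\<bar> \<le> \<bar>enn2real (G x)\<bar>"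
    using le True by eventually_elim (auto simp: enn2real_mono top.not_eq_extremum)
  ultimately show ?thesis using True by (simp add: enorm_eq mono)
qed (simp add: enorm_infinite)

lemma enorm_cong_AE:
  assumes "F \<in> borel_measurable lebesgue" "G \<in> borel_measurable lebesgue"
    and "AE x in lebesgue. F x = G x"
  shows "enorm N F = enorm N G"
  by (rule antisym; rule enorm_mono; use assms in \<open>auto elim: eventually_mono\<close>)

lemma enorm_zero [simp]: "enorm N (\<lambda>x. 0) = 0"
  by (simp add: enorm_def)

lemma enorm_cmult:
  assumes [measurable]: "F \<in> borel_measurable lebesgue" and c: "0 \<le> c"
  shows "enorm N (\<lambda>x. ennreal c * F x) = ennreal c * enorm N F"
proof (cases "c = 0")
  case False
  with c have c: "c > 0" by simp
  have eq: "ennreal c * F x \<noteq> \<infinity> \<longleftrightarrow> F x \<noteq> \<infinity>" for x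
    using c by (auto simp: ennreal_mult_eq_top_iff)
  show ?thesis
  proof (cases "AE x in lebesgue. F x \<noteq> \<infinity>")
    case True
    then have "enorm N (\<lambda>x. ennreal c * F x) = N (\<lambda>x. enn2real (ennreal c * F x))"
      unfolding enorm_def eq by simp
    also have "\<dots> = ennreal c * N (\<lambda>x. enn2real (F x))"
      using c by (simp add: enn2real_mult cmult)
    finally show ?thesis using True by (simp add: enorm_def)
  next
    case False
    then show ?thesis using c unfolding enorm_def eq by (simp add: ennreal_mult_top)
  qed
qed simp

lemma enorm_add:
  assumes [measurable]: "F \<in> borel_measurable lebesgue" "G \<in> borel_measurable lebesgue"
  shows "enorm N (\<lambda>x. F x + G x) \<le> enorm N F + enorm N G"
proof (cases "(AE x in lebesgue. F x \<noteq> \<infinity>) \<and> (AE x in lebesgue. G x \<noteq> \<infinity>)")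
  case True
  then have F: "AE x in lebesgue. F x \<noteq> \<infinity>" and G: "AE x in lebesgue. G x \<noteq> \<infinity>" by auto
  have FG: "AE x in lebesgue. F x + G x \<noteq> \<infinity>" using F G by eventually_elim auto
  have "enorm N (\<lambda>x. F x + G x) = N (\<lambda>x. enn2real (F x + G x))"
    using FG by (rule enorm_eq)
  also have "\<dots> = N (\<lambda>x. enn2real (F x) + enn2real (G x))"
  proof (rule cong_AE)
    show "AE x in lebesgue. \<bar>enn2real (F x + G x)\<bar> = \<bar>enn2real (F x) + enn2real (G x)\<bar>"
      using F G by eventually_elim (auto simp: enn2real_plus less_top)
  qed measurable
  also have "\<dots> \<le> N (\<lambda>x. enn2real (F x)) + N (\<lambda>x. enn2real (G x))"
    by (rule triangle) measurable
  finally show ?thesis using F G by (simp add: enorm_eq)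
next
  case False
  then show ?thesis by (auto simp: enorm_def)
qed

lemma enorm_sum:
  assumes "finite I" "\<And>i. i \<in> I \<Longrightarrow> F i \<in> borel_measurable lebesgue"
  shows "enorm N (\<lambda>x. \<Sum>i\<in>I. F i x) \<le> (\<Sum>i\<in>I. enorm N (F i))"
  using assms
proof (induction rule: finite_induct)
  case (insert i I)
  have "enorm N (\<lambda>x. F i x + (\<Sum>i\<in>I. F i x)) \<le> enorm N (F i) + enorm N (\<lambda>x. \<Sum>i\<in>I. F i x)"
    using insert by (intro enorm_add borel_measurable_sum) auto
  with insert show ?case by (simp add: add_left_mono order_trans)
qed simp

lemma enorm_local_integral:
  obtains C :: real where "0 \<le> C"
    "\<And>F. F \<in> borel_measurable lebesgue \<Longrightarrow> enorm N F < \<infinity> \<Longrightarrow>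
      (\<integral>\<^sup>+ x\<in>ball c r. F x \<partial>lebesgue) \<le> ennreal C * enorm N F"
proof -
  obtain C where C: "0 \<le> C"
    "\<And>f. f \<in> borel_measurable lebesgue \<Longrightarrow> (\<integral>\<^sup>+ x\<in>ball c r. ennreal \<bar>f x\<bar> \<partial>lebesgue) \<le> ennreal C * N f"
    using local_integral by blast
  show thesis
  proof (rule that[OF C(1)])
    fix F :: "'a \<Rightarrow> ennreal" assume F[measurable]: "F \<in> borel_measurable lebesgue" and "enorm N F < \<infinity>"
    then have fin: "AE x in lebesgue. F x \<noteq> \<infinity>"
      by (auto simp: enorm_def split: if_splits)
    have "(\<integral>\<^sup>+ x\<in>ball c r. F x \<partial>lebesgue) = (\<integral>\<^sup>+ x\<in>ball c r. ennreal \<bar>enn2real (F x)\<bar> \<partial>lebesgue)"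
      using fin by (intro nn_integral_cong_AE) (auto elim!: eventually_mono simp: less_top)
    also have "\<dots> \<le> ennreal C * N (\<lambda>x. enn2real (F x))" by (rule C) measurable
    finally show "(\<integral>\<^sup>+ x\<in>ball c r. F x \<partial>lebesgue) \<le> ennreal C * enorm N F"
      using fin by (simp add: enorm_eq)
  qed
qed

text \<open>Axiom (c) requires a real-valued limit, so the point is that a finite right-hand side
  forces the supremum to be finite almost everywhere. This follows from axiom (f): by monotone
  convergence the supremum has a finite integral over every ball.\<close>

lemma enorm_SUP_le:
  fixes F :: "nat \<Rightarrow> 'a \<Rightarrow> ennreal"
  assumes F[measurable]: "\<And>k. F k \<in> borel_measurable lebesgue" and inc: "incseq F"
  shows "enorm N (\<lambda>x. SUP k. F k x) \<le> (SUP k. enorm N (F k))"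
proof (cases "(SUP k. enorm N (F k)) = \<infinity>")
  let ?X = "\<lambda>x m. enn2real (F m x)"
  case False
  let ?R = "SUP k. enorm N (F k)"
  have R: "enorm N (F k) \<le> ?R" for k by (rule SUP_upper) simp
  have lt: "enorm N (F k) < \<infinity>" for k
    using R[of k] False by (metis R False infinity_ennreal_def less_top top_unique)
  have incx: "incseq (\<lambda>k. F k x)" for x using inc by (auto simp: incseq_def le_fun_def)
  have ball: "AE x in lebesgue. x \<in> ball 0 (real n) \<longrightarrow> (SUP k. F k x) \<noteq> \<infinity>" for n :: nat
  proof -
    obtain C where C: "0 \<le> C" "\<And>F. F \<in> borel_measurable lebesgue \<Longrightarrow> enorm N F < \<infinity> \<Longrightarrow>
      (\<integral>\<^sup>+ x\<in>ball 0 (real n). F x \<partial>lebesgue) \<le> ennreal C * enorm N F"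
      using enorm_local_integral[of 0 "real n"] by blast
    have "(\<integral>\<^sup>+ x. (SUP k. F k x * indicator (ball 0 (real n)) x) \<partial>lebesgue)
      = (SUP k. \<integral>\<^sup>+ x. F k x * indicator (ball 0 (real n)) x \<partial>lebesgue)"
        using incx by (intro nn_integral_monotone_convergence_SUP)
        (auto simp: incseq_def le_fun_def intro!: mult_right_mono)
    also have "\<dots> \<le> ennreal C * ?R"
      by (intro SUP_least order_trans[OF C(2)[OF F lt]] mult_left_mono R) auto
    also have "\<dots> < \<infinity>" using False by (metis ennreal_less_top ennreal_mult_less_top infinity_ennreal_def less_top False)
    finally have "AE x in lebesgue. (SUP k. F k x * indicator (ball 0 (real n)) x) \<noteq> \<infinity>"
      by (intro nn_integral_PInf_AE) auto
    then show ?thesis by eventually_elim (auto simp: indicator_def)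
  qed
  have "AE x in lebesgue. \<forall>n::nat. x \<in> ball 0 (real n) \<longrightarrow> (SUP k. F k x) \<noteq> \<infinity>"
    using ball by (subst AE_all_countable) auto
  then have fin: "AE x in lebesgue. (SUP k. F k x) \<noteq> \<infinity>"
  proof eventually_elim
    fix x :: 'a assume "\<forall>n::nat. x \<in> ball 0 (real n) \<longrightarrow> (SUP k. F k x) \<noteq> \<infinity>"
    moreover obtain n :: nat where "norm x < real n" using reals_Archimedean2 by blast
    ultimately show "(SUP k. F k x) \<noteq> \<infinity>" by auto
  qed
  have fink: "AE x in lebesgue. F k x \<noteq> \<infinity>" for k
    using lt[of k] by (auto simp: enorm_def split: if_splits)
  have "(\<lambda>k. N (\<lambda>x. enn2real (F k x))) \<longlonglongrightarrow> N (\<lambda>x. enn2real (SUP k. F k x))"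
  proof (rule Fatou)
    show "AE x in lebesgue. (\<forall>m. 0 \<le> enn2real (F m x)) \<and> incseq (?X x) \<and>
           (?X x) \<longlonglongrightarrow> enn2real (SUP k. F k x)"
      using fin
    proof eventually_elim
      fix x assume x: "(SUP k. F k x) \<noteq> \<infinity>"
      then have le: "F k x < top" for k
        by (metis SUP_upper UNIV_I infinity_ennreal_def le_less_trans less_top)
      have "(\<lambda>m. F m x) \<longlonglongrightarrow> (SUP k. F k x)" by (rule LIMSEQ_SUP[OF incx])
      then have "(?X x) \<longlonglongrightarrow> enn2real (SUP k. F k x)"
        using x by (intro tendsto_enn2real) (simp_all only: infinity_ennreal_def ennreal_enn2real_if if_False enn2real_nonneg)
      moreover have "incseq (?X x)"
        using incx[of x] le by (auto simp: incseq_def intro!: enn2real_mono)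
      ultimately show "(\<forall>m. 0 \<le> enn2real (F m x)) \<and> incseq (?X x) \<and>
           (?X x) \<longlonglongrightarrow> enn2real (SUP k. F k x)" by simp
    qed
  qed measurable
  then have "N (\<lambda>x. enn2real (SUP k. F k x)) \<le> ?R"
    by (rule LIMSEQ_le_const2) (use R fink in \<open>auto simp: enorm_eq\<close>)
  then show ?thesis using fin by (simp add: enorm_eq)
next
  case True
  then show ?thesis by (metis infinity_ennreal_def top_greatest)
qed

lemma enorm_liminf_le:
  fixes F :: "nat \<Rightarrow> 'a \<Rightarrow> ennreal"
  assumes F[measurable]: "\<And>k. F k \<in> borel_measurable lebesgue"
  shows "enorm N (\<lambda>x. liminf (\<lambda>k. F k x)) \<le> liminf (\<lambda>k. enorm N (F k))"
proof -
  let ?G = "\<lambda>k x. INF j\<in>{k..}. F j x"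
  have "enorm N (\<lambda>x. SUP k. ?G k x) \<le> (SUP k. enorm N (?G k))"
    by (rule enorm_SUP_le) (auto simp: incseq_def le_fun_def intro!: INF_superset_mono)
  also have "\<dots> \<le> (SUP k. INF j\<in>{k..}. enorm N (F j))"
    by (intro SUP_mono) (auto intro!: INF_greatest enorm_mono AE_I2 INF_lower exI)
  finally show ?thesis by (simp add: liminf_SUP_INF)
qed

text \<open>Norm balls are closed under almost everywhere convergence, without monotonicity or a
  dominating function. This is what keeps limits of minimising sequences and of approximating
  gradients in the ball they come from.\<close>

lemma Fatou_AE:
  assumes f[measurable]: "\<And>k. f k \<in> borel_measurable lebesgue" "g \<in> borel_measurable lebesgue"
    and lim: "AE x in lebesgue. (\<lambda>k. f k x) \<longlonglongrightarrow> g x" and R: "\<And>k. N (f k) \<le> R"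
  shows "N g \<le> R"
proof -
  let ?X = "\<lambda>x k. ennreal \<bar>f k x\<bar>"
  have "N g = enorm N (\<lambda>x. ennreal \<bar>g x\<bar>)" by (simp add: enorm_ennreal)
  also have "\<dots> = enorm N (\<lambda>x. liminf (?X x))"
  proof (rule enorm_cong_AE)
    show "AE x in lebesgue. ennreal \<bar>g x\<bar> = liminf (?X x)" using lim
    proof eventually_elim
      fix x assume "(\<lambda>k. f k x) \<longlonglongrightarrow> g x"
      then have "(?X x) \<longlonglongrightarrow> ennreal \<bar>g x\<bar>" by (intro tendsto_intros)
      then show "ennreal \<bar>g x\<bar> = liminf (?X x)"
        by (metis lim_imp_Liminf trivial_limit_sequentially)
    qed
  qed measurable
  also have "\<dots> \<le> liminf (\<lambda>k. enorm N (\<lambda>x. ennreal \<bar>f k x\<bar>))" by (rule enorm_liminf_le) measurable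
  also have "\<dots> = liminf (\<lambda>k. N (f k))" by (simp add: enorm_ennreal)
  also have "\<dots> \<le> R"
    proof -
    have "liminf (\<lambda>k. N (f k)) \<le> liminf (\<lambda>k. R)"
      by (rule Liminf_mono) (simp add: R)
    then show ?thesis by (simp add: Liminf_const)
  qed
  finally show ?thesis .
qed

text \<open>\<open>associate_norm\<close> tests only against functions of norm exactly 1, so
  \<open>f\<close> is divided by its norm. A function of norm 0 vanishes almost everywhere by axiom
  (a) and is treated apart.\<close>

lemma Hoelder:
  assumes f[measurable]: "f \<in> borel_measurable lebesgue" "g \<in> borel_measurable lebesgue" and fin: "N f < \<infinity>"
  shows "(\<integral>\<^sup>+ x. ennreal \<bar>f x * g x\<bar> \<partial>lebesgue) \<le> N f * associate_norm N g"
proof (cases "N f = 0")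
  case True
  then have "AE x in lebesgue. f x = 0" by (rule eq_0_AE[OF f(1)])
  then have "AE x in lebesgue. ennreal \<bar>f x * g x\<bar> = 0" by eventually_elim simp
  then have "(\<integral>\<^sup>+ x. ennreal \<bar>f x * g x\<bar> \<partial>lebesgue) = (\<integral>\<^sup>+ (x::'a). 0 \<partial>lebesgue)"
    by (rule nn_integral_cong_AE)
  then show ?thesis by simp
next
  case False
  then obtain r where r: "0 < r" "N f = ennreal r"
    using fin by (cases "N f") (auto simp: less_top[symmetric] ennreal_eq_0_iff less_le)
  have "N (\<lambda>x. (1/r) * f x) = 1"
    using r by (simp only: cmult[OF f(1)]) (simp flip: ennreal_mult)
  then have "(\<integral>\<^sup>+ x. ennreal \<bar>g x * ((1/r) * f x)\<bar> \<partial>lebesgue) \<le> associate_norm N g"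
    unfolding associate_norm_def by (intro SUP_upper) auto
  then have "ennreal r * (\<integral>\<^sup>+ x. ennreal \<bar>g x * ((1/r) * f x)\<bar> \<partial>lebesgue) \<le> ennreal r * associate_norm N g"
    by (rule mult_left_mono) simp
  also have "ennreal r * (\<integral>\<^sup>+ x. ennreal \<bar>g x * ((1/r) * f x)\<bar> \<partial>lebesgue) = (\<integral>\<^sup>+ x. ennreal r * ennreal \<bar>g x * ((1/r) * f x)\<bar> \<partial>lebesgue)"
    by (rule nn_integral_cmult[symmetric]) measurable
  also have "\<dots> = (\<integral>\<^sup>+ x. ennreal \<bar>f x * g x\<bar> \<partial>lebesgue)"
    using r by (intro nn_integral_cong) (auto simp: abs_mult mult_ac simp flip: ennreal_mult)
  finally show ?thesis using r by simp
qed

lemma Hoelder_enorm: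
  assumes F[measurable]: "F \<in> borel_measurable lebesgue" "G \<in> borel_measurable lebesgue"
    and fin: "enorm N F < \<infinity>" "AE x in lebesgue. G x < \<infinity>"
  shows "(\<integral>\<^sup>+ x. F x * G x \<partial>lebesgue) \<le> enorm N F * associate_norm N (\<lambda>x. enn2real (G x))"
proof -
  have fF: "AE x in lebesgue. F x \<noteq> \<infinity>" using fin(1) by (auto simp: enorm_def split: if_splits)
  have "(\<integral>\<^sup>+ x. F x * G x \<partial>lebesgue) = (\<integral>\<^sup>+ x. ennreal \<bar>enn2real (F x) * enn2real (G x)\<bar> \<partial>lebesgue)"
  proof (rule nn_integral_cong_AE)
    show "AE x in lebesgue. F x * G x = ennreal \<bar>enn2real (F x) * enn2real (G x)\<bar>"
      using fF fin(2) by eventually_elim (auto simp: abs_mult ennreal_mult less_top)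
  qed
  also have "\<dots> \<le> N (\<lambda>x. enn2real (F x)) * associate_norm N (\<lambda>x. enn2real (G x))"
    using fF fin by (intro Hoelder) (auto simp: enorm_eq)
  finally show ?thesis using fF by (simp add: enorm_eq)
qed

text \<open>Axiom (f) amounts to indicators of balls lying in the associate space. Test functions
  enter the duality through this.\<close>

lemma associate_norm_bounded:
  assumes g[measurable]: "g \<in> borel_measurable lebesgue" and b: "\<And>x. \<bar>g x\<bar> \<le> b * indicator (ball c r) x"
  shows "associate_norm N g < \<infinity>"
proof -
  obtain C where C: "0 \<le> C"
    "\<And>f. f \<in> borel_measurable lebesgue \<Longrightarrow> (\<integral>\<^sup>+ x\<in>ball c r. ennreal \<bar>f x\<bar> \<partial>lebesgue) \<le> ennreal C * N f"
    using local_integral by blast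
  have "associate_norm N g \<le> ennreal \<bar>b\<bar> * ennreal C" unfolding associate_norm_def
  proof (rule SUP_least)
    fix h assume "h \<in> {g \<in> borel_measurable lebesgue. N g = 1}"
    then have h[measurable]: "h \<in> borel_measurable lebesgue" and 1: "N h = 1" by auto
    have "(\<integral>\<^sup>+ x. ennreal \<bar>g x * h x\<bar> \<partial>lebesgue) \<le> (\<integral>\<^sup>+ x. ennreal \<bar>b\<bar> * (ennreal \<bar>h x\<bar> * indicator (ball c r) x) \<partial>lebesgue)"
    proof (rule nn_integral_mono)
      fix x
      have "\<bar>g x * h x\<bar> \<le> \<bar>b\<bar> * (\<bar>h x\<bar> * indicator (ball c r) x)"
        proof (cases "x \<in> ball c r")
        case True
        then show ?thesis using b[of x] True by (simp add: abs_mult mult_right_mono)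
      next
        case False
        then show ?thesis using b[of x] by simp
      qed
      then have "ennreal \<bar>g x * h x\<bar> \<le> ennreal (\<bar>b\<bar> * (\<bar>h x\<bar> * indicator (ball c r) x))" by (rule ennreal_leI)
      then show "ennreal \<bar>g x * h x\<bar> \<le> ennreal \<bar>b\<bar> * (ennreal \<bar>h x\<bar> * indicator (ball c r) x)"
        by (auto simp: ennreal_mult ennreal_indicator)
    qed
    also have "\<dots> = ennreal \<bar>b\<bar> * (\<integral>\<^sup>+ x\<in>ball c r. ennreal \<bar>h x\<bar> \<partial>lebesgue)"
      by (rule nn_integral_cmult) measurable
    also have "\<dots> \<le> ennreal \<bar>b\<bar> * ennreal C"
      using C(2)[OF h] 1 by (simp add: mult_left_mono)
    finally show "(\<integral>\<^sup>+ x. ennreal \<bar>g x * h x\<bar> \<partial>lebesgue) \<le> ennreal \<bar>b\<bar> * ennreal C" .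
  qed
  then show ?thesis by (simp add: ennreal_mult_less_top order_le_less_trans)
qed

text \<open>Glues the constants of axiom (f) on an exhausting sequence of balls into a single
  weight. The measure with density \<open>w\<close> is finite, has the same null sets as Lebesgue
  measure, and the space embeds into its L1 with norm at most 1, so convex functionals can be
  minimised there.\<close>

lemma positive_weight:
  obtains w :: "'a \<Rightarrow> real" where "w \<in> borel_measurable lebesgue" "\<And>x. 0 < w x"
    "(\<integral>\<^sup>+ x. ennreal (w x) \<partial>lebesgue) < \<infinity>"
    "\<And>h. h \<in> borel_measurable lebesgue \<Longrightarrow> (\<integral>\<^sup>+ x. ennreal (\<bar>h x\<bar> * w x) \<partial>lebesgue) \<le> N h"
proof -
  let ?B = "\<lambda>m::nat. ball (0::'a) (real m + 1)"
  have "\<exists>C\<ge>0. \<forall>f\<in>borel_measurable lebesgue. (\<integral>\<^sup>+ x\<in>?B m. ennreal \<bar>f x\<bar> \<partial>lebesgue) \<le> ennreal C * N f" for m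
    using local_integral[of 0 "real m + 1"] by metis
  then obtain C where C: "\<And>m. 0 \<le> C m"
     "\<And>m f. f \<in> borel_measurable lebesgue \<Longrightarrow> (\<integral>\<^sup>+ x\<in>?B m. ennreal \<bar>f x\<bar> \<partial>lebesgue) \<le> ennreal (C m) * N f"
    by metis
  define V where "V m = measure lebesgue (?B m)" for m
  have V: "0 \<le> V m" "emeasure lebesgue (?B m) = ennreal (V m)" for m
    using emeasure_lborel_ball_finite[of "0::'a" "real m + 1"]
    by (auto simp: V_def emeasure_eq_ennreal_measure top.not_eq_extremum)
  \<comment> \<open>Dividing by both \<open>1 + C m\<close> and \<open>1 + V m\<close> makes the
    terms of the dual bound and of the total mass at most \<open>(1/2)^Suc m\<close>, whose sum is
    1.\<close>
  define a where "a m = (1/2)^Suc m / ((1 + C m) * (1 + V m))" for m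
  have a: "0 < a m" for m using C(1)[of m] V(1)[of m] by (simp add: a_def add_pos_nonneg)
  have aC: "a m * C m \<le> (1/2)^Suc m" for m
  proof -
    show ?thesis
      using C(1)[of m] V(1)[of m] by (simp add: a_def field_simps add_pos_nonneg)
  qed
  have aV: "a m * V m \<le> (1/2)^Suc m" for m
  proof -
    show ?thesis
      using C(1)[of m] V(1)[of m] by (simp add: a_def field_simps add_pos_nonneg)
  qed
  have a1: "a m \<le> (1/2)^Suc m" for m
  proof -
    show ?thesis
      using C(1)[of m] V(1)[of m] by (simp add: a_def field_simps add_pos_nonneg)
  qed
  have half: "(\<lambda>m. (1/2)^Suc m) sums (1::real)" using power_half_series .
  have summ: "summable (\<lambda>m. a m * indicator (?B m) x)" for x :: 'a
    by (rule summable_comparison_test'[OF sums_summable[OF half], of 0])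
       (use a a1 in \<open>auto simp: indicator_def less_imp_le abs_of_pos\<close>)
  define w where "w x = (\<Sum>m. a m * indicator (?B m) x)" for x :: 'a
  have w_enn: "ennreal (w x) = (\<Sum>m. ennreal (a m) * indicator (?B m) x)" for x
  proof -
    have "(\<Sum>m. ennreal (a m * indicator (?B m) x)) = ennreal (w x)"
      unfolding w_def using a summ by (intro suminf_ennreal2) (auto simp: less_imp_le)
    then show ?thesis using a by (simp add: ennreal_mult ennreal_indicator less_imp_le)
  qed
  have half_enn: "(\<Sum>m. ennreal ((1/2)^Suc m)) = 1"
    using suminf_ennreal2[of "\<lambda>m. (1/2)^Suc m"] half by (metis (no_types, lifting) ennreal_1 sums_iff zero_le_divide_1_iff zero_le_numeral zero_le_power)
  have w_meas[measurable]: "w \<in> borel_measurable lebesgue" unfolding w_def by measurable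
  show thesis
  proof
    show "0 < w x" for x
    proof -
      obtain m :: nat where "norm x < real m" using reals_Archimedean2 by blast
      then have "0 < a m * indicator (?B m) x" using a by (auto simp: indicator_def)
      moreover have "\<forall>n. 0 \<le> a n * indicator (?B n) x" using a by (auto simp: less_imp_le)
      ultimately show ?thesis unfolding w_def by (subst suminf_pos_iff[OF summ]) auto
    qed
    have "(\<integral>\<^sup>+ x. ennreal (w x) \<partial>lebesgue) = (\<Sum>m. \<integral>\<^sup>+ x. ennreal (a m) * indicator (?B m) x \<partial>lebesgue)"
      unfolding w_enn by (rule nn_integral_suminf) measurable
    also have "\<dots> = (\<Sum>m. ennreal (a m * V m))"
      using a V by (simp add: nn_integral_cmult_indicator ennreal_mult less_imp_le)
    also have "\<dots> \<le> (\<Sum>m. ennreal ((1/2)^Suc m))"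
      by (intro suminf_le ennreal_leI aV) auto
    finally show "(\<integral>\<^sup>+ x. ennreal (w x) \<partial>lebesgue) < \<infinity>"
      using half_enn by (simp add: order_le_less_trans)
    fix h :: "'a \<Rightarrow> real" assume h[measurable]: "h \<in> borel_measurable lebesgue"
    have "(\<integral>\<^sup>+ x. ennreal (\<bar>h x\<bar> * w x) \<partial>lebesgue) = (\<integral>\<^sup>+ x. (\<Sum>m. ennreal (a m) * (ennreal \<bar>h x\<bar> * indicator (?B m) x)) \<partial>lebesgue)"
      using \<open>\<And>x. 0 < w x\<close> by (intro nn_integral_cong)
        (auto simp: ennreal_mult less_imp_le w_enn mult_ac simp flip: ennreal_suminf_cmult)
    also have "\<dots> = (\<Sum>m. \<integral>\<^sup>+ x. ennreal (a m) * (ennreal \<bar>h x\<bar> * indicator (?B m) x) \<partial>lebesgue)"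
      by (rule nn_integral_suminf) measurable
    also have "\<dots> = (\<Sum>m. ennreal (a m) * (\<integral>\<^sup>+ x\<in>?B m. ennreal \<bar>h x\<bar> \<partial>lebesgue))"
      by (subst nn_integral_cmult) auto
    also have "\<dots> \<le> (\<Sum>m. ennreal ((1/2)^Suc m) * N h)"
    proof (intro suminf_le)
      fix m
      have "ennreal (a m) * (\<integral>\<^sup>+ x\<in>?B m. ennreal \<bar>h x\<bar> \<partial>lebesgue) \<le> ennreal (a m) * (ennreal (C m) * N h)"
        by (intro mult_left_mono C h) auto
      also have "\<dots> = ennreal (a m * C m) * N h"
        using a C by (simp add: ennreal_mult less_imp_le mult.assoc)
      also have "\<dots> \<le> ennreal ((1/2)^Suc m) * N h"
        by (intro mult_right_mono ennreal_leI aC) auto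
      finally show "ennreal (a m) * (\<integral>\<^sup>+ x\<in>?B m. ennreal \<bar>h x\<bar> \<partial>lebesgue) \<le> ennreal ((1/2)^Suc m) * N h" .
    qed auto
    also have "\<dots> = N h" by (simp only: ennreal_suminf_multc half_enn mult_1)
    finally show "(\<integral>\<^sup>+ x. ennreal (\<bar>h x\<bar> * w x) \<partial>lebesgue) \<le> N h" .
  qed (rule w_meas)
qed

end

subsection \<open>The maximal operator\<close>

lemma emeasure_ball_lebesgue:
  "0 \<le> r \<Longrightarrow> emeasure lebesgue (ball (c::'a::euclidean_space) r) = ennreal (unit_ball_vol (real DIM('a)) * r ^ DIM('a))"
  by (simp add: emeasure_ball)

lemma emeasure_ball_lebesgue_pos:
  "0 < r \<Longrightarrow> 0 < emeasure lebesgue (ball (c::'a::euclidean_space) r)"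
  by (simp add: emeasure_ball)

lemma emeasure_ball_lebesgue_finite: "emeasure lebesgue (ball (c::'a::euclidean_space) r) < top"
  using emeasure_lborel_ball_finite by simp

lemma emeasure_ball_lebesgue_mult:
  fixes c c' :: "'a::euclidean_space"
  assumes "0 \<le> r" "0 \<le> k"
  shows "emeasure lebesgue (ball c (k * r)) = ennreal (k ^ DIM('a)) * emeasure lebesgue (ball c' r)"
  using assms by (simp add: emeasure_ball power_mult_distrib mult_ac flip: ennreal_mult)

lemma ennreal_divide_times_self: "b \<noteq> 0 \<Longrightarrow> b \<noteq> top \<Longrightarrow> a / b * b = (a :: ennreal)"
  by (metis ennreal_divide_self ennreal_divide_times less_top mult_1_right)

lemma maximal_op_ball:
  assumes "x \<in> ball c r"
  shows "(\<integral>\<^sup>+ y\<in>ball c r. ennreal \<bar>f y\<bar> \<partial>lebesgue) \<le> emeasure lebesgue (ball c r) * maximal_op f x"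
proof -
  have r: "0 < r" using assms by (simp add: dist_pos_lt le_less_trans[OF zero_le_dist])
  let ?I = "\<integral>\<^sup>+ y\<in>ball c r. ennreal \<bar>f y\<bar> \<partial>lebesgue"
  have le: "?I / emeasure lebesgue (ball c r) \<le> maximal_op f x"
    unfolding maximal_op_def using assms r by (intro SUP_upper) auto
  have V: "emeasure lebesgue (ball c r) \<noteq> 0" "emeasure lebesgue (ball c r) \<noteq> top"
    using emeasure_ball_lebesgue_pos[OF r, of c] emeasure_ball_lebesgue_finite[of c r] by auto
  have "?I = emeasure lebesgue (ball c r) * (?I / emeasure lebesgue (ball c r))"
    by (simp only: mult.commute[of _ "?I / _"] ennreal_divide_times_self[OF V])
  also have "\<dots> \<le> emeasure lebesgue (ball c r) * maximal_op f x"
    by (intro mult_left_mono le) simp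
  finally show ?thesis .
qed

text \<open>The division-free form presents a superlevel set as a union of balls. It is therefore
  open, which is the source of the measurability of \<open>maximal_op\<close>; the radius needs no
  sign condition because a ball containing \<open>x\<close> has positive radius.\<close>

lemma less_maximal_op_iff:
  assumes t: "0 \<le> t"
  shows "ennreal t < maximal_op f x \<longleftrightarrow> (\<exists>c r. x \<in> ball c r \<and>
     ennreal t * emeasure lebesgue (ball c r) < (\<integral>\<^sup>+ y\<in>ball c r. ennreal \<bar>f y\<bar> \<partial>lebesgue))"
proof
  assume "ennreal t < maximal_op f x"
  then obtain c r where cr: "0 < r" "x \<in> ball c r"
    "ennreal t < (\<integral>\<^sup>+ y\<in>ball c r. ennreal \<bar>f y\<bar> \<partial>lebesgue) / emeasure lebesgue (ball c r)"
    unfolding maximal_op_def less_SUP_iff by blast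
  let ?I = "\<integral>\<^sup>+ y\<in>ball c r. ennreal \<bar>f y\<bar> \<partial>lebesgue"
  have V: "emeasure lebesgue (ball c r) \<noteq> 0" "emeasure lebesgue (ball c r) \<noteq> top"
    using emeasure_ball_lebesgue_pos[OF cr(1), of c] emeasure_ball_lebesgue_finite[of c r] by auto
  have "\<not> ?I \<le> ennreal t * emeasure lebesgue (ball c r)"
    using cr(3) V by (metis divide_right_mono_ennreal ennreal_mult_divide_eq linorder_not_le)
  then show "\<exists>c r. x \<in> ball c r \<and>
     ennreal t * emeasure lebesgue (ball c r) < (\<integral>\<^sup>+ y\<in>ball c r. ennreal \<bar>f y\<bar> \<partial>lebesgue)"
       using cr by (auto simp: not_le)
next
  assume "\<exists>c r. x \<in> ball c r \<and>
     ennreal t * emeasure lebesgue (ball c r) < (\<integral>\<^sup>+ y\<in>ball c r. ennreal \<bar>f y\<bar> \<partial>lebesgue)"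
  then obtain c r where x: "x \<in> ball c r"
    and lt: "ennreal t * emeasure lebesgue (ball c r) < (\<integral>\<^sup>+ y\<in>ball c r. ennreal \<bar>f y\<bar> \<partial>lebesgue)" by blast
  from lt maximal_op_ball[OF x, of f]
  have "emeasure lebesgue (ball c r) * ennreal t < emeasure lebesgue (ball c r) * maximal_op f x"
    by (simp add: mult.commute)
  then show "ennreal t < maximal_op f x" by (meson linorder_not_le mult_left_mono zero_le)
qed

lemma open_maximal_op: "0 \<le> t \<Longrightarrow> open {x. ennreal t < maximal_op f x}"
proof -
  assume t: "0 \<le> t"
  have "{x. ennreal t < maximal_op f x} = (\<Union>(c, r)\<in>{(c, r). ennreal t * emeasure lebesgue (ball c r) <
     (\<integral>\<^sup>+ y\<in>ball c r. ennreal \<bar>f y\<bar> \<partial>lebesgue)}. ball c r)"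
    unfolding less_maximal_op_iff[OF t] by fastforce
  then show ?thesis by auto
qed

lemma maximal_op_measurable [measurable]: "maximal_op f \<in> borel_measurable lebesgue"
proof (rule borel_measurableI_greater)
  fix y :: ennreal
  show "{x \<in> space lebesgue. y < maximal_op f x} \<in> sets lebesgue"
  proof (cases y)
    case (real t)
    then show ?thesis using open_maximal_op[of t f] by (metis (mono_tags, lifting) Collect_cong UNIV_I borel_open sets_completionI_sets sets_lborel space_borel space_completion space_lborel)
  next
    case top
    then show ?thesis by simp
  qed
qed

lemma maximal_op_mono_AE:
  assumes "AE x in lebesgue. \<bar>f x\<bar> \<le> \<bar>g x\<bar>"
  shows "maximal_op f x \<le> maximal_op g x"
  unfolding maximal_op_def
proof (intro SUP_mono)
  fix B assume B: "B \<in> {ball c r |c r. 0 < r \<and> x \<in> ball c r}"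
  let ?X = "\<integral>\<^sup>+ y\<in>B. ennreal \<bar>f y\<bar> \<partial>lebesgue"
  have "?X \<le> (\<integral>\<^sup>+ y\<in>B. ennreal \<bar>g y\<bar> \<partial>lebesgue)"
    using assms by (intro nn_integral_mono_AE) (auto elim!: eventually_mono intro!: mult_right_mono ennreal_leI)
  then show "\<exists>m\<in>{ball c r |c r. 0 < r \<and> x \<in> ball c r}. ?X / emeasure lebesgue B
      \<le> (\<integral>\<^sup>+ y\<in>m. ennreal \<bar>g y\<bar> \<partial>lebesgue) / emeasure lebesgue m"
    using B by (intro bexI[of _ B] divide_right_mono_ennreal)
qed

section \<open>Weighted weak type and strong type inequalities for the maximal operator\<close>

text \<open>The superlevel set is covered by balls on which the mean of \<open>\<bar>f\<bar>\<close>
  exceeds \<open>t\<close>. A disjoint subfamily, enlarged five times, still covers it, and the mean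
  of \<open>\<bar>w\<bar>\<close> over an enlarged ball is a lower bound for
  \<open>maximal_op w\<close> everywhere on the small one. This moves the weight under the integral
  of \<open>f\<close>.\<close>

lemma weak_type_aux:
  fixes f w :: "'a::euclidean_space \<Rightarrow> real"
  assumes f[measurable]: "f \<in> borel_measurable lebesgue" and w[measurable]: "w \<in> borel_measurable lebesgue"
    and t: "0 < t" and fin: "(\<integral>\<^sup>+ x. ennreal \<bar>f x\<bar> \<partial>lebesgue) < \<infinity>"
  shows "ennreal t * (\<integral>\<^sup>+ x\<in>{x. ennreal t < maximal_op f x}. ennreal \<bar>w x\<bar> \<partial>lebesgue)
     \<le> ennreal (5 ^ DIM('a)) * (\<integral>\<^sup>+ x. ennreal \<bar>f x\<bar> * maximal_op w x \<partial>lebesgue)"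
proof -
  let ?S = "{x. ennreal t < maximal_op f x}"
  let ?V = "\<lambda>c r. emeasure lebesgue (ball (c::'a) r)"
  let ?X = "\<lambda>i. \<integral>\<^sup>+ x\<in>ball (fst i) (snd i). ennreal \<bar>f x\<bar> * maximal_op w x \<partial>lebesgue"
  let ?Y = "\<lambda>i. \<integral>\<^sup>+ x\<in>ball (fst i) (5 * snd i). ennreal \<bar>w x\<bar> \<partial>lebesgue"
  let ?Z = "\<integral>\<^sup>+ x\<in>?S. ennreal \<bar>w x\<bar> \<partial>lebesgue"
  let ?U = "\<lambda>i. ball (fst i) (snd i)"
  let ?H = "\<lambda>x. ennreal \<bar>f x\<bar> * maximal_op w x"
  define K where "K = {(c::'a, r). 0 < r \<and> ennreal t * ?V c r < (\<integral>\<^sup>+ y\<in>ball c r. ennreal \<bar>f y\<bar> \<partial>lebesgue)}"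
  obtain I where I: "0 \<le> I" "(\<integral>\<^sup>+ x. ennreal \<bar>f x\<bar> \<partial>lebesgue) = ennreal I"
    using fin by (cases "\<integral>\<^sup>+ x. ennreal \<bar>f x\<bar> \<partial>lebesgue") (auto simp: top_unique)
  let ?k = "unit_ball_vol (real DIM('a))"
  have k: "0 < ?k" by simp
  \<comment> \<open>The Vitali lemma needs bounded radii, which is why \<open>f\<close> is assumed
    integrable here: the volume of an admissible ball is below \<open>I / t\<close>. A radius of at
    least 1 is at most its own power of exponent \<open>DIM('a)\<close>.\<close>
  have rad: "0 < snd i \<and> snd i \<le> max 1 (I / (t * ?k))" if "i \<in> K" for i
  proof -
    obtain c r where i: "i = (c, r)" by (cases i)
    with that have r: "0 < r" and lt: "ennreal t * ?V c r < (\<integral>\<^sup>+ y\<in>ball c r. ennreal \<bar>f y\<bar> \<partial>lebesgue)"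
      by (auto simp: K_def)
    note lt
    also have "(\<integral>\<^sup>+ y\<in>ball c r. ennreal \<bar>f y\<bar> \<partial>lebesgue) \<le> (\<integral>\<^sup>+ y. ennreal \<bar>f y\<bar> \<partial>lebesgue)"
      by (intro nn_integral_mono) (auto simp: indicator_def)
    finally have "ennreal (t * (?k * r ^ DIM('a))) < ennreal I"
      using t r k I by (simp add: emeasure_ball ennreal_mult less_imp_le)
    then have *: "t * (?k * r ^ DIM('a)) < I"
      using t r k by (simp add: ennreal_less_iff less_imp_le)
    have "r \<le> I / (t * ?k)" if "1 \<le> r"
    proof -
      have "r ^ 1 \<le> r ^ DIM('a)" using that by (intro power_increasing) auto
      then have "(t * ?k) * r \<le> (t * ?k) * r ^ DIM('a)" using t k by (intro mult_left_mono) auto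
      then have "(t * ?k) * r \<le> I" using * by (simp add: mult_ac)
      then show ?thesis using t k by (simp add: field_simps)
    qed
    then show ?thesis using r i by (cases "1 \<le> r") auto
  qed
  have cov: "?S \<subseteq> (\<Union>i\<in>K. ball (fst i) (snd i))"
  proof
    fix x assume "x \<in> ?S"
    then obtain c r where x: "x \<in> ball c r" and lt: "ennreal t * ?V c r < (\<integral>\<^sup>+ y\<in>ball c r. ennreal \<bar>f y\<bar> \<partial>lebesgue)"
      using less_maximal_op_iff[of t f x] t by auto
    have "0 < r" using x by (simp add: le_less_trans[OF zero_le_dist])
    then show "x \<in> (\<Union>i\<in>K. ball (fst i) (snd i))" using x lt by (auto simp: K_def intro!: bexI[of _ "(c, r)"])
  qed
  obtain C where C: "countable C" "C \<subseteq> K"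
     "pairwise (\<lambda>i j. disjnt (?U i) (ball (fst j) (snd j))) C"
     "?S \<subseteq> (\<Union>i\<in>C. ball (fst i) (5 * snd i))"
    using Vitali_covering_lemma_balls[OF cov rad] by blast
  let ?Q = "\<lambda>x. \<integral>\<^sup>+ i. indicator (?U i) x \<partial>count_space C"
  \<comment> \<open>Disjointness of the selected balls, expressed as an overlap count of at most
    one. Counting measure on \<open>C\<close> allows sums over the balls to be exchanged with
    Lebesgue integrals.\<close>
  have one: "(?Q x) \<le> 1" for x
  proof (cases "\<exists>i\<in>C. x \<in> ball (fst i) (snd i)")
    case True
    then obtain i where i: "i \<in> C" "x \<in> ball (fst i) (snd i)" by blast
    have "indicator (ball (fst j) (snd j)) x = (indicator {i} j :: ennreal)" if "j \<in> C" for j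
      proof (cases "j = i")
      case False
      then have "x \<notin> ball (fst j) (snd j)" using C(3) i(1) that i(2) unfolding pairwise_def disjnt_def by blast
      then show ?thesis using False by simp
    qed (use i in simp)
    then have "(?Q x) = (\<integral>\<^sup>+ j. indicator {i} j \<partial>count_space C)"
      by (intro nn_integral_cong) auto
    also have "\<dots> = emeasure (count_space C) {i}" using i by (intro nn_integral_indicator) auto
    also have "\<dots> = 1" using i by simp
    finally show ?thesis by simp
  next
    case False
    then have "(?Q x) = (\<integral>\<^sup>+ i. 0 \<partial>count_space C)"
      by (intro nn_integral_cong) auto
    then show ?thesis by simp
  qed
  have each: "ennreal t * (?Y i)
      \<le> ennreal (5 ^ DIM('a)) * (?X i)" if "i \<in> C" for i
  proof -
    obtain c r where i: "i = (c, r)" by (cases i)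
    with that C have r: "0 < r" and lt: "ennreal t * ?V c r < (\<integral>\<^sup>+ y\<in>ball c r. ennreal \<bar>f y\<bar> \<partial>lebesgue)"
      by (auto simp: K_def)
    let ?W = "\<integral>\<^sup>+ x\<in>ball c (5 * r). ennreal \<bar>w x\<bar> \<partial>lebesgue"
    \<comment> \<open>The mean of the weight over the enlarged ball. Its volume is
      \<open>5 ^ DIM('a)\<close> times that of the small ball, which is the constant of the
      lemma.\<close>
    define m where "m = ?W / ?V c (5 * r)"
    have V: "?V c (5 * r) \<noteq> 0" "?V c (5 * r) \<noteq> top"
      using emeasure_ball_lebesgue_pos[of "5 * r" c] emeasure_ball_lebesgue_finite[of c "5*r"] r by auto
    have W: "?W = m * ?V c (5 * r)"
      unfolding m_def by (rule ennreal_divide_times_self[OF V, symmetric])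
    have mle: "m \<le> maximal_op w x" if "x \<in> ball c r" for x unfolding m_def maximal_op_def
      by (rule SUP_upper2[of "ball c (5 * r)"]) (use that r in \<open>auto intro!: exI[of _ c] exI[of _ "5 * r"]\<close>)
    have "ennreal t * ?W = ennreal (5 ^ DIM('a)) * (m * (ennreal t * ?V c r))"
      unfolding W using r emeasure_ball_lebesgue_mult[of r 5 c c] by (simp add: mult_ac)
    also have "\<dots> \<le> ennreal (5 ^ DIM('a)) * (m * (\<integral>\<^sup>+ y\<in>ball c r. ennreal \<bar>f y\<bar> \<partial>lebesgue))"
      using lt by (intro mult_left_mono) auto
    also have "m * (\<integral>\<^sup>+ y\<in>ball c r. ennreal \<bar>f y\<bar> \<partial>lebesgue) = (\<integral>\<^sup>+ y. m * (ennreal \<bar>f y\<bar> * indicator (ball c r) y) \<partial>lebesgue)"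
      by (rule nn_integral_cmult[symmetric]) measurable
    also have "\<dots> \<le> (\<integral>\<^sup>+ x\<in>ball c r. ennreal \<bar>f x\<bar> * maximal_op w x \<partial>lebesgue)"
      using mle by (intro nn_integral_mono) (auto simp: indicator_def mult.commute[of m] intro!: mult_left_mono mult_right_mono)
    finally show ?thesis using i by (simp add: mult_left_mono)
  qed
  let ?P = "\<lambda>x. \<integral>\<^sup>+ i. ennreal \<bar>w x\<bar> * indicator (ball (fst i) (5 * snd i)) x \<partial>count_space C"
  have "?Z
     \<le> (\<integral>\<^sup>+ x. (?P x) \<partial>lebesgue)"
  proof (rule nn_integral_mono)
    fix x :: 'a
    show "ennreal \<bar>w x\<bar> * indicator ?S x \<le> (?P x)"
    proof (cases "x \<in> ?S")
      case True
      then obtain i where i: "i \<in> C" "x \<in> ball (fst i) (5 * snd i)" using C(4) by blast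
      have "ennreal \<bar>w x\<bar> = ennreal \<bar>w x\<bar> * indicator (ball (fst i) (5 * snd i)) x"
        using i by simp
      also have "\<dots> \<le> (?P x)" using i(1) by (intro nn_integral_ge_point) auto
      finally show ?thesis using True by simp
    qed simp
  qed
  also have "\<dots> = (\<integral>\<^sup>+ i. (?Y i) \<partial>count_space C)"
    by (rule nn_integral_count_space_nn_integral[OF C(1)]) measurable
  finally have "ennreal t * ?Z
     \<le> ennreal t * (\<integral>\<^sup>+ i. (?Y i) \<partial>count_space C)"
    by (rule mult_left_mono) simp
  also have "\<dots> = (\<integral>\<^sup>+ i. ennreal t * (?Y i) \<partial>count_space C)"
    by (rule nn_integral_cmult[symmetric]) simp
  also have "\<dots> \<le> (\<integral>\<^sup>+ i. ennreal (5 ^ DIM('a)) * (?X i) \<partial>count_space C)"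
    by (intro nn_integral_mono each) simp
  also have "\<dots> = ennreal (5 ^ DIM('a)) * (\<integral>\<^sup>+ i. (?X i) \<partial>count_space C)"
    by (rule nn_integral_cmult) simp
  also have "(\<integral>\<^sup>+ i. (?X i) \<partial>count_space C)
     = (\<integral>\<^sup>+ x. (\<integral>\<^sup>+ i. (?H x) * indicator (?U i) x \<partial>count_space C) \<partial>lebesgue)"
       by (rule nn_integral_count_space_nn_integral[OF C(1), symmetric]) measurable
  also have "\<dots> = (\<integral>\<^sup>+ x. (?H x) * (?Q x) \<partial>lebesgue)"
    by (intro nn_integral_cong nn_integral_cmult) simp
  also have "\<dots> \<le> (\<integral>\<^sup>+ x. (?H x) * 1 \<partial>lebesgue)"
    by (intro nn_integral_mono mult_left_mono one) simp
  finally show ?thesis by (simp add: mult_left_mono)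
qed

text \<open>Removes integrability of \<open>f\<close> by exhausting it with bounded functions of
  bounded support. A ball that witnesses \<open>ennreal t < maximal_op f x\<close> is already a
  witness for some truncation, by monotone convergence, so the superlevel sets of the truncations
  increase to that of \<open>f\<close>.\<close>

lemma weak_type:
  fixes f w :: "'a::euclidean_space \<Rightarrow> real"
  assumes f[measurable]: "f \<in> borel_measurable lebesgue" and w[measurable]: "w \<in> borel_measurable lebesgue"
    and t: "0 < t"
  shows "ennreal t * (\<integral>\<^sup>+ x\<in>{x. ennreal t < maximal_op f x}. ennreal \<bar>w x\<bar> \<partial>lebesgue)
     \<le> ennreal (5 ^ DIM('a)) * (\<integral>\<^sup>+ x. ennreal \<bar>f x\<bar> * maximal_op w x \<partial>lebesgue)"
proof -
  let ?X = "\<integral>\<^sup>+ x. ennreal \<bar>f x\<bar> * maximal_op w x \<partial>lebesgue"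
  let ?Y = "\<integral>\<^sup>+ x\<in>{x. ennreal t < maximal_op f x}. ennreal \<bar>w x\<bar> \<partial>lebesgue"
  define F where "F k x = min \<bar>f x\<bar> (real k) * indicator (ball 0 (real k)) x" for k x
  have F[measurable]: "F k \<in> borel_measurable lebesgue" for k unfolding F_def by measurable
  have F0: "0 \<le> F k x" for k x by (simp add: F_def)
  have Fle: "\<bar>F k x\<bar> \<le> \<bar>f x\<bar>" for k x by (auto simp: F_def indicator_def)
  have Finc: "F k x \<le> F l x" if "k \<le> l" for k l x
    using that by (auto simp: F_def indicator_def)
  have Fev: "\<exists>k. F k x = \<bar>f x\<bar>" for x
  proof -
    obtain k :: nat where "max \<bar>f x\<bar> (norm x) < real k" using reals_Archimedean2 by blast
    then show ?thesis by (intro exI[of _ k]) (auto simp: F_def)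
  qed
  have Fsup: "(SUP k. ennreal \<bar>F k x\<bar>) = ennreal \<bar>f x\<bar>" for x
  proof (rule antisym)
    show "(SUP k. ennreal \<bar>F k x\<bar>) \<le> ennreal \<bar>f x\<bar>" by (intro SUP_least ennreal_leI Fle)
    obtain k where "F k x = \<bar>f x\<bar>" using Fev by blast
    then show "ennreal \<bar>f x\<bar> \<le> (SUP k. ennreal \<bar>F k x\<bar>)" by (intro SUP_upper2[of k]) auto
  qed
  have fin: "(\<integral>\<^sup>+ x. ennreal \<bar>F k x\<bar> \<partial>lebesgue) < \<infinity>" for k
  proof -
    have "(\<integral>\<^sup>+ x. ennreal \<bar>F k x\<bar> \<partial>lebesgue) \<le> (\<integral>\<^sup>+ (x::'a). ennreal (real k) * indicator (ball 0 (real k)) x \<partial>lebesgue)"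
      by (intro nn_integral_mono) (auto simp: F_def indicator_def intro!: ennreal_leI)
    also have "\<dots> = ennreal (real k) * emeasure lebesgue (ball (0::'a) (real k))"
      by (rule nn_integral_cmult_indicator) simp
    also have "\<dots> < \<infinity>" using emeasure_ball_lebesgue_finite[of "0::'a" "real k"] by (simp add: ennreal_mult_less_top)
    finally show ?thesis .
  qed
  let ?S = "\<lambda>k. {x. ennreal t < maximal_op (F k) x}"
  have S: "?S k \<in> sets lebesgue" for k using open_maximal_op[of t "F k"] t by (simp add: borel_open)
  have ex: "\<exists>k. x \<in> ?S k" if "ennreal t < maximal_op f x" for x
  proof -
    obtain c r where x: "x \<in> ball c r" and lt: "ennreal t * emeasure lebesgue (ball c r) < (\<integral>\<^sup>+ y\<in>ball c r. ennreal \<bar>f y\<bar> \<partial>lebesgue)"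
      using \<open>ennreal t < maximal_op f x\<close> t less_maximal_op_iff[of t f x] by auto
    have "(\<integral>\<^sup>+ y\<in>ball c r. ennreal \<bar>f y\<bar> \<partial>lebesgue) = (\<integral>\<^sup>+ y. (SUP k. ennreal \<bar>F k y\<bar> * indicator (ball c r) y) \<partial>lebesgue)"
      by (simp add: Fsup[symmetric] SUP_mult_right_ennreal)
    also have "\<dots> = (SUP k. \<integral>\<^sup>+ y. ennreal \<bar>F k y\<bar> * indicator (ball c r) y \<partial>lebesgue)"
      using F0 Finc by (intro nn_integral_monotone_convergence_SUP) (auto simp: incseq_def le_fun_def intro!: mult_right_mono ennreal_leI)
    finally obtain k where "ennreal t * emeasure lebesgue (ball c r) < (\<integral>\<^sup>+ y\<in>ball c r. ennreal \<bar>F k y\<bar> \<partial>lebesgue)"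
      using lt by (auto simp: less_SUP_iff)
    then show ?thesis using x t less_maximal_op_iff[of t "F k" x] by auto
  qed
  have Smono: "?S k \<subseteq> ?S l" if "k \<le> l" for k l
    using maximal_op_mono_AE[of "F k" "F l"] F0 Finc[OF that] by (auto intro: less_le_trans)
  let ?Z = "\<lambda>k. \<integral>\<^sup>+ x. ennreal \<bar>w x\<bar> * indicator (?S k) x \<partial>lebesgue"
  let ?U = "SUP k. \<integral>\<^sup>+ x. ennreal \<bar>w x\<bar> * indicator (?S k) x \<partial>lebesgue"
  have "?Y
     \<le> (\<integral>\<^sup>+ x. (SUP k. ennreal \<bar>w x\<bar> * indicator (?S k) x) \<partial>lebesgue)"
  proof (rule nn_integral_mono)
    fix x :: 'a
    show "ennreal \<bar>w x\<bar> * indicator {x. ennreal t < maximal_op f x} x \<le> (SUP k. ennreal \<bar>w x\<bar> * indicator (?S k) x)"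
    proof (cases "ennreal t < maximal_op f x")
      case True
      then obtain k where "x \<in> ?S k" using ex by blast
      then show ?thesis using True by (intro SUP_upper2[of k]) auto
    qed simp
  qed
  also have "\<dots> = ?U"
  proof (rule nn_integral_monotone_convergence_SUP)
    show "incseq (\<lambda>k x. ennreal \<bar>w x\<bar> * indicator (?S k) x)"
      unfolding incseq_def le_fun_def
    proof (intro allI impI mult_left_mono)
      fix k l :: nat and x :: 'a assume "k \<le> l"
      from Smono[OF this] show "indicator (?S k) x \<le> (indicator (?S l) x :: ennreal)"
        by (auto simp: indicator_def)
    qed simp
  qed measurable
  finally have "ennreal t * ?Y
     \<le> ennreal t * ?U"
    by (rule mult_left_mono) simp
  also have "\<dots> = (SUP k. ennreal t * (?Z k))" by (simp add: SUP_mult_left_ennreal)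
  also have "\<dots> \<le> ennreal (5 ^ DIM('a)) * ?X"
  proof (rule SUP_least)
    fix k
    have "ennreal t * (?Z k)
      \<le> ennreal (5 ^ DIM('a)) * (\<integral>\<^sup>+ x. ennreal \<bar>F k x\<bar> * maximal_op w x \<partial>lebesgue)"
      by (rule weak_type_aux[OF F w t fin])
    also have "\<dots> \<le> ennreal (5 ^ DIM('a)) * ?X"
      by (intro mult_left_mono nn_integral_mono mult_right_mono ennreal_leI Fle) auto
    finally show "ennreal t * (?Z k)
      \<le> ennreal (5 ^ DIM('a)) * ?X" .
  qed
  finally show ?thesis .
qed

text \<open>The value \<open>a = \<infinity>\<close> has to be included because
  \<open>maximal_op\<close> may be infinite. That case is reached by comparison with all finite
  values.\<close>

lemma layer_cake:
  assumes q: "0 < q"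
  shows "(\<integral>\<^sup>+ s. ennreal (q * s powr (q - 1)) * indicator {s. 0 < s \<and> ennreal s < a} s \<partial>lborel) = enn_powr a q"
proof -
  let ?X = "\<lambda>c. \<integral>\<^sup>+ s. ennreal (q * s powr (q - 1)) * indicator {s. 0 < s \<and> ennreal s < ennreal c} s \<partial>lborel"
  have finite_case: "(?X c) = ennreal (c powr q)"
    if c: "0 \<le> c" for c
  proof -
    have "((\<lambda>x. x powr (q - 1)) has_integral (c powr (q - 1 + 1) / (q - 1 + 1))) {0..c}"
      using q c by (intro has_integral_powr_from_0) auto
    then have "((\<lambda>x. q * x powr (q - 1)) has_integral (q * (c powr (q - 1 + 1) / (q - 1 + 1)))) {0..c}"
      by (rule has_integral_mult_right)
    then have "(\<integral>\<^sup>+ s. ennreal (q * s powr (q - 1)) * indicator {0..c} s \<partial>lborel) = ennreal (c powr q)"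
      using q by (intro nn_integral_has_integral_lebesgue') auto
    moreover have "(?X c)
       = (\<integral>\<^sup>+ s. ennreal (q * s powr (q - 1)) * indicator {0..c} s \<partial>lborel)"
    proof (rule nn_integral_cong_AE)
      show "AE s in lborel. ennreal (q * s powr (q - 1)) * indicator {s. 0 < s \<and> ennreal s < ennreal c} s
         = ennreal (q * s powr (q - 1)) * indicator {0..c} s" using AE_lborel_singleton[of 0] AE_lborel_singleton[of c]
           by eventually_elim (auto simp: indicator_def ennreal_less_iff)
    qed
    ultimately show ?thesis by simp
  qed
  show ?thesis
  proof (cases a)
    case (real c)
    then show ?thesis using finite_case[of c] by (simp add: enn_powr_ennreal)
  next
    case top
    let ?J = "\<integral>\<^sup>+ s. ennreal (q * s powr (q - 1)) * indicator {s. 0 < s \<and> ennreal s < a} s \<partial>lborel"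
    have lower: "ennreal c \<le> ?J" if c: "0 \<le> c" for c
    proof -
      have "ennreal c = ennreal ((c powr (1 / q)) powr q)" using q c by (simp add: powr_powr)
      also have "\<dots> \<le> ?J"
        unfolding finite_case[of "c powr (1/q)", simplified, symmetric] top
        by (intro nn_integral_mono) (auto simp: indicator_def)
      finally show ?thesis .
    qed
    have "?J = top"
    proof (cases ?J)
      case (real r)
      then show ?thesis using lower[of "r + 1"] real by (simp add: ennreal_le_iff)
    qed simp
    then show ?thesis using top by simp
  qed
qed

text \<open>Marcinkiewicz interpolation against the trivial bound for bounded functions: at height
  \<open>s\<close> the weak type inequality is applied only to the part of \<open>f\<close> above
  \<open>s/2\<close>, and the result is integrated over \<open>s\<close>. The integral of
  \<open>s powr (p - 2)\<close> from 0 converges because \<open>1 < p\<close>; this is the origin of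
  the denominator \<open>p - 1\<close>.\<close>

theorem Fefferman_Stein:
  fixes f w :: "'a::euclidean_space \<Rightarrow> real"
  assumes f[measurable]: "f \<in> borel_measurable lebesgue" and w[measurable]: "w \<in> borel_measurable lebesgue"
    and p: "1 < p"
  shows "(\<integral>\<^sup>+ x. enn_powr (maximal_op f x) p * ennreal \<bar>w x\<bar> \<partial>lebesgue)
     \<le> ennreal (5 ^ DIM('a) * 2 * p / (p - 1) * 2 powr (p - 1)) *
        (\<integral>\<^sup>+ x. ennreal (\<bar>f x\<bar> powr p) * maximal_op w x \<partial>lebesgue)"
proof -
  let ?X = "\<lambda>x. ennreal \<bar>f x\<bar> * maximal_op w x"
  let ?Y = "\<lambda>x. \<bar>f x\<bar> powr (p - 1) * \<bar>f x\<bar>"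
  let ?Z = "\<lambda>s. 2 * p * s powr (p - 2)"
  let ?U = "\<lambda>x. 2 * \<bar>f x\<bar>"
  let ?W = "\<lambda>s. (p - 1) * s powr (p - 1 - 1)"
  let ?H = "\<lambda>s. p * s powr (p - 1)"
  interpret P: pair_sigma_finite "lebesgue :: 'a measure" "lborel :: real measure" ..
  let ?D = "5 ^ DIM('a) :: real"
  have meas: "(\<lambda>(x, s). ennreal (?H s) * indicator {s. 0 < s \<and> ennreal s < maximal_op f x} s * ennreal \<bar>w x\<bar>)
     \<in> borel_measurable (lebesgue \<Otimes>\<^sub>M (lborel :: real measure))"
  by simp
  let ?P = "\<lambda>s. 2 * ?D * p * s powr (p - 2)"
  have meas2: "(\<lambda>(x, s). ennreal (?P s) * indicator {s. 0 < s \<and> s < 2 * \<bar>f x\<bar>} s * (?X x))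
     \<in> borel_measurable (lebesgue \<Otimes>\<^sub>M (lborel :: real measure))"
  by simp
  have level: "(\<integral>\<^sup>+ x. ennreal (?H s) * indicator {s. 0 < s \<and> ennreal s < maximal_op f x} s * ennreal \<bar>w x\<bar> \<partial>lebesgue)
    \<le> (\<integral>\<^sup>+ x. ennreal (?P s) * indicator {s. 0 < s \<and> s < 2 * \<bar>f x\<bar>} s * (?X x) \<partial>lebesgue)"
    for s
  proof (cases "0 < s")
    case True
    \<comment> \<open>The discarded part of \<open>f\<close> is at most \<open>s/2\<close>, so it
      contributes at most \<open>s/2\<close> to the mean over any ball; whatever lifts the maximal
      function above \<open>s\<close> must lift that of \<open>g\<close> above
      \<open>s/2\<close>.\<close>
    define g where "g x = f x * indicator {x. s < 2 * \<bar>f x\<bar>} x" for x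
    have g[measurable]: "g \<in> borel_measurable lebesgue" unfolding g_def by measurable
    have sub: "ennreal (s/2) < maximal_op g x" if "ennreal s < maximal_op f x" for x
    proof -
      obtain c r where x: "x \<in> ball c r" and lt: "ennreal s * emeasure lebesgue (ball c r) < (\<integral>\<^sup>+ y\<in>ball c r. ennreal \<bar>f y\<bar> \<partial>lebesgue)"
        using that True less_maximal_op_iff[of s f x] using \<open>ennreal s < maximal_op f x\<close> by auto
      let ?V = "emeasure lebesgue (ball c r)"
      have "(\<integral>\<^sup>+ y\<in>ball c r. ennreal \<bar>f y\<bar> \<partial>lebesgue)
        \<le> (\<integral>\<^sup>+ y. ennreal \<bar>g y\<bar> * indicator (ball c r) y + ennreal (s/2) * indicator (ball c r) y \<partial>lebesgue)"
        using True by (intro nn_integral_mono) (auto simp: g_def indicator_def intro!: ennreal_leI)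
      also have "\<dots> = (\<integral>\<^sup>+ y\<in>ball c r. ennreal \<bar>g y\<bar> \<partial>lebesgue) + ennreal (s/2) * ?V"
        by (subst nn_integral_add) (auto simp: nn_integral_cmult_indicator)
      finally have le: "(\<integral>\<^sup>+ y\<in>ball c r. ennreal \<bar>f y\<bar> \<partial>lebesgue) \<le> (\<integral>\<^sup>+ y\<in>ball c r. ennreal \<bar>g y\<bar> \<partial>lebesgue) + ennreal (s/2) * ?V" .
      have "ennreal s = ennreal (s/2) + ennreal (s/2)" using True by (simp flip: ennreal_plus)
      then have "ennreal s * ?V = ennreal (s/2) * ?V + ennreal (s/2) * ?V"
        by (simp add: distrib_right)
      with lt le have "ennreal (s/2) * ?V + ennreal (s/2) * ?V < ennreal (s/2) * ?V + (\<integral>\<^sup>+ y\<in>ball c r. ennreal \<bar>g y\<bar> \<partial>lebesgue)"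
        by (metis (no_types, lifting) add.commute linorder_not_le order_le_less_trans)
      then show ?thesis using x True less_maximal_op_iff[of "s/2" g x] by auto
    qed
    have "(\<integral>\<^sup>+ x. ennreal (?H s) * indicator {s. 0 < s \<and> ennreal s < maximal_op f x} s * ennreal \<bar>w x\<bar> \<partial>lebesgue)
      \<le> (\<integral>\<^sup>+ x. ennreal (?Z s) * (ennreal (s/2) * (ennreal \<bar>w x\<bar> * indicator {x. ennreal (s/2) < maximal_op g x} x)) \<partial>lebesgue)"
    proof (rule nn_integral_mono)
      fix x :: 'a
      \<comment> \<open>One factor \<open>s\<close> is split off to pay for the weak type inequality
        at height \<open>s/2\<close>.\<close>
      have "ennreal (?H s) = ennreal (?Z s) * ennreal (s/2)"
        using True powr_add[of s "p - 2" 1] p by (simp flip: ennreal_mult)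
      then show "ennreal (?H s) * indicator {s. 0 < s \<and> ennreal s < maximal_op f x} s * ennreal \<bar>w x\<bar>
         \<le> ennreal (?Z s) * (ennreal (s/2) * (ennreal \<bar>w x\<bar> * indicator {x. ennreal (s/2) < maximal_op g x} x))"
        using sub[of x] by (auto simp: indicator_def mult_ac)
    qed
    also have "\<dots> = ennreal (?Z s) * (ennreal (s/2) * (\<integral>\<^sup>+ x\<in>{x. ennreal (s/2) < maximal_op g x}. ennreal \<bar>w x\<bar> \<partial>lebesgue))"
      by (simp add: nn_integral_cmult)
    also have "\<dots> \<le> ennreal (?Z s) * (ennreal ?D * (\<integral>\<^sup>+ x. ennreal \<bar>g x\<bar> * maximal_op w x \<partial>lebesgue))"
      using True by (intro mult_left_mono weak_type) auto
    also have "\<dots> = (\<integral>\<^sup>+ x. ennreal (?Z s) * (ennreal ?D * (ennreal \<bar>g x\<bar> * maximal_op w x)) \<partial>lebesgue)"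
      by (simp add: nn_integral_cmult)
    also have "\<dots> = (\<integral>\<^sup>+ x. ennreal (?P s) * indicator {s. 0 < s \<and> s < 2 * \<bar>f x\<bar>} s * (?X x) \<partial>lebesgue)"
    proof (rule nn_integral_cong)
      fix x :: 'a
      have "ennreal (?P s) = ennreal (?Z s) * ennreal ?D"
        using p by (simp add: mult_ac flip: ennreal_mult)
      then show "ennreal (?Z s) * (ennreal ?D * (ennreal \<bar>g x\<bar> * maximal_op w x))
        = ennreal (?P s) * indicator {s. 0 < s \<and> s < 2 * \<bar>f x\<bar>} s * (?X x)"
          using True by (auto simp: g_def indicator_def mult_ac)
    qed
    finally show ?thesis .
  qed simp
  let ?Q = "\<lambda>x. \<integral>\<^sup>+ s. ennreal (?P s) * indicator {s. 0 < s \<and> s < 2 * \<bar>f x\<bar>} s * (?X x) \<partial>lborel"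
  let ?A = "\<lambda>x. \<integral>\<^sup>+ s. ennreal (?P s) * indicator {s. 0 < s \<and> s < 2 * \<bar>f x\<bar>} s \<partial>lborel"
  let ?B = "?D * 2 * p / (p - 1) * 2 powr (p - 1)"
  have "(\<integral>\<^sup>+ x. enn_powr (maximal_op f x) p * ennreal \<bar>w x\<bar> \<partial>lebesgue)
    = (\<integral>\<^sup>+ x. (\<integral>\<^sup>+ s. ennreal (?H s) * indicator {s. 0 < s \<and> ennreal s < maximal_op f x} s * ennreal \<bar>w x\<bar> \<partial>lborel) \<partial>lebesgue)"
      using p by (intro nn_integral_cong, subst nn_integral_multc) (auto simp: layer_cake)
  also have "\<dots> = (\<integral>\<^sup>+ s. (\<integral>\<^sup>+ x. ennreal (?H s) * indicator {s. 0 < s \<and> ennreal s < maximal_op f x} s * ennreal \<bar>w x\<bar> \<partial>lebesgue) \<partial>lborel)"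
    using P.Fubini[OF meas] by simp
  also have "\<dots> \<le> (\<integral>\<^sup>+ s. (\<integral>\<^sup>+ x. ennreal (?P s) * indicator {s. 0 < s \<and> s < 2 * \<bar>f x\<bar>} s * (?X x) \<partial>lebesgue) \<partial>lborel)"
    by (intro nn_integral_mono level)
  also have "\<dots> = (\<integral>\<^sup>+ x. (?Q x) \<partial>lebesgue)"
    using P.Fubini[OF meas2] by simp
  also have "\<dots> = (\<integral>\<^sup>+ x. ennreal ?B * (ennreal (\<bar>f x\<bar> powr p) * maximal_op w x) \<partial>lebesgue)"
  proof (rule nn_integral_cong)
    fix x :: 'a
    let ?a = "2 * ?D * p / (p - 1)"
    have a: "0 \<le> ?a" using p by simp
    have "(?Q x)
      = (?A x) * (?X x)"
    proof -
      have S: "{s. 0 < s \<and> s < 2 * \<bar>f x\<bar>} = {0<..<2 * \<bar>f x\<bar>}" by auto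
      show ?thesis unfolding S by (rule nn_integral_multc) measurable
    qed
    also have "(?A x)
       = (\<integral>\<^sup>+ s. ennreal ?a * (ennreal (?W s) * indicator {s. 0 < s \<and> ennreal s < ennreal (?U x)} s) \<partial>lborel)"
    proof (rule nn_integral_cong)
      fix s :: real
      have "ennreal (?P s) = ennreal (?a * (?W s))" using p by simp
      also have "\<dots> = ennreal ?a * ennreal (?W s)" using p by (intro ennreal_mult'') simp
      finally have "ennreal (?P s) = ennreal ?a * ennreal (?W s)" .
      then show "ennreal (?P s) * indicator {s. 0 < s \<and> s < 2 * \<bar>f x\<bar>} s
        = ennreal ?a * (ennreal (?W s) * indicator {s. 0 < s \<and> ennreal s < ennreal (?U x)} s)"
          by (auto simp: indicator_def ennreal_less_iff)
    qed
    also have "\<dots> = ennreal ?a * ennreal ((?U x) powr (p - 1))"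
      using p layer_cake[of "p - 1" "ennreal (?U x)"]
      by (subst nn_integral_cmult) (auto simp: enn_powr_ennreal)
    also have "ennreal ?a * ennreal ((?U x) powr (p - 1)) * (?X x)
       = ennreal (?a * 2 powr (p - 1)) * (ennreal (?Y x) * maximal_op w x)"
    proof -
      have E: "ennreal ?a * ennreal ((?U x) powr (p - 1)) * ennreal \<bar>f x\<bar>
         = ennreal (?a * 2 powr (p - 1)) * ennreal (?Y x)"
        proof -
        have "ennreal ?a * ennreal ((?U x) powr (p - 1)) * ennreal \<bar>f x\<bar> = ennreal (?a * (?U x) powr (p - 1) * \<bar>f x\<bar>)"
          by (metis ennreal_mult'' powr_ge_zero abs_ge_zero)
        also have "?a * (?U x) powr (p - 1) * \<bar>f x\<bar> = (?a * 2 powr (p - 1)) * (?Y x)"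
          by (simp add: powr_mult)
        also have "ennreal \<dots> = ennreal (?a * 2 powr (p - 1)) * ennreal (?Y x)"
          by (rule ennreal_mult'') simp
        finally show ?thesis .
      qed
      have shuffle: "a' * b * c = d * e \<Longrightarrow> a' * b * (c * m) = d * (e * m)" for a' b c d e m :: ennreal
        by (metis mult.assoc)
      show ?thesis by (rule shuffle[OF E])
    qed
    also have "\<bar>f x\<bar> powr (p - 1) * \<bar>f x\<bar> = \<bar>f x\<bar> powr p"
      using powr_add[of "\<bar>f x\<bar>" "p - 1" 1] by simp
    finally show "(?Q x)
      = ennreal ?B * (ennreal (\<bar>f x\<bar> powr p) * maximal_op w x)" by (simp add: mult_ac)
  qed
  also have "\<dots> = ennreal ?B * (\<integral>\<^sup>+ x. ennreal (\<bar>f x\<bar> powr p) * maximal_op w x \<partial>lebesgue)"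
    by (rule nn_integral_cmult) measurable
  finally show ?thesis .
qed

section \<open>Integrals of distance kernels bounded by the maximal function\<close>

lemma dyadic_bracket: "1 \<le> (u::real) \<Longrightarrow> \<exists>j::nat. 2 ^ j \<le> u \<and> u \<le> 2 ^ Suc j"
proof -
  assume u: "1 \<le> u"
  obtain m :: nat where m: "u < 2 ^ m" using real_arch_pow[of 2 u] by auto
  define k where "k = (LEAST m. u < (2::real) ^ m)"
  have k: "u < 2 ^ k" unfolding k_def by (rule LeastI[of _ m]) (rule m)
  then obtain j where j: "k = Suc j" using u by (cases k) auto
  have "\<not> u < 2 ^ j" using not_less_Least[of j "\<lambda>m. u < (2::real) ^ m"] j by (simp add: k_def)
  then show ?thesis using k j by (intro exI[of _ j]) auto
qed

text \<open>Up to the centre, the set is a ball of radius \<open>T powr (1 / \<gamma>)\<close> for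
  positive \<open>\<gamma>\<close> and its exterior for negative \<open>\<gamma>\<close>. On a
  dyadic shell of radius \<rho> the kernel is comparable to \<rho> to the power \<gamma> - n, while
  the integral of \<open>\<bar>w\<bar>\<close> is at most a constant times \<rho> to the power n
  times \<open>maximal_op w y\<close>. The shells thus form a geometric series of ratio
  \<open>2 powr (- \<bar>\<gamma>\<bar>)\<close>, which is below 1 because
  \<open>\<gamma> \<noteq> 0\<close>.\<close>

lemma dist_kernel_maximal_bound:
  fixes w :: "'a::euclidean_space \<Rightarrow> real"
  assumes w[measurable]: "w \<in> borel_measurable lebesgue" and g: "\<gamma> \<noteq> 0" and T: "0 < T"
  shows "(\<integral>\<^sup>+ x\<in>{x. dist x y powr \<gamma> < T}. ennreal (dist x y powr (\<gamma> - real DIM('a)) * \<bar>w x\<bar>) \<partial>lebesgue)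
     \<le> ennreal (2 powr \<bar>\<gamma> - real DIM('a)\<bar> * unit_ball_vol (real DIM('a)) * 2 ^ DIM('a) / (1 - 2 powr (- \<bar>\<gamma>\<bar>)))
        * (ennreal T * maximal_op w y)"
proof -
  let ?n = "real DIM('a)" and ?k = "unit_ball_vol (real DIM('a))"
  let ?X = "\<lambda>x. dist x y powr (\<gamma> - ?n) * \<bar>w x\<bar>"
  define R where "R = T powr (1 / \<gamma>)"
  have R: "0 < R" "R powr \<gamma> = T" using T g by (auto simp: R_def powr_powr)
  define q where "q = 2 powr (- \<bar>\<gamma>\<bar>)"
  have q: "0 < q" "q < 1" using g powr_less_mono[of "- \<bar>\<gamma>\<bar>" 0 2] by (auto simp: q_def)
  \<comment> \<open>Outer radii of the shells: they shrink towards \<open>y\<close> for positive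
    \<open>\<gamma>\<close> and run to infinity otherwise. The shift by \<open>Suc\<close> makes the
    innermost shell of the exterior start at \<open>R\<close>.\<close>
  define \<rho> where "\<rho> j = (if \<gamma> > 0 then R / 2 ^ j else R * 2 ^ Suc j)" for j :: nat
  have rho: "0 < \<rho> j" for j using R by (simp add: \<rho>_def)
  have rho_g: "\<rho> j powr \<gamma> \<le> T * q ^ j" for j
  proof (cases "\<gamma> > 0")
    case True
    have "\<rho> j powr \<gamma> = T * (2 powr - \<gamma>) ^ j"
    proof -
      have e1: "((2::real) ^ j) powr \<gamma> = 2 powr (real j * \<gamma>)" by (simp add: powr_powr flip: powr_realpow)
      have e2: "(2 powr - \<gamma>) ^ j = 2 powr (- (real j * \<gamma>))" by (simp add: powr_powr mult.commute flip: powr_realpow)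
      show ?thesis using True R by (simp add: \<rho>_def divide_powr_uminus e1 e2 powr_divide)
    qed
    then show ?thesis using True by (simp add: q_def)
  next
    case False
    then have "\<rho> j powr \<gamma> = T * (2 powr \<gamma>) ^ Suc j"
    proof -
      have e1: "((2::real) ^ Suc j) powr \<gamma> = 2 powr (real (Suc j) * \<gamma>)" by (simp only: powr_powr flip: powr_realpow)
      have e2: "(2 powr \<gamma>) ^ Suc j = 2 powr (real (Suc j) * \<gamma>)"
        by (simp add: powr_powr mult.commute flip: powr_realpow del: power_Suc)
      have "\<rho> j powr \<gamma> = R powr \<gamma> * ((2::real) ^ Suc j) powr \<gamma>"
        using False R by (simp add: \<rho>_def powr_mult del: power_Suc)
      then show ?thesis using R(2) by (simp only: e1 e2)
    qed
    also have "\<dots> \<le> T * (2 powr \<gamma>) ^ j"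
    proof -
      have "2 powr \<gamma> \<le> 2 powr 0" using False by (intro powr_mono) auto
      then show ?thesis using T by (intro mult_left_mono power_decreasing) auto
    qed
    finally show ?thesis using False g by (simp add: q_def)
  qed
  define A where "A j = {x. \<rho> j / 2 \<le> dist x y \<and> dist x y \<le> \<rho> j}" for j
  have A[measurable]: "A j \<in> sets lebesgue" for j
  proof -
    show ?thesis unfolding A_def by simp
  qed
  have cov: "\<exists>j. x \<in> A j" if x: "dist x y powr \<gamma> < T" "x \<noteq> y" for x
  proof -
    have d: "0 < dist x y" using x by simp
    show ?thesis
    proof (cases "\<gamma> > 0")
      case True
      have "dist x y < R"
      proof (rule ccontr)
        assume "\<not> dist x y < R"
        then have "R powr \<gamma> \<le> dist x y powr \<gamma>" using True R by (intro powr_mono2) auto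
        with x R show False by simp
      qed
      then have "1 \<le> R / dist x y" using d by simp
      then obtain j :: nat where "2 ^ j \<le> R / dist x y" "R / dist x y \<le> 2 ^ Suc j" using dyadic_bracket by blast
      then show ?thesis using d True by (intro exI[of _ j]) (auto simp: A_def \<rho>_def field_simps)
    next
      case False
      have "R < dist x y"
      proof (rule ccontr)
        assume "\<not> R < dist x y"
        then have "R powr \<gamma> \<le> dist x y powr \<gamma>" using False R d by (intro powr_mono2') auto
        with x R show False by simp
      qed
      then have "1 \<le> dist x y / R" using R by simp
      then obtain j :: nat where "2 ^ j \<le> dist x y / R" "dist x y / R \<le> 2 ^ Suc j" using dyadic_bracket by blast
      then show ?thesis using R False by (intro exI[of _ j]) (auto simp: A_def \<rho>_def field_simps)
    qed
  qed
  have pw: "dist x y powr (\<gamma> - ?n) \<le> 2 powr \<bar>\<gamma> - ?n\<bar> * \<rho> j powr (\<gamma> - ?n)" if "x \<in> A j" for x j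
  proof -
    let ?u = "dist x y / \<rho> j"
    have u: "1/2 \<le> ?u" "?u \<le> 1" using that rho[of j] by (auto simp: A_def field_simps)
    have "?u powr (\<gamma> - ?n) \<le> 2 powr \<bar>\<gamma> - ?n\<bar>"
    proof (cases "\<gamma> - ?n \<ge> 0")
      case True
      then have "?u powr (\<gamma> - ?n) \<le> 1 powr (\<gamma> - ?n)" using u by (intro powr_mono2) linarith+
      also have "\<dots> \<le> 2 powr \<bar>\<gamma> - ?n\<bar>" by (simp add: ge_one_powr_ge_zero)
      finally show ?thesis .
    next
      case False
      then have "?u powr (\<gamma> - ?n) \<le> (1/2) powr (\<gamma> - ?n)" using u by (intro powr_mono2') auto
      also have "\<dots> = 2 powr \<bar>\<gamma> - ?n\<bar>" using False by (simp add: powr_divide powr_minus_divide[symmetric])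
      finally show ?thesis .
    qed
    moreover have "dist x y powr (\<gamma> - ?n) = ?u powr (\<gamma> - ?n) * \<rho> j powr (\<gamma> - ?n)"
      using rho[of j] by (simp add: powr_divide)
    ultimately show ?thesis by (simp add: mult_right_mono)
  qed
  let ?c = "2 powr \<bar>\<gamma> - ?n\<bar> * ?k * 2 ^ DIM('a)"
  have c: "0 \<le> ?c" by (simp add: less_imp_le)
  let ?Y = "\<lambda>j. 2 powr \<bar>\<gamma> - ?n\<bar> * \<rho> j powr (\<gamma> - ?n)"
  \<comment> \<open>The open ball is given radius \<open>2 * \<rho> j\<close> so that it contains
    the closed shell, whence the factor \<open>2 ^ DIM('a)\<close> in \<open>?c\<close>.\<close>
  have each: "(\<integral>\<^sup>+ x\<in>A j. ennreal (?X x) \<partial>lebesgue) \<le> ennreal (?c * T) * maximal_op w y * ennreal (q ^ j)" for j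
  proof -
    have "(\<integral>\<^sup>+ x\<in>A j. ennreal (?X x) \<partial>lebesgue)
       \<le> (\<integral>\<^sup>+ x. ennreal (?Y j) * (ennreal \<bar>w x\<bar> * indicator (ball y (2 * \<rho> j)) x) \<partial>lebesgue)"
    proof (rule nn_integral_mono)
      fix x :: 'a
      show "ennreal (?X x) * indicator (A j) x
         \<le> ennreal (?Y j) * (ennreal \<bar>w x\<bar> * indicator (ball y (2 * \<rho> j)) x)"
      proof (cases "x \<in> A j")
        case True
        then have "x \<in> ball y (2 * \<rho> j)" using rho[of j] by (auto simp: A_def dist_commute)
        then show ?thesis using True pw[OF True]
          by (simp add: mult_right_mono ennreal_leI flip: ennreal_mult)
      qed simp
    qed
    also have "\<dots> = ennreal (?Y j) * (\<integral>\<^sup>+ x\<in>ball y (2 * \<rho> j). ennreal \<bar>w x\<bar> \<partial>lebesgue)"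
      by (rule nn_integral_cmult) measurable
    also have "\<dots> \<le> ennreal (?Y j) * (emeasure lebesgue (ball y (2 * \<rho> j)) * maximal_op w y)"
      using rho[of j] by (intro mult_left_mono maximal_op_ball) auto
    also have "\<dots> = ennreal (?c * \<rho> j powr \<gamma>) * maximal_op w y"
    proof -
      have "?c * \<rho> j powr \<gamma> = 2 powr \<bar>\<gamma> - ?n\<bar> * \<rho> j powr (\<gamma> - ?n) * (?k * (2 * \<rho> j) ^ DIM('a))"
        using rho[of j] by (simp add: powr_diff powr_realpow)
      then have "ennreal (?Y j) * ennreal (?k * (2 * \<rho> j) ^ DIM('a)) = ennreal (?c * \<rho> j powr \<gamma>)"
        using rho[of j] by (simp only:) (intro ennreal_mult''[symmetric], simp add: less_imp_le)
      moreover have "emeasure lebesgue (ball y (2 * \<rho> j)) = ennreal (?k * (2 * \<rho> j) ^ DIM('a))"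
        using rho[of j] by (intro emeasure_ball_lebesgue) simp
      ultimately show ?thesis by (metis mult.assoc)
    qed
    also have "\<dots> \<le> ennreal (?c * (T * q ^ j)) * maximal_op w y"
      by (intro mult_right_mono ennreal_leI mult_left_mono rho_g c) auto
    also have "\<dots> = ennreal (?c * T) * maximal_op w y * ennreal (q ^ j)"
    proof -
      have "?c * (T * q ^ j) = (?c * T) * q ^ j" by simp
      then have "ennreal (?c * (T * q ^ j)) = ennreal ((?c * T) * q ^ j)" by (rule arg_cong)
      also have "\<dots> = ennreal (?c * T) * ennreal (q ^ j)" using q by (intro ennreal_mult'') simp
      finally have "ennreal (?c * (T * q ^ j)) = ennreal (?c * T) * ennreal (q ^ j)" .
      then show ?thesis by (simp only: mult_ac)
    qed
    finally show ?thesis .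
  qed
  have km: "(\<lambda>x. ennreal (?X x)) \<in> borel_measurable lebesgue" by measurable
  let ?Z = "\<lambda>x. \<Sum>j. ennreal (?X x) * indicator (A j) x"
  have "(\<integral>\<^sup>+ x\<in>{x. dist x y powr \<gamma> < T}. ennreal (?X x) \<partial>lebesgue)
    \<le> (\<integral>\<^sup>+ x. (?Z x) \<partial>lebesgue)"
  proof (rule nn_integral_mono)
    fix x :: 'a
    show "ennreal (?X x) * indicator {x. dist x y powr \<gamma> < T} x
      \<le> (?Z x)"
    \<comment> \<open>No shell contains \<open>y\<close> itself, but there the kernel is 0, since
      \<open>0 powr a\<close> is 0.\<close>
    proof (cases "dist x y powr \<gamma> < T \<and> x \<noteq> y")
      case True
      then obtain j where "x \<in> A j" using cov by blast
      then have "ennreal (?X x) * indicator {x. dist x y powr \<gamma> < T} x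
        = (\<Sum>j\<in>{j}. ennreal (?X x) * indicator (A j) x)" using True by simp
      also have "\<dots> \<le> (?Z x)" by (rule sum_le_suminf) auto
      finally show ?thesis .
    next
      case False
      then show ?thesis by (auto simp: indicator_def)
    qed
  qed
  also have "\<dots> = (\<Sum>j. \<integral>\<^sup>+ x\<in>A j. ennreal (?X x) \<partial>lebesgue)"
    by (intro nn_integral_suminf borel_measurable_times_ennreal km borel_measurable_indicator A)
  also have "\<dots> \<le> (\<Sum>j. ennreal (?c * T) * maximal_op w y * ennreal (q ^ j))"
    by (intro suminf_le each) auto
  also have "\<dots> = ennreal (?c * T) * maximal_op w y * (\<Sum>j. ennreal (q ^ j))"
    by (rule ennreal_suminf_cmult)
  also have "(\<Sum>j. ennreal (q ^ j)) = ennreal (1 / (1 - q))"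
    using q by (subst suminf_ennreal2) (auto simp: suminf_geometric summable_geometric)
  also have "ennreal (?c * T) * maximal_op w y * ennreal (1 / (1 - q)) = ennreal (?c / (1 - q)) * (ennreal T * maximal_op w y)"
  proof -
    have "ennreal (?c * T) * ennreal (1 / (1 - q)) = ennreal (?c / (1 - q)) * ennreal T"
      using c T q by (simp flip: ennreal_mult'')
    moreover have "a * b = c * d \<Longrightarrow> a * m * b = c * (d * m)" for a b c d m :: ennreal
      by (metis mult.assoc mult.commute)
    ultimately show ?thesis by blast
  qed
  finally show ?thesis unfolding q_def .
qed

subsection \<open>Smooth bump functions\<close>

text \<open>The family is closed under differentiation up to linear combinations
  (\<open>flat_derivative\<close>), so smoothness of every order follows without any formula for
  higher derivatives. \<open>flat 0\<close> is the classical function exp (-1/t), continued by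
  0.\<close>

definition flat :: "nat \<Rightarrow> real \<Rightarrow> real" where
  "flat m t = (if 0 < t then exp (- (1 / t)) / t ^ m else 0)"

lemma flat_nonneg: "0 \<le> flat m t"
  by (simp add: flat_def)

lemma flat_eq_0_iff: "flat m t = 0 \<longleftrightarrow> t \<le> 0"
  by (auto simp: flat_def)

lemma power_fact_le_exp: "0 \<le> (u::real) \<Longrightarrow> u ^ m / fact m \<le> exp u"
proof -
  assume u: "0 \<le> u"
  have s: "(\<lambda>n. u ^ n /\<^sub>R fact n) sums exp u" by (rule exp_converges)
  have "(\<Sum>n\<in>{m}. u ^ n /\<^sub>R fact n) \<le> (\<Sum>n. u ^ n /\<^sub>R fact n)"
    using s u by (intro sum_le_suminf) (auto simp: sums_iff)
  then show ?thesis using s by (simp add: sums_iff divide_inverse mult.commute)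
qed

text \<open>Keeps a single term, of order \<open>m + k\<close>, in the exponential series of
  \<open>exp (1 / t)\<close>. The free exponent \<open>k\<close> expresses flatness of infinite
  order at 0.\<close>

lemma flat_le: "flat m t \<le> fact (m + k) * \<bar>t\<bar> ^ k"
proof (cases "0 < t")
  case True
  have "(1 / t) ^ (m + k) / fact (m + k) \<le> exp (1 / t)" using True by (intro power_fact_le_exp) simp
  then have "exp (- (1 / t)) \<le> fact (m + k) * t ^ (m + k)"
    using True by (simp add: exp_minus field_simps)
  then show ?thesis using True by (simp add: flat_def field_simps power_add)
qed (simp add: flat_def)

lemma flat_bounded: "flat m t \<le> fact m"
  using flat_le[of m t 0] by simp

lemma flat_derivative:
  "(flat m has_real_derivative (flat (m + 2) t - real m * flat (m + 1) t)) (at t)"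
proof -
  let ?X = "(exp (- (1 / t)) * (1 / t^2)) * t ^ m - exp (- (1 / t)) * (real m * t ^ (m - 1))"
  consider "t > 0" | "t < 0" | "t = 0" by linarith
  then show ?thesis
  proof cases
    case 1
    have "((\<lambda>t. exp (- (1 / t)) / t ^ m) has_real_derivative (flat (m + 2) t - real m * flat (m + 1) t)) (at t)"
    proof -
      have "((\<lambda>t. exp (- (1 / t)) / t ^ m) has_real_derivative
         ?X / (t ^ m * t ^ m)) (at t)" using 1 by (auto intro!: derivative_eq_intros simp: power2_eq_square field_simps)
      moreover have "?X / (t ^ m * t ^ m)
          = flat (m + 2) t - real m * flat (m + 1) t"
            using 1 by (cases m) (auto simp: flat_def field_simps power2_eq_square)
      ultimately show ?thesis by simp
    qed
    moreover have "eventually (\<lambda>x. exp (- (1 / x)) / x ^ m = flat m x) (nhds t)"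
      using eventually_nhds_in_open[of "{0<..}" t] 1 by (auto simp: flat_def elim!: eventually_mono)
    ultimately show ?thesis by (subst (asm) DERIV_cong_ev[OF refl _ refl])
  next
    case 2
    have "((\<lambda>t::real. 0::real) has_real_derivative 0) (at t)" by simp
    moreover have "eventually (\<lambda>x. 0 = flat m x) (nhds t)"
      using eventually_nhds_in_open[of "{..<0}" t] 2 by (auto simp: flat_def elim!: eventually_mono)
    ultimately have "(flat m has_real_derivative 0) (at t)"
      by (subst (asm) DERIV_cong_ev[OF refl _ refl])
    then show ?thesis using 2 by (simp add: flat_def)
  next
    \<comment> \<open>With exponent 2 in \<open>flat_le\<close> the difference quotient at 0 is at
      most a constant times \<open>\<bar>h\<bar>\<close>.\<close>
    case 3
    have "((\<lambda>h. flat m h / h) \<longlongrightarrow> 0) (at 0)"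
    proof (rule Lim_null_comparison)
      show "\<forall>\<^sub>F h in at 0. norm (flat m h / h) \<le> fact (m + 2) * \<bar>h\<bar>"
      proof (rule eventually_at_topological[THEN iffD2], intro exI[of _ UNIV] conjI ballI impI)
        fix h :: real assume h: "h \<noteq> 0"
        have "flat m h \<le> fact (m + 2) * \<bar>h\<bar> ^ 2" by (rule flat_le)
        then have "flat m h / \<bar>h\<bar> \<le> fact (m + 2) * \<bar>h\<bar>"
          using h by (simp add: pos_divide_le_eq power2_eq_square mult.assoc del: fact_Suc)
        then show "norm (flat m h / h) \<le> fact (m + 2) * \<bar>h\<bar>"
          by (simp add: flat_nonneg)
      qed auto
      show "((\<lambda>h::real. fact (m + 2) * \<bar>h\<bar>) \<longlongrightarrow> 0) (at 0)"
        by (rule tendsto_eq_intros refl | simp)+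
    qed
    then show ?thesis using 3 by (simp add: has_field_derivative_iff flat_def)
  qed
qed

text \<open>A generated class, not the class of all smooth functions: it is large enough for the
  bumps below and closed under partial derivatives (\<open>smooth_frechet_derivative\<close>), so
  that \<open>Ck_on k UNIV\<close> follows for all \<open>k\<close> by induction.\<close>

inductive smooth :: "('a::euclidean_space \<Rightarrow> real) \<Rightarrow> bool" where
  const: "smooth (\<lambda>x. c)"
| inner: "smooth (\<lambda>x. x \<bullet> b)"
| add: "smooth f \<Longrightarrow> smooth g \<Longrightarrow> smooth (\<lambda>x. f x + g x)"
| mult: "smooth f \<Longrightarrow> smooth g \<Longrightarrow> smooth (\<lambda>x. f x * g x)"
| flat: "smooth f \<Longrightarrow> smooth (\<lambda>x. flat m (f x))"

lemma smooth_cmult: "smooth f \<Longrightarrow> smooth (\<lambda>x. c * f x)"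
  by (rule smooth.mult[OF smooth.const])

lemma smooth_diff: "smooth f \<Longrightarrow> smooth g \<Longrightarrow> smooth (\<lambda>x. f x - g x)"
  using smooth.add[of f "\<lambda>x. (-1) * g x"] smooth_cmult[of g "-1"] by simp

lemma smooth_sum: "finite I \<Longrightarrow> (\<And>i. i \<in> I \<Longrightarrow> smooth (f i)) \<Longrightarrow> smooth (\<lambda>x. \<Sum>i\<in>I. f i x)"
proof (induction rule: finite_induct)
  case empty
  then show ?case by (simp add: smooth.const)
next
  case (insert i I)
  then show ?case using smooth.add[of "f i" "\<lambda>x. \<Sum>i\<in>I. f i x"] by simp
qed

lemma smooth_inner_diff: "smooth (\<lambda>x. (x - z) \<bullet> b)"
  using smooth_diff[OF smooth.inner[of b] smooth.const[of "z \<bullet> b"]] by (simp add: inner_diff_left)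

lemma smooth_dist_sq: "smooth (\<lambda>x. (dist x z)\<^sup>2)"
proof -
  let ?X = "\<lambda>x. \<Sum>i\<in>Basis. ((x - z) \<bullet> i) * ((x - z) \<bullet> i)"
  have "smooth ?X" by (intro smooth_sum smooth.mult smooth_inner_diff) auto
  moreover have "?X = (\<lambda>x. (dist x z)\<^sup>2)"
    proof
    fix x
    show "(\<Sum>i\<in>Basis. ((x - z) \<bullet> i) * ((x - z) \<bullet> i)) = (dist x z)\<^sup>2"
      using euclidean_inner[of "x - z" "x - z"] by (simp add: dist_norm power2_norm_eq_inner)
  qed
  ultimately show ?thesis by simp
qed

lemma smooth_derivative:
  assumes "smooth f"
  shows "\<exists>f'. (\<forall>x. (f has_derivative f' x) (at x)) \<and> (\<forall>i. smooth (\<lambda>x. f' x i))"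
  using assms
proof induction
  case (const c)
  show ?case by (rule exI[of _ "\<lambda>x h. 0"]) (auto intro: smooth.const)
next
  case (inner b)
  show ?case by (rule exI[of _ "\<lambda>x h. h \<bullet> b"]) (auto intro: smooth.const derivative_intros)
next
  case (add f g)
  then obtain f' g' where *: "\<forall>x. (f has_derivative f' x) (at x)" "\<forall>i. smooth (\<lambda>x. f' x i)"
    "\<forall>x. (g has_derivative g' x) (at x)" "\<forall>i. smooth (\<lambda>x. g' x i)" by blast
  then show ?case
    by (intro exI[of _ "\<lambda>x h. f' x h + g' x h"]) (auto intro!: smooth.add derivative_intros)
next
  case (mult f g)
  then obtain f' g' where *: "\<forall>x. (f has_derivative f' x) (at x)" "\<forall>i. smooth (\<lambda>x. f' x i)"
    "\<forall>x. (g has_derivative g' x) (at x)" "\<forall>i. smooth (\<lambda>x. g' x i)" by blast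
  then show ?case using mult.hyps
    by (intro exI[of _ "\<lambda>x h. f x * g' x h + f' x h * g x"]) (auto intro!: smooth.add smooth.mult has_derivative_mult)
next
  case (flat f m)
  then obtain f' where *: "\<forall>x. (f has_derivative f' x) (at x)" "\<forall>i. smooth (\<lambda>x. f' x i)" by blast
  have "((\<lambda>x. flat m (f x)) has_derivative (\<lambda>h. f' x h * (flat (m + 2) (f x) - real m * flat (m + 1) (f x)))) (at x)" for x
    by (rule DERIV_compose_FDERIV[OF flat_derivative]) (use * in auto)
  then show ?case using flat.hyps *(2)
    by (intro exI[of _ "\<lambda>x h. f' x h * (flat (m + 2) (f x) - real m * flat (m + 1) (f x))"])
       (auto intro!: smooth.mult smooth_diff smooth_cmult smooth.flat)
qed

lemma smooth_has_derivative:
  "smooth f \<Longrightarrow> (f has_derivative frechet_derivative f (at x)) (at x)"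
  using smooth_derivative[of f] frechet_derivative_works differentiableI by metis

lemma smooth_frechet_derivative: "smooth f \<Longrightarrow> smooth (\<lambda>x. frechet_derivative f (at x) i)"
proof -
  assume "smooth f"
  then obtain f' where *: "\<forall>x. (f has_derivative f' x) (at x)" "\<forall>i. smooth (\<lambda>x. f' x i)"
    using smooth_derivative by blast
  then have "frechet_derivative f (at x) = f' x" for x by (metis frechet_derivative_at)
  then show ?thesis using * by simp
qed

lemma smooth_continuous: "smooth f \<Longrightarrow> continuous_on S f"
  by (meson continuous_at_imp_continuous_on has_derivative_continuous smooth_has_derivative)

lemma smooth_Ck_on: "smooth f \<Longrightarrow> Ck_on k UNIV f"
proof (induction k arbitrary: f)
  case 0
  then show ?case by (simp add: smooth_continuous)
next
  case (Suc k)
  then show ?case by (auto intro: smooth_frechet_derivative differentiableI smooth_has_derivative)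
qed

lemma smooth_test_function:
  assumes f: "smooth f" and "\<And>x. x \<notin> ball z r \<Longrightarrow> f x = 0" and "cball z r \<subseteq> \<Omega>"
  shows "test_function \<Omega> f"
proof -
  have "closure {x. f x \<noteq> 0} \<subseteq> cball z r"
    using assms(2) ball_subset_cball by (intro closure_minimal) (auto intro: ccontr)
  moreover from this have "compact (closure {x. f x \<noteq> 0})"
    by (metis bounded_cball bounded_subset closed_closure compact_eq_bounded_closed)
  ultimately show ?thesis using f assms(3) smooth_Ck_on unfolding test_function_def by blast
qed

lemma test_function_frechet_derivative:
  assumes "test_function \<Omega> \<phi>"
  shows "(\<phi> has_derivative frechet_derivative \<phi> (at x)) (at x)"
    and "i \<in> Basis \<Longrightarrow> continuous_on UNIV (\<lambda>x. frechet_derivative \<phi> (at x) i)"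
    and "continuous_on UNIV \<phi>"
proof -
  have 0: "Ck_on 0 UNIV \<phi>" and 1: "Ck_on (Suc 0) UNIV \<phi>" using assms by (auto simp: test_function_def)
  show "(\<phi> has_derivative frechet_derivative \<phi> (at x)) (at x)"
    using 1 by (auto simp: frechet_derivative_works)
  show "i \<in> Basis \<Longrightarrow> continuous_on UNIV (\<lambda>x. frechet_derivative \<phi> (at x) i)" using 1 by auto
  show "continuous_on UNIV \<phi>" using 0 by simp
qed

section \<open>Integration of derivatives of compactly supported functions\<close>

lemma derivative_zero_off_support:
  assumes "closed K" "\<And>x. x \<notin> K \<Longrightarrow> f x = 0" "x \<notin> K" "(f has_derivative f') (at x)"
  shows "f' = (\<lambda>h. 0)"
proof -
  have "eventually (\<lambda>y. f y = 0) (nhds x)"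
    using eventually_nhds_in_open[of "- K" x] assms by (smt (verit, ccfv_SIG) Compl_iff eventually_nhds open_Compl)
  then have "((\<lambda>x. 0) has_derivative f') (at x)"
    using assms(2,3,4) by (smt (verit, best) UNIV_I eventually_at_topological eventually_nhds_conv_at has_derivative_transform_within_open)
  then show ?thesis by (metis has_derivative_const has_derivative_unique)
qed

lemma translation_lebesgue_integral:
  fixes f :: "'a::euclidean_space \<Rightarrow> real"
  assumes [measurable]: "f \<in> borel_measurable borel"
  shows "(LINT x|lebesgue. f (c + x)) = (LINT x|lebesgue. f x)"
proof -
  have "(LINT x|lebesgue. f x) = (LINT x|distr lborel borel ((+) c). f x)"
    by (simp add: lborel_distr_plus integral_completion)
  also have "\<dots> = (LINT x|lborel. f (c + x))" by (subst integral_distr) auto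
  also have "\<dots> = (LINT x|lebesgue. f (c + x))" by (simp add: integral_completion)
  finally show ?thesis by simp
qed

text \<open>The difference quotients of \<open>F\<close> in direction \<open>i\<close> have integral
  0 by translation invariance. The mean value theorem bounds them by the maximum of the derivative
  on a ball enlarged by \<open>norm i\<close>, because the steps are at most 1, and dominated
  convergence gives the claim.\<close>

lemma integral_derivative_compact_support:
  fixes F :: "'a::euclidean_space \<Rightarrow> real"
  assumes der: "\<And>x. (F has_derivative F' x) (at x)" and cont: "continuous_on UNIV (\<lambda>x. F' x i)"
    and supp: "\<And>x. x \<notin> cball z r \<Longrightarrow> F x = 0"
  shows "(LINT x|lebesgue. F' x i) = 0"
proof -
  let ?X = "\<bar>r\<bar> + norm i"
  have Fc: "continuous_on UNIV F"
    using der by (meson continuous_at_imp_continuous_on has_derivative_continuous)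
  have Fm[measurable]: "F \<in> borel_measurable borel" using Fc by (rule borel_measurable_continuous_onI)
  have F'm[measurable]: "(\<lambda>x. F' x i) \<in> borel_measurable borel" using cont by (rule borel_measurable_continuous_onI)
  have F'0: "F' x i = 0" if "x \<notin> cball z r" for x
    using derivative_zero_off_support[OF closed_cball supp that der] by simp
  have "compact ((\<lambda>x. F' x i) ` cball z r)"
    by (intro compact_continuous_image continuous_on_subset[OF cont]) auto
  then obtain M where M0: "0 < M" and "\<forall>y\<in>(\<lambda>x. F' x i) ` cball z r. norm y \<le> M"
    using compact_imp_bounded bounded_pos by metis
  then have M: "\<bar>F' x i\<bar> \<le> M" for x using F'0[of x] by (cases "x \<in> cball z r") auto
  define s where "s k = inverse (real (Suc k))" for k
  have s: "0 < s k" "s k \<le> 1" for k by (auto simp: s_def field_simps)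
  have s0: "s \<longlonglongrightarrow> 0" unfolding s_def using LIMSEQ_inverse_real_of_nat by simp
  have line: "((\<lambda>t. F (x + t *\<^sub>R i)) has_real_derivative F' (x + t *\<^sub>R i) i) (at t)" for x t
  proof -
    have "((\<lambda>t. F (x + t *\<^sub>R i)) has_derivative (\<lambda>h. F' (x + t *\<^sub>R i) (h *\<^sub>R i))) (at t)"
      by (rule has_derivative_compose[of "\<lambda>t. x + t *\<^sub>R i" "\<lambda>h. h *\<^sub>R i", OF _ der]) (auto intro!: derivative_eq_intros)
    moreover have "(\<lambda>h. F' (x + t *\<^sub>R i) (h *\<^sub>R i)) = (\<lambda>h. h * F' (x + t *\<^sub>R i) i)"
      using linear_scale[OF has_derivative_linear[OF der]] by (auto simp: fun_eq_iff)
    ultimately show ?thesis by (simp add: has_derivative_imp_has_field_derivative)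
  qed
  define q where "q k x = (F (s k *\<^sub>R i + x) - F x) / s k" for k x
  have qM: "\<bar>q k x\<bar> \<le> M" for k x
  proof -
    obtain t where "F (x + s k *\<^sub>R i) - F x = s k * F' (x + t *\<^sub>R i) i"
      using MVT2[of 0 "s k" "\<lambda>t. F (x + t *\<^sub>R i)" "\<lambda>t. F' (x + t *\<^sub>R i) i"] s[of k] line by auto
    then show ?thesis using s[of k] M by (simp add: q_def add.commute)
  qed
  have q0: "q k x = 0" if "x \<notin> cball z ?X" for k x
  proof -
    have "\<bar>r\<bar> + norm i < dist z x" using that by simp
    moreover have "dist z x \<le> dist z (s k *\<^sub>R i + x) + norm (s k *\<^sub>R i)"
      using norm_triangle_ineq[of "z - (s k *\<^sub>R i + x)" "s k *\<^sub>R i"] by (simp add: dist_norm algebra_simps)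
    moreover have "norm (s k *\<^sub>R i) \<le> norm i" using s[of k] by (simp add: mult_left_le_one_le)
    ultimately have "s k *\<^sub>R i + x \<notin> cball z r" "x \<notin> cball z r"
      using abs_ge_self[of r] norm_ge_zero[of i] unfolding mem_cball by linarith+
    then show ?thesis using supp by (simp add: q_def)
  qed
  have lim: "(\<lambda>k. q k x) \<longlonglongrightarrow> F' x i" for x
  proof -
    have "((\<lambda>t. (F (x + t *\<^sub>R i) - F (x + 0 *\<^sub>R i)) / (t - 0)) \<longlongrightarrow> F' (x + 0 *\<^sub>R i) i) (at 0)"
      using line[of x 0] unfolding has_field_derivative_iff by blast
    moreover have "filterlim s (at 0) sequentially"
      using s0 s by (auto simp: filterlim_at less_imp_neq[symmetric] intro!: always_eventually)
    ultimately have "((\<lambda>k. (F (x + s k *\<^sub>R i) - F (x + 0 *\<^sub>R i)) / (s k - 0)) \<longlonglongrightarrow> F' (x + 0 *\<^sub>R i) i)"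
      by (rule filterlim_compose)
    then show ?thesis by (simp add: q_def add.commute)
  qed
  have fm: "cball z ?X \<in> lmeasurable" by simp
  have "(\<lambda>k. LINT x|lebesgue. q k x) \<longlonglongrightarrow> (LINT x|lebesgue. F' x i)"
  proof (rule integral_dominated_convergence)
    show "integrable lebesgue (\<lambda>x. M * indicator (cball z ?X) x)"
      using fm by (intro integrable_mult_right integrable_real_indicator) (auto simp: fmeasurable_def)
    show "AE x in lebesgue. (\<lambda>k. q k x) \<longlonglongrightarrow> F' x i" using lim by simp
    show "AE x in lebesgue. norm (q k x) \<le> M * indicator (cball z ?X) x" for k
      using qM q0 by (intro AE_I2) (auto simp: indicator_def)
    show "(\<lambda>x. F' x i) \<in> borel_measurable lebesgue" by (rule borel_imp_lebesgue_measurable) measurable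
    show "q k \<in> borel_measurable lebesgue" for k unfolding q_def by (rule borel_imp_lebesgue_measurable) measurable
  qed
  moreover have "(LINT x|lebesgue. q k x) = 0" for k
  proof -
    have i1: "integrable lebesgue F"
    proof -
      have "integrable lborel F"
      proof -
        have "integrable lborel (\<lambda>x. indicator (cball z r) x *\<^sub>R F x)"
          using borel_integrable_compact[OF compact_cball continuous_on_subset[OF Fc subset_UNIV]] by (simp add: mult.commute indicator_def if_distrib cong: if_cong)
        moreover have "(\<lambda>x. indicator (cball z r) x *\<^sub>R F x) = F" using supp by (auto simp: indicator_def fun_eq_iff)
        ultimately show ?thesis by simp
      qed
      then show ?thesis by (simp add: integrable_completion)
    qed
    have i2: "integrable lebesgue (\<lambda>x. F (s k *\<^sub>R i + x))"
    proof -
      have "integrable lborel F" using i1 by (simp add: integrable_completion)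
      then have "integrable (distr lborel borel ((+) (s k *\<^sub>R i))) F" by (simp add: lborel_distr_plus)
      then have "integrable lborel (\<lambda>x. F (s k *\<^sub>R i + x))" by (subst (asm) integrable_distr_eq) auto
      then show ?thesis by (simp add: integrable_completion)
    qed
    show ?thesis unfolding q_def using i1 i2 by (simp add: translation_lebesgue_integral[OF Fm])
  qed
  ultimately show ?thesis by (simp add: LIMSEQ_const_iff)
qed

lemma lebesgue_integral_affine:
  fixes f :: "'a::euclidean_space \<Rightarrow> real"
  assumes [measurable]: "f \<in> borel_measurable borel" and c: "c \<noteq> 0"
  shows "(LINT x|lebesgue. f x) = \<bar>c\<bar> ^ DIM('a) * (LINT x|lebesgue. f (t + c *\<^sub>R x))"
proof -
  have "(LINT x|lebesgue. f x) = (LINT x|density (distr lborel borel (\<lambda>x. t + c *\<^sub>R x)) (\<lambda>_. \<bar>c\<bar> ^ DIM('a)). f x)"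
    using lborel_affine[OF c, of t] by (simp add: integral_completion)
  also have "\<dots> = (LINT x|distr lborel borel (\<lambda>x. t + c *\<^sub>R x). \<bar>c\<bar> ^ DIM('a) *\<^sub>R f x)"
    by (subst integral_density) (auto simp: )
  also have "\<dots> = (LINT x|lborel. \<bar>c\<bar> ^ DIM('a) *\<^sub>R f (t + c *\<^sub>R x))"
    by (subst integral_distr) auto
  also have "\<dots> = \<bar>c\<bar> ^ DIM('a) * (LINT x|lebesgue. f (t + c *\<^sub>R x))"
    by (simp add: integral_completion)
  finally show ?thesis .
qed

lemma integrable_bounded_mult:
  fixes f \<phi> :: "'a::euclidean_space \<Rightarrow> real"
  assumes f: "locally_integrable_on f \<Omega>" and K: "compact K" "K \<subseteq> \<Omega>"
    and phi: "\<phi> \<in> borel_measurable lebesgue" and B: "\<And>x. \<bar>\<phi> x\<bar> \<le> B" and 0: "\<And>x. x \<notin> K \<Longrightarrow> \<phi> x = 0"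
  shows "integrable lebesgue (\<lambda>x. f x * \<phi> x)"
    and "(LINT x:\<Omega>|lebesgue. f x * \<phi> x) = (LINT x|lebesgue. f x * \<phi> x)"
proof -
  have "set_integrable lebesgue K f" using f K by (auto simp: locally_integrable_on_def)
  then have i: "integrable lebesgue (\<lambda>x. indicator K x *\<^sub>R f x)" by (simp add: set_integrable_def)
  have eq: "f x * \<phi> x = (indicator K x *\<^sub>R f x) * \<phi> x" for x using 0[of x] by (auto simp: indicator_def)
  show "integrable lebesgue (\<lambda>x. f x * \<phi> x)"
  proof (rule Bochner_Integration.integrable_bound[of _ "\<lambda>x. B * (indicator K x *\<^sub>R f x)"])
    show "integrable lebesgue (\<lambda>x. B * (indicator K x *\<^sub>R f x))" using i by (rule integrable_mult_right)
    show "(\<lambda>x. f x * \<phi> x) \<in> borel_measurable lebesgue"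
      unfolding eq using borel_measurable_integrable[OF i] phi by measurable
    have "\<bar>f x\<bar> * \<bar>\<phi> x\<bar> \<le> \<bar>f x\<bar> * \<bar>B\<bar>" for x
      using B[of x] by (intro mult_left_mono) auto
    then show "AE x in lebesgue. norm (f x * \<phi> x) \<le> norm (B * (indicator K x *\<^sub>R f x))"
      using 0 by (intro AE_I2) (auto simp: indicator_def abs_mult mult.commute)
  qed
  show "(LINT x:\<Omega>|lebesgue. f x * \<phi> x) = (LINT x|lebesgue. f x * \<phi> x)"
    unfolding set_lebesgue_integral_def
    using 0 K by (intro Bochner_Integration.integral_cong) (auto simp: indicator_def)
qed

lemma locally_integrable_onD:
  assumes "locally_integrable_on f \<Omega>" "compact K" "K \<subseteq> \<Omega>"
  shows "integrable lebesgue (\<lambda>x. indicator K x *\<^sub>R f x)"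
    and "(\<lambda>x. indicator K x *\<^sub>R f x) \<in> borel_measurable lebesgue"
proof -
  show "integrable lebesgue (\<lambda>x. indicator K x *\<^sub>R f x)"
    using assms unfolding locally_integrable_on_def set_integrable_def by blast
  then show "(\<lambda>x. indicator K x *\<^sub>R f x) \<in> borel_measurable lebesgue" by (rule borel_measurable_integrable)
qed

subsection \<open>Lebesgue points\<close>

text \<open>The strong form, with the absolute value under the integral. It controls averages over
  every ball of proportionate size near \<open>x\<close>, not only over centred ones, and that is
  how it is used along curves.\<close>

definition lebesgue_point :: "('a::euclidean_space \<Rightarrow> real) \<Rightarrow> 'a \<Rightarrow> bool" where
  "lebesgue_point f x \<longleftrightarrow> (\<forall>e>0. \<exists>\<delta>>0. \<forall>r. 0 < r \<and> r < \<delta> \<longrightarrow>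
     (\<integral>\<^sup>+ y\<in>ball x r. ennreal \<bar>f y - f x\<bar> \<partial>lebesgue) \<le> ennreal e * emeasure lebesgue (ball x r))"

lemma maximal_op_const_le: "maximal_op (\<lambda>x. 1) (y::'a::euclidean_space) \<le> 1"
  unfolding maximal_op_def
proof (rule SUP_least)
  fix B :: "'a set" assume "B \<in> {ball c r |c r. 0 < r \<and> y \<in> ball c r}"
  then obtain c r where B: "B = ball c r" "0 < r" by blast
  then show "(\<integral>\<^sup>+ y\<in>B. ennreal \<bar>1\<bar> \<partial>lebesgue) / emeasure lebesgue B \<le> 1"
    using emeasure_ball_lebesgue_pos[of r c] emeasure_ball_lebesgue_finite[of c r] B by simp
qed

text \<open>On \<open>A\<close> the function is within \<open>t\<close> of \<open>q\<close>; off
  \<open>A\<close>, small balls around points of \<open>A\<close> see only the part of the function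
  inside an open neighbourhood \<open>V k\<close> of \<open>A\<close>. As these neighbourhoods
  shrink to \<open>A\<close> in measure, the integral of that part tends to 0, and the weak type
  inequality makes the exceptional set null. Open supersets take the role usually played by
  continuous approximations.\<close>

lemma lebesgue_points_aux:
  fixes f :: "'a::euclidean_space \<Rightarrow> real"
  assumes f: "integrable lebesgue f" and t: "0 < t"
  shows "AE x in lebesgue. \<bar>f x - q\<bar> < t \<longrightarrow> (\<exists>\<delta>>0. \<forall>r. 0 < r \<and> r < \<delta> \<longrightarrow>
     (\<integral>\<^sup>+ y\<in>ball x r. ennreal \<bar>f y - q\<bar> \<partial>lebesgue) \<le> ennreal (2 * t) * emeasure lebesgue (ball x r))"
proof -
  let ?X = "\<integral>\<^sup>+ x. ennreal \<bar>f x\<bar> \<partial>lebesgue"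
  have fm[measurable]: "f \<in> borel_measurable lebesgue" using f by simp
  define A where "A = {x. \<bar>f x - q\<bar> < t}"
  have "{x \<in> space lebesgue. \<bar>f x - q\<bar> < t} \<in> sets lebesgue" by measurable
  then have A[measurable]: "A \<in> sets lebesgue" unfolding A_def by simp
  have "\<exists>U. open U \<and> A \<subseteq> U \<and> emeasure lebesgue (U - A) < ennreal ((1/2) ^ k)" for k :: nat
  proof -
    have "0 < (1/2::real) ^ k" by simp
    then obtain T where "open T" "A \<subseteq> T" "emeasure lebesgue (T - A) < ennreal ((1/2) ^ k)"
      using sets_lebesgue_outer_open[OF A] by metis
    then show ?thesis by blast
  qed
  then obtain U where U: "\<And>k. open (U k)" "\<And>k. A \<subseteq> U k" "\<And>k::nat. emeasure lebesgue (U k - A) < ennreal ((1/2) ^ k)"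
    by metis
  \<comment> \<open>Finite intersections make the neighbourhoods decreasing, so that one of them,
    with its finite excess measure, dominates all the others.\<close>
  define V where "V k = (\<Inter>j\<in>{..k}. U j)" for k
  have V: "open (V k)" "A \<subseteq> V k" for k using U by (auto simp: V_def)
  have Vm[measurable]: "V k \<in> sets lebesgue" for k using V(1)[of k] by simp
  have Vle: "emeasure lebesgue (V k - A) \<le> ennreal ((1/2) ^ k)" for k
  proof -
    have "emeasure lebesgue (V k - A) \<le> emeasure lebesgue (U k - A)"
      using U(1)[of k] by (intro emeasure_mono) (auto simp: V_def)
    then show ?thesis using U(3)[of k] by (meson less_imp_le order_trans)
  qed
  define h where "h k x = \<bar>f x - q\<bar> * indicator (V k - A) x" for k x
  have h[measurable]: "h k \<in> borel_measurable lebesgue" for k unfolding h_def by measurable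
  have null: "(\<Inter>k. V k - A) \<in> null_sets lebesgue"
  proof -
    have "emeasure lebesgue (\<Inter>k. V k - A) \<le> ennreal ((1/2) ^ k)" for k
    proof -
      have "emeasure lebesgue (\<Inter>k. V k - A) \<le> emeasure lebesgue (V k - A)"
        by (intro emeasure_mono) auto
      then show ?thesis using Vle[of k] by (rule order_trans)
    qed
    moreover have "(\<lambda>k. ennreal ((1/2) ^ k)) \<longlonglongrightarrow> ennreal 0"
      by (intro tendsto_ennrealI LIMSEQ_realpow_zero) auto
    ultimately have "emeasure lebesgue (\<Inter>k. V k - A) \<le> 0"
      using LIMSEQ_le_const[of "\<lambda>k. ennreal ((1/2) ^ k)" "ennreal 0"] by auto
    moreover have "(\<Inter>k. V k - A) \<in> sets lebesgue" by measurable
    ultimately show ?thesis by (auto simp: null_sets_def)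
  qed
  have lim: "(\<lambda>k. \<integral>\<^sup>+ x. ennreal \<bar>h k x\<bar> \<partial>lebesgue) \<longlonglongrightarrow> (\<integral>\<^sup>+ (x::'a). 0 \<partial>lebesgue)"
  proof (rule nn_integral_dominated_convergence[where w="\<lambda>x. ennreal \<bar>f x\<bar> + ennreal \<bar>q\<bar> * indicator (V 0 - A) x"])
    show "(\<integral>\<^sup>+ x. (ennreal \<bar>f x\<bar> + ennreal \<bar>q\<bar> * indicator (V 0 - A) x) \<partial>lebesgue) < \<infinity>"
    proof -
      have "(\<integral>\<^sup>+ x. (ennreal \<bar>f x\<bar> + ennreal \<bar>q\<bar> * indicator (V 0 - A) x) \<partial>lebesgue)
        = ?X + ennreal \<bar>q\<bar> * emeasure lebesgue (V 0 - A)"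
          by (subst nn_integral_add) (auto simp: nn_integral_cmult_indicator)
      moreover have "?X < \<infinity>" using f by (auto simp: integrable_iff_bounded)
      moreover have "emeasure lebesgue (V 0 - A) < \<infinity>" using Vle[of 0] by (auto intro: order_le_less_trans)
      ultimately show ?thesis by (simp add: ennreal_mult_less_top)
    qed
    show "AE x in lebesgue. ennreal \<bar>h k x\<bar> \<le> ennreal \<bar>f x\<bar> + ennreal \<bar>q\<bar> * indicator (V 0 - A) x" for k
    proof (rule AE_I2)
      fix x
      have "V k \<subseteq> V 0" unfolding V_def by auto
      then show "ennreal \<bar>h k x\<bar> \<le> ennreal \<bar>f x\<bar> + ennreal \<bar>q\<bar> * indicator (V 0 - A) x"
        by (auto simp: h_def indicator_def simp flip: ennreal_plus intro!: ennreal_leI)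
    qed
    show "AE x in lebesgue. (\<lambda>k. ennreal \<bar>h k x\<bar>) \<longlonglongrightarrow> 0"
      using AE_not_in[OF null]
    proof eventually_elim
      fix x assume "x \<notin> (\<Inter>k. V k - A)"
      then obtain k where k: "x \<notin> V k - A" by blast
      have "V j \<subseteq> V k" if "k \<le> j" for j using that unfolding V_def by auto
      then have "eventually (\<lambda>j. ennreal \<bar>h j x\<bar> = 0) sequentially"
        using k by (intro eventually_sequentiallyI[of k]) (auto simp: h_def indicator_def)
      then show "(\<lambda>k. ennreal \<bar>h k x\<bar>) \<longlonglongrightarrow> 0" by (rule tendsto_eventually)
    qed
  qed measurable
  define Z where "Z k = {x. ennreal t < maximal_op (h k) x}" for k
  have Z[measurable]: "Z k \<in> sets lebesgue" for k using open_maximal_op[of t "h k"] t by (simp add: Z_def)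
  \<comment> \<open>The weight 1 turns the weighted inequality into the classical weak type bound,
    as the maximal function of 1 is at most 1.\<close>
  have Zle: "ennreal t * emeasure lebesgue (Z k) \<le> ennreal (5 ^ DIM('a)) * (\<integral>\<^sup>+ x. ennreal \<bar>h k x\<bar> \<partial>lebesgue)" for k
  proof -
    have "ennreal t * emeasure lebesgue (Z k) = ennreal t * (\<integral>\<^sup>+ x\<in>Z k. ennreal \<bar>1\<bar> \<partial>lebesgue)" by simp
    also have "\<dots> \<le> ennreal (5 ^ DIM('a)) * (\<integral>\<^sup>+ x. ennreal \<bar>h k x\<bar> * maximal_op (\<lambda>x. 1) x \<partial>lebesgue)"
      unfolding Z_def by (rule weak_type[OF h _ t]) simp
    also have "\<dots> \<le> ennreal (5 ^ DIM('a)) * (\<integral>\<^sup>+ x. ennreal \<bar>h k x\<bar> * 1 \<partial>lebesgue)"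
      by (intro mult_left_mono nn_integral_mono maximal_op_const_le) auto
    finally show ?thesis by simp
  qed
  have nullZ: "(\<Inter>k. Z k) \<in> null_sets lebesgue"
  proof -
    have "ennreal t * emeasure lebesgue (\<Inter>k. Z k) \<le> ennreal (5 ^ DIM('a)) * (\<integral>\<^sup>+ x. ennreal \<bar>h k x\<bar> \<partial>lebesgue)" for k
      by (rule order_trans[OF mult_left_mono[OF emeasure_mono] Zle[of k]]) auto
    moreover have "(\<lambda>k. ennreal (5 ^ DIM('a)) * (\<integral>\<^sup>+ x. ennreal \<bar>h k x\<bar> \<partial>lebesgue)) \<longlonglongrightarrow> ennreal (5 ^ DIM('a)) * 0"
      using lim by (intro ennreal_tendsto_cmult) auto
    ultimately have "ennreal t * emeasure lebesgue (\<Inter>k. Z k) \<le> 0"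
      using LIMSEQ_le_const by (metis (no_types, lifting) mult_zero_right)
    then have "emeasure lebesgue (\<Inter>k. Z k) = 0" using t by simp
    moreover have "(\<Inter>k. Z k) \<in> sets lebesgue" by measurable
    ultimately show ?thesis by (auto simp: null_sets_def)
  qed
  from AE_not_in[OF nullZ] show ?thesis
  proof eventually_elim
    fix x assume "x \<notin> (\<Inter>k. Z k)"
    then obtain k where k: "maximal_op (h k) x \<le> ennreal t" by (auto simp: Z_def not_less)
    show "\<bar>f x - q\<bar> < t \<longrightarrow> (\<exists>\<delta>>0. \<forall>r. 0 < r \<and> r < \<delta> \<longrightarrow>
     (\<integral>\<^sup>+ y\<in>ball x r. ennreal \<bar>f y - q\<bar> \<partial>lebesgue) \<le> ennreal (2 * t) * emeasure lebesgue (ball x r))"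
    proof
      assume "\<bar>f x - q\<bar> < t"
      then have "x \<in> V k" using V(2)[of k] by (auto simp: A_def)
      then obtain \<delta> where d: "0 < \<delta>" "ball x \<delta> \<subseteq> V k" using V(1)[of k] openE by blast
      have "(\<integral>\<^sup>+ y\<in>ball x r. ennreal \<bar>f y - q\<bar> \<partial>lebesgue) \<le> ennreal (2 * t) * emeasure lebesgue (ball x r)"
        if r: "0 < r" "r < \<delta>" for r
      proof -
        have sub: "ball x r \<subseteq> V k" using r d by (meson less_imp_le order_trans subset_ball)
        have "(\<integral>\<^sup>+ y\<in>ball x r. ennreal \<bar>f y - q\<bar> \<partial>lebesgue)
          \<le> (\<integral>\<^sup>+ y. ennreal t * indicator (ball x r) y + ennreal \<bar>h k y\<bar> * indicator (ball x r) y \<partial>lebesgue)"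
        proof (rule nn_integral_mono)
          fix y
          show "ennreal \<bar>f y - q\<bar> * indicator (ball x r) y \<le> ennreal t * indicator (ball x r) y + ennreal \<bar>h k y\<bar> * indicator (ball x r) y"
          proof (cases "y \<in> ball x r")
            case True
            then show ?thesis using sub True t by (cases "y \<in> A") (auto simp: h_def A_def intro!: ennreal_leI)
          qed simp
        qed
        also have "\<dots> = ennreal t * emeasure lebesgue (ball x r) + (\<integral>\<^sup>+ y\<in>ball x r. ennreal \<bar>h k y\<bar> \<partial>lebesgue)"
          by (subst nn_integral_add) (auto simp: nn_integral_cmult_indicator)
        also have "\<dots> \<le> ennreal t * emeasure lebesgue (ball x r) + emeasure lebesgue (ball x r) * maximal_op (h k) x"
          using r by (intro add_left_mono maximal_op_ball) auto
        also have "\<dots> \<le> ennreal t * emeasure lebesgue (ball x r) + emeasure lebesgue (ball x r) * ennreal t"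
          using k by (intro add_left_mono mult_left_mono) auto
        also have "\<dots> = ennreal (2 * t) * emeasure lebesgue (ball x r)"
          unfolding mult_2 ennreal_plus[OF less_imp_le less_imp_le, OF t t] distrib_right by (simp only: mult.commute)
        finally show ?thesis .
      qed
      then show "\<exists>\<delta>>0. \<forall>r. 0 < r \<and> r < \<delta> \<longrightarrow>
     (\<integral>\<^sup>+ y\<in>ball x r. ennreal \<bar>f y - q\<bar> \<partial>lebesgue) \<le> ennreal (2 * t) * emeasure lebesgue (ball x r)"
        using d by blast
    qed
  qed
qed

text \<open>Countably many rational pairs suffice. For \<open>q\<close> within
  \<open>t < e / 3\<close> of \<open>f x\<close>, the mean deviation from \<open>q\<close> is at
  most \<open>2 * t\<close>, and replacing \<open>q\<close> by \<open>f x\<close> costs another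
  \<open>t\<close>.\<close>

lemma AE_lebesgue_point:
  fixes f :: "'a::euclidean_space \<Rightarrow> real"
  assumes f: "integrable lebesgue f"
  shows "AE x in lebesgue. lebesgue_point f x"
proof -
  have fm[measurable]: "f \<in> borel_measurable lebesgue" using f by simp
  have "AE x in lebesgue. \<forall>q\<in>\<rat>. \<forall>t\<in>{t\<in>\<rat>. 0 < t}. \<bar>f x - q\<bar> < t \<longrightarrow> (\<exists>\<delta>>0. \<forall>r. 0 < r \<and> r < \<delta> \<longrightarrow>
     (\<integral>\<^sup>+ y\<in>ball x r. ennreal \<bar>f y - q\<bar> \<partial>lebesgue) \<le> ennreal (2 * t) * emeasure lebesgue (ball x r))"
    by (intro AE_ball_countable' lebesgue_points_aux[OF f] countable_rat countable_subset[OF _ countable_rat]) auto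
  then show ?thesis
  proof eventually_elim
    fix x assume H: "\<forall>q\<in>\<rat>. \<forall>t\<in>{t\<in>\<rat>. 0 < t}. \<bar>f x - q\<bar> < t \<longrightarrow> (\<exists>\<delta>>0. \<forall>r. 0 < r \<and> r < \<delta> \<longrightarrow>
     (\<integral>\<^sup>+ y\<in>ball x r. ennreal \<bar>f y - q\<bar> \<partial>lebesgue) \<le> ennreal (2 * t) * emeasure lebesgue (ball x r))"
    show "lebesgue_point f x" unfolding lebesgue_point_def
    proof (intro allI impI)
      fix e :: real assume e: "0 < e"
      obtain t where t: "t \<in> \<rat>" "0 < t" "t < e / 3" using Rats_dense_in_real[of 0 "e/3"] e by auto
      obtain q where q: "q \<in> \<rat>" "f x - t < q" "q < f x" using Rats_dense_in_real[of "f x - t" "f x"] t by auto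
      then have fq: "\<bar>f x - q\<bar> < t" by auto
      then obtain \<delta> where d: "\<delta> > 0" "\<And>r. 0 < r \<and> r < \<delta> \<Longrightarrow>
         (\<integral>\<^sup>+ y\<in>ball x r. ennreal \<bar>f y - q\<bar> \<partial>lebesgue) \<le> ennreal (2 * t) * emeasure lebesgue (ball x r)"
        using H q t by blast
      have "(\<integral>\<^sup>+ y\<in>ball x r. ennreal \<bar>f y - f x\<bar> \<partial>lebesgue) \<le> ennreal e * emeasure lebesgue (ball x r)"
        if r: "0 < r \<and> r < \<delta>" for r
      proof -
        have "(\<integral>\<^sup>+ y\<in>ball x r. ennreal \<bar>f y - f x\<bar> \<partial>lebesgue)
          \<le> (\<integral>\<^sup>+ y. ennreal \<bar>f y - q\<bar> * indicator (ball x r) y + ennreal t * indicator (ball x r) y \<partial>lebesgue)"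
          using fq t by (intro nn_integral_mono) (auto simp: indicator_def simp flip: ennreal_plus intro!: ennreal_leI)
        also have "\<dots> = (\<integral>\<^sup>+ y\<in>ball x r. ennreal \<bar>f y - q\<bar> \<partial>lebesgue) + ennreal t * emeasure lebesgue (ball x r)"
          by (subst nn_integral_add) (auto simp: nn_integral_cmult_indicator)
        also have "\<dots> \<le> ennreal (2 * t) * emeasure lebesgue (ball x r) + ennreal t * emeasure lebesgue (ball x r)"
          by (intro add_right_mono d r)
        also have "\<dots> = ennreal (3 * t) * emeasure lebesgue (ball x r)"
          using t by (simp flip: distrib_right ennreal_plus)
        also have "\<dots> \<le> ennreal e * emeasure lebesgue (ball x r)"
          using t by (intro mult_right_mono ennreal_leI) auto
        finally show ?thesis .
      qed
      then show "\<exists>\<delta>>0. \<forall>r. 0 < r \<and> r < \<delta> \<longrightarrow>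
         (\<integral>\<^sup>+ y\<in>ball x r. ennreal \<bar>f y - f x\<bar> \<partial>lebesgue) \<le> ennreal e * emeasure lebesgue (ball x r)"
        using d(1) by blast
    qed
  qed
qed

text \<open>Compact subsets are absorbed by an interior, not merely by a set of the sequence: the
  locality of Lebesgue points and the mollification of test functions both need a
  neighbourhood.\<close>

lemma open_compact_exhaustion:
  fixes \<Omega> :: "'a::euclidean_space set"
  assumes "open \<Omega>"
  obtains K :: "nat \<Rightarrow> 'a set" where "\<And>k. compact (K k)" "\<And>k. K k \<subseteq> \<Omega>"
    "\<And>C. compact C \<Longrightarrow> C \<subseteq> \<Omega> \<Longrightarrow> \<exists>k. C \<subseteq> interior (K k)" "\<And>k l. k \<le> l \<Longrightarrow> K k \<subseteq> K l"
proof -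
  define K where "K k = cball 0 (real k) \<inter> {x. \<forall>y. y \<notin> \<Omega> \<longrightarrow> 1 / (real k + 1) \<le> dist x y}" for k
  have cl: "closed {x. \<forall>y. y \<notin> \<Omega> \<longrightarrow> c \<le> dist x y}" for c
  proof -
    have "{x. \<forall>y. y \<notin> \<Omega> \<longrightarrow> c \<le> dist x y} = (\<Inter>y\<in>-\<Omega>. {x. c \<le> dist x y})" by auto
    then show ?thesis by (auto intro!: closed_INT closed_Collect_le continuous_intros)
  qed
  have 1: "compact (K k)" for k unfolding K_def by (intro compact_Int_closed cl) auto
  have 2: "K k \<subseteq> \<Omega>" for k
  proof
    fix x assume "x \<in> K k"
    then show "x \<in> \<Omega>" unfolding K_def by (auto simp: field_simps split: if_splits)
  qed
  have 3: "K k \<subseteq> K l" if "k \<le> l" for k l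
  proof -
    have "1 / (real l + 1) \<le> 1 / (real k + 1)" using that by (simp add: frac_le)
    then show ?thesis using that unfolding K_def by (auto intro: order_trans)
  qed
  have 4: "\<exists>k. C \<subseteq> interior (K k)" if C: "compact C" "C \<subseteq> \<Omega>" for C
  proof -
    obtain b where b: "C \<subseteq> cball 0 b" using compact_imp_bounded[OF C(1)] by (meson bounded_subset_ballD ball_subset_cball order_trans)
    obtain e where e: "0 < e" "\<And>x y. x \<in> C \<Longrightarrow> y \<notin> \<Omega> \<Longrightarrow> e \<le> dist x y"
    proof (cases "C = {} \<or> \<Omega> = UNIV")
      case True
      then show ?thesis using that[of 1] by auto
    next
      case False
      then have "0 < setdist C (- \<Omega>)"
        using C assms setdist_eq_0_compact_closed[of C "-\<Omega>"] setdist_pos_le[of C "-\<Omega>"] by (auto simp: less_le)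
      then show ?thesis using that[of "setdist C (-\<Omega>)"] setdist_le_dist by blast
    qed
    obtain k :: nat where k: "max (b + 1) (2 / e) < real k" using reals_Archimedean2 by blast
    then have k1: "b + 1 < real k" "1 / (real k + 1) < e / 2" using e(1) by (auto simp: field_simps)
    let ?U = "\<Union>x\<in>C. ball x (min 1 (e / 2))"
    have "?U \<subseteq> K k"
    proof
      fix z assume "z \<in> ?U"
      then obtain x where x: "x \<in> C" "dist x z < 1" "dist x z < e / 2" by auto
      have "norm x \<le> b" using b x(1) by auto
      then have "norm z \<le> real k" using x(2) k1(1) norm_triangle_ineq4[of x "x - z"] by (simp add: dist_norm)
      moreover have "1 / (real k + 1) \<le> dist z y" if "y \<notin> \<Omega>" for y
        using e(2)[OF x(1) that] dist_triangle[of x y z] x(3) k1(2) by linarith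
      ultimately show "z \<in> K k" by (simp add: K_def)
    qed
    then have "?U \<subseteq> interior (K k)" by (intro interior_maximal) auto
    moreover have "C \<subseteq> ?U" using e(1) by auto
    ultimately show ?thesis by blast
  qed
  show thesis using that[OF 1 2 4 3] .
qed

lemma lebesgue_point_cong:
  assumes "open S" "x \<in> S" and eq: "\<And>y. y \<in> S \<Longrightarrow> f y = g y" and f: "lebesgue_point f x"
  shows "lebesgue_point g x"
  unfolding lebesgue_point_def
proof (intro allI impI)
  let ?X = "\<lambda>r. \<integral>\<^sup>+ y\<in>ball x r. ennreal \<bar>g y - g x\<bar> \<partial>lebesgue"
  let ?Y = "\<lambda>r. \<integral>\<^sup>+ y\<in>ball x r. ennreal \<bar>f y - f x\<bar> \<partial>lebesgue"
  fix e :: real assume "0 < e"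
  then obtain \<delta> where d: "\<delta> > 0" "\<And>r. 0 < r \<and> r < \<delta> \<Longrightarrow>
     (?Y r) \<le> ennreal e * emeasure lebesgue (ball x r)"
    using f unfolding lebesgue_point_def by blast
  obtain d2 where d2: "d2 > 0" "ball x d2 \<subseteq> S" using assms openE by blast
  have "(?X r) \<le> ennreal e * emeasure lebesgue (ball x r)"
    if r: "0 < r \<and> r < min \<delta> d2" for r
  proof -
    have "(?X r) = (?Y r)"
      using r d2 eq assms(2) by (intro nn_integral_cong) (auto simp: indicator_def subset_iff)
    then show ?thesis using d(2)[of r] r by simp
  qed
  then show "\<exists>\<delta>>0. \<forall>r. 0 < r \<and> r < \<delta> \<longrightarrow>
     (?X r) \<le> ennreal e * emeasure lebesgue (ball x r)"
    using d(1) d2(1) by (intro exI[of _ "min \<delta> d2"]) auto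
qed

lemma locally_integrable_measurable:
  assumes "open \<Omega>" "locally_integrable_on f \<Omega>"
  shows "(\<lambda>x. if x \<in> \<Omega> then f x else 0) \<in> borel_measurable lebesgue"
proof -
  obtain K where K: "\<And>k::nat. compact (K k)" "\<And>k. K k \<subseteq> \<Omega>"
    "\<And>C. compact C \<Longrightarrow> C \<subseteq> \<Omega> \<Longrightarrow> \<exists>k. C \<subseteq> interior (K k)" "\<And>k l. k \<le> l \<Longrightarrow> K k \<subseteq> K l"
    using open_compact_exhaustion[OF assms(1)] by blast
  have "(\<lambda>x. indicator (K k) x *\<^sub>R f x) \<in> borel_measurable lebesgue" for k
    by (intro locally_integrable_onD[OF assms(2)] K)
  moreover have "(\<lambda>k. indicator (K k) x *\<^sub>R f x) \<longlonglongrightarrow> (if x \<in> \<Omega> then f x else 0)" for x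
  proof (cases "x \<in> \<Omega>")
    case True
    then have "\<exists>k. {x} \<subseteq> interior (K k)" by (intro K(3)) auto
    then obtain k where "x \<in> K k" using interior_subset by blast
    then have "eventually (\<lambda>l. indicator (K l) x *\<^sub>R f x = f x) sequentially"
      using K(4) by (intro eventually_sequentiallyI[of k]) (auto simp: indicator_def)
    then show ?thesis using True by (simp add: tendsto_eventually)
  next
    case False
    then have "x \<notin> K l" for l using K(2) by blast
    then show ?thesis using False by simp
  qed
  ultimately show ?thesis by (rule borel_measurable_LIMSEQ_real[rotated])
qed

lemma AE_lebesgue_point_locally:
  fixes f :: "'a::euclidean_space \<Rightarrow> real"
  assumes "open \<Omega>" "locally_integrable_on f \<Omega>"
  shows "AE x in lebesgue. x \<in> \<Omega> \<longrightarrow> lebesgue_point f x"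
proof -
  obtain K where K: "\<And>k::nat. compact (K k)" "\<And>k. K k \<subseteq> \<Omega>"
    "\<And>C. compact C \<Longrightarrow> C \<subseteq> \<Omega> \<Longrightarrow> \<exists>k. C \<subseteq> interior (K k)" "\<And>k l. k \<le> l \<Longrightarrow> K k \<subseteq> K l"
    using open_compact_exhaustion[OF assms(1)] by blast
  have "integrable lebesgue (\<lambda>x. indicator (K k) x *\<^sub>R f x)" for k
    by (intro locally_integrable_onD[OF assms(2)] K)
  then have "AE x in lebesgue. \<forall>k. lebesgue_point (\<lambda>x. indicator (K k) x *\<^sub>R f x) x"
    using AE_lebesgue_point by (subst AE_all_countable) blast
  then show ?thesis
  proof eventually_elim
    fix x assume H: "\<forall>k. lebesgue_point (\<lambda>x. indicator (K k) x *\<^sub>R f x) x"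
    show "x \<in> \<Omega> \<longrightarrow> lebesgue_point f x"
    proof
      assume "x \<in> \<Omega>"
      then have "\<exists>k. {x} \<subseteq> interior (K k)" by (intro K(3)) auto
      then obtain k where k: "x \<in> interior (K k)" by blast
      show "lebesgue_point f x"
        by (rule lebesgue_point_cong[OF open_interior k _ H[rule_format, of k]])
           (use interior_subset in \<open>auto simp: indicator_def\<close>)
    qed
  qed
qed

subsection \<open>The pointwise estimate on uniform domains\<close>

text \<open>The factor \<open>1 / r ^ DIM('a)\<close> makes the integral independent of the radius
  (\<open>bump_integral\<close>). When centre and radius move, the average of a constant therefore
  stays fixed, with \<open>bump_mass\<close> as total mass in place of 1.\<close>

definition bump :: "real \<Rightarrow> 'a::euclidean_space \<Rightarrow> 'a \<Rightarrow> real" where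
  "bump r z w = flat 0 (1 - (dist w z)\<^sup>2 / r\<^sup>2) / r ^ DIM('a)"

lemma bump_smooth: "smooth (bump r z)"
proof -
  have "smooth (\<lambda>w. (1 / r ^ DIM('a)) * flat 0 (1 - (1 / r\<^sup>2) * (dist w z)\<^sup>2))"
    by (intro smooth_cmult smooth.flat smooth_diff smooth.const smooth_dist_sq)
  then show ?thesis by (simp add: bump_def[abs_def])
qed

lemma bump_continuous: "continuous_on S (bump r z)"
  by (rule smooth_continuous[OF bump_smooth])

lemma bump_measurable [measurable]: "bump r z \<in> borel_measurable borel"
  by (rule borel_measurable_continuous_onI[OF bump_continuous])

lemma bump_lebesgue_measurable [measurable]: "bump r z \<in> borel_measurable lebesgue"
  by (rule borel_imp_lebesgue_measurable[OF bump_measurable])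

lemma bump_nonneg: "0 < r \<Longrightarrow> 0 \<le> bump r z w"
  by (simp add: bump_def flat_nonneg)

lemma bump_le: "0 < r \<Longrightarrow> bump r (z::'a::euclidean_space) w \<le> 1 / r ^ DIM('a)"
  using flat_bounded[of 0 "1 - (dist w z)\<^sup>2 / r\<^sup>2"] by (simp add: bump_def divide_right_mono)

lemma bump_abs_le: "0 < r \<Longrightarrow> \<bar>bump r (z::'a::euclidean_space) w\<bar> \<le> 1 / r ^ DIM('a)"
  by (simp only: abs_of_nonneg[OF bump_nonneg] bump_le)

lemma bump_arg_le_0: "0 < r \<Longrightarrow> w \<notin> ball z r \<Longrightarrow> 1 - (dist w z)\<^sup>2 / r\<^sup>2 \<le> 0"
proof -
  assume "0 < r" "w \<notin> ball z r"
  then have "r\<^sup>2 \<le> (dist w z)\<^sup>2" by (intro power_mono) (auto simp: dist_commute)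
  then show ?thesis using \<open>0 < r\<close> by (simp add: field_simps)
qed

lemma bump_eq_0: "0 < r \<Longrightarrow> w \<notin> ball z r \<Longrightarrow> bump r z w = 0"
  using bump_arg_le_0[of r w z] by (simp add: bump_def flat_eq_0_iff)

definition bump_mass :: "'a::euclidean_space itself \<Rightarrow> real" where
  "bump_mass _ = (LINT w|lebesgue. bump 1 (0::'a) w)"

lemma bump_integral:
  assumes r: "0 < r"
  shows "(LINT w|lebesgue. bump r (z::'a::euclidean_space) w) = bump_mass TYPE('a)"
proof -
  have "bump r z (z + r *\<^sub>R x) = bump 1 0 x / r ^ DIM('a)" for x :: 'a
    using r by (simp add: bump_def dist_norm power_mult_distrib)
  then show ?thesis
    using lebesgue_integral_affine[OF bump_measurable, of r r z z] r by (simp add: bump_mass_def)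
qed

lemma bump_integrable:
  assumes r: "0 < r"
  shows "integrable lebesgue (bump r (z::'a::euclidean_space))"
proof (rule Bochner_Integration.integrable_bound)
  show "integrable lebesgue (\<lambda>x. (1 / r ^ DIM('a)) * indicator (ball z r) x)"
    using emeasure_ball_lebesgue_finite[of z r] by (intro integrable_mult_right integrable_real_indicator) auto
  show "AE x in lebesgue. norm (bump r z x) \<le> norm ((1 / r ^ DIM('a)) * indicator (ball z r) x)"
  proof (rule AE_I2)
    fix x show "norm (bump r z x) \<le> norm ((1 / r ^ DIM('a)) * indicator (ball z r) x)"
      using bump_abs_le[OF r, of z x] bump_eq_0[OF r, of x z] r by (cases "x \<in> ball z r") auto
  qed
qed measurable

lemma bump_mass_pos: "0 < bump_mass TYPE('a::euclidean_space)"
proof -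
  have "0 \<le> bump_mass TYPE('a)" unfolding bump_mass_def by (intro integral_nonneg_AE) (simp add: bump_nonneg)
  moreover have "bump_mass TYPE('a) \<noteq> 0"
  proof
    assume "bump_mass TYPE('a) = 0"
    then have "AE w in lebesgue. bump 1 (0::'a) w = 0" unfolding bump_mass_def
      by (subst (asm) integral_nonneg_eq_0_iff_AE) (auto simp: bump_integrable bump_nonneg)
    then have "AE w in lebesgue. w \<notin> ball (0::'a) 1"
    proof eventually_elim
      fix w :: 'a assume 0: "bump 1 0 w = 0"
      show "w \<notin> ball 0 1"
      proof
        assume "w \<in> ball 0 1"
        then have "(norm w)\<^sup>2 < 1" by (simp add: power_less_one_iff)
        then show False using 0 by (simp add: bump_def flat_eq_0_iff)
      qed
    qed
    then show False using emeasure_ball_lebesgue_pos[of 1 "0::'a"] by (subst (asm) AE_iff_null_sets[symmetric]) auto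
  qed
  ultimately show ?thesis by simp
qed

text \<open>The derivative of \<open>bump (r + t * s) (z + t *\<^sub>R d)\<close> with respect to \<open>t\<close>; it is minus the divergence
  of the field \<open>bump r z * V\<close> with the affine velocity \<open>V w = d + (s / r) *\<^sub>R (w - z)\<close>.\<close>
definition bump_velocity :: "'a::euclidean_space \<Rightarrow> real \<Rightarrow> real \<Rightarrow> 'a \<Rightarrow> 'a \<Rightarrow> real" where
  "bump_velocity d s r z w =
     flat 2 (1 - (dist w z)\<^sup>2 / r\<^sup>2) * (2 * ((w - z) \<bullet> d) / r\<^sup>2 + 2 * (dist w z)\<^sup>2 * s / r ^ 3) / r ^ DIM('a)
     - flat 0 (1 - (dist w z)\<^sup>2 / r\<^sup>2) * (real DIM('a) * s) / r ^ Suc DIM('a)"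

lemma bump_time_derivative:
  fixes z d w :: "'a::euclidean_space"
  assumes r: "0 < r + t * s"
  shows "((\<lambda>t. bump (r + t * s) (z + t *\<^sub>R d) w) has_real_derivative
     bump_velocity d s (r + t * s) (z + t *\<^sub>R d) w) (at t)"
proof -
  let ?q = "\<lambda>t. 1 - ((w - (z + t *\<^sub>R d)) \<bullet> (w - (z + t *\<^sub>R d))) / (r + t * s)\<^sup>2"
  let ?u = "w - (z + t *\<^sub>R d)" and ?r = "r + t * s"
  let ?X = "2 * (?u \<bullet> d) / ?r\<^sup>2 + 2 * (?u \<bullet> ?u) * s / ?r ^ 3"
  let ?Y = "real DIM('a) * ?r ^ (DIM('a) - 1) * s"
  have dist: "(dist w y)\<^sup>2 = (w - y) \<bullet> (w - y)" for y by (simp add: dist_norm power2_norm_eq_inner)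
  have inn: "((\<lambda>t. (w - (z + t *\<^sub>R d)) \<bullet> (w - (z + t *\<^sub>R d))) has_real_derivative (- 2 * (?u \<bullet> d))) (at t)"
    unfolding has_field_derivative_def
    by (rule has_derivative_eq_rhs, (rule derivative_intros)+) (auto simp: fun_eq_iff inner_commute algebra_simps)
  have q: "(?q has_real_derivative ?X) (at t)"
  proof -
    have rd: "((\<lambda>t. (r + t * s)\<^sup>2) has_real_derivative (2 * ?r * s)) (at t)"
      by (auto intro!: derivative_eq_intros)
    have 1: "(?q has_real_derivative (0 - ((- 2 * (?u \<bullet> d)) * ?r\<^sup>2 - (?u \<bullet> ?u) * (2 * ?r * s)) / (?r\<^sup>2 * ?r\<^sup>2))) (at t)"
      by (intro DERIV_diff DERIV_const DERIV_divide inn rd) (use r in simp)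
    have 2: "0 - ((- 2 * a) * R\<^sup>2 - c * (2 * R * s)) / (R\<^sup>2 * R\<^sup>2) = 2 * a / R\<^sup>2 + 2 * c * s / R ^ 3"
      if "0 < R" for a c R :: real
      using that by (simp add: divide_simps power2_eq_square power3_eq_cube) (simp add: algebra_simps)
    show ?thesis using 1 unfolding 2[OF r, of "?u \<bullet> d" "?u \<bullet> ?u"] .
  qed
  have fq: "((\<lambda>t. flat 0 (?q t)) has_real_derivative
     (flat 2 (?q t) * ?X)) (at t)"
    using DERIV_chain2[OF flat_derivative[of 0] q] by (simp add: numeral_2_eq_2)
  have pw: "((\<lambda>t. (r + t * s) ^ DIM('a)) has_real_derivative ?Y) (at t)"
    by (rule derivative_eq_intros refl | simp)+
  have "((\<lambda>t. flat 0 (?q t) / (r + t * s) ^ DIM('a)) has_real_derivative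
    ((flat 2 (?q t) * ?X) * ?r ^ DIM('a)
       - flat 0 (?q t) * ?Y) / (?r ^ DIM('a) * ?r ^ DIM('a))) (at t)" by (rule DERIV_divide[OF fq pw]) (use r in simp)
  moreover have "((flat 2 (?q t) * ?X) * ?r ^ DIM('a)
       - flat 0 (?q t) * ?Y) / (?r ^ DIM('a) * ?r ^ DIM('a))
     = bump_velocity d s ?r (z + t *\<^sub>R d) w"
  proof -
    have P: "?r ^ DIM('a) = ?r * ?r ^ (DIM('a) - 1)"
      using DIM_positive[where 'a='a] by (simp add: power_eq_if)
    have split: "(a * X - b * (c * Y * s)) / (X * X) = a / X - b * (c * s) / (e * X)"
      if "X = e * Y" "e \<noteq> 0" "Y \<noteq> 0" for a b c X Y e :: real
      using that by (simp add: field_simps)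
    show ?thesis unfolding bump_velocity_def dist by (subst split[OF P]) (use r in auto)
  qed
  ultimately show ?thesis by (simp add: bump_def dist)
qed

lemma bump_velocity_eq_0: "0 < r \<Longrightarrow> w \<notin> ball z r \<Longrightarrow> bump_velocity d s r z w = 0"
  using bump_arg_le_0[of r w z] by (simp add: bump_velocity_def flat_eq_0_iff[THEN iffD2])

text \<open>The two coefficients 4 are \<open>fact 2\<close>, the bound of \<open>flat 2\<close>,
  times the factor 2 produced by differentiating a square. Being uniform in \<open>w\<close>, the
  bound serves as a Lipschitz constant in time.\<close>

lemma bump_velocity_bound:
  fixes z d w :: "'a::euclidean_space"
  assumes rm: "0 < rm" "rm \<le> r"
  shows "\<bar>bump_velocity d s r z w\<bar> \<le> (4 * norm d + 4 * \<bar>s\<bar> + real DIM('a) * \<bar>s\<bar>) / rm ^ Suc DIM('a)"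
proof (cases "w \<in> ball z r")
  case False
  then show ?thesis using rm bump_velocity_eq_0[of r w z d s] by (simp add: divide_nonneg_pos)
next
  case True
  have r: "0 < r" using rm by simp
  let ?D = "dist w z"
  have D: "?D \<le> r" "0 \<le> ?D" using True by (auto simp: dist_commute)
  let ?f2 = "flat 2 (1 - ?D\<^sup>2 / r\<^sup>2)" and ?f0 = "flat 0 (1 - ?D\<^sup>2 / r\<^sup>2)"
  have f: "0 \<le> ?f2" "?f2 \<le> 2" "0 \<le> ?f0" "?f0 \<le> 1"
    using flat_bounded[of 2 "1 - ?D\<^sup>2 / r\<^sup>2"] flat_bounded[of 0 "1 - ?D\<^sup>2 / r\<^sup>2"] by (auto simp: flat_nonneg numeral_2_eq_2)
  have a: "\<bar>2 * ((w - z) \<bullet> d) / r\<^sup>2\<bar> \<le> 2 * norm d / r"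
  proof -
    have "\<bar>(w - z) \<bullet> d\<bar> \<le> r * norm d"
      using Cauchy_Schwarz_ineq2[of "w - z" d] D by (metis dist_norm mult_right_mono norm_ge_zero order_trans)
    then show ?thesis using r by (simp add: abs_mult power2_eq_square field_simps)
  qed
  have b: "\<bar>2 * ?D\<^sup>2 * s / r ^ 3\<bar> \<le> 2 * \<bar>s\<bar> / r"
  proof -
    have "?D\<^sup>2 \<le> r\<^sup>2" using D by (intro power_mono)
    then have "?D\<^sup>2 * \<bar>s\<bar> \<le> r\<^sup>2 * \<bar>s\<bar>" by (rule mult_right_mono) simp
    then show ?thesis using r by (simp add: abs_mult power2_eq_square power3_eq_cube field_simps)
  qed
  let ?X = "2 * ((w - z) \<bullet> d) / r\<^sup>2 + 2 * ?D\<^sup>2 * s / r ^ 3"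
  let ?Z = "4 * norm d + 4 * \<bar>s\<bar>"
  have "\<bar>?f2 * ?X\<bar> \<le> 2 * (2 * norm d / r + 2 * \<bar>s\<bar> / r)"
    unfolding abs_mult using f by (intro mult_mono order_trans[OF abs_triangle_ineq add_mono[OF a b]]) auto
  then have "\<bar>?f2 * ?X / r ^ DIM('a)\<bar> \<le> 2 * (2 * norm d / r + 2 * \<bar>s\<bar> / r) / r ^ DIM('a)"
    using r by (simp add: abs_divide divide_right_mono)
  also have "\<dots> = ?Z / r ^ Suc DIM('a)" using r by (simp add: field_simps)
  finally have 1: "\<bar>?f2 * ?X / r ^ DIM('a)\<bar> \<le> ?Z / r ^ Suc DIM('a)" .
  let ?U = "real DIM('a) * \<bar>s\<bar>"
  have "\<bar>?f0 * (real DIM('a) * s)\<bar> \<le> 1 * ?U"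
    unfolding abs_mult using f by (intro mult_mono) auto
  then have 2: "\<bar>?f0 * (real DIM('a) * s) / r ^ Suc DIM('a)\<bar> \<le> ?U / r ^ Suc DIM('a)"
    using r by (simp only: abs_divide) (simp add: divide_right_mono)
  let ?Y = "4 * norm d + 4 * \<bar>s\<bar> + real DIM('a) * \<bar>s\<bar>"
  have "\<bar>bump_velocity d s r z w\<bar> \<le> ?Z / r ^ Suc DIM('a) + ?U / r ^ Suc DIM('a)"
    unfolding bump_velocity_def using 1 2 by linarith
  also have "\<dots> = ?Y / r ^ Suc DIM('a)" by (simp add: add_divide_distrib)
  also have "\<dots> \<le> ?Y / rm ^ Suc DIM('a)"
    using rm by (intro divide_left_mono power_mono mult_pos_pos) auto
  finally show ?thesis .
qed

lemma bump_velocity_measurable [measurable]: "bump_velocity d s r z \<in> borel_measurable borel"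
proof -
  have [measurable]: "flat m \<in> borel_measurable borel" for m
    by (rule borel_measurable_continuous_onI) (meson DERIV_isCont continuous_at_imp_continuous_on flat_derivative)
  show ?thesis unfolding bump_velocity_def by measurable
qed

lemma bump_velocity_lebesgue_measurable [measurable]: "bump_velocity d s r z \<in> borel_measurable lebesgue"
  by (rule borel_imp_lebesgue_measurable[OF bump_velocity_measurable])

section \<open>Averages of a weakly differentiable function over moving balls\<close>

text \<open>Each component of the field \<open>bump r z * V\<close> is a test function on
  \<open>\<Omega>\<close>. Summing the defining identities of the weak gradient over the basis
  produces the divergence on the side of \<open>f\<close> and the inner product with the velocity on
  the side of \<open>G\<close>.\<close>

lemma weak_gradient_bump:
  fixes z d :: "'a::euclidean_space"
  assumes wg: "weak_gradient \<Omega> f G" and r: "0 < r" and sub: "cball z r \<subseteq> \<Omega>"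
  shows "(LINT w|lebesgue. f w * bump_velocity d s r z w)
       = (LINT w|lebesgue. (G w \<bullet> (d + (s / r) *\<^sub>R (w - z))) * bump r z w)"
proof -
  let ?X = "\<lambda>w. 1 - (dist w z)\<^sup>2 / r\<^sup>2"
  let ?Y = "\<lambda>w. 1 - ((w - z) \<bullet> (w - z)) / r\<^sup>2"
  define V where "V i w = (d \<bullet> i + (s / r) * ((w - z) \<bullet> i))" for i w
  define \<phi> where "\<phi> i w = V i w * bump r z w" for i w
  have lf: "locally_integrable_on f \<Omega>" and lG: "\<And>i. i \<in> Basis \<Longrightarrow> locally_integrable_on (\<lambda>x. G x \<bullet> i) \<Omega>"
    using wg by (auto simp: weak_gradient_def)
  have smV: "smooth (V i)" for i
    unfolding V_def by (intro smooth.add smooth.const smooth_cmult smooth_inner_diff)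
  have sm: "smooth (\<phi> i)" for i unfolding \<phi>_def by (intro smooth.mult smV bump_smooth)
  have z0: "\<phi> i w = 0" if "w \<notin> ball z r" for i w using bump_eq_0[OF r that] by (simp add: \<phi>_def)
  have tf: "test_function \<Omega> (\<phi> i)" for i by (rule smooth_test_function[OF sm z0 sub])
  have dV: "(V i has_derivative (\<lambda>h. (s / r) * (h \<bullet> i))) (at w)" for i w
    unfolding V_def using r by (auto intro!: derivative_eq_intros)
  have dist: "(dist w y)\<^sup>2 = (w - y) \<bullet> (w - y)" for w y :: 'a by (simp add: dist_norm power2_norm_eq_inner)
  have db: "(bump r z has_derivative (\<lambda>h. flat 2 (?X w) * (- 2 * ((w - z) \<bullet> h) / r\<^sup>2) / r ^ DIM('a))) (at w)" for w
  proof -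
    have q: "((\<lambda>w. 1 - ((w - z) \<bullet> (w - z)) / r\<^sup>2) has_derivative (\<lambda>h. - 2 * ((w - z) \<bullet> h) / r\<^sup>2)) (at w)"
      by (rule has_derivative_eq_rhs, (rule derivative_intros)+) (use r in \<open>auto simp: fun_eq_iff inner_commute field_simps\<close>)
    have "((\<lambda>w. flat 0 (?Y w)) has_derivative
       (\<lambda>h. (- 2 * ((w - z) \<bullet> h) / r\<^sup>2) * (flat 2 (?Y w)))) (at w)"
      using DERIV_compose_FDERIV[OF flat_derivative[of 0] q] by (simp add: numeral_2_eq_2)
    then have "((\<lambda>w. flat 0 (?Y w) / r ^ DIM('a)) has_derivative
       (\<lambda>h. (- 2 * ((w - z) \<bullet> h) / r\<^sup>2) * (flat 2 (?Y w)) / r ^ DIM('a))) (at w)"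
      by (rule bounded_linear.has_derivative[OF bounded_linear_divide])
    then show ?thesis by (simp add: bump_def[abs_def] dist mult.commute)
  qed
  have fd: "frechet_derivative (\<phi> i) (at w) i = (s / r) * bump r z w
      + V i w * (flat 2 (?X w) * (- 2 * ((w - z) \<bullet> i) / r\<^sup>2) / r ^ DIM('a))" if i: "i \<in> Basis" for i w
  proof -
    have "(\<phi> i has_derivative (\<lambda>h. V i w * (flat 2 (?X w) * (- 2 * ((w - z) \<bullet> h) / r\<^sup>2) / r ^ DIM('a))
       + ((s / r) * (h \<bullet> i)) * bump r z w)) (at w)" unfolding \<phi>_def by (rule has_derivative_mult[OF dV db])
    then have "frechet_derivative (\<phi> i) (at w) = (\<lambda>h. V i w * (flat 2 (?X w) * (- 2 * ((w - z) \<bullet> h) / r\<^sup>2) / r ^ DIM('a))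
       + ((s / r) * (h \<bullet> i)) * bump r z w)" by (rule frechet_derivative_at[symmetric])
    then show ?thesis using i by simp
  qed
  \<comment> \<open>The continuity equation for a transported bump: its time derivative is minus the
    divergence of the flux. The term with \<open>real DIM('a) * s\<close> comes from the divergence
    of the radial part of the velocity.\<close>
  have div: "bump_velocity d s r z w = - (\<Sum>i\<in>Basis. frechet_derivative (\<phi> i) (at w) i)" for w
  proof -
    let ?F = "flat 2 (?X w)"
    have VS: "(\<Sum>i\<in>Basis. V i w * ((w - z) \<bullet> i)) = (w - z) \<bullet> d + (s / r) * (dist w z)\<^sup>2"
      unfolding V_def dist
      by (simp add: distrib_left distrib_right sum.distrib sum_distrib_left euclidean_inner[of "w - z" d] euclidean_inner[of "w - z" "w - z"] mult_ac)
    have "(\<Sum>i\<in>Basis. frechet_derivative (\<phi> i) (at w) i)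
      = (\<Sum>i\<in>(Basis :: 'a set). (s / r) * bump r z w) + (\<Sum>i\<in>Basis. (- 2 * ?F / r\<^sup>2 / r ^ DIM('a)) * (V i w * ((w - z) \<bullet> i)))"
        by (simp only: sum.distrib[symmetric], intro sum.cong refl) (simp add: fd)
    also have "\<dots> = real DIM('a) * (s / r) * bump r z w + (- 2 * ?F / r\<^sup>2 / r ^ DIM('a)) * ((w - z) \<bullet> d + (s / r) * (dist w z)\<^sup>2)"
      by (simp only: VS[symmetric] sum_distrib_left) simp
    also have "\<dots> = - bump_velocity d s r z w"
      using r by (simp add: bump_velocity_def bump_def field_simps power2_eq_square power3_eq_cube)
    finally show ?thesis by simp
  qed
  let ?Z = "\<lambda>i w. frechet_derivative (\<phi> i) (at w) i"
  have dm: "(?Z i) \<in> borel_measurable lebesgue" for i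
    by (intro borel_imp_lebesgue_measurable borel_measurable_continuous_onI smooth_continuous smooth_frechet_derivative sm)
  have d0: "frechet_derivative (\<phi> i) (at w) i = 0" if "w \<notin> cball z r" for i w
    using derivative_zero_off_support[OF closed_cball _ that smooth_has_derivative[OF sm[of i]]] z0[of _ i] ball_subset_cball[of z r] by (metis subsetD)
  have dB: "\<exists>B. \<forall>w. \<bar>frechet_derivative (\<phi> i) (at w) i\<bar> \<le> B" for i
  proof -
    have "compact ((?Z i) ` cball z r)"
      by (intro compact_continuous_image smooth_continuous smooth_frechet_derivative sm) auto
    then obtain B where "0 < B" "\<forall>y\<in>(?Z i) ` cball z r. norm y \<le> B"
      using compact_imp_bounded bounded_pos by metis
    then show ?thesis using d0[of _ i] by (intro exI[of _ B]) (metis abs_zero image_eqI less_imp_le real_norm_def)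
  qed
  have pB: "\<exists>B. \<forall>w. \<bar>\<phi> i w\<bar> \<le> B" for i
  proof -
    have "compact (\<phi> i ` cball z r)"
      by (intro compact_continuous_image smooth_continuous sm) auto
    then obtain B where "0 < B" "\<forall>y\<in>\<phi> i ` cball z r. norm y \<le> B"
      using compact_imp_bounded bounded_pos by metis
    moreover have "\<phi> i w = 0" if "w \<notin> cball z r" for w using z0[of w i] that by auto
    ultimately show ?thesis by (intro exI[of _ B]) (metis abs_zero image_eqI less_imp_le real_norm_def)
  qed
  have pm: "\<phi> i \<in> borel_measurable lebesgue" for i
    by (intro borel_imp_lebesgue_measurable borel_measurable_continuous_onI smooth_continuous sm)
  have p0: "\<phi> i w = 0" if "w \<notin> cball z r" for i w using z0[of w i] that by auto
  have each: "integrable lebesgue (\<lambda>w. f w * frechet_derivative (\<phi> i) (at w) i)"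
     "integrable lebesgue (\<lambda>w. (G w \<bullet> i) * \<phi> i w)"
     "(LINT w|lebesgue. f w * frechet_derivative (\<phi> i) (at w) i) = - (LINT w|lebesgue. (G w \<bullet> i) * \<phi> i w)"
    if i: "i \<in> Basis" for i
  proof -
    obtain B1 where B1: "\<And>w. \<bar>frechet_derivative (\<phi> i) (at w) i\<bar> \<le> B1" using dB by blast
    obtain B2 where B2: "\<And>w. \<bar>\<phi> i w\<bar> \<le> B2" using pB by blast
    show "integrable lebesgue (\<lambda>w. f w * frechet_derivative (\<phi> i) (at w) i)"
      by (rule integrable_bounded_mult(1)[OF lf compact_cball sub dm B1 d0])
    show "integrable lebesgue (\<lambda>w. (G w \<bullet> i) * \<phi> i w)"
      by (rule integrable_bounded_mult(1)[OF lG[OF i] compact_cball sub pm B2 p0])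
    have "(LINT x:\<Omega>|lebesgue. f x * frechet_derivative (\<phi> i) (at x) i) = - (LINT x:\<Omega>|lebesgue. (G x \<bullet> i) * \<phi> i x)"
      using wg tf i unfolding weak_gradient_def by blast
    moreover have "(LINT x:\<Omega>|lebesgue. f x * frechet_derivative (\<phi> i) (at x) i) = (LINT x|lebesgue. f x * frechet_derivative (\<phi> i) (at x) i)"
      by (rule integrable_bounded_mult(2)[OF lf compact_cball sub dm B1 d0])
    moreover have "(LINT x:\<Omega>|lebesgue. (G x \<bullet> i) * \<phi> i x) = (LINT x|lebesgue. (G x \<bullet> i) * \<phi> i x)"
      by (rule integrable_bounded_mult(2)[OF lG[OF i] compact_cball sub pm B2 p0])
    ultimately show "(LINT w|lebesgue. f w * frechet_derivative (\<phi> i) (at w) i) = - (LINT w|lebesgue. (G w \<bullet> i) * \<phi> i w)" by argo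
  qed
  have "(LINT w|lebesgue. f w * bump_velocity d s r z w)
     = (LINT w|lebesgue. - (\<Sum>i\<in>Basis. f w * frechet_derivative (\<phi> i) (at w) i))"
       unfolding div by (simp add: sum_distrib_left)
  also have "\<dots> = - (\<Sum>i\<in>Basis. LINT w|lebesgue. f w * frechet_derivative (\<phi> i) (at w) i)"
    using each(1) by (simp add: Bochner_Integration.integral_sum)
  also have "\<dots> = (\<Sum>i\<in>Basis. LINT w|lebesgue. (G w \<bullet> i) * \<phi> i w)"
    using each(3) by (simp add: sum_negf)
  also have "\<dots> = (LINT w|lebesgue. (\<Sum>i\<in>Basis. (G w \<bullet> i) * \<phi> i w))"
    using each(2) by (simp add: Bochner_Integration.integral_sum)
  also have "(\<lambda>w. \<Sum>i\<in>Basis. (G w \<bullet> i) * \<phi> i w) = (\<lambda>w. (G w \<bullet> (d + (s / r) *\<^sub>R (w - z))) * bump r z w)"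
  proof
    fix w
    have "G w \<bullet> (d + (s / r) *\<^sub>R (w - z)) = (\<Sum>i\<in>Basis. (G w \<bullet> i) * V i w)"
      unfolding V_def by (subst euclidean_inner) (simp add: inner_add_left)
    then show "(\<Sum>i\<in>Basis. (G w \<bullet> i) * \<phi> i w) = (G w \<bullet> (d + (s / r) *\<^sub>R (w - z))) * bump r z w"
      by (simp add: \<phi>_def sum_distrib_right mult.assoc)
  qed
  finally show ?thesis .
qed

text \<open>The bump is moved linearly from one centre and radius to the other, and the average is
  differentiated under the integral sign. By \<open>weak_gradient_bump\<close> its derivative is a
  pairing of \<open>G\<close> with a field of length at most
  \<open>(norm d + \<bar>s\<bar>) / rm ^ DIM('a)\<close>, and the mean value theorem
  concludes.\<close>

lemma bump_average_step:
  fixes z d :: "'a::euclidean_space"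
  assumes wg: "weak_gradient \<Omega> f G" and K: "compact K" "K \<subseteq> \<Omega>" and rm: "0 < rm"
    and r: "\<And>t. 0 \<le> t \<Longrightarrow> t \<le> 1 \<Longrightarrow> rm \<le> r + t * s"
    and sub: "\<And>t. 0 \<le> t \<Longrightarrow> t \<le> 1 \<Longrightarrow> cball (z + t *\<^sub>R d) (r + t * s) \<subseteq> K"
    and J: "(\<integral>\<^sup>+ w\<in>K. ennreal (norm (G w)) \<partial>lebesgue) \<le> ennreal J" and J0: "0 \<le> J"
  shows "\<bar>(LINT w|lebesgue. f w * bump (r + s) (z + d) w) - (LINT w|lebesgue. f w * bump r z w)\<bar>
     \<le> (norm d + \<bar>s\<bar>) * J / rm ^ DIM('a)"
proof -
  let ?X = "\<lambda>t. z + t *\<^sub>R d"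
  let ?Y = "norm d + \<bar>s\<bar>"
  let ?Z = "?Y / rm ^ DIM('a)"
  let ?U = "\<lambda>w. indicator K w *\<^sub>R f w"
  have lf: "locally_integrable_on f \<Omega>" using wg by (auto simp: weak_gradient_def)
  define A where "A t = (LINT w|lebesgue. f w * bump (r + t * s) (?X t) w)" for t
  define A' where "A' t = (LINT w|lebesgue. f w * bump_velocity d s (r + t * s) (?X t) w)" for t
  let ?L = "(4 * norm d + 4 * \<bar>s\<bar> + real DIM('a) * \<bar>s\<bar>) / rm ^ Suc DIM('a)"
  have rpos: "0 < r + t * s" if "t \<in> {0..1}" for t using r[of t] rm that by auto
  have out: "w \<notin> ball (?X t) (r + t * s)" if "t \<in> {0..1}" "w \<notin> K" for t w
    using sub[of t] that ball_subset_cball by fastforce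
  have int: "integrable lebesgue (\<lambda>w. f w * bump (r + t * s) (?X t) w)" if t: "t \<in> {0..1}" for t
  proof (rule integrable_bounded_mult(1)[OF lf K])
    show "\<bar>bump (r + t * s) (?X t) x\<bar> \<le> 1 / (r + t * s) ^ DIM('a)" for x
      by (rule bump_abs_le[OF rpos[OF t]])
    show "bump (r + t * s) (?X t) x = 0" if "x \<notin> K" for x
      using bump_eq_0[OF rpos[OF t] out[OF t that]] .
  qed measurable
  \<comment> \<open>A Lipschitz bound in time, uniform in \<open>w\<close>; multiplied by
    \<open>\<bar>f\<bar>\<close> on \<open>K\<close> it dominates the difference quotients.\<close>
  have lip: "\<bar>bump (r + t * s) (?X t) w - bump (r + u * s) (z + u *\<^sub>R d) w\<bar> \<le> ?L * \<bar>t - u\<bar>"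
    if "t \<in> {0..1}" "u \<in> {0..1}" for t u w
  proof -
    have "norm (bump (r + t * s) (?X t) w - bump (r + u * s) (z + u *\<^sub>R d) w) \<le> ?L * norm (t - u)"
    proof (rule field_differentiable_bound[of "{0..1}" "\<lambda>t. bump (r + t * s) (?X t) w" "\<lambda>t. bump_velocity d s (r + t * s) (?X t) w"])
      show "((\<lambda>t. bump (r + t * s) (?X t) w) has_field_derivative bump_velocity d s (r + t * s) (?X t) w) (at t within {0..1})"
        if "t \<in> {0..1}" for t
        by (rule has_field_derivative_at_within[OF bump_time_derivative[OF rpos[OF that]]])
      show "norm (bump_velocity d s (r + t * s) (?X t) w) \<le> ?L" if "t \<in> {0..1}" for t
        unfolding real_norm_def by (rule bump_velocity_bound[OF rm r]) (use that in auto)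
    qed (use that in auto)
    then show ?thesis by simp
  qed
  have fK: "integrable lebesgue (\<lambda>w. indicator K w *\<^sub>R f w)"
    by (rule locally_integrable_onD[OF lf K])
  have der: "(A has_field_derivative A' t) (at t within {0..1})" if t: "t \<in> {0..1}" for t
    unfolding has_field_derivative_iff tendsto_at_iff_sequentially
  proof (intro allI impI)
    fix X :: "nat \<Rightarrow> real" assume X: "\<forall>i. X i \<in> {0..1} - {t}" "X \<longlonglongrightarrow> t"
    let ?q = "\<lambda>k w. f w * ((bump (r + X k * s) (z + X k *\<^sub>R d) w - bump (r + t * s) (?X t) w) / (X k - t))"
    have Xt: "filterlim X (at t) sequentially" using X by (auto simp: filterlim_at)
    have eq: "(A (X k) - A t) / (X k - t) = (LINT w|lebesgue. ?q k w)" for k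
    proof -
      have "A (X k) - A t = (LINT w|lebesgue. f w * bump (r + X k * s) (z + X k *\<^sub>R d) w - f w * bump (r + t * s) (?X t) w)"
        using X unfolding A_def by (intro Bochner_Integration.integral_diff[symmetric] int t) auto
      then have "(A (X k) - A t) / (X k - t) = (LINT w|lebesgue. (f w * bump (r + X k * s) (z + X k *\<^sub>R d) w - f w * bump (r + t * s) (?X t) w) / (X k - t))"
        by simp
      also have "\<dots> = (LINT w|lebesgue. ?q k w)"
        by (intro Bochner_Integration.integral_cong) (auto simp: right_diff_distrib)
      finally show ?thesis .
    qed
    have "(\<lambda>k. LINT w|lebesgue. ?q k w) \<longlonglongrightarrow> A' t" unfolding A'_def
    proof (rule integral_dominated_convergence[where w="\<lambda>w. ?L * norm (?U w)"])
      show "integrable lebesgue (\<lambda>w. ?L * norm (?U w))"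
        using fK by (intro integrable_mult_right integrable_norm)
      show "AE w in lebesgue. (\<lambda>k. ?q k w) \<longlonglongrightarrow> f w * bump_velocity d s (r + t * s) (?X t) w"
      proof (rule AE_I2)
        fix w
        have "((\<lambda>u. (bump (r + u * s) (z + u *\<^sub>R d) w - bump (r + t * s) (?X t) w) / (u - t)) \<longlongrightarrow> bump_velocity d s (r + t * s) (?X t) w) (at t)"
          using bump_time_derivative[OF rpos[OF t]] unfolding has_field_derivative_iff .
        from filterlim_compose[OF this Xt]
        show "(\<lambda>k. ?q k w) \<longlonglongrightarrow> f w * bump_velocity d s (r + t * s) (?X t) w"
          by (intro tendsto_mult tendsto_const)
      qed
      show "AE w in lebesgue. norm (?q k w) \<le> ?L * norm (?U w)" for k
      proof (rule AE_I2)
        fix w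
        have Xk: "X k \<in> {0..1}" "X k \<noteq> t" using X by auto
        show "norm (?q k w) \<le> ?L * norm (?U w)"
        proof (cases "w \<in> K")
          case True
          have "\<bar>(bump (r + X k * s) (z + X k *\<^sub>R d) w - bump (r + t * s) (?X t) w) / (X k - t)\<bar> \<le> ?L"
            using lip[OF Xk(1) t, of w] Xk(2) by (simp only: abs_divide) (simp add: pos_divide_le_eq)
          then have "\<bar>f w\<bar> * \<bar>(bump (r + X k * s) (z + X k *\<^sub>R d) w - bump (r + t * s) (?X t) w) / (X k - t)\<bar> \<le> \<bar>f w\<bar> * ?L"
            by (rule mult_left_mono) simp
          then show ?thesis using True by (simp add: abs_mult mult.commute)
        next
          case False
          then have "bump (r + X k * s) (z + X k *\<^sub>R d) w = 0" "bump (r + t * s) (?X t) w = 0"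
            using bump_eq_0[OF rpos out] Xk t by auto
          moreover have "0 \<le> ?L" using rm by simp
          ultimately show ?thesis by (simp only: diff_self div_0 mult_zero_right norm_zero mult_nonneg_nonneg norm_ge_zero)
        qed
      qed
      have [measurable]: "(\<lambda>w. f w * bump (r + t * s) (?X t) w) \<in> borel_measurable lebesgue" if "t \<in> {0..1}" for t
        using int[OF that] by simp
      show "?q k \<in> borel_measurable lebesgue" for k
      proof -
        show ?thesis using X t by (simp add: right_diff_distrib)
      qed
      have "(\<lambda>w. (?U w) * bump_velocity d s (r + t * s) (?X t) w) \<in> borel_measurable lebesgue"
        using borel_measurable_integrable[OF fK] by measurable
      also have "(\<lambda>w. (?U w) * bump_velocity d s (r + t * s) (?X t) w) = (\<lambda>w. f w * bump_velocity d s (r + t * s) (?X t) w)"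
        using bump_velocity_eq_0[OF rpos[OF t] out[OF t]] by (auto simp: indicator_def fun_eq_iff)
      finally show "(\<lambda>w. f w * bump_velocity d s (r + t * s) (?X t) w) \<in> borel_measurable lebesgue" .
    qed
    then show "((\<lambda>y. (A y - A t) / (y - t)) \<circ> X) \<longlonglongrightarrow> A' t"
      by (simp add: comp_def eq)
  qed
  have bd: "\<bar>A' t\<bar> \<le> ?Y * J / rm ^ DIM('a)" if t: "t \<in> {0..1}" for t
  proof -
    let ?r = "r + t * s" and ?z = "z + t *\<^sub>R d"
    have sub': "cball ?z ?r \<subseteq> \<Omega>" using sub[of t] K t by auto
    let ?h = "\<lambda>w. (G w \<bullet> (d + (s / ?r) *\<^sub>R (w - ?z))) * bump ?r ?z w"
    have A': "A' t = (LINT w|lebesgue. ?h w)"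
      unfolding A'_def by (rule weak_gradient_bump[OF wg rpos[OF t] sub'])
    have rm_r: "rm \<le> ?r" using r t by auto
    \<comment> \<open>Inside the bump \<open>norm (w - ?z) \<le> ?r\<close>, so the velocity has
      length at most \<open>norm d + \<bar>s\<bar>\<close>.\<close>
    have pt: "\<bar>?h w\<bar> \<le> ?Z * (norm (G w) * indicator K w)" for w
    proof (cases "w \<in> ball ?z ?r")
      case True
      then have wK: "w \<in> K" using sub[of t] t ball_subset_cball by fastforce
      have "norm (w - ?z) \<le> ?r" using True by (auto simp: dist_norm norm_minus_commute)
      then have "norm ((s / ?r) *\<^sub>R (w - ?z)) \<le> \<bar>s / ?r\<bar> * ?r"
        unfolding norm_scaleR by (rule mult_left_mono) simp
      also have "\<dots> = \<bar>s\<bar>" using rpos[OF t] by (simp add: abs_divide)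
      finally have "norm ((s / ?r) *\<^sub>R (w - ?z)) \<le> \<bar>s\<bar>" .
      then have "norm (d + (s / ?r) *\<^sub>R (w - ?z)) \<le> norm d + \<bar>s\<bar>"
        using norm_triangle_ineq[of d "(s / ?r) *\<^sub>R (w - ?z)"] by linarith
      then have 1: "\<bar>G w \<bullet> (d + (s / ?r) *\<^sub>R (w - ?z))\<bar> \<le> norm (G w) * ?Y"
        by (metis Cauchy_Schwarz_ineq2 mult_left_mono norm_ge_zero order_trans)
      have "\<bar>bump ?r ?z w\<bar> \<le> 1 / ?r ^ DIM('a)" by (rule bump_abs_le[OF rpos[OF t]])
      also have "\<dots> \<le> 1 / rm ^ DIM('a)" using rm rm_r by (intro divide_left_mono power_mono mult_pos_pos) auto
      finally have 2: "\<bar>bump ?r ?z w\<bar> \<le> 1 / rm ^ DIM('a)" .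
      have "\<bar>?h w\<bar> \<le> (norm (G w) * ?Y) * (1 / rm ^ DIM('a))"
        unfolding abs_mult using 1 2 by (intro mult_mono) auto
      then show ?thesis using wK by (simp add: mult_ac)
    next
      case False
      then show ?thesis using bump_eq_0[OF rpos[OF t], of w ?z] rm by (simp add: divide_nonneg_pos)
    qed
    have "ennreal \<bar>A' t\<bar> \<le> ennreal ?Z * ennreal J"
    proof (cases "integrable lebesgue ?h")
      case True
      have [measurable]: "?h \<in> borel_measurable lebesgue" using True by simp
      have "ennreal \<bar>A' t\<bar> \<le> (\<integral>\<^sup>+ w. ennreal (norm (?h w)) \<partial>lebesgue)"
        using integral_norm_bound_ennreal[OF True] unfolding A' by simp
      also have "\<dots> \<le> (\<integral>\<^sup>+ w. ennreal ?Z * (ennreal (norm (G w)) * indicator K w) \<partial>lebesgue)"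
      proof (rule nn_integral_mono)
        fix w
        have "ennreal (norm (?h w)) \<le> ennreal (?Z * (norm (G w) * indicator K w))"
          using pt[of w] by (intro ennreal_leI) simp
        then show "ennreal (norm (?h w)) \<le> ennreal ?Z * (ennreal (norm (G w)) * indicator K w)"
          by (simp only: ennreal_mult[OF divide_nonneg_nonneg[OF add_nonneg_nonneg zero_le_power] mult_nonneg_nonneg]
            ennreal_mult norm_ge_zero abs_ge_zero indicator_pos_le ennreal_indicator less_imp_le[OF rm])
      qed
      also have "\<dots> = ennreal ?Z * (\<integral>\<^sup>+ w\<in>K. ennreal (norm (G w)) \<partial>lebesgue)"
      proof (rule nn_integral_cmult)
        have "(\<lambda>w. indicator K w *\<^sub>R (G w \<bullet> i)) \<in> borel_measurable lebesgue" if "i \<in> Basis" for i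
          using wg that by (intro locally_integrable_onD[OF _ K]) (auto simp: weak_gradient_def)
        then have "(\<lambda>w. indicator K w *\<^sub>R G w) \<in> borel_measurable lebesgue"
          by (intro borel_measurable_euclidean_space[THEN iffD2]) auto
        then have "(\<lambda>w. ennreal (norm (indicator K w *\<^sub>R G w))) \<in> borel_measurable lebesgue" by measurable
        also have "(\<lambda>w. ennreal (norm (indicator K w *\<^sub>R G w))) = (\<lambda>w. ennreal (norm (G w)) * indicator K w)"
          by (auto simp: indicator_def fun_eq_iff)
        finally show "(\<lambda>w. ennreal (norm (G w)) * indicator K w) \<in> borel_measurable lebesgue" .
      qed
      also have "\<dots> \<le> ennreal ?Z * ennreal J" by (intro mult_left_mono J) simp
      finally show ?thesis .
    next
      \<comment> \<open>The integral of a non-integrable function is 0 by convention, so the bound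
        holds here as well.\<close>
      case False
      then show ?thesis unfolding A' by (simp add: not_integrable_integral_eq)
    qed
    also have "\<dots> = ennreal (?Y / rm ^ DIM('a) * J)"
      by (rule ennreal_mult[symmetric]) (use rm J0 in auto)
    finally show ?thesis using rm J0 by (simp add: divide_nonneg_pos)
  qed
  have "norm (A 1 - A 0) \<le> ?Y * J / rm ^ DIM('a) * norm (1 - 0 :: real)"
    by (rule field_differentiable_bound[of "{0..1}" A A']) (use der bd in auto)
  then show ?thesis by (simp add: A_def)
qed

subsection \<open>Almost everywhere convergence from strict convexity\<close>

text \<open>A strictly convex function of linear growth: it can be integrated for L1 functions, and
  its convexity defect still measures distances.\<close>

definition smooth_norm :: "'b::real_inner \<Rightarrow> real" where
  "smooth_norm v = sqrt (1 + (norm v)\<^sup>2)"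

lemma smooth_norm_ge: "1 \<le> smooth_norm v" "norm v \<le> smooth_norm v" "0 \<le> smooth_norm v" "0 < smooth_norm v"
proof -
  show "1 \<le> smooth_norm v" by (simp add: smooth_norm_def)
  then show "0 \<le> smooth_norm v" "0 < smooth_norm v" by auto
  show "norm v \<le> smooth_norm v" unfolding smooth_norm_def by (rule real_le_rsqrt) simp
qed

lemma smooth_norm_le: "smooth_norm v \<le> 1 + norm v"
  unfolding smooth_norm_def by (rule real_le_lsqrt) (auto simp: power2_eq_square algebra_simps)

lemma smooth_norm_sq: "(smooth_norm v)\<^sup>2 = 1 + (norm v)\<^sup>2"
  by (simp add: smooth_norm_def)

lemma smooth_norm_measurable [measurable]:
  fixes f :: "'a \<Rightarrow> 'b::euclidean_space"
  assumes [measurable]: "f \<in> borel_measurable M"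
  shows "(\<lambda>x. smooth_norm (f x)) \<in> borel_measurable M"
  unfolding smooth_norm_def by measurable

text \<open>Quantitative strict convexity. With \<open>P\<close> the mean of the values and
  \<open>Q\<close> the value at the midpoint, the difference of the squares of \<open>P\<close> and
  \<open>Q\<close> is half of \<open>?A * ?B - ?X\<close>. By Cauchy-Schwarz, the square of
  \<open>?A * ?B\<close> exceeds that of \<open>?X\<close> by at least the square of
  \<open>norm (a - b)\<close>.\<close>

lemma smooth_norm_midpoint:
  fixes a b :: "'b::real_inner"
  defines "D \<equiv> (smooth_norm a + smooth_norm b) / 2 - smooth_norm ((1/2) *\<^sub>R (a + b))"
  shows "(norm (a - b))\<^sup>2 \<le> D * (smooth_norm a + smooth_norm b) ^ 3" and "0 \<le> D"
proof -
  let ?A = "smooth_norm a" and ?B = "smooth_norm b"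
  let ?X = "1 + a \<bullet> b"
  define P where "P = (?A + ?B) / 2"
  define Q where "Q = smooth_norm ((1/2) *\<^sub>R (a + b))"
  have pos: "1 \<le> ?A" "1 \<le> ?B" "1 \<le> P" "1 \<le> Q" using smooth_norm_ge(1)[of a] smooth_norm_ge(1)[of b] smooth_norm_ge(1) by (auto simp: P_def Q_def)
  have nab: "(norm (a - b))\<^sup>2 = (norm a)\<^sup>2 + (norm b)\<^sup>2 - 2 * (a \<bullet> b)"
    by (simp add: power2_norm_eq_inner inner_diff_left inner_diff_right inner_commute)
  have nhalf: "(norm ((1/2) *\<^sub>R (a + b)))\<^sup>2 = ((norm a)\<^sup>2 + (norm b)\<^sup>2 + 2 * (a \<bullet> b)) / 4"
    by (simp add: power2_norm_eq_inner inner_add_left inner_add_right inner_commute power_divide algebra_simps)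
  have AB2: "(?A * ?B)\<^sup>2 = (1 + (norm a)\<^sup>2) * (1 + (norm b)\<^sup>2)"
    by (simp add: power_mult_distrib smooth_norm_sq)
  have CS: "(a \<bullet> b)\<^sup>2 \<le> (norm a)\<^sup>2 * (norm b)\<^sup>2"
    using Cauchy_Schwarz_ineq[of a b] by (simp add: power2_norm_eq_inner)
  have sq: "(norm (a - b))\<^sup>2 \<le> (?A * ?B)\<^sup>2 - ?X\<^sup>2"
    using CS unfolding AB2 nab by (simp add: power2_eq_square algebra_simps)
  have y: "1 + a \<bullet> b \<le> ?A * ?B"
  proof (rule power2_le_imp_le)
    show "?X\<^sup>2 \<le> (?A * ?B)\<^sup>2" using sq zero_le_power2[of "norm (a - b)"] by linarith
    show "0 \<le> ?A * ?B" using pos by simp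
  qed
  have "(norm (a - b))\<^sup>2 \<le> (?A * ?B - ?X) * (?A * ?B + ?X)"
    using sq by (simp add: power2_eq_square algebra_simps)
  also have "\<dots> \<le> (?A * ?B - ?X) * (2 * (?A * ?B))" using y by (intro mult_left_mono) auto
  finally have 1: "(norm (a - b))\<^sup>2 \<le> (?A * ?B - ?X) * (2 * (?A * ?B))" .
  have PQ2: "P\<^sup>2 - Q\<^sup>2 = (?A * ?B - ?X) / 2"
  proof -
    have "P\<^sup>2 = (?A\<^sup>2 + ?B\<^sup>2 + 2 * (?A * ?B)) / 4" by (simp add: P_def power2_eq_square field_simps)
    also have "\<dots> = (2 + (norm a)\<^sup>2 + (norm b)\<^sup>2 + 2 * (?A * ?B)) / 4" by (simp add: smooth_norm_sq)
    finally have P2: "P\<^sup>2 = (2 + (norm a)\<^sup>2 + (norm b)\<^sup>2 + 2 * (?A * ?B)) / 4" .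
    have Q2: "Q\<^sup>2 = 1 + ((norm a)\<^sup>2 + (norm b)\<^sup>2 + 2 * (a \<bullet> b)) / 4"
      unfolding Q_def smooth_norm_sq nhalf ..
    show ?thesis unfolding P2 Q2 by (simp add: field_simps)
  qed
  then have "Q\<^sup>2 \<le> P\<^sup>2" using y by simp
  then have QP: "Q \<le> P" using pos by (intro power2_le_imp_le[of Q P]) auto
  then show D0: "0 \<le> D" by (simp add: D_def P_def Q_def)
  have D: "D = P - Q" by (simp add: D_def P_def Q_def)
  have "(norm (a - b))\<^sup>2 \<le> (P\<^sup>2 - Q\<^sup>2) * (4 * (?A * ?B))"
    using 1 unfolding PQ2 by (simp only:)
  also have "P\<^sup>2 - Q\<^sup>2 = D * (P + Q)" by (simp add: D power2_eq_square algebra_simps)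
  also have "D * (P + Q) * (4 * (?A * ?B)) \<le> D * (2 * P) * (4 * P\<^sup>2)"
  proof (intro mult_mono)
    show "?A * ?B \<le> P\<^sup>2"
      using zero_le_power2[of "?A - ?B"] by (simp add: P_def power2_eq_square field_simps)
  qed (use D0 QP pos in auto)
  also have "\<dots> = D * (?A + ?B) ^ 3" by (simp add: P_def power2_eq_square power3_eq_cube)
  finally show "(norm (a - b))\<^sup>2 \<le> D * (?A + ?B) ^ 3" .
qed

text \<open>The square root and the parameter \<open>e\<close> make the right-hand side linear in
  the sizes and in the convexity defect, so it can be integrated knowing only first moments. Either
  \<open>s \<le> e * S\<close>, or the fourth power bound \<open>s ^ 4 \<le> D * S ^ 3\<close>
  together with \<open>e * S < s\<close> leaves \<open>s \<le> D / e ^ 3\<close>.\<close>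

lemma sqrt_norm_diff_le:
  fixes a b :: "'b::real_inner"
  assumes e: "0 < e"
  shows "sqrt (norm (a - b)) \<le> e * (smooth_norm a + smooth_norm b)
    + ((smooth_norm a + smooth_norm b) / 2 - smooth_norm ((1/2) *\<^sub>R (a + b))) / e ^ 3"
proof -
  define s where "s = sqrt (norm (a - b))"
  define S where "S = smooth_norm a + smooth_norm b"
  define D where "D = (smooth_norm a + smooth_norm b) / 2 - smooth_norm ((1/2) *\<^sub>R (a + b))"
  have s: "0 \<le> s" "s\<^sup>2 = norm (a - b)" by (auto simp: s_def)
  have S: "0 < S" using smooth_norm_ge(4)[of a] smooth_norm_ge(4)[of b] by (simp add: S_def)
  have D0: "0 \<le> D" using smooth_norm_midpoint(2)[of a b] by (simp add: D_def)
  have 4: "s ^ 4 \<le> D * S ^ 3"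
    using smooth_norm_midpoint(1)[of a b] by (simp add: D_def S_def s(2)[symmetric])
  show ?thesis
  proof (cases "s \<le> e * S")
    case True
    then show ?thesis using D0 e by (simp add: s_def S_def D_def add_increasing2)
  next
    case False
    then have "(e * S) ^ 3 \<le> s ^ 3" using e S by (intro power_mono) auto
    then have "e ^ 3 * (D * S ^ 3) \<le> D * s ^ 3" using D0 by (simp add: power_mult_distrib mult_left_mono mult_ac)
    moreover have "e ^ 3 * s ^ 4 \<le> e ^ 3 * (D * S ^ 3)" using 4 e by (intro mult_left_mono) auto
    ultimately have "(e ^ 3 * s) * s ^ 3 \<le> D * s ^ 3" by (simp add: eval_nat_numeral mult_ac)
    moreover have "0 < s" using False e S by (metis less_eq_real_def linorder_not_le mult_pos_pos order_less_trans)
    ultimately have "s \<le> D / e ^ 3" using e by (simp add: field_simps)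
    then show ?thesis using e S by (simp add: s_def S_def D_def add_increasing)
  qed
qed

lemma summable_sqrt_imp_convergent:
  fixes h :: "nat \<Rightarrow> 'b::banach"
  assumes "summable (\<lambda>k. sqrt (norm (h (Suc k) - h k)))"
  shows "convergent h"
proof -
  let ?X = "\<lambda>k. norm (h (Suc k) - h k)"
  have "eventually (\<lambda>k. sqrt (?X k) < 1) sequentially"
    using summable_LIMSEQ_zero[OF assms] by (rule order_tendstoD) simp
  then have "eventually (\<lambda>k. norm (h (Suc k) - h k) \<le> sqrt (?X k)) sequentially"
  proof eventually_elim
    fix k assume "sqrt (?X k) < 1"
    then have "sqrt (?X k) * sqrt (?X k) \<le> 1 * sqrt (?X k)" by (intro mult_right_mono) auto
    then show "norm (h (Suc k) - h k) \<le> sqrt (?X k)" by simp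
  qed
  then have "summable (\<lambda>k. h (Suc k) - h k)"
    by (intro summable_comparison_test_ev[OF _ assms]) simp
  then have "(\<lambda>n. \<Sum>k<n. h (Suc k) - h k) \<longlonglongrightarrow> (\<Sum>k. h (Suc k) - h k)" by (rule summable_LIMSEQ)
  then have "(\<lambda>n. (\<Sum>k<n. h (Suc k) - h k) + h 0) \<longlonglongrightarrow> (\<Sum>k. h (Suc k) - h k) + h 0"
    by (intro tendsto_intros)
  then show ?thesis unfolding convergent_def by (auto simp: sum_lessThan_telescope)
qed

text \<open>A form of Komlos' theorem: near-minimisers of the strictly convex functional are close to each other in
  measure, so no weak compactness is needed.\<close>
lemma midpoint_convex_AE_convergent:
  fixes C :: "nat \<Rightarrow> ('a \<Rightarrow> 'b::euclidean_space) set"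
  assumes meas: "\<And>k h. h \<in> C k \<Longrightarrow> h \<in> borel_measurable M"
    and ne: "\<And>k. C k \<noteq> {}" and dec: "\<And>k l. k \<le> l \<Longrightarrow> C l \<subseteq> C k"
    and mid: "\<And>k g h. g \<in> C k \<Longrightarrow> h \<in> C k \<Longrightarrow> (\<lambda>x. (1/2) *\<^sub>R (g x + h x)) \<in> C k"
    and int: "\<And>k h. h \<in> C k \<Longrightarrow> integrable M (\<lambda>x. smooth_norm (h x))"
    and R: "\<And>k h. h \<in> C k \<Longrightarrow> (\<integral>x. smooth_norm (h x) \<partial>M) \<le> R"
  obtains h u where "\<And>k. h k \<in> C k" "u \<in> borel_measurable M" "AE x in M. (\<lambda>k. h k x) \<longlonglongrightarrow> u x"
proof -
  define I where "I h = (\<integral>x. smooth_norm (h x) \<partial>M)" for h :: "'a \<Rightarrow> 'b"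
  define m where "m k = Inf (I ` C k)" for k
  have I0: "0 \<le> I h" for h unfolding I_def by (intro integral_nonneg_AE) (simp add: smooth_norm_ge)
  have bdd: "bdd_below (I ` C k)" for k using I0 by (auto intro: bdd_belowI[of _ 0])
  have m_le: "m k \<le> I h" if "h \<in> C k" for k h unfolding m_def using bdd that by (intro cInf_lower) auto
  have m_mono: "m k \<le> m l" if "k \<le> l" for k l
    unfolding m_def using dec[OF that] ne by (intro cInf_superset_mono bdd image_mono) auto
  have mR: "m k \<le> R" for k
  proof -
    obtain h where "h \<in> C k" using ne[of k] by blast
    then show ?thesis using m_le[of h k] R[of h k] by (simp add: I_def)
  qed
  obtain L where L: "m \<longlonglongrightarrow> L" "\<And>k. m k \<le> L"
    using incseq_convergent[of m R] m_mono mR by (metis incseq_def)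
  have "\<exists>g\<in>C k. I g < m k + (1/2)^k" for k
  proof -
    show ?thesis using cInf_lessD[of "I ` C k"] ne[of k] by (simp add: m_def)
  qed
  then obtain g where g: "\<And>k. g k \<in> C k" "\<And>k. I (g k) < m k + (1/2)^k" by metis
  \<comment> \<open>Bounds the convexity defect of \<open>g k\<close> and \<open>g j\<close> for
    \<open>k \<le> j\<close>: both values of \<open>I\<close> are at most
    \<open>L + (1/2)^k\<close>, while the midpoint lies in \<open>C k\<close> and so has value at
    least \<open>m k\<close>.\<close>
  define \<delta> where "\<delta> k = (L - m k) + (1/2)^k" for k
  have d0: "\<delta> \<longlonglongrightarrow> 0"
  proof -
    have "\<delta> \<longlonglongrightarrow> (L - L) + 0" unfolding \<delta>_def by (intro tendsto_intros L LIMSEQ_realpow_zero) auto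
    then show ?thesis by simp
  qed
  have gap: "integrable M (\<lambda>x. sqrt (norm (g k x - g j x)))"
     "(\<integral>x. sqrt (norm (g k x - g j x)) \<partial>M) \<le> e * (2 * R) + \<delta> k / e ^ 3" if "k \<le> j" "0 < e" for k j e
  proof -
    have gj: "g j \<in> C k" using g(1) dec[OF that(1)] by blast
    let ?h = "\<lambda>x. (1/2) *\<^sub>R (g k x + g j x)"
    have h: "?h \<in> C k" by (rule mid[OF g(1) gj])
    note i = int[OF g(1)[of k]] int[OF g(1)[of j]] int[OF h]
    have [measurable]: "g k \<in> borel_measurable M" "g j \<in> borel_measurable M" using meas g(1) by auto
    let ?U = "\<lambda>x. e * (smooth_norm (g k x) + smooth_norm (g j x))
      + ((smooth_norm (g k x) + smooth_norm (g j x)) / 2 - smooth_norm (?h x)) / e ^ 3"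
    have iU: "integrable M ?U" using i by simp
    have le: "sqrt (norm (g k x - g j x)) \<le> ?U x" for x by (rule sqrt_norm_diff_le[OF that(2)])
    show iS: "integrable M (\<lambda>x. sqrt (norm (g k x - g j x)))"
    proof (rule Bochner_Integration.integrable_bound[OF iU])
      show "AE x in M. norm (sqrt (norm (g k x - g j x))) \<le> norm (?U x)"
      proof (rule AE_I2)
        fix x show "norm (sqrt (norm (g k x - g j x))) \<le> norm (?U x)"
          using le[of x] by (simp only: real_norm_def abs_of_nonneg[OF real_sqrt_ge_zero[OF norm_ge_zero]])
      qed
    qed measurable
    have "(\<integral>x. sqrt (norm (g k x - g j x)) \<partial>M) \<le> (\<integral>x. ?U x \<partial>M)"
      by (rule integral_mono[OF iS iU le])
    also have "\<dots> = e * (I (g k) + I (g j)) + ((I (g k) + I (g j)) / 2 - I ?h) / e ^ 3"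
      using i by (simp add: I_def)
    also have "\<dots> \<le> e * (2 * R) + \<delta> k / e ^ 3"
    proof (intro add_mono mult_left_mono divide_right_mono)
      show "I (g k) + I (g j) \<le> 2 * R" using R[OF g(1)[of k]] R[OF g(1)[of j]] by (simp add: I_def)
      have "(1/2::real)^j \<le> (1/2)^k" using that by (intro power_decreasing) auto
      show "(I (g k) + I (g j)) / 2 - I ?h \<le> \<delta> k"
      proof -
        have "(a + b) / 2 - c \<le> L - p + d'" if "e' \<le> d'" "a < p + d'" "b < q + e'" "p \<le> c" "q \<le> L" "p \<le> L" for a b c d' e' p q L :: real
          using that by (simp add: field_simps)
        from this[OF _ g(2) g(2) m_le[OF h] L(2) L(2)] \<open>(1/2::real)^j \<le> (1/2)^k\<close> show ?thesis unfolding \<delta>_def .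
      qed
    qed (use that in auto)
    finally show "(\<integral>x. sqrt (norm (g k x - g j x)) \<partial>M) \<le> e * (2 * R) + \<delta> k / e ^ 3" .
  qed
  \<comment> \<open>Prepares the choice \<open>e = (1/4)^i\<close> in \<open>gap\<close>: the
    defect, divided by the cube of \<open>e\<close>, must still be at most \<open>(1/4)^i\<close>,
    so that the integrals of successive differences are summable.\<close>
  have "\<exists>K. \<forall>k\<ge>K. \<delta> k \<le> (1/4)^i * ((1/4)^i)^3" for i :: nat
  proof -
    have "eventually (\<lambda>k. \<delta> k < (1/4)^i * ((1/4)^i)^3) sequentially"
      using d0 by (rule order_tendstoD) simp
    then show ?thesis unfolding eventually_sequentially using less_imp_le by blast
  qed
  then obtain K where K: "\<And>i k. K i \<le> k \<Longrightarrow> \<delta> k \<le> (1/4)^i * ((1/4)^i)^3" by metis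
  define r where "r i = i + (\<Sum>j\<le>i. K j)" for i
  have r: "i \<le> r i" "K i \<le> r i" "r i \<le> r (Suc i)" for i
    by (auto simp: r_def intro: order_trans[OF member_le_sum[of i "{..i}" K]])
  define h where "h i = g (r i)" for i
  have hC: "h i \<in> C i" for i using g(1)[of "r i"] dec[OF r(1)] by (auto simp: h_def)
  have hm[measurable]: "h i \<in> borel_measurable M" for i using meas hC by blast
  let ?Y = "\<lambda>i. \<integral>\<^sup>+ x. ennreal (sqrt (norm (h (Suc i) x - h i x))) \<partial>M"
  have step: "(?Y i) \<le> ennreal ((2 * R + 1) * (1/4)^i)" for i
  proof -
    have "(?Y i) = (\<integral>\<^sup>+ x. ennreal (sqrt (norm (g (r i) x - g (r (Suc i)) x))) \<partial>M)"
      by (simp add: h_def norm_minus_commute)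
    also have "\<dots> = ennreal (\<integral>x. sqrt (norm (g (r i) x - g (r (Suc i)) x)) \<partial>M)"
      using gap(1)[OF r(3)[of i], of 1] by (intro nn_integral_eq_integral) auto
    also have "\<dots> \<le> ennreal ((1/4)^i * (2 * R) + \<delta> (r i) / ((1/4)^i)^3)"
      by (intro ennreal_leI gap(2)[OF r(3)]) simp
    also have "\<dots> \<le> ennreal ((2 * R + 1) * (1/4)^i)"
    proof (intro ennreal_leI)
      have "\<delta> (r i) / ((1/4)^i)^3 \<le> (1/4)^i" using K[OF r(2)[of i]] by (simp add: pos_divide_le_eq)
      then show "(1/4)^i * (2 * R) + \<delta> (r i) / ((1/4)^i)^3 \<le> (2 * R + 1) * (1/4)^i" by (simp add: algebra_simps)
    qed
    finally show ?thesis .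
  qed
  have R0: "0 \<le> R" using mR[of 0] cInf_greatest[of "I ` C 0" 0] I0 ne[of 0] by (fastforce simp: m_def)
  let ?X = "\<lambda>x. \<Sum>i. ennreal (sqrt (norm (h (Suc i) x - h i x)))"
  have "(\<integral>\<^sup>+ x. (?X x) \<partial>M)
     = (\<Sum>i. \<integral>\<^sup>+ x. ennreal (sqrt (norm (h (Suc i) x - h i x))) \<partial>M)"
       by (rule nn_integral_suminf) measurable
  also have "\<dots> \<le> (\<Sum>i. ennreal ((2 * R + 1) * (1/4)^i))" by (intro suminf_le step) auto
  also have "\<dots> = ennreal (\<Sum>i. (2 * R + 1) * (1/4)^i)"
    using R0 by (intro suminf_ennreal2) (auto intro!: summable_mult summable_geometric)
  also have "\<dots> < \<infinity>" by simp
  finally have "AE x in M. (?X x) \<noteq> \<infinity>" by (intro nn_integral_PInf_AE) auto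
  then have conv: "AE x in M. convergent (\<lambda>i. h i x)"
  proof eventually_elim
    fix x assume "(?X x) \<noteq> \<infinity>"
    then have "summable (\<lambda>i. sqrt (norm (h (Suc i) x - h i x)))"
      by (intro summable_suminf_not_top) auto
    then show "convergent (\<lambda>i. h i x)" by (rule summable_sqrt_imp_convergent)
  qed
  show thesis
  proof
    show "(\<lambda>x. lim (\<lambda>k. h k x)) \<in> borel_measurable M" by measurable
    show "AE x in M. (\<lambda>k. h k x) \<longlonglongrightarrow> lim (\<lambda>k. h k x)"
      using conv by eventually_elim (simp add: convergent_LIMSEQ_iff)
  qed (rule hC)
qed

subsection \<open>The second associate space\<close>

text \<open>The convex function sqrt (1 + x^2) lies above its tangent at \<open>a - b\<close>, whose
  slope is \<open>(a - b) / smooth_norm (a - b)\<close>.\<close>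

lemma smooth_norm_tangent:
  fixes a b :: real
  shows "smooth_norm (a - b) - smooth_norm a \<le> - b * ((a - b) / smooth_norm (a - b))"
proof -
  have A: "0 < smooth_norm a" and C: "0 < smooth_norm (a - b)" by (rule smooth_norm_ge)+
  have "(1 + a * (a - b))\<^sup>2 \<le> (smooth_norm a * smooth_norm (a - b))\<^sup>2"
  proof -
    have "(smooth_norm a * smooth_norm (a - b))\<^sup>2 = (1 + a\<^sup>2) * (1 + (a - b)\<^sup>2)" by (simp add: power_mult_distrib smooth_norm_sq)
    then show ?thesis using zero_le_power2[of b] by (simp add: power2_eq_square algebra_simps)
  qed
  then have "1 + a * (a - b) \<le> smooth_norm a * smooth_norm (a - b)"
    by (rule power2_le_imp_le) (use A C in simp)
  then have "(smooth_norm (a - b))\<^sup>2 - smooth_norm a * smooth_norm (a - b) \<le> - b * (a - b)"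
    unfolding smooth_norm_sq real_norm_def power2_abs by (simp add: power2_eq_square algebra_simps)
  then show ?thesis using C by (simp add: field_simps power2_eq_square)
qed

lemma associate_norm_cmult:
  fixes N :: "('a::euclidean_space \<Rightarrow> real) \<Rightarrow> ennreal"
  assumes [measurable]: "w \<in> borel_measurable lebesgue"
  shows "associate_norm N (\<lambda>x. c * w x) = ennreal \<bar>c\<bar> * associate_norm N w"
proof -
  have "(\<integral>\<^sup>+ x. ennreal \<bar>c * w x * g x\<bar> \<partial>lebesgue) = ennreal \<bar>c\<bar> * (\<integral>\<^sup>+ x. ennreal \<bar>w x * g x\<bar> \<partial>lebesgue)"
    if [measurable]: "g \<in> borel_measurable lebesgue" for g
    by (subst nn_integral_cmult[symmetric]) (auto simp: abs_mult ennreal_mult mult.assoc)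
  then show ?thesis
    unfolding associate_norm_def by (auto simp: SUP_mult_left_ennreal intro!: SUP_cong)
qed

context bbfs
begin

text \<open>Separates \<open>f\<close> from the unit ball \<open>K\<close>. The functional
  \<open>J\<close> is minimised over \<open>K\<close>; at a minimiser \<open>v\<close> the
  derivative of \<open>smooth_norm\<close> at \<open>u = f - v\<close> is a bounded function
  \<open>g\<close> whose pairing with elements of \<open>K\<close> is largest at \<open>v\<close>
  and strictly larger at \<open>f\<close>. A multiple of \<open>g\<close> times the weight is the
  required \<open>w\<close>. Boundedness of \<open>f\<close> makes it integrable for the finite
  measure \<mu>.\<close>

lemma Lorentz_Luxemburg_aux:
  assumes f[measurable]: "f \<in> borel_measurable lebesgue" and b: "\<And>x. \<bar>f x\<bar> \<le> b" and gt: "1 < N f"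
  shows "\<exists>w\<in>borel_measurable lebesgue. associate_norm N w \<le> 1 \<and> 1 < (\<integral>\<^sup>+ x. ennreal \<bar>f x * w x\<bar> \<partial>lebesgue)"
proof -
  obtain w0 where w0[measurable]: "w0 \<in> borel_measurable lebesgue" and w0p: "\<And>x. 0 < w0 x"
    and w0fin: "(\<integral>\<^sup>+ x. ennreal (w0 x) \<partial>lebesgue) < \<infinity>"
    and w0N: "\<And>h. h \<in> borel_measurable lebesgue \<Longrightarrow> (\<integral>\<^sup>+ x. ennreal (\<bar>h x\<bar> * w0 x) \<partial>lebesgue) \<le> N h"
    using positive_weight by blast
  define \<mu> where "\<mu> = density lebesgue (\<lambda>x. ennreal (w0 x))"
  have sets_mu[measurable_cong, simp]: "sets \<mu> = sets lebesgue" by (simp add: \<mu>_def)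
  have AE_mu: "(AE x in \<mu>. P x) \<longleftrightarrow> (AE x in lebesgue. P x)" for P
    unfolding \<mu>_def by (subst AE_density) (use w0p in auto)
  have nn_mu: "(\<integral>\<^sup>+ x. F x \<partial>\<mu>) = (\<integral>\<^sup>+ x. ennreal (w0 x) * F x \<partial>lebesgue)" if "F \<in> borel_measurable lebesgue" for F
    unfolding \<mu>_def by (rule nn_integral_density) (use that in auto)
  have fin: "finite_measure \<mu>"
  proof
    have "emeasure \<mu> (space \<mu>) = (\<integral>\<^sup>+ x. 1 \<partial>\<mu>)" by simp
    also have "\<dots> = (\<integral>\<^sup>+ x. ennreal (w0 x) \<partial>lebesgue)" by (subst nn_mu) auto
    finally show "emeasure \<mu> (space \<mu>) \<noteq> \<infinity>" using w0fin by simp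
  qed
  interpret \<mu>: finite_measure \<mu> by (rule fin)
  let ?U = "\<lambda>v. \<integral>x. \<bar>v x\<bar> \<partial>\<mu>"
  let ?H = "\<lambda>v. \<integral>\<^sup>+ x. ennreal \<bar>v x\<bar> \<partial>\<mu>"
  have N_int: "integrable \<mu> v" "(?U v) \<le> 1" if v[measurable]: "v \<in> borel_measurable lebesgue" and "N v \<le> 1" for v
  proof -
    have "(?H v) = (\<integral>\<^sup>+ x. ennreal (\<bar>v x\<bar> * w0 x) \<partial>lebesgue)"
      using w0p by (subst nn_mu) (auto simp: ennreal_mult less_imp_le mult.commute)
    also have "\<dots> \<le> 1" using w0N[OF v] that(2) by (rule order_trans)
    finally have *: "(?H v) \<le> 1" .
    show i: "integrable \<mu> v"
      by (rule integrableI_bounded) (use * in \<open>auto intro: order_le_less_trans\<close>)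
    have "ennreal (?U v) = (?H v)" using i by (intro nn_integral_eq_integral[symmetric]) auto
    then have "ennreal (?U v) \<le> ennreal 1" using * by simp
    then show "(?U v) \<le> 1" by (subst (asm) ennreal_le_iff) auto
  qed
  have f_int: "integrable \<mu> f" by (rule \<mu>.integrable_const_bound[of _ b]) (use b in auto)
  define K where "K = {v \<in> borel_measurable lebesgue. N v \<le> 1}"
  define J where "J v = (\<integral>x. smooth_norm (f x - v x) \<partial>\<mu>)" for v
  have K0: "(\<lambda>x. 0) \<in> K" by (simp add: K_def)
  have Kconv: "(\<lambda>x. (1 - t) * u x + t * v x) \<in> K" if "u \<in> K" "v \<in> K" "0 \<le> t" "t \<le> 1" for u v t
  proof -
    have [measurable]: "u \<in> borel_measurable lebesgue" "v \<in> borel_measurable lebesgue" using that by (auto simp: K_def)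
    have "N (\<lambda>x. (1 - t) * u x + t * v x) \<le> N (\<lambda>x. (1 - t) * u x) + N (\<lambda>x. t * v x)" by (rule triangle) measurable
    also have "\<dots> = ennreal (1 - t) * N u + ennreal t * N v" using that by (simp add: cmult)
    also have "\<dots> \<le> ennreal (1 - t) * 1 + ennreal t * 1" using that by (intro add_mono mult_left_mono) (auto simp: K_def)
    also have "\<dots> = 1" using that by (simp flip: ennreal_plus)
    finally show ?thesis by (simp add: K_def)
  qed
  have Jint: "integrable \<mu> (\<lambda>x. smooth_norm (f x - v x))" if "v \<in> K" for v
  proof -
    have v[measurable]: "v \<in> borel_measurable lebesgue" and Nv: "N v \<le> 1" using that by (auto simp: K_def)
    show ?thesis
    proof (rule Bochner_Integration.integrable_bound)
      show "integrable \<mu> (\<lambda>x. 1 + \<bar>f x\<bar> + \<bar>v x\<bar>)"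
        using f_int N_int(1)[OF v Nv] by auto
      show "AE x in \<mu>. norm (smooth_norm (f x - v x)) \<le> norm (1 + \<bar>f x\<bar> + \<bar>v x\<bar>)"
      proof (rule AE_I2)
        fix x show "norm (smooth_norm (f x - v x)) \<le> norm (1 + \<bar>f x\<bar> + \<bar>v x\<bar>)"
          using smooth_norm_le[of "f x - v x"] smooth_norm_ge(3)[of "f x - v x"] by simp
      qed
    qed measurable
  qed
  have J0: "0 \<le> J v" for v unfolding J_def by (intro integral_nonneg_AE) (simp add: smooth_norm_ge)
  define m where "m = Inf (J ` K)"
  have m_le: "m \<le> J v" if "v \<in> K" for v
    unfolding m_def using that J0 by (intro cInf_lower bdd_belowI[of _ 0]) auto
  define C where "C k = {h. \<exists>v\<in>K. h = (\<lambda>x. f x - v x) \<and> J v \<le> m + (1/2)^k}" for k :: nat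
  obtain h u where h: "\<And>k. h k \<in> C k" and u: "u \<in> borel_measurable \<mu>" and lim: "AE x in \<mu>. (\<lambda>k. h k x) \<longlonglongrightarrow> u x"
  proof (rule midpoint_convex_AE_convergent[of C \<mu> "m + 1"])
    show "h \<in> borel_measurable \<mu>" if "h \<in> C k" for k h using that by (auto simp: C_def K_def)
    show "C k \<noteq> {}" for k
    proof -
      have "Inf (J ` K) < m + (1/2)^k" by (simp add: m_def)
      then obtain v where "v \<in> K" "J v < m + (1/2)^k" using cInf_lessD[of "J ` K"] K0 by auto
      then show ?thesis by (auto simp: C_def intro!: less_imp_le)
    qed
    show "C l \<subseteq> C k" if "k \<le> l" for k l
    proof -
      have le: "(1/2::real)^l \<le> (1/2)^k" using that by (intro power_decreasing) auto
      show ?thesis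
      proof
        fix h assume "h \<in> C l"
        then obtain v where v: "v \<in> K" "h = (\<lambda>x. f x - v x)" "J v \<le> m + (1/2)^l" by (auto simp: C_def)
        then have "J v \<le> m + (1/2)^k" using le by linarith
        then show "h \<in> C k" unfolding C_def using v by blast
      qed
    qed
    show "(\<lambda>x. (1/2) *\<^sub>R (g x + h x)) \<in> C k" if gh: "g \<in> C k" "h \<in> C k" for k g h
    proof -
      obtain v v' where v: "v \<in> K" "g = (\<lambda>x. f x - v x)" "J v \<le> m + (1/2)^k"
        and v': "v' \<in> K" "h = (\<lambda>x. f x - v' x)" "J v' \<le> m + (1/2)^k" using gh by (auto simp: C_def)
      let ?V = "\<lambda>x. (1 - 1/2) * v x + (1/2) * v' x"
      have V: "?V \<in> K" by (rule Kconv) (use v v' in auto)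
      have "J ?V \<le> (\<integral>x. (smooth_norm (f x - v x) + smooth_norm (f x - v' x)) / 2 \<partial>\<mu>)"
        unfolding J_def
      proof (rule integral_mono)
        show "integrable \<mu> (\<lambda>x. smooth_norm (f x - ?V x))" by (rule Jint[OF V])
        show "integrable \<mu> (\<lambda>x. (smooth_norm (f x - v x) + smooth_norm (f x - v' x)) / 2)"
          using Jint[OF v(1)] Jint[OF v'(1)] by auto
        fix x
        have eq: "f x - ?V x = (1/2) *\<^sub>R ((f x - v x) + (f x - v' x))" by (simp add: field_simps)
        show "smooth_norm (f x - ?V x) \<le> (smooth_norm (f x - v x) + smooth_norm (f x - v' x)) / 2"
          using smooth_norm_midpoint(2)[of "f x - v x" "f x - v' x"] unfolding eq by linarith
      qed
      also have "\<dots> = (J v + J v') / 2" using Jint[OF v(1)] Jint[OF v'(1)] by (simp add: J_def)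
      also have "\<dots> \<le> m + (1/2)^k" using v v' by simp
      finally have J: "J ?V \<le> m + (1/2)^k" .
      have eq: "(\<lambda>x. (1/2) *\<^sub>R (g x + h x)) = (\<lambda>x. f x - ?V x)" by (simp add: v v' fun_eq_iff field_simps)
      show ?thesis unfolding C_def mem_Collect_eq by (rule bexI[of _ ?V], intro conjI, rule eq, rule J, rule V)
    qed
    show "integrable \<mu> (\<lambda>x. smooth_norm (h x))" if "h \<in> C k" for k h using that Jint by (auto simp: C_def)
    show "(\<integral>x. smooth_norm (h x) \<partial>\<mu>) \<le> m + 1" if "h \<in> C k" for k h
    proof -
      have "(1/2::real)^k \<le> 1" by (simp add: power_le_one)
      then show ?thesis using that by (auto simp: C_def J_def)
    qed
  qed blast
  have um[measurable]: "u \<in> borel_measurable lebesgue" using u by simp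
  have lim': "AE x in lebesgue. (\<lambda>k. h k x) \<longlonglongrightarrow> u x" using lim by (simp add: AE_mu)
  have "\<exists>v. v \<in> K \<and> h k = (\<lambda>x. f x - v x) \<and> J v \<le> m + (1/2)^k" for k using h[of k] by (auto simp: C_def)
  then obtain V where V: "\<And>k. V k \<in> K" "\<And>k. h k = (\<lambda>x. f x - V k x)" "\<And>k. J (V k) \<le> m + (1/2)^k" by metis
  have Vm[measurable]: "V k \<in> borel_measurable lebesgue" for k using V(1)[of k] by (simp add: K_def)
  define v where "v x = f x - u x" for x
  have vm[measurable]: "v \<in> borel_measurable lebesgue" unfolding v_def by measurable
  have Vlim: "AE x in lebesgue. (\<lambda>k. V k x) \<longlonglongrightarrow> v x" using lim'
  proof eventually_elim
    fix x assume "(\<lambda>k. h k x) \<longlonglongrightarrow> u x"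
    then have "(\<lambda>k. f x - h k x) \<longlonglongrightarrow> f x - u x" by (intro tendsto_intros)
    then show "(\<lambda>k. V k x) \<longlonglongrightarrow> v x" by (simp add: V(2) v_def)
  qed
  have vK: "v \<in> K" using Fatou_AE[OF Vm vm Vlim, of 1] V(1) by (simp add: K_def)
  let ?Z = "\<lambda>x k. ennreal (smooth_norm (f x - V k x))"
  let ?A = "\<lambda>k. ennreal (m + (1/2)^k)"
  have Jv: "J v \<le> m"
  proof -
    have nJ: "ennreal (J z) = (\<integral>\<^sup>+ x. ennreal (smooth_norm (f x - z x)) \<partial>\<mu>)" if "z \<in> K" for z
      unfolding J_def by (rule nn_integral_eq_integral[symmetric, OF Jint[OF that]]) (simp add: smooth_norm_ge)
    have "ennreal (J v) = (\<integral>\<^sup>+ x. liminf (?Z x) \<partial>\<mu>)"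
      unfolding nJ[OF vK]
    proof (rule nn_integral_cong_AE)
      have "AE x in \<mu>. (\<lambda>k. V k x) \<longlonglongrightarrow> v x" using Vlim by (simp add: AE_mu)
      then show "AE x in \<mu>. ennreal (smooth_norm (f x - v x)) = liminf (?Z x)"
      proof eventually_elim
        fix x assume "(\<lambda>k. V k x) \<longlonglongrightarrow> v x"
        then have "(?Z x) \<longlonglongrightarrow> ennreal (smooth_norm (f x - v x))"
          unfolding smooth_norm_def by (intro tendsto_intros tendsto_ennrealI)
        then show "ennreal (smooth_norm (f x - v x)) = liminf (?Z x)"
          by (metis lim_imp_Liminf trivial_limit_sequentially)
      qed
    qed
    also have "\<dots> \<le> liminf (\<lambda>k. \<integral>\<^sup>+ x. ennreal (smooth_norm (f x - V k x)) \<partial>\<mu>)"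
      by (rule nn_integral_liminf) measurable
    also have "\<dots> = liminf (\<lambda>k. ennreal (J (V k)))" by (simp add: nJ V(1))
    also have "\<dots> \<le> liminf ?A"
      by (intro Liminf_mono always_eventually allI ennreal_leI V(3))
    also have "?A \<longlonglongrightarrow> ennreal (m + 0)"
      by (intro tendsto_ennrealI tendsto_intros LIMSEQ_realpow_zero) auto
    then have "liminf ?A = ennreal m"
      using lim_imp_Liminf[OF trivial_limit_sequentially] by fastforce
    finally have "ennreal (J v) \<le> ennreal m" .
    moreover have "0 \<le> m" unfolding m_def using K0 J0 by (intro cInf_greatest) auto
    ultimately show ?thesis by (simp add: ennreal_le_iff)
  qed
  \<comment> \<open>The derivative of \<open>smooth_norm\<close> at the residual \<open>u\<close>,
    that is, the normal direction of the separating hyperplane. It is bounded by 1, hence pairs with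
    every integrable function.\<close>
  define g where "g x = u x / smooth_norm (u x)" for x
  have gm[measurable]: "g \<in> borel_measurable lebesgue" unfolding g_def by measurable
  have g1: "\<bar>g x\<bar> \<le> 1" for x
    using smooth_norm_ge(2)[of "u x"] smooth_norm_ge(4)[of "u x"] by (simp add: g_def)
  have zg_int: "integrable \<mu> (\<lambda>x. z x * g x)" if "integrable \<mu> z" for z
  proof (rule Bochner_Integration.integrable_bound[OF that])
    show "(\<lambda>x. z x * g x) \<in> borel_measurable \<mu>" using borel_measurable_integrable[OF that] by measurable
    show "AE x in \<mu>. norm (z x * g x) \<le> norm (z x)"
      using g1 by (intro AE_I2) (simp add: abs_mult mult_left_le)
  qed
  have vint: "integrable \<mu> v" by (rule N_int(1)) (use vK in \<open>auto simp: K_def\<close>)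
  let ?P = "\<integral>x. v x * g x \<partial>\<mu>"
  \<comment> \<open>First variation: \<open>v\<close> is compared with the points
    \<open>v + ?t k * b\<close> of the segment towards \<open>z\<close>. The tangent inequality is
    divided by the step and the step sent to 0.\<close>
  have var: "(\<integral>x. z x * g x \<partial>\<mu>) \<le> ?P" if z: "z \<in> K" for z
  proof -
    have zm[measurable]: "z \<in> borel_measurable lebesgue" using z by (simp add: K_def)
    have zint: "integrable \<mu> z" by (rule N_int(1)) (use z in \<open>auto simp: K_def\<close>)
    define b where "b x = z x - v x" for x
    have [measurable]: "b \<in> borel_measurable lebesgue" unfolding b_def by measurable
    have bint: "integrable \<mu> b" unfolding b_def using zint vint by simp
    let ?t = "\<lambda>k. inverse (real (Suc k))"
    let ?q = "\<lambda>k x. b x * ((u x - ?t k * b x) / smooth_norm (u x - ?t k * b x))"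
    have ratio: "\<bar>a / smooth_norm a\<bar> \<le> 1" for a :: real
      using smooth_norm_ge(2)[of a] smooth_norm_ge(4)[of a] by simp
    have qint: "integrable \<mu> (?q k)" for k
    proof (rule Bochner_Integration.integrable_bound[OF bint])
      show "AE x in \<mu>. norm (?q k x) \<le> norm (b x)"
        using ratio by (intro AE_I2) (simp only: real_norm_def abs_mult mult_left_le abs_ge_zero)
    qed measurable
    have le0: "(\<integral>x. ?q k x \<partial>\<mu>) \<le> 0" for k
    proof -
      have t: "0 < ?t k" "?t k \<le> 1" by (auto simp: field_simps)
      let ?W = "\<lambda>x. (1 - ?t k) * v x + ?t k * z x"
      have W: "?W \<in> K" by (rule Kconv[OF vK z]) (use t in auto)
      have eq: "f x - ?W x = u x - ?t k * b x" for x by (simp add: v_def b_def algebra_simps)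
      have "0 \<le> J ?W - J v" using Jv m_le[OF W] by simp
      also have "\<dots> = (\<integral>x. smooth_norm (u x - ?t k * b x) - smooth_norm (u x) \<partial>\<mu>)"
        unfolding J_def eq using Jint[OF W] Jint[OF vK] by (subst Bochner_Integration.integral_diff) (simp_all only: eq, auto simp: v_def)
      also have "\<dots> \<le> (\<integral>x. - ?t k * ?q k x \<partial>\<mu>)"
      proof (rule integral_mono)
        have "integrable \<mu> (\<lambda>x. smooth_norm (f x - ?W x) - smooth_norm (f x - v x))"
          by (intro Bochner_Integration.integrable_diff Jint W vK)
        then show "integrable \<mu> (\<lambda>x. smooth_norm (u x - ?t k * b x) - smooth_norm (u x))"
          unfolding eq by (simp add: v_def)
        show "integrable \<mu> (\<lambda>x. - ?t k * ?q k x)" by (intro integrable_mult_right qint)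
        show "smooth_norm (u x - ?t k * b x) - smooth_norm (u x) \<le> - ?t k * ?q k x" for x
          using smooth_norm_tangent[of "u x" "?t k * b x"] by (simp add: mult.assoc)
      qed
      also have "\<dots> = - ?t k * (\<integral>x. ?q k x \<partial>\<mu>)" by (rule integral_mult_right_zero)
      finally show ?thesis using t(1) by (simp add: mult_le_0_iff)
    qed
    have "(\<lambda>k. \<integral>x. ?q k x \<partial>\<mu>) \<longlonglongrightarrow> (\<integral>x. b x * g x \<partial>\<mu>)"
    proof (rule integral_dominated_convergence[where w="\<lambda>x. \<bar>b x\<bar>"])
      show "integrable \<mu> (\<lambda>x. \<bar>b x\<bar>)" using bint by simp
      show "AE x in \<mu>. norm (?q k x) \<le> \<bar>b x\<bar>" for k
        using ratio by (intro AE_I2) (simp only: real_norm_def abs_mult mult_left_le abs_ge_zero)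
      show "AE x in \<mu>. (\<lambda>k. ?q k x) \<longlonglongrightarrow> b x * g x"
      proof (rule AE_I2)
        fix x
        have "(\<lambda>k. u x - ?t k * b x) \<longlonglongrightarrow> u x - 0 * b x"
          by (intro tendsto_intros LIMSEQ_inverse_real_of_nat)
        then have L: "(\<lambda>k. u x - ?t k * b x) \<longlonglongrightarrow> u x" by simp
        have "smooth_norm (u x) \<noteq> 0" using smooth_norm_ge(4)[of "u x"] by simp
        then show "(\<lambda>k. ?q k x) \<longlonglongrightarrow> b x * g x"
          unfolding g_def using L unfolding smooth_norm_def by (intro tendsto_intros) auto
      qed
    qed measurable
    then have "(\<integral>x. b x * g x \<partial>\<mu>) \<le> 0" by (rule LIMSEQ_le_const2) (use le0 in auto)
    moreover have "(\<integral>x. b x * g x \<partial>\<mu>) = (\<integral>x. z x * g x \<partial>\<mu>) - ?P"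
      unfolding b_def using zg_int[OF zint] zg_int[OF vint] by (simp add: left_diff_distrib)
    ultimately show ?thesis by simp
  qed
  define s where "s = ?P"
  define \<delta> where "\<delta> = (\<integral>x. f x * g x \<partial>\<mu>)"
  have s0: "0 \<le> s" using var[OF K0] by (simp add: s_def)
  let ?Y = "\<integral>x. u x * g x \<partial>\<mu>"
  \<comment> \<open>The difference is the integral of \<open>u x * g x\<close>, which is nonnegative
    and vanishes only if \<open>f\<close> and \<open>v\<close> agree almost everywhere; then
    \<open>N f = N v \<le> 1\<close> would contradict the assumption.\<close>
  have "s < \<delta>"
  proof -
    have uint: "integrable \<mu> u"
    proof -
      have "integrable \<mu> (\<lambda>x. f x - v x)" using f_int vint by simp
      then show ?thesis by (simp add: v_def)
    qed
    have ug: "u x * g x = (u x)\<^sup>2 / smooth_norm (u x)" for x by (simp add: g_def power2_eq_square)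
    have ug0: "0 \<le> u x * g x" for x unfolding ug using smooth_norm_ge(4)[of "u x"] by simp
    have "\<delta> - s = ?Y" unfolding \<delta>_def s_def using zg_int[OF f_int] zg_int[OF vint]
      by (subst Bochner_Integration.integral_diff[symmetric]) (auto simp: v_def left_diff_distrib)
    moreover have "?Y \<noteq> 0"
    proof
      assume "?Y = 0"
      then have "AE x in \<mu>. u x * g x = 0"
        using ug0 by (subst (asm) integral_nonneg_eq_0_iff_AE[OF zg_int[OF uint]]) auto
      then have "AE x in lebesgue. u x * g x = 0" by (simp add: AE_mu)
      then have "AE x in lebesgue. \<bar>f x\<bar> = \<bar>v x\<bar>"
      proof eventually_elim
        fix x assume "u x * g x = 0"
        then have "u x = 0" using smooth_norm_ge(4)[of "u x"] by (auto simp: ug)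
        then show "\<bar>f x\<bar> = \<bar>v x\<bar>" by (simp add: v_def)
      qed
      then have "N f = N v" by (intro cong_AE) auto
      then show False using gt vK by (simp add: K_def)
    qed
    moreover have "0 \<le> ?Y" using ug0 by (intro integral_nonneg_AE) simp
    ultimately show ?thesis by linarith
  qed
  define W where "W x = g x * w0 x" for x
  have Wm[measurable]: "W \<in> borel_measurable lebesgue" unfolding W_def by measurable
  have NW: "associate_norm N W \<le> ennreal s" unfolding associate_norm_def
  proof (rule SUP_least)
    fix z assume "z \<in> {g \<in> borel_measurable lebesgue. N g = 1}"
    then have z[measurable]: "z \<in> borel_measurable lebesgue" and z1: "N z = 1" by auto
    \<comment> \<open>Adjusting the sign of \<open>z\<close> to that of \<open>g\<close> keeps it in
      the unit ball and turns the absolute pairing into a signed one, to which \<open>var\<close>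
      applies.\<close>
    define y where "y x = \<bar>z x\<bar> * sgn (g x)" for x
    have ym[measurable]: "y \<in> borel_measurable lebesgue" unfolding y_def sgn_real_def by measurable
    have "N y \<le> N z" by (rule mono) (auto simp: y_def abs_mult sgn_if)
    then have yK: "y \<in> K" using z1 by (simp add: K_def)
    have yint: "integrable \<mu> y" by (rule N_int(1)) (use yK in \<open>auto simp: K_def\<close>)
    have yg: "y x * g x = \<bar>z x\<bar> * \<bar>g x\<bar>" for x by (simp add: y_def sgn_if)
    have "(\<integral>\<^sup>+ x. ennreal \<bar>W x * z x\<bar> \<partial>lebesgue) = (\<integral>\<^sup>+ x. ennreal (w0 x) * ennreal (y x * g x) \<partial>lebesgue)"
    proof (rule nn_integral_cong)
      fix x
      have "\<bar>W x * z x\<bar> = w0 x * (y x * g x)" unfolding yg W_def using w0p[of x] by (simp add: abs_mult)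
      moreover have "0 \<le> y x * g x" unfolding yg by simp
      ultimately show "ennreal \<bar>W x * z x\<bar> = ennreal (w0 x) * ennreal (y x * g x)"
        using w0p[of x] by (simp only: ennreal_mult less_imp_le)
    qed
    also have "\<dots> = (\<integral>\<^sup>+ x. ennreal (y x * g x) \<partial>\<mu>)" by (rule nn_mu[symmetric]) measurable
    also have "\<dots> = ennreal (\<integral>x. y x * g x \<partial>\<mu>)"
      by (rule nn_integral_eq_integral[OF zg_int[OF yint]]) (simp add: yg)
    also have "\<dots> \<le> ennreal s" using var[OF yK] by (simp add: s_def ennreal_leI)
    finally show "(\<integral>\<^sup>+ x. ennreal \<bar>W x * z x\<bar> \<partial>lebesgue) \<le> ennreal s" .
  qed
  let ?X = "\<integral>\<^sup>+ x. ennreal \<bar>f x * W x\<bar> \<partial>lebesgue"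
  have fW: "ennreal \<delta> \<le> ?X"
  proof -
    have "\<delta> \<le> (\<integral>x. \<bar>f x * g x\<bar> \<partial>\<mu>)" unfolding \<delta>_def using zg_int[OF f_int] by (intro integral_mono) auto
    then have "ennreal \<delta> \<le> ennreal (\<integral>x. \<bar>f x * g x\<bar> \<partial>\<mu>)" by (rule ennreal_leI)
    also have "\<dots> = (\<integral>\<^sup>+ x. ennreal \<bar>f x * g x\<bar> \<partial>\<mu>)"
      using zg_int[OF f_int] by (intro nn_integral_eq_integral[symmetric]) auto
    also have "\<dots> = (\<integral>\<^sup>+ x. ennreal (w0 x) * ennreal \<bar>f x * g x\<bar> \<partial>lebesgue)" by (rule nn_mu) measurable
    also have "\<dots> = ?X"
      using w0p by (intro nn_integral_cong) (auto simp: W_def abs_mult less_imp_le mult_ac simp flip: ennreal_mult)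
    finally show ?thesis .
  qed
  \<comment> \<open>Twice the reciprocal of the sum of the two pairings, so that
    \<open>c * s \<le> 1 < c * \<delta>\<close>; the choice also works for
    \<open>s = 0\<close>.\<close>
  define c where "c = 2 / (s + \<delta>)"
  have c: "0 < c" using s0 \<open>s < \<delta>\<close> by (simp add: c_def)
  let ?Q = "\<integral>\<^sup>+ x. ennreal \<bar>f x * (c * W x)\<bar> \<partial>lebesgue"
  show ?thesis
  proof (intro bexI[of _ "\<lambda>x. c * W x"] conjI)
    have "associate_norm N (\<lambda>x. c * W x) \<le> ennreal c * ennreal s"
      using c NW by (simp add: associate_norm_cmult mult_left_mono)
    also have "\<dots> = ennreal (c * s)" using c s0 by (simp add: ennreal_mult)
    also have "\<dots> \<le> 1" using \<open>s < \<delta>\<close> s0 by (simp add: c_def field_simps)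
    finally show "associate_norm N (\<lambda>x. c * W x) \<le> 1" .
    have "1 < ennreal (c * \<delta>)"
      using \<open>s < \<delta>\<close> s0 by (simp add: c_def field_simps)
    also have "\<dots> = ennreal c * ennreal \<delta>" using c s0 \<open>s < \<delta>\<close> by (simp add: ennreal_mult)
    also have "\<dots> \<le> ennreal c * ?X" by (intro mult_left_mono fW) simp
    also have "\<dots> = (\<integral>\<^sup>+ x. ennreal c * ennreal \<bar>f x * W x\<bar> \<partial>lebesgue)" by (rule nn_integral_cmult[symmetric]) measurable
    also have "\<dots> = ?Q"
      using c by (intro nn_integral_cong) (auto simp: abs_mult mult_ac simp flip: ennreal_mult)
    finally show "1 < ?Q" .
  qed measurable
qed

text \<open>Converts bounds tested on the associate unit ball into norm bounds, which is how
  boundedness on the associate space of the convexification is put to use. If the norm of a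
  truncation \<open>G k\<close> exceeded \<open>B\<close>, dividing by a constant strictly between
  the two would contradict \<open>Lorentz_Luxemburg_aux\<close>; the Fatou property removes the
  truncation.\<close>

theorem Lorentz_Luxemburg:
  assumes F[measurable]: "F \<in> borel_measurable lebesgue"
    and B: "\<And>w. w \<in> borel_measurable lebesgue \<Longrightarrow> associate_norm N w \<le> 1 \<Longrightarrow>
       (\<integral>\<^sup>+ x. F x * ennreal \<bar>w x\<bar> \<partial>lebesgue) \<le> B"
  shows "enorm N F \<le> B"
proof -
  define G where "G k x = enn2real (min (F x) (ennreal (real k)))" for k x
  have [measurable]: "G k \<in> borel_measurable lebesgue" for k unfolding G_def by measurable
  have G: "ennreal (G k x) = min (F x) (ennreal (real k))" "0 \<le> G k x" "\<bar>G k x\<bar> \<le> real k" for k x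
  proof -
    have "min (F x) (ennreal (real k)) < top" by (simp add: min_less_iff_disj)
    then show eq: "ennreal (G k x) = min (F x) (ennreal (real k))" by (simp add: G_def)
    show "0 \<le> G k x" by (simp add: G_def)
    moreover have "ennreal (G k x) \<le> ennreal (real k)" unfolding eq by simp
    ultimately show "\<bar>G k x\<bar> \<le> real k" by (simp add: ennreal_le_iff)
  qed
  have "N (G k) \<le> B" for k
  proof (rule ccontr)
    assume "\<not> N (G k) \<le> B"
    then have "B < N (G k)" by simp
    then obtain c0 where c0: "B < c0" "c0 < N (G k)" using dense by blast
    have "0 < c0" using c0(1) by (rule le_less_trans[OF zero_le])
    moreover have "c0 < top" using c0(2) by (rule less_le_trans[OF _ top_greatest])
    ultimately have "0 < enn2real c0" "c0 = ennreal (enn2real c0)" by (auto simp: enn2real_positive_iff)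
    then obtain c where c: "0 < c" "c0 = ennreal c" by blast
    have "N (\<lambda>x. (1/c) * G k x) = ennreal (1/c) * N (G k)" by (subst cmult) (use c in auto)
    moreover have "1 < ennreal (1/c) * N (G k)"
    proof -
      have "ennreal (1/c) * ennreal c = 1" using c by (simp flip: ennreal_mult)
      moreover have "ennreal (1/c) * ennreal c < ennreal (1/c) * N (G k)"
        using c0 c by (intro ennreal_mult_strict_left_mono) auto
      ultimately show ?thesis by simp
    qed
    ultimately have "1 < N (\<lambda>x. (1/c) * G k x)" by simp
    moreover have "\<bar>(1/c) * G k x\<bar> \<le> (1/c) * real k" for x using G(2,3)[of k x] c by (simp add: abs_mult divide_right_mono)
    ultimately obtain w where w[measurable]: "w \<in> borel_measurable lebesgue" and w1: "associate_norm N w \<le> 1"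
      and gt: "1 < (\<integral>\<^sup>+ x. ennreal \<bar>(1/c) * G k x * w x\<bar> \<partial>lebesgue)"
      using Lorentz_Luxemburg_aux[of "\<lambda>x. (1/c) * G k x" "(1/c) * real k"] by auto
    have "(\<integral>\<^sup>+ x. ennreal \<bar>(1/c) * G k x * w x\<bar> \<partial>lebesgue) = (\<integral>\<^sup>+ x. ennreal (1/c) * (ennreal (G k x) * ennreal \<bar>w x\<bar>) \<partial>lebesgue)"
      using c G(2) by (intro nn_integral_cong) (auto simp: abs_mult simp flip: ennreal_mult)
    also have "\<dots> = ennreal (1/c) * (\<integral>\<^sup>+ x. ennreal (G k x) * ennreal \<bar>w x\<bar> \<partial>lebesgue)"
      by (rule nn_integral_cmult) measurable
    also have "\<dots> \<le> ennreal (1/c) * (\<integral>\<^sup>+ x. F x * ennreal \<bar>w x\<bar> \<partial>lebesgue)"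
      by (intro mult_left_mono nn_integral_mono mult_right_mono) (auto simp: G(1))
    also have "\<dots> \<le> ennreal (1/c) * ennreal c"
      using B[OF w w1] c0 c by (intro mult_left_mono) auto
    also have "\<dots> = 1" using c by (simp flip: ennreal_mult)
    finally show False using gt by simp
  qed
  then have le: "enorm N (\<lambda>x. ennreal (G k x)) \<le> B" for k
    using enorm_ennreal[of "G k"] G(2) by simp
  have sup: "(SUP k. ennreal (G k x)) = F x" for x
  proof (rule antisym)
    show "(SUP k. ennreal (G k x)) \<le> F x" by (intro SUP_least) (simp add: G(1))
    show "F x \<le> (SUP k. ennreal (G k x))"
    proof (cases "F x")
      case (real r)
      obtain k :: nat where "r \<le> real k" using real_arch_simple by blast
      then show ?thesis using real by (intro SUP_upper2[of k]) (auto simp: G(1) ennreal_leI)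
    next
      case top
      then show ?thesis by (simp add: G(1) ennreal_SUP_of_nat_eq_top flip: ennreal_of_nat_eq_real_of_nat)
    qed
  qed
  have "enorm N F = enorm N (\<lambda>x. SUP k. ennreal (G k x))" by (simp add: sup)
  also have "\<dots> \<le> (SUP k. enorm N (\<lambda>x. ennreal (G k x)))"
    by (rule enorm_SUP_le) (auto simp: incseq_def le_fun_def G(1) intro!: min.coboundedI2 ennreal_leI)
  also have "\<dots> \<le> B" by (intro SUP_least le)
  finally show ?thesis .
qed

end

section \<open>Kernel bound and measurability in the form used for level functions\<close>

lemma dist_kernel_maximal_bound_ennreal:
  fixes w :: "'a::euclidean_space \<Rightarrow> real"
  assumes g: "\<gamma> \<noteq> 0"
  obtains K :: real where "0 < K"
    "\<And>w (y::'a) T. w \<in> borel_measurable lebesgue \<Longrightarrow> T < \<infinity> \<Longrightarrow>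
      (\<integral>\<^sup>+ x. indicator {x. ennreal (dist x y powr \<gamma>) < T} x * ennreal (dist x y powr (\<gamma> - real DIM('a)) * \<bar>w x\<bar>) \<partial>lebesgue)
        \<le> ennreal K * (T * maximal_op w y)"
proof -
  let ?K = "2 powr \<bar>\<gamma> - real DIM('a)\<bar> * unit_ball_vol (real DIM('a)) * 2 ^ DIM('a) / (1 - 2 powr (- \<bar>\<gamma>\<bar>))"
  have K: "0 < ?K"
    using g powr_less_mono[of "- \<bar>\<gamma>\<bar>" 0 2] by (intro divide_pos_pos mult_pos_pos) auto
  show thesis
  proof (rule that[OF K])
    fix w :: "'a \<Rightarrow> real" and y :: 'a and T :: ennreal
    assume w: "w \<in> borel_measurable lebesgue" and "T < \<infinity>"
    then obtain t where t: "0 \<le> t" "T = ennreal t" by (cases T) auto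
    show "(\<integral>\<^sup>+ x. indicator {x. ennreal (dist x y powr \<gamma>) < T} x * ennreal (dist x y powr (\<gamma> - real DIM('a)) * \<bar>w x\<bar>) \<partial>lebesgue)
        \<le> ennreal ?K * (T * maximal_op w y)"
    proof (cases "t = 0")
      case True
      then show ?thesis using t by simp
    next
      case False
      have "(\<integral>\<^sup>+ x. indicator {x. ennreal (dist x y powr \<gamma>) < T} x * ennreal (dist x y powr (\<gamma> - real DIM('a)) * \<bar>w x\<bar>) \<partial>lebesgue)
        = (\<integral>\<^sup>+ x\<in>{x. dist x y powr \<gamma> < t}. ennreal (dist x y powr (\<gamma> - real DIM('a)) * \<bar>w x\<bar>) \<partial>lebesgue)"
          using t by (intro nn_integral_cong) (auto simp: indicator_def ennreal_less_iff)
      also have "\<dots> \<le> ennreal ?K * (ennreal t * maximal_op w y)"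
        using False t by (intro dist_kernel_maximal_bound w g) auto
      finally show ?thesis using t by simp
    qed
  qed
qed

lemma enn_powr_cmult: "0 \<le> c \<Longrightarrow> 0 < q \<Longrightarrow> enn_powr (ennreal c * a) q = ennreal (c powr q) * enn_powr a q"
  by (simp add: enn_powr_mult enn_powr_ennreal)

lemma level_integrand_measurable:
  fixes f :: "'a::euclidean_space \<Rightarrow> real"
  assumes op: "open \<Omega>" and f: "(\<lambda>x. if x \<in> \<Omega> then f x else 0) \<in> borel_measurable lebesgue"
  shows "(\<lambda>(x, y). indicator (E_set \<Omega> f lam \<beta>) (x, y) * ennreal (dist x y powr q) * indicator \<Omega> y)
    \<in> borel_measurable (lebesgue \<Otimes>\<^sub>M lebesgue)"
proof -
  define f0 where "f0 x = (if x \<in> \<Omega> then f x else 0)" for x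
  have [measurable]: "f0 \<in> borel_measurable lebesgue" using f unfolding f0_def .
  have [measurable]: "\<Omega> \<in> sets lebesgue" using op by simp
  let ?X = "\<lambda>z. if fst z \<in> \<Omega> \<and> snd z \<in> \<Omega> \<and> fst z \<noteq> snd z \<and> \<bar>f0 (fst z) - f0 (snd z)\<bar> > lam * dist (fst z) (snd z) powr (1 + \<beta>) then 1 else 0 :: ennreal"
  have "(\<lambda>z. (?X z)
      * ennreal (dist (fst z) (snd z) powr q)) \<in> borel_measurable (lebesgue \<Otimes>\<^sub>M lebesgue)"
        by measurable
  also have "(\<lambda>z. (?X z)
      * ennreal (dist (fst z) (snd z) powr q))
     = (\<lambda>(x, y). indicator (E_set \<Omega> f lam \<beta>) (x, y) * ennreal (dist x y powr q) * indicator \<Omega> y)"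
       by (auto simp: fun_eq_iff E_set_def f0_def indicator_def)
  finally show ?thesis .
qed

lemma level_fun_eq:
  "level_fun \<Omega> f p \<gamma> lam x = enn_powr (\<integral>\<^sup>+ y. indicator (E_set \<Omega> f lam (\<gamma> / p)) (x, y)
     * ennreal (dist x y powr (\<gamma> - real DIM('a))) * indicator \<Omega> y \<partial>lebesgue) (1 / p)" for x :: "'a::euclidean_space"
proof (cases "x \<in> \<Omega>")
  case False
  then have "(x, y) \<notin> E_set \<Omega> f lam (\<gamma> / p)" for y by (simp add: E_set_def)
  then show ?thesis using False by (simp add: level_fun_def)
qed (simp add: level_fun_def)

lemma level_fun_measurable:
  fixes f :: "'a::euclidean_space \<Rightarrow> real"
  assumes "open \<Omega>" "(\<lambda>x. if x \<in> \<Omega> then f x else 0) \<in> borel_measurable lebesgue"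
  shows "level_fun \<Omega> f p \<gamma> lam \<in> borel_measurable lebesgue"
  unfolding level_fun_eq[abs_def]
  using lebesgue.borel_measurable_nn_integral_fst[OF level_integrand_measurable[OF assms]]
  by (intro enn_powr_measurable) simp

subsection \<open>Convexification\<close>

text \<open>\<open>N\<close> is the norm of X and \<open>convexification p N\<close> that of
  X^{1/p}. Both are kept side by side because a level function is the p-th root of an integral over
  \<open>y\<close>: triangle inequality and duality act on the integral itself, which lives in the
  convexification.\<close>

locale convexified_bbfs = X: bbfs N + Y: bbfs "convexification p N"
  for N :: "('a::euclidean_space \<Rightarrow> real) \<Rightarrow> ennreal" and p :: real +
  assumes p: "1 \<le> p"
    and maximal_dual: "maximal_bounded_on (associate_norm (convexification p N))"
    and maximal_self: "p = 1 \<Longrightarrow> maximal_bounded_on N"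
begin

abbreviation "NY \<equiv> convexification p N"

lemma p0: "0 < p" "0 < 1 / p" using p by auto

lemma enorm_NY:
  assumes [measurable]: "F \<in> borel_measurable lebesgue"
  shows "enorm NY F = enn_powr (enorm N (\<lambda>x. enn_powr (F x) (1 / p))) p"
  by (simp add: enorm_def convexification_def infinity_ennreal_def)

lemma enorm_NY_powr:
  assumes [measurable]: "G \<in> borel_measurable lebesgue"
  shows "enorm NY (\<lambda>x. enn_powr (G x) p) = enn_powr (enorm N G) p"
  using p0 by (simp add: enorm_NY)

lemma enorm_root:
  assumes [measurable]: "F \<in> borel_measurable lebesgue"
  shows "enorm N (\<lambda>x. enn_powr (F x) (1 / p)) = enn_powr (enorm NY F) (1 / p)"
  using p0 by (simp add: enorm_NY)

lemma maximal_dual_bound: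
  obtains C :: real where "0 \<le> C"
    "\<And>w. w \<in> borel_measurable lebesgue \<Longrightarrow> associate_norm NY w \<le> 1 \<Longrightarrow>
       (AE x in lebesgue. maximal_op w x < \<infinity>) \<and> associate_norm NY (\<lambda>x. enn2real (maximal_op w x)) \<le> ennreal C"
proof -
  obtain C :: real where C: "\<And>f. f \<in> borel_measurable lebesgue \<Longrightarrow> associate_norm NY f < \<infinity> \<Longrightarrow>
        (AE x in lebesgue. maximal_op f x < \<infinity>) \<and>
        associate_norm NY (\<lambda>x. enn2real (maximal_op f x)) \<le> ennreal C * associate_norm NY f"
          using maximal_dual unfolding maximal_bounded_on_def by blast
  show thesis
  proof (rule that[of "max 0 C"])
    fix w :: "'a \<Rightarrow> real" assume w: "w \<in> borel_measurable lebesgue" "associate_norm NY w \<le> 1"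
    then have lt: "associate_norm NY w < \<infinity>" by (metis ennreal_one_less_top infinity_ennreal_def order_le_less_trans)
    have "ennreal C * associate_norm NY w \<le> ennreal (max 0 C) * 1"
      using w(2) by (intro mult_mono ennreal_leI) auto
    then show "(AE x in lebesgue. maximal_op w x < \<infinity>) \<and> associate_norm NY (\<lambda>x. enn2real (maximal_op w x)) \<le> ennreal (max 0 C)"
      using C[OF w(1) lt] by auto
  qed simp
qed

lemma dual_pairing:
  assumes [measurable]: "F \<in> borel_measurable lebesgue" "G \<in> borel_measurable lebesgue"
    and fin: "enorm NY F < \<infinity>" and G: "AE x in lebesgue. G x < \<infinity>" and C: "associate_norm NY (\<lambda>x. enn2real (G x)) \<le> C"
  shows "(\<integral>\<^sup>+ x. F x * G x \<partial>lebesgue) \<le> enorm NY F * C"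
  using Y.Hoelder_enorm[OF assms(1,2) fin G] C by (meson mult_left_mono order_trans zero_le)

text \<open>For \<open>p = 1\<close> this is hypothesis (iv). For \<open>1 < p\<close> the p-th
  power of the maximal function is paired with \<open>w\<close> in the associate unit ball; the
  Fefferman-Stein inequality moves the maximal operator onto \<open>w\<close>, where hypothesis
  (iii) bounds it. Its constant degenerates as p tends to 1, hence the case distinction.\<close>

lemma maximal_op_bounded:
  obtains C :: real where "0 \<le> C"
    "\<And>g. g \<in> borel_measurable lebesgue \<Longrightarrow> N g < \<infinity> \<Longrightarrow> enorm N (maximal_op g) \<le> ennreal C * N g"
proof (cases "p = 1")
  case True
  then obtain C :: real where C: "\<And>f. f \<in> borel_measurable lebesgue \<Longrightarrow> N f < \<infinity> \<Longrightarrow>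
        (AE x in lebesgue. maximal_op f x < \<infinity>) \<and> N (\<lambda>x. enn2real (maximal_op f x)) \<le> ennreal C * N f"
    using maximal_self unfolding maximal_bounded_on_def by blast
  show thesis
  proof (rule that[of "max 0 C"])
    fix g :: "'a \<Rightarrow> real" assume g: "g \<in> borel_measurable lebesgue" "N g < \<infinity>"
    then have "AE x in lebesgue. maximal_op g x < \<infinity>" using C by blast
    then have "AE x in lebesgue. maximal_op g x \<noteq> \<infinity>" by eventually_elim auto
    then have "enorm N (maximal_op g) = N (\<lambda>x. enn2real (maximal_op g x))" by (rule X.enorm_eq)
    also have "\<dots> \<le> ennreal C * N g" using C g by blast
    also have "\<dots> \<le> ennreal (max 0 C) * N g" by (intro mult_right_mono ennreal_leI) auto
    finally show "enorm N (maximal_op g) \<le> ennreal (max 0 C) * N g" .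
  qed simp
next
  case False
  then have p1: "1 < p" using p by simp
  obtain CM :: real where CM: "0 \<le> CM"
    "\<And>w. w \<in> borel_measurable lebesgue \<Longrightarrow> associate_norm NY w \<le> 1 \<Longrightarrow>
       (AE x in lebesgue. maximal_op w x < \<infinity>) \<and> associate_norm NY (\<lambda>x. enn2real (maximal_op w x)) \<le> ennreal CM"
    using maximal_dual_bound by blast
  define K where "K = 5 ^ DIM('a) * 2 * p / (p - 1) * 2 powr (p - 1)"
  have K0: "0 \<le> K" using p1 by (simp add: K_def)
  show thesis
  proof (rule that[of "(K * CM) powr (1 / p)"])
    fix g :: "'a \<Rightarrow> real" assume g[measurable]: "g \<in> borel_measurable lebesgue" and Ng: "N g < \<infinity>"
    have gp: "enorm NY (\<lambda>x. ennreal (\<bar>g x\<bar> powr p)) = enn_powr (N g) p"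
      using enorm_NY_powr[of "\<lambda>x. ennreal \<bar>g x\<bar>"] by (simp add: X.enorm_ennreal enn_powr_ennreal)
    have "enorm NY (\<lambda>x. enn_powr (maximal_op g x) p) \<le> ennreal (K * CM) * enn_powr (N g) p"
    proof (rule Y.Lorentz_Luxemburg)
      fix w :: "'a \<Rightarrow> real" assume w[measurable]: "w \<in> borel_measurable lebesgue" and w1: "associate_norm NY w \<le> 1"
      have "(\<integral>\<^sup>+ x. enn_powr (maximal_op g x) p * ennreal \<bar>w x\<bar> \<partial>lebesgue)
        \<le> ennreal K * (\<integral>\<^sup>+ x. ennreal (\<bar>g x\<bar> powr p) * maximal_op w x \<partial>lebesgue)"
        unfolding K_def by (rule Fefferman_Stein[OF g w p1])
      also have "(\<integral>\<^sup>+ x. ennreal (\<bar>g x\<bar> powr p) * maximal_op w x \<partial>lebesgue) \<le> enn_powr (N g) p * ennreal CM"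
        unfolding gp[symmetric] using CM(2)[OF w w1] Ng
        by (intro dual_pairing) (auto simp: gp less_top[symmetric])
      also have "ennreal K * (enn_powr (N g) p * ennreal CM) = ennreal (K * CM) * enn_powr (N g) p"
        using K0 CM by (simp add: ennreal_mult mult_ac)
      finally show "(\<integral>\<^sup>+ x. enn_powr (maximal_op g x) p * ennreal \<bar>w x\<bar> \<partial>lebesgue) \<le> ennreal (K * CM) * enn_powr (N g) p"
        by (simp add: mult_left_mono)
    qed measurable
    then have "enn_powr (enorm N (maximal_op g)) p \<le> ennreal (K * CM) * enn_powr (N g) p"
      by (simp add: enorm_NY_powr)
    also have "\<dots> = enn_powr (ennreal ((K * CM) powr (1 / p)) * N g) p"
      using p0 K0 CM by (simp add: enn_powr_cmult powr_powr)
    finally show "enorm N (maximal_op g) \<le> ennreal ((K * CM) powr (1 / p)) * N g"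
      using p0 by (simp add: enn_powr_le_iff)
  qed simp
qed

subsection \<open>The upper bound\<close>

text \<open>Isolates what the upper estimate takes from the domain: a pointwise inequality by
  maximal functions outside a null set. In the constant, the summand 1 of \<open>1 + CM\<close>
  stems from the half of the level set controlled at \<open>x\<close>, and \<open>CM\<close> from
  the half controlled at \<open>y\<close>.\<close>

lemma level_fun_upper_bound:
  assumes g: "\<gamma> \<noteq> 0" and op: "open \<Omega>"
  obtains A :: real where "0 \<le> A"
    "\<And>f g lam c. (\<lambda>x. if x \<in> \<Omega> then f x else 0) \<in> borel_measurable lebesgue \<Longrightarrow> g \<in> borel_measurable lebesgue \<Longrightarrow>
       N g < \<infinity> \<Longrightarrow> 0 < c \<Longrightarrow> 0 < lam \<Longrightarrow>
       (\<exists>Z. (AE x in lebesgue. x \<in> Z) \<and> (\<forall>x\<in>Z\<inter>\<Omega>. \<forall>y\<in>Z\<inter>\<Omega>.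
           ennreal \<bar>f x - f y\<bar> \<le> ennreal (c * dist x y) * (maximal_op g x + maximal_op g y))) \<Longrightarrow>
       ennreal lam * enorm N (level_fun \<Omega> f p \<gamma> lam) \<le> ennreal (A * c) * N g"
proof -
  obtain K :: real where K: "0 < K"
    "\<And>w (y::'a) T. w \<in> borel_measurable lebesgue \<Longrightarrow> T < \<infinity> \<Longrightarrow>
      (\<integral>\<^sup>+ x. indicator {x. ennreal (dist x y powr \<gamma>) < T} x * ennreal (dist x y powr (\<gamma> - real DIM('a)) * \<bar>w x\<bar>) \<partial>lebesgue)
        \<le> ennreal K * (T * maximal_op w y)"
    using dist_kernel_maximal_bound_ennreal[OF g] by blast
  obtain CM :: real where CM: "0 \<le> CM"
    "\<And>w. w \<in> borel_measurable lebesgue \<Longrightarrow> associate_norm NY w \<le> 1 \<Longrightarrow>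
       (AE x in lebesgue. maximal_op w x < \<infinity>) \<and> associate_norm NY (\<lambda>x. enn2real (maximal_op w x)) \<le> ennreal CM"
    using maximal_dual_bound by blast
  obtain CX :: real where CX: "0 \<le> CX"
    "\<And>g. g \<in> borel_measurable lebesgue \<Longrightarrow> N g < \<infinity> \<Longrightarrow> enorm N (maximal_op g) \<le> ennreal CX * N g"
    using maximal_op_bounded by blast
  let ?n = "real DIM('a)"
  show thesis
  proof (rule that[of "(K * (1 + CM)) powr (1 / p) * 2 * CX"])
    show "0 \<le> (K * (1 + CM)) powr (1 / p) * 2 * CX" using CX by simp
    fix f g :: "'a \<Rightarrow> real" and lam c :: real
    assume f: "(\<lambda>x. if x \<in> \<Omega> then f x else 0) \<in> borel_measurable lebesgue"
      and gm[measurable]: "g \<in> borel_measurable lebesgue" and Ng: "N g < \<infinity>" and c: "0 < c" and lam: "0 < lam"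
      and "\<exists>Z. (AE x in lebesgue. x \<in> Z) \<and> (\<forall>x\<in>Z\<inter>\<Omega>. \<forall>y\<in>Z\<inter>\<Omega>.
           ennreal \<bar>f x - f y\<bar> \<le> ennreal (c * dist x y) * (maximal_op g x + maximal_op g y))"
    then obtain Z where Z: "AE x in lebesgue. x \<in> Z"
      "\<And>x y. x \<in> Z \<Longrightarrow> x \<in> \<Omega> \<Longrightarrow> y \<in> Z \<Longrightarrow> y \<in> \<Omega> \<Longrightarrow>
        ennreal \<bar>f x - f y\<bar> \<le> ennreal (c * dist x y) * (maximal_op g x + maximal_op g y)" by blast
    have [measurable]: "\<Omega> \<in> sets lebesgue" using op by simp
    \<comment> \<open>The threshold for \<open>dist x y powr \<gamma>\<close>: on the level set, the
      larger of the two maximal functions exceeds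
      \<open>lam / (2 * c) * dist x y powr (\<gamma> / p)\<close>.\<close>
    define H where "H x = enn_powr (ennreal (2 * c / lam) * maximal_op g x) p" for x
    have H[measurable]: "H \<in> borel_measurable lebesgue" unfolding H_def by measurable
    have NM: "enorm N (maximal_op g) \<le> ennreal CX * N g" by (rule CX(2)[OF gm Ng])
    have NH: "enorm NY H \<le> enn_powr (ennreal (2 * c / lam * CX) * N g) p"
    proof -
      have "enorm NY H = enn_powr (enorm N (\<lambda>x. ennreal (2 * c / lam) * maximal_op g x)) p"
        unfolding H_def by (rule enorm_NY_powr) measurable
      also have "\<dots> = enn_powr (ennreal (2 * c / lam) * enorm N (maximal_op g)) p"
        using c lam by (subst X.enorm_cmult) auto
      also have "\<dots> \<le> enn_powr (ennreal (2 * c / lam) * (ennreal CX * N g)) p"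
        using p0 by (intro enn_powr_mono mult_left_mono NM) auto
      also have "ennreal (2 * c / lam) * (ennreal CX * N g) = ennreal (2 * c / lam * CX) * N g"
        using c lam by (subst ennreal_mult[OF _ CX(1)]) (auto simp: mult.assoc)
      finally show ?thesis .
    qed
    have NHfin: "enorm NY H < \<infinity>"
    proof -
      have "ennreal (2 * c / lam * CX) * N g < top" using Ng by (simp add: ennreal_mult_less_top)
      then have "enn_powr (ennreal (2 * c / lam * CX) * N g) p < top" by (simp add: less_top[symmetric])
      then show ?thesis using NH by (simp add: order_le_less_trans)
    qed
    have Hfin: "AE x in lebesgue. H x < \<infinity>"
      using NHfin by (auto simp: enorm_def less_top split: if_splits)
    define I where "I x = (\<integral>\<^sup>+ y. indicator (E_set \<Omega> f lam (\<gamma> / p)) (x, y)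
     * ennreal (dist x y powr (\<gamma> - ?n)) * indicator \<Omega> y \<partial>lebesgue)" for x
    have I[measurable]: "I \<in> borel_measurable lebesgue"
      unfolding I_def using lebesgue.borel_measurable_nn_integral_fst[OF level_integrand_measurable[OF op f]] by simp
    have key: "ennreal (dist x y powr \<gamma>) < H x \<or> ennreal (dist x y powr \<gamma>) < H y"
      if xy: "x \<in> Z" "y \<in> Z" "(x, y) \<in> E_set \<Omega> f lam (\<gamma> / p)" for x y
    proof -
      have E: "x \<in> \<Omega>" "y \<in> \<Omega>" "x \<noteq> y" "lam * dist x y powr (1 + \<gamma> / p) < \<bar>f x - f y\<bar>"
        using xy(3) by (auto simp: E_set_def)
      let ?d = "dist x y"
      have d: "0 < ?d" using E by simp
      define m where "m = max (maximal_op g x) (maximal_op g y)"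
      have "ennreal (lam * ?d powr (1 + \<gamma> / p)) < ennreal \<bar>f x - f y\<bar>"
        using E(4) lam by (simp add: ennreal_less_iff)
      also have "\<dots> \<le> ennreal (c * ?d) * (maximal_op g x + maximal_op g y)" by (rule Z(2)) (use xy E in auto)
      also have "\<dots> \<le> ennreal (c * ?d) * (m + m)"
        by (intro mult_left_mono add_mono) (auto simp: m_def)
      also have "\<dots> = ennreal (2 * c * ?d) * m"
      proof -
        have "ennreal (2 * c * ?d) = ennreal (c * ?d) + ennreal (c * ?d)" using c by (simp flip: ennreal_plus)
        then show ?thesis by (simp add: distrib_left distrib_right)
      qed
      finally have lt: "ennreal (lam * ?d powr (1 + \<gamma> / p)) < ennreal (2 * c * ?d) * m" .
      have "ennreal (?d powr (\<gamma> / p)) < ennreal (2 * c / lam) * m"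
      proof (rule ccontr)
        assume "\<not> ennreal (?d powr (\<gamma> / p)) < ennreal (2 * c / lam) * m"
        then have "ennreal (lam * ?d) * (ennreal (2 * c / lam) * m) \<le> ennreal (lam * ?d) * ennreal (?d powr (\<gamma> / p))"
          by (intro mult_left_mono) auto
        also have "\<dots> = ennreal (lam * ?d powr (1 + \<gamma> / p))"
          using lam d by (simp add: powr_add mult.assoc flip: ennreal_mult)
        also have "ennreal (lam * ?d) * (ennreal (2 * c / lam) * m) = ennreal (2 * c * ?d) * m"
        proof -
          show ?thesis using lam d c by (simp add: field_simps flip: ennreal_mult)
        qed
        finally show False using lt by simp
      qed
      then have "enn_powr (ennreal (?d powr (\<gamma> / p))) p < enn_powr (ennreal (2 * c / lam) * m) p"
        using p0 by (simp add: enn_powr_less_iff)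
      moreover have "enn_powr (ennreal (?d powr (\<gamma> / p))) p = ennreal (?d powr \<gamma>)"
        using p0 by (simp add: enn_powr_ennreal powr_powr)
      ultimately show ?thesis by (auto simp: H_def m_def max_def split: if_splits)
    qed
    \<comment> \<open>The half of the level set whose condition sits at \<open>y\<close>. Fubini's
      theorem makes \<open>x\<close> the inner variable, the kernel bound then produces
      \<open>maximal_op w y\<close>, and this is where (iii) enters.\<close>
    define F where "F w x y = indicator {y. ennreal (dist x y powr \<gamma>) < H y} y * ennreal (dist x y powr (\<gamma> - ?n) * \<bar>w x\<bar>)"
      for w :: "'a \<Rightarrow> real" and x y :: 'a
    have "enorm NY I \<le> ennreal (K * (1 + CM)) * enn_powr (ennreal (2 * c / lam * CX) * N g) p"
    proof (rule Y.Lorentz_Luxemburg[OF I])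
      fix w :: "'a \<Rightarrow> real" assume w[measurable]: "w \<in> borel_measurable lebesgue" and w1: "associate_norm NY w \<le> 1"
      have Mw: "AE x in lebesgue. maximal_op w x < \<infinity>" "associate_norm NY (\<lambda>x. enn2real (maximal_op w x)) \<le> ennreal CM"
        using CM(2)[OF w w1] by auto
      have Fm: "(\<lambda>(x, y). F w x y) \<in> borel_measurable (lebesgue \<Otimes>\<^sub>M lebesgue)"
      proof -
        show ?thesis by (simp add: F_def case_prod_beta indicator_def of_bool_def)
      qed
      have Fx: "F w x \<in> borel_measurable lebesgue" for x
        using measurable_Pair2[OF Fm, of x] by (simp add: comp_def)
      \<comment> \<open>By \<open>key\<close> each pair is charged either to \<open>H x\<close> or
        to \<open>H y\<close>. In the first case the kernel is integrated over \<open>y\<close> with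
        weight 1, whose maximal function is at most 1.\<close>
      have pt: "AE x in lebesgue. I x * ennreal \<bar>w x\<bar> \<le> ennreal K * (H x * ennreal \<bar>w x\<bar>) + (\<integral>\<^sup>+ y. F w x y \<partial>lebesgue)"
        using Z(1) Hfin
      proof eventually_elim
        fix x assume x: "x \<in> Z" "H x < \<infinity>"
        have Em: "(\<lambda>y. indicator (E_set \<Omega> f lam (\<gamma> / p)) (x, y) * ennreal (dist x y powr (\<gamma> - ?n)) * indicator \<Omega> y) \<in> borel_measurable lebesgue"
          using measurable_Pair2[OF level_integrand_measurable[OF op f], of x] by (simp add: comp_def)
        have Gm: "(\<lambda>y. indicator {y. ennreal (dist y x powr \<gamma>) < H x} y * ennreal (dist y x powr (\<gamma> - ?n) * \<bar>1\<bar>)) \<in> borel_measurable lebesgue"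
          by measurable
        have "I x * ennreal \<bar>w x\<bar> = (\<integral>\<^sup>+ y. indicator (E_set \<Omega> f lam (\<gamma> / p)) (x, y)
             * ennreal (dist x y powr (\<gamma> - ?n)) * indicator \<Omega> y * ennreal \<bar>w x\<bar> \<partial>lebesgue)"
               unfolding I_def by (rule nn_integral_multc[symmetric, OF Em])
        also have "\<dots> \<le> (\<integral>\<^sup>+ y. (indicator {y. ennreal (dist y x powr \<gamma>) < H x} y * ennreal (dist y x powr (\<gamma> - ?n) * \<bar>1\<bar>)) * ennreal \<bar>w x\<bar>
              + F w x y \<partial>lebesgue)"
        proof (rule nn_integral_mono_AE)
          show "AE y in lebesgue. indicator (E_set \<Omega> f lam (\<gamma> / p)) (x, y)
             * ennreal (dist x y powr (\<gamma> - ?n)) * indicator \<Omega> y * ennreal \<bar>w x\<bar>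
              \<le> (indicator {y. ennreal (dist y x powr \<gamma>) < H x} y * ennreal (dist y x powr (\<gamma> - ?n) * \<bar>1\<bar>)) * ennreal \<bar>w x\<bar> + F w x y"
            using Z(1)
          proof eventually_elim
            fix y assume y: "y \<in> Z"
            show "indicator (E_set \<Omega> f lam (\<gamma> / p)) (x, y)
             * ennreal (dist x y powr (\<gamma> - ?n)) * indicator \<Omega> y * ennreal \<bar>w x\<bar>
              \<le> (indicator {y. ennreal (dist y x powr \<gamma>) < H x} y * ennreal (dist y x powr (\<gamma> - ?n) * \<bar>1\<bar>)) * ennreal \<bar>w x\<bar> + F w x y"
            proof (cases "(x, y) \<in> E_set \<Omega> f lam (\<gamma> / p)")
              case True
              then have y\<Omega>: "y \<in> \<Omega>" by (simp add: E_set_def)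
              have eq: "ennreal (dist x y powr (\<gamma> - ?n) * \<bar>w x\<bar>) = ennreal (dist x y powr (\<gamma> - ?n)) * ennreal \<bar>w x\<bar>"
                by (simp add: ennreal_mult)
              show ?thesis using key[OF x(1) y True] True y\<Omega>
                by (auto simp: F_def eq dist_commute[of y x] indicator_def add_increasing add_increasing2)
            qed simp
          qed
        qed
        also have "\<dots> = (\<integral>\<^sup>+ y. (indicator {y. ennreal (dist y x powr \<gamma>) < H x} y * ennreal (dist y x powr (\<gamma> - ?n) * \<bar>1\<bar>)) * ennreal \<bar>w x\<bar> \<partial>lebesgue)
              + (\<integral>\<^sup>+ y. F w x y \<partial>lebesgue)"
                by (rule nn_integral_add[OF borel_measurable_times_ennreal[OF Gm] Fx]) simp
        also have "(\<integral>\<^sup>+ y. (indicator {y. ennreal (dist y x powr \<gamma>) < H x} y * ennreal (dist y x powr (\<gamma> - ?n) * \<bar>1\<bar>)) * ennreal \<bar>w x\<bar> \<partial>lebesgue)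
            = (\<integral>\<^sup>+ y. indicator {y. ennreal (dist y x powr \<gamma>) < H x} y * ennreal (dist y x powr (\<gamma> - ?n) * \<bar>1\<bar>) \<partial>lebesgue) * ennreal \<bar>w x\<bar>"
              by (rule nn_integral_multc[OF Gm])
        also have "\<dots> \<le> (ennreal K * (H x * maximal_op (\<lambda>x. 1) x)) * ennreal \<bar>w x\<bar>"
          using x by (intro mult_right_mono K(2)) auto
        also have "\<dots> \<le> (ennreal K * (H x * 1)) * ennreal \<bar>w x\<bar>"
          by (intro mult_right_mono mult_left_mono maximal_op_const_le) auto
        finally show "I x * ennreal \<bar>w x\<bar> \<le> ennreal K * (H x * ennreal \<bar>w x\<bar>) + (\<integral>\<^sup>+ y. F w x y \<partial>lebesgue)"
          by (simp add: mult.assoc)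
      qed
      have Hw: "(\<integral>\<^sup>+ x. H x * ennreal \<bar>w x\<bar> \<partial>lebesgue) \<le> enorm NY H * 1"
        using Y.Hoelder_enorm[OF H, of "\<lambda>x. ennreal \<bar>w x\<bar>"] NHfin w1
      proof -
        have "associate_norm NY (\<lambda>x. enn2real (ennreal \<bar>w x\<bar>)) = associate_norm NY w"
          unfolding associate_norm_def by (simp add: abs_mult)
        then show ?thesis using w1 NHfin by (intro dual_pairing) auto
      qed
      have HMw: "(\<integral>\<^sup>+ x. H x * maximal_op w x \<partial>lebesgue) \<le> enorm NY H * ennreal CM"
        by (rule dual_pairing[OF H _ NHfin Mw]) measurable
      have "(\<integral>\<^sup>+ x. (\<integral>\<^sup>+ y. F w x y \<partial>lebesgue) \<partial>lebesgue) = (\<integral>\<^sup>+ y. (\<integral>\<^sup>+ x. F w x y \<partial>lebesgue) \<partial>lebesgue)"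
        using lebesgue_pair.Fubini[OF Fm] by simp
      also have "\<dots> \<le> (\<integral>\<^sup>+ y. ennreal K * (H y * maximal_op w y) \<partial>lebesgue)"
      proof (rule nn_integral_mono_AE)
        show "AE y in lebesgue. (\<integral>\<^sup>+ x. F w x y \<partial>lebesgue) \<le> ennreal K * (H y * maximal_op w y)"
          using Hfin
        proof eventually_elim
          fix y assume y: "H y < \<infinity>"
          have "(\<integral>\<^sup>+ x. F w x y \<partial>lebesgue) = (\<integral>\<^sup>+ x. indicator {x. ennreal (dist x y powr \<gamma>) < H y} x * ennreal (dist x y powr (\<gamma> - ?n) * \<bar>w x\<bar>) \<partial>lebesgue)"
            by (intro nn_integral_cong) (simp add: F_def indicator_def)
          also have "\<dots> \<le> ennreal K * (H y * maximal_op w y)" by (rule K(2)[OF w y])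
          finally show "(\<integral>\<^sup>+ x. F w x y \<partial>lebesgue) \<le> ennreal K * (H y * maximal_op w y)" .
        qed
      qed
      also have "\<dots> = ennreal K * (\<integral>\<^sup>+ y. H y * maximal_op w y \<partial>lebesgue)"
        by (rule nn_integral_cmult) measurable
      finally have FF: "(\<integral>\<^sup>+ x. (\<integral>\<^sup>+ y. F w x y \<partial>lebesgue) \<partial>lebesgue) \<le> ennreal K * (enorm NY H * ennreal CM)"
        using HMw by (meson mult_left_mono order_trans zero_le)
      have "(\<integral>\<^sup>+ x. I x * ennreal \<bar>w x\<bar> \<partial>lebesgue)
        \<le> (\<integral>\<^sup>+ x. ennreal K * (H x * ennreal \<bar>w x\<bar>) + (\<integral>\<^sup>+ y. F w x y \<partial>lebesgue) \<partial>lebesgue)"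
        by (rule nn_integral_mono_AE[OF pt])
      also have "\<dots> = (\<integral>\<^sup>+ x. ennreal K * (H x * ennreal \<bar>w x\<bar>) \<partial>lebesgue) + (\<integral>\<^sup>+ x. (\<integral>\<^sup>+ y. F w x y \<partial>lebesgue) \<partial>lebesgue)"
        using lebesgue.borel_measurable_nn_integral[OF Fm] by (intro nn_integral_add) auto
      also have "\<dots> \<le> ennreal K * (enorm NY H * 1) + ennreal K * (enorm NY H * ennreal CM)"
      proof (rule add_mono[OF _ FF])
        have "(\<integral>\<^sup>+ x. ennreal K * (H x * ennreal \<bar>w x\<bar>) \<partial>lebesgue) = ennreal K * (\<integral>\<^sup>+ x. H x * ennreal \<bar>w x\<bar> \<partial>lebesgue)"
          by (rule nn_integral_cmult) measurable
        then show "(\<integral>\<^sup>+ x. ennreal K * (H x * ennreal \<bar>w x\<bar>) \<partial>lebesgue) \<le> ennreal K * (enorm NY H * 1)"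
          using Hw by (simp add: mult_left_mono)
      qed
      also have "\<dots> = ennreal (K * (1 + CM)) * enorm NY H"
      proof -
        have "ennreal (K * (1 + CM)) = ennreal K * (1 + ennreal CM)"
          using K CM by (simp add: ennreal_mult)
        then show ?thesis by (simp add: distrib_left distrib_right mult_ac)
      qed
      also have "\<dots> \<le> ennreal (K * (1 + CM)) * enn_powr (ennreal (2 * c / lam * CX) * N g) p"
        by (rule mult_left_mono[OF NH]) simp
      finally show "(\<integral>\<^sup>+ x. I x * ennreal \<bar>w x\<bar> \<partial>lebesgue) \<le> ennreal (K * (1 + CM)) * enn_powr (ennreal (2 * c / lam * CX) * N g) p" .
    qed
    also have "\<dots> = enn_powr (ennreal ((K * (1 + CM)) powr (1 / p) * (2 * c / lam * CX)) * N g) p"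
    proof -
      have *: "ennreal (K * (1 + CM)) = enn_powr (ennreal ((K * (1 + CM)) powr (1 / p))) p"
        using K CM p0 by (simp add: enn_powr_ennreal powr_powr)
      have e: "ennreal ((K * (1 + CM)) powr (1 / p) * (2 * c / lam * CX)) = ennreal ((K * (1 + CM)) powr (1 / p)) * ennreal (2 * c / lam * CX)"
        using CX c lam by (intro ennreal_mult) auto
      show ?thesis unfolding e mult.assoc[of "ennreal _"] * enn_powr_mult[OF p0(1)] ..
    qed
    finally have le: "enorm NY I \<le> enn_powr (ennreal ((K * (1 + CM)) powr (1 / p) * (2 * c / lam * CX)) * N g) p" .
    have "enorm N (level_fun \<Omega> f p \<gamma> lam) = enn_powr (enorm NY I) (1 / p)"
      unfolding level_fun_eq[abs_def] I_def[symmetric] by (rule enorm_root[OF I])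
    also have "\<dots> \<le> enn_powr (enn_powr (ennreal ((K * (1 + CM)) powr (1 / p) * (2 * c / lam * CX)) * N g) p) (1 / p)"
      using p0 by (intro enn_powr_mono le) auto
    also have "\<dots> = ennreal ((K * (1 + CM)) powr (1 / p) * (2 * c / lam * CX)) * N g" using p0 by simp
    finally have "ennreal lam * enorm N (level_fun \<Omega> f p \<gamma> lam) \<le> ennreal lam * (ennreal ((K * (1 + CM)) powr (1 / p) * (2 * c / lam * CX)) * N g)"
      by (rule mult_left_mono) simp
    also have "\<dots> = ennreal ((K * (1 + CM)) powr (1 / p) * 2 * CX * c) * N g"
      using lam CX c by (simp add: mult.assoc[symmetric] flip: ennreal_mult) (simp add: mult_ac)
    finally show "ennreal lam * enorm N (level_fun \<Omega> f p \<gamma> lam) \<le> ennreal ((K * (1 + CM)) powr (1 / p) * 2 * CX * c) * N g" .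
  qed
qed

end

subsection \<open>Chaining along a rectifiable curve\<close>

text \<open>A closed ball is connected, so it cannot leave \<open>\<Omega>\<close> without meeting
  the frontier. An empty frontier offers no such point, in agreement with the value \<infinity> of
  \<open>dist_boundary\<close> there.\<close>

lemma cball_subset_of_dist_boundary:
  fixes z :: "'a::euclidean_space"
  assumes "open \<Omega>" "z \<in> \<Omega>" and r: "0 \<le> r" and d: "ennreal d \<le> dist_boundary \<Omega> z" "r < d"
  shows "cball z r \<subseteq> \<Omega>"
proof (rule ccontr)
  assume "\<not> cball z r \<subseteq> \<Omega>"
  then have "cball z r - \<Omega> \<noteq> {}" by blast
  moreover have "z \<in> cball z r \<inter> \<Omega>" using assms by simp
  then have "cball z r \<inter> \<Omega> \<noteq> {}" by blast
  ultimately have "cball z r \<inter> frontier \<Omega> \<noteq> {}"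
    by (intro connected_Int_frontier) auto
  then obtain y where y: "y \<in> cball z r" "y \<in> frontier \<Omega>" by blast
  then have "infdist z (frontier \<Omega>) \<le> r" using infdist_le[OF y(2), of z] by simp
  moreover have "d \<le> infdist z (frontier \<Omega>)"
  proof -
    have "ennreal d \<le> ennreal (infdist z (frontier \<Omega>))" using d(1) y(2) by (auto simp: dist_boundary_def split: if_splits)
    then show ?thesis using d r infdist_nonneg by (subst (asm) ennreal_le_iff) auto
  qed
  ultimately show False using d by simp
qed

lemma sum_dist_le_curve_length:
  assumes u: "\<And>k. k \<le> n \<Longrightarrow> u k \<in> {0..1}" "\<And>k l. k \<le> l \<Longrightarrow> l \<le> n \<Longrightarrow> u k \<le> u l"
  shows "ennreal (\<Sum>k<n. dist (g (u k)) (g (u (Suc k)))) \<le> curve_length g"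
proof -
  let ?ts = "map u [0..<Suc n]"
  let ?X = "\<Sum>i<length ?ts - 1. ennreal (dist (g (?ts ! i)) (g (?ts ! Suc i)))"
  have "sorted ?ts" by (auto simp: sorted_iff_nth_mono nth_append u simp del: upt_Suc)
  moreover have "set ?ts \<subseteq> {0..1}" using u(1) by auto
  ultimately have "?X \<le> curve_length g" unfolding curve_length_def by (intro SUP_upper) auto
  also have "?X = (\<Sum>k<n. ennreal (dist (g (u k)) (g (u (Suc k)))))"
    by (intro sum.cong) (auto simp del: upt_Suc simp: nth_map)
  finally show ?thesis by (simp add: sum_ennreal)
qed

text \<open>Uniform continuity yields a partition with consecutive points closer than
  \<open>rmin / 4\<close>, so the local estimate applies to every step. The sum of the steps is the
  length of an inscribed polygon.\<close>

lemma chain_along_curve: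
  fixes g :: "real \<Rightarrow> 'a::euclidean_space"
  assumes g: "path g" and len: "curve_length g \<le> ennreal L" and L: "0 \<le> L"
    and st: "0 \<le> s" "s \<le> t" "t \<le> 1"
    and r: "\<And>u. s \<le> u \<Longrightarrow> u \<le> t \<Longrightarrow> rmin \<le> r (g u)" "0 < rmin"
    and step: "\<And>u v. s \<le> u \<Longrightarrow> u \<le> t \<Longrightarrow> s \<le> v \<Longrightarrow> v \<le> t \<Longrightarrow> dist (g u) (g v) \<le> r (g u) / 4 \<Longrightarrow>
        \<bar>A (g v) - A (g u)\<bar> \<le> c * dist (g u) (g v)" and c: "0 \<le> c"
  shows "\<bar>A (g t) - A (g s)\<bar> \<le> c * L"
proof -
  have "uniformly_continuous_on {0..1} g"
    using g compact_uniformly_continuous[of "{0..1}" g] by (simp add: path_def)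
  from this[unfolded uniformly_continuous_on_def, rule_format, of "rmin / 4"] r(2)
  obtain \<delta> where d': "0 < \<delta> \<and> (\<forall>u\<in>{0..1}. \<forall>v\<in>{0..1}. dist v u < \<delta> \<longrightarrow> dist (g v) (g u) < rmin / 4)"
    by auto
  note d = d'[THEN conjunct1] d'[THEN conjunct2, rule_format]
  obtain n :: nat where n: "(t - s) / \<delta> < real n" using reals_Archimedean2 by blast
  have n0: "0 < n"
  proof (rule ccontr)
    assume "\<not> 0 < n"
    then show False using n d(1) st by (simp add: divide_less_0_iff)
  qed
  define u where "u k = s + (t - s) * real k / real n" for k
  have u0: "u 0 = s" "u n = t" using n0 by (auto simp: u_def)
  have umono: "u k \<le> u l" if "k \<le> l" for k l
    using that st n0 by (auto simp: u_def divide_right_mono mult_left_mono)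
  have uin: "s \<le> u k" "u k \<le> t" if "k \<le> n" for k
    using umono[of 0 k] umono[of k n] that u0 by auto
  have u01: "u k \<in> {0..1}" if "k \<le> n" for k using uin[OF that] st by auto
  have ustep: "u (Suc k) - u k = (t - s) / real n" for k using n0 by (simp add: u_def field_simps)
  have small: "dist (g (u k)) (g (u (Suc k))) < rmin / 4" if "k < n" for k
  proof -
    have "\<bar>u (Suc k) - u k\<bar> < \<delta>"
      unfolding ustep using n n0 d(1) st by (simp add: field_simps)
    then show ?thesis using d(2)[of "u (Suc k)" "u k"] u01[of k] u01[of "Suc k"] that by (simp add: dist_real_def abs_minus_commute)
  qed
  let ?X = "\<Sum>k<n. dist (g (u k)) (g (u (Suc k)))"
  have "A (g t) - A (g s) = (\<Sum>k<n. A (g (u (Suc k))) - A (g (u k)))"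
    using sum_lessThan_telescope[of "\<lambda>k. A (g (u k))" n] u0 by simp
  also have "\<bar>\<dots>\<bar> \<le> (\<Sum>k<n. \<bar>A (g (u (Suc k))) - A (g (u k))\<bar>)" by (rule sum_abs)
  also have "\<dots> \<le> (\<Sum>k<n. c * dist (g (u k)) (g (u (Suc k))))"
  proof (rule sum_mono)
    fix k assume "k \<in> {..<n}"
    then have k: "k < n" by simp
    have "rmin \<le> r (g (u k))" using r(1) uin[of k] k by auto
    then show "\<bar>A (g (u (Suc k))) - A (g (u k))\<bar> \<le> c * dist (g (u k)) (g (u (Suc k)))"
      using small[OF k] uin[of k] uin[of "Suc k"] k by (intro step) auto
  qed
  also have "\<dots> = c * ?X" by (simp add: sum_distrib_left)
  also have "\<dots> \<le> c * L"
  proof (rule mult_left_mono[OF _ c])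
    have "ennreal ?X \<le> ennreal L"
      using sum_dist_le_curve_length[of n u g] u01 umono len by (meson order_trans)
    then show "?X \<le> L" using L by (simp add: ennreal_le_iff)
  qed
  finally show ?thesis .
qed

text \<open>A curve may return to its endpoints, where the averaging scale would vanish. Between the
  last visit to \<open>x\<close> and the first later visit to \<open>y\<close> the scale stays
  positive.\<close>

lemma arc_between_last_and_first_visit:
  fixes g :: "real \<Rightarrow> 'a::metric_space"
  assumes g: "path g" "pathstart g = x" "pathfinish g = y" and xy: "x \<noteq> y"
  obtains a b where "0 \<le> a" "a < b" "b \<le> 1" "g a = x" "g b = y" "\<And>u. a < u \<Longrightarrow> u < b \<Longrightarrow> g u \<noteq> x \<and> g u \<noteq> y"
proof -
  have cont: "continuous_on {0..1} g" using g by (simp add: path_def)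
  have g01: "g 0 = x" "g 1 = y" using g by (auto simp: pathstart_def pathfinish_def)
  define S where "S = {0..1} \<inter> g -` {x}"
  have "compact S" unfolding S_def
    using continuous_closed_preimage[OF cont, of "{x}"] by (intro compact_Int_closed[of "{0..1}" "{0..1} \<inter> g -` {x}", simplified]) auto
  moreover have "0 \<in> S" using g01 by (simp add: S_def)
  then have "S \<noteq> {}" by blast
  ultimately obtain a where a: "a \<in> S" "\<And>u. u \<in> S \<Longrightarrow> u \<le> a" using compact_attains_sup[of S] by blast
  define T where "T = {a..1} \<inter> g -` {y}"
  have a01: "0 \<le> a" "a \<le> 1" "g a = x" using a by (auto simp: S_def)
  have cont': "continuous_on {a..1} g" by (rule continuous_on_subset[OF cont]) (use a01 in auto)
  have "compact T" unfolding T_def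
    using continuous_closed_preimage[OF cont', of "{y}"] by (intro compact_Int_closed[of "{a..1}" "{a..1} \<inter> g -` {y}", simplified]) auto
  moreover have "T \<noteq> {}" using g01 a01 by (auto simp: T_def)
  ultimately obtain b where b: "b \<in> T" "\<And>u. u \<in> T \<Longrightarrow> b \<le> u" using compact_attains_inf[of T] by blast
  have b1: "a \<le> b" "b \<le> 1" "g b = y" using b by (auto simp: T_def)
  have "a \<noteq> b" using a01 b1 xy by auto
  then have "a < b" using b1 by simp
  moreover have "g u \<noteq> x \<and> g u \<noteq> y" if "a < u" "u < b" for u
  proof
    show "g u \<noteq> x" using a(2)[of u] that a01 b1 by (auto simp: S_def)
    show "g u \<noteq> y" using b(2)[of u] that a01 b1 by (auto simp: T_def)
  qed
  ultimately show thesis using that a01 b1 by blast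
qed

text \<open>The bump is at most the reciprocal of its radius to the power \<open>DIM('a)\<close> and
  lives in a ball contained in \<open>ball x (2 * m)\<close>. The ratio of the two radii is
  \<open>16 / \<epsilon>\<close>, so the mean deviation grows by at most that ratio to the power of
  the dimension.\<close>

lemma bump_average_near_lebesgue_point:
  fixes x z :: "'a::euclidean_space"
  assumes lf: "locally_integrable_on f \<Omega>" and sub: "cball z (\<epsilon> / 8 * m) \<subseteq> \<Omega>"
    and e: "0 < \<epsilon>" "\<epsilon> \<le> 1" and m: "0 < m" "dist x z = m" and k: "0 \<le> k"
    and lp: "(\<integral>\<^sup>+ w\<in>ball x (2 * m). ennreal \<bar>f w - f x\<bar> \<partial>lebesgue) \<le> ennreal k * emeasure lebesgue (ball x (2 * m))"
  shows "\<bar>(LINT w|lebesgue. f w * bump (\<epsilon> / 8 * m) z w) - bump_mass TYPE('a) * f x\<bar>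
     \<le> unit_ball_vol (real DIM('a)) * (16 / \<epsilon>) ^ DIM('a) * k"
proof -
  let ?r = "\<epsilon> / 8 * m" and ?n = "DIM('a)"
  let ?X = "\<lambda>w. ennreal \<bar>indicator (cball z ?r) w *\<^sub>R f w - f x\<bar> * indicator (ball z ?r) w"
  let ?Y = "LINT w|lebesgue. (f w - f x) * bump ?r z w"
  let ?Z = "\<lambda>w. ennreal \<bar>f w - f x\<bar> * indicator (ball z ?r) w"
  have r: "0 < ?r" using e m by simp
  have int: "integrable lebesgue (\<lambda>w. f w * bump ?r z w)"
  proof (rule integrable_bounded_mult(1)[OF lf compact_cball sub])
    show "\<bar>bump ?r z w\<bar> \<le> 1 / ?r ^ ?n" for w by (rule bump_abs_le[OF r])
    show "bump ?r z w = 0" if "w \<notin> cball z ?r" for w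
      using bump_eq_0[OF r] that ball_subset_cball by blast
  qed measurable
  have eq: "(LINT w|lebesgue. f w * bump ?r z w) - bump_mass TYPE('a) * f x = ?Y"
  proof -
    have "?Y = (LINT w|lebesgue. f w * bump ?r z w - f x * bump ?r z w)"
      by (simp add: left_diff_distrib)
    also have "\<dots> = (LINT w|lebesgue. f w * bump ?r z w) - f x * (LINT w|lebesgue. bump ?r z w)"
      using int bump_integrable[OF r, of z] by simp
    finally show ?thesis unfolding bump_integral[OF r] by (simp add: mult.commute)
  qed
  have int2: "integrable lebesgue (\<lambda>w. (f w - f x) * bump ?r z w)"
    using int bump_integrable[OF r, of z] by (simp add: left_diff_distrib)
  have bs: "ball z ?r \<subseteq> ball x (2 * m)"
  proof
    fix w assume "w \<in> ball z ?r"
    then have "dist z w < ?r" by simp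
    moreover have "?r \<le> m" using e m by (simp add: field_simps)
    moreover have "dist x w \<le> dist x z + dist z w" by (rule dist_triangle)
    ultimately have "dist x w < 2 * m" using m by linarith
    then show "w \<in> ball x (2 * m)" by simp
  qed
  have "ennreal \<bar>?Y\<bar> \<le> (\<integral>\<^sup>+ w. ennreal (norm ((f w - f x) * bump ?r z w)) \<partial>lebesgue)"
    using integral_norm_bound_ennreal[OF int2] by simp
  also have "\<dots> \<le> (\<integral>\<^sup>+ w. ennreal (1 / ?r ^ ?n) * (ennreal \<bar>f w - f x\<bar> * indicator (ball z ?r) w) \<partial>lebesgue)"
  proof (rule nn_integral_mono)
    fix w
    show "ennreal (norm ((f w - f x) * bump ?r z w)) \<le> ennreal (1 / ?r ^ ?n) * (ennreal \<bar>f w - f x\<bar> * indicator (ball z ?r) w)"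
    proof (cases "w \<in> ball z ?r")
      case True
      have "\<bar>f w - f x\<bar> * \<bar>bump ?r z w\<bar> \<le> \<bar>f w - f x\<bar> * (1 / ?r ^ ?n)"
        by (intro mult_left_mono bump_abs_le[OF r]) auto
      then have "ennreal (norm ((f w - f x) * bump ?r z w)) \<le> ennreal (1 / ?r ^ ?n * \<bar>f w - f x\<bar>)"
        by (intro ennreal_leI) (simp add: abs_mult mult.commute)
      also have "\<dots> = ennreal (1 / ?r ^ ?n) * ennreal \<bar>f w - f x\<bar>" using r by (intro ennreal_mult) auto
      finally show ?thesis using True by simp
    next
      case False
      then show ?thesis using bump_eq_0[OF r False] by simp
    qed
  qed
  also have "\<dots> = ennreal (1 / ?r ^ ?n) * (\<integral>\<^sup>+ w\<in>ball z ?r. ennreal \<bar>f w - f x\<bar> \<partial>lebesgue)"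
  proof (rule nn_integral_cmult)
    have [measurable]: "(\<lambda>w. indicator (cball z ?r) w *\<^sub>R f w) \<in> borel_measurable lebesgue"
      by (rule locally_integrable_onD[OF lf compact_cball sub])
    have "?X \<in> borel_measurable lebesgue" by measurable
    also have "?X = ?Z" using ball_subset_cball[of z ?r] by (auto simp: indicator_def fun_eq_iff)
    finally show "?Z \<in> borel_measurable lebesgue" .
  qed
  also have "\<dots> \<le> ennreal (1 / ?r ^ ?n) * (\<integral>\<^sup>+ w\<in>ball x (2 * m). ennreal \<bar>f w - f x\<bar> \<partial>lebesgue)"
    using bs by (intro mult_left_mono nn_integral_mono) (auto simp: indicator_def)
  also have "\<dots> \<le> ennreal (1 / ?r ^ ?n) * (ennreal k * emeasure lebesgue (ball x (2 * m)))"
    by (intro mult_left_mono lp) simp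
  also have "\<dots> = ennreal (unit_ball_vol (real ?n) * (16 / \<epsilon>) ^ ?n * k)"
  proof -
    have "emeasure lebesgue (ball x (2 * m)) = ennreal (unit_ball_vol (real ?n) * (2 * m) ^ ?n)"
      using m by (intro emeasure_ball_lebesgue) simp
    moreover have "1 / ?r ^ ?n * (k * (unit_ball_vol (real ?n) * (2 * m) ^ ?n)) = unit_ball_vol (real ?n) * (16 / \<epsilon>) ^ ?n * k"
    proof -
      have "2 * m / ?r = 16 / \<epsilon>" using e m by (simp add: field_simps)
      then have "(2 * m) ^ ?n / ?r ^ ?n = (16 / \<epsilon>) ^ ?n" by (simp only: power_divide[symmetric])
      moreover have "1 / a * (k * (V * b)) = V * (b / a) * k" for a b V :: real by simp
      ultimately show ?thesis by metis
    qed
    ultimately show ?thesis using r k m by (simp flip: ennreal_mult)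
  qed
  finally show ?thesis unfolding eq using k e by (subst (asm) ennreal_le_iff) (auto simp: less_imp_le)
qed

text \<open>Here \<open>32 / \<epsilon>\<close> is the ratio of the radius
  \<open>2 * \<mu> z\<close> of the ball about an endpoint to half the averaging radius
  \<open>\<epsilon> / 8 * \<mu> z\<close>. The factor 2 accounts for centre and radius moving
  together, \<open>1 / \<epsilon>\<close> for the length of the curve, and \<open>bump_mass\<close>
  for the normalisation of the averages.\<close>

definition pointwise_const :: "'a::euclidean_space itself \<Rightarrow> real \<Rightarrow> real" where
  "pointwise_const _ \<epsilon> = 2 * unit_ball_vol (real DIM('a)) * (32 / \<epsilon>) ^ DIM('a) / (bump_mass TYPE('a) * \<epsilon>)"

lemma pointwise_const_pos: "0 < \<epsilon> \<Longrightarrow> 0 < pointwise_const TYPE('a::euclidean_space) \<epsilon>"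
  unfolding pointwise_const_def using bump_mass_pos[where 'a='a]
  by (intro divide_pos_pos mult_pos_pos zero_less_power) auto

text \<open>At a point \<open>z\<close> of the curve the function is replaced by its average at the scale
  \<open>\<epsilon> / 8 * min (dist x z) (dist y z)\<close>. A ball of that size around \<open>z\<close> occupies a fixed
  proportion of a ball around \<open>x\<close> or \<open>y\<close>, so the average changes along the curve at a speed bounded by the
  maximal function of the gradient at the endpoints.\<close>
theorem pointwise_estimate:
  fixes x y :: "'a::euclidean_space"
  assumes dom: "eps_infty_domain \<epsilon> \<Omega>" and e: "0 < \<epsilon>" "\<epsilon> \<le> 1" and wg: "weak_gradient \<Omega> f G"
    and x: "x \<in> \<Omega>" "lebesgue_point f x" and y: "y \<in> \<Omega>" "lebesgue_point f y"
  defines "g \<equiv> (\<lambda>w. if w \<in> \<Omega> then norm (G w) else 0)"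
  shows "ennreal \<bar>f x - f y\<bar> \<le> ennreal (pointwise_const TYPE('a) \<epsilon> * dist x y) * (maximal_op g x + maximal_op g y)"
proof -
  let ?X = "dist x y / \<epsilon>"
  consider "x = y" | "x \<noteq> y" "maximal_op g x + maximal_op g y = top"
    | m where "x \<noteq> y" "0 \<le> m" "maximal_op g x + maximal_op g y = ennreal m"
      by (cases "maximal_op g x + maximal_op g y") auto
  then show ?thesis
  proof cases
    case 1
    then show ?thesis by simp
  next
    case 2
    then show ?thesis using pointwise_const_pos[OF e(1), where 'a='a] unfolding 2(2) by (simp add: ennreal_mult_top)
  next
    case 3
    note xy = 3(1) and m0 = 3(2) and M = 3(3)
    let ?n = "DIM('a)" and ?k = "unit_ball_vol (real DIM('a))"
    have k0: "0 < ?k" by simp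
    have Mx: "maximal_op g x \<le> ennreal m" "maximal_op g y \<le> ennreal m" unfolding M[symmetric] by auto
    have op: "open \<Omega>" using dom by (simp add: eps_infty_domain_def)
    have lf: "locally_integrable_on f \<Omega>" using wg by (simp add: weak_gradient_def)
    have D: "0 < dist x y" using xy by simp
    obtain q where q: "path q" "pathstart q = x" "pathfinish q = y" "path_image q \<subseteq> \<Omega>"
      "curve_length q \<le> ennreal ?X"
      "\<And>z. z \<in> path_image q \<Longrightarrow> ennreal (\<epsilon> * dist x z * dist y z / dist x y) \<le> dist_boundary \<Omega> z"
      using dom x(1) y(1) xy unfolding eps_infty_domain_def by blast
    obtain a b where ab: "0 \<le> a" "a < b" "b \<le> 1" "q a = x" "q b = y" "\<And>u. a < u \<Longrightarrow> u < b \<Longrightarrow> q u \<noteq> x \<and> q u \<noteq> y"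
      using arc_between_last_and_first_visit[OF q(1-3) xy] by blast
    define \<mu> where "\<mu> z = min (dist x z) (dist y z)" for z
    define \<rho> where "\<rho> z = \<epsilon> / 8 * \<mu> z" for z
    define A where "A z = (LINT w|lebesgue. f w * bump (\<rho> z) z w)" for z
    define c where "c = 2 * ?k * (32 / \<epsilon>) ^ ?n * m"
    have c0: "0 \<le> c" using m0 e k0 by (simp add: c_def less_imp_le)
    have mu_lip: "\<bar>\<mu> z' - \<mu> z\<bar> \<le> dist z z'" for z z'
      using dist_triangle[of x z' z] dist_triangle[of x z z'] dist_triangle[of y z' z] dist_triangle[of y z z']
      by (auto simp: \<mu>_def min_def dist_commute)
    have inner: "0 < \<mu> (q u)" "cball (q u) (2 * \<rho> (q u)) \<subseteq> \<Omega>"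
      "(\<integral>\<^sup>+ w\<in>cball (q u) (2 * \<rho> (q u)). ennreal (norm (G w)) \<partial>lebesgue) \<le> ennreal (?k * (2 * \<mu> (q u)) ^ ?n * m)"
      if u: "a < u" "u < b" for u
    proof -
      let ?z = "q u"
      have zi: "?z \<in> path_image q" using u ab by (auto simp: path_image_def)
      show mu: "0 < \<mu> ?z" using ab(6)[OF u] by (auto simp: \<mu>_def)
      \<comment> \<open>The larger of the two distances is at least \<open>dist x y / 2\<close>. The
        domain condition therefore gives a distance of at least
        \<open>\<epsilon> * \<mu> ?z / 2\<close> to the boundary, while \<open>2 * \<rho> ?z\<close>
        is only half of that.\<close>
      have "\<mu> ?z * (dist x y / 2) \<le> \<mu> ?z * max (dist x ?z) (dist y ?z)"
        using dist_triangle[of x y ?z] mu by (simp add: dist_commute)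
      also have "\<dots> = dist x ?z * dist y ?z" by (simp add: \<mu>_def min_def max_def)
      finally have "\<epsilon> * (\<mu> ?z * (dist x y / 2)) / dist x y \<le> \<epsilon> * (dist x ?z * dist y ?z) / dist x y"
        using e D by (intro divide_right_mono mult_left_mono) auto
      then have "\<epsilon> * \<mu> ?z / 2 \<le> \<epsilon> * dist x ?z * dist y ?z / dist x y" using D by (simp add: mult.assoc)
      moreover have "2 * \<rho> ?z < \<epsilon> * \<mu> ?z / 2" using mu e by (simp add: \<rho>_def)
      ultimately have "2 * \<rho> ?z < \<epsilon> * dist x ?z * dist y ?z / dist x y" by linarith
      moreover have "0 \<le> 2 * \<rho> ?z" using mu e by (simp add: \<rho>_def)
      ultimately show sub: "cball ?z (2 * \<rho> ?z) \<subseteq> \<Omega>"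
        using zi q(4) by (intro cball_subset_of_dist_boundary[OF op _ _ q(6)[OF zi]]) auto
      have le: "2 * \<rho> ?z < \<mu> ?z" using mu e by (simp add: \<rho>_def)
      \<comment> \<open>The ball about \<open>?z\<close> lies in a ball of radius
        \<open>2 * \<mu> ?z\<close> about the endpoint at distance \<open>\<mu> ?z\<close>, so the
        maximal function at that endpoint controls the gradient there.\<close>
      have J: "(\<integral>\<^sup>+ w\<in>cball ?z (2 * \<rho> ?z). ennreal (norm (G w)) \<partial>lebesgue) \<le> ennreal (?k * (2 * \<mu> ?z) ^ ?n * m)"
        if v: "dist v ?z = \<mu> ?z" "maximal_op g v \<le> ennreal m" for v
      proof -
        have sub2: "cball ?z (2 * \<rho> ?z) \<subseteq> ball v (2 * \<mu> ?z)"
        proof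
          fix w assume "w \<in> cball ?z (2 * \<rho> ?z)"
          then show "w \<in> ball v (2 * \<mu> ?z)" using dist_triangle[of v w ?z] v(1) le by simp
        qed
        have "(\<integral>\<^sup>+ w\<in>cball ?z (2 * \<rho> ?z). ennreal (norm (G w)) \<partial>lebesgue) \<le> (\<integral>\<^sup>+ w\<in>ball v (2 * \<mu> ?z). ennreal \<bar>g w\<bar> \<partial>lebesgue)"
          using sub sub2 by (intro nn_integral_mono) (auto simp: g_def indicator_def)
        also have "\<dots> \<le> emeasure lebesgue (ball v (2 * \<mu> ?z)) * maximal_op g v"
          using mu by (intro maximal_op_ball) simp
        also have "\<dots> \<le> emeasure lebesgue (ball v (2 * \<mu> ?z)) * ennreal m" by (intro mult_left_mono v(2)) simp
        also have "emeasure lebesgue (ball v (2 * \<mu> ?z)) = ennreal (?k * (2 * \<mu> ?z) ^ ?n)"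
          using mu by (intro emeasure_ball_lebesgue) simp
        also have "\<dots> * ennreal m = ennreal (?k * (2 * \<mu> ?z) ^ ?n * m)"
          using m0 by (rule ennreal_mult''[symmetric])
        finally show ?thesis .
      qed
      show "(\<integral>\<^sup>+ w\<in>cball ?z (2 * \<rho> ?z). ennreal (norm (G w)) \<partial>lebesgue) \<le> ennreal (?k * (2 * \<mu> ?z) ^ ?n * m)"
      proof (cases "dist x ?z \<le> dist y ?z")
        case True
        then show ?thesis using J[of x] Mx by (simp add: \<mu>_def)
      next
        case False
        then show ?thesis using J[of y] Mx by (simp add: \<mu>_def)
      qed
    qed
    have step: "\<bar>A (q v) - A (q u)\<bar> \<le> c * dist (q u) (q v)"
      if u: "a < u" "u < b" and v: "a < v" "v < b" and near: "dist (q u) (q v) \<le> \<rho> (q u) / 4" for u v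
    proof -
      let ?z = "q u" and ?d = "q v - q u" and ?s = "\<rho> (q v) - \<rho> (q u)" and ?r = "\<rho> (q u)"
      have mu: "0 < \<mu> ?z" and sub: "cball ?z (2 * ?r) \<subseteq> \<Omega>"
        and J: "(\<integral>\<^sup>+ w\<in>cball ?z (2 * ?r). ennreal (norm (G w)) \<partial>lebesgue) \<le> ennreal (?k * (2 * \<mu> ?z) ^ ?n * m)"
        using inner[OF u] by auto
      have r: "0 < ?r" using mu e by (simp add: \<rho>_def)
      have nd: "norm ?d = dist ?z (q v)" by (simp add: dist_norm norm_minus_commute)
      have s: "\<bar>?s\<bar> \<le> norm ?d"
      proof -
        have "\<bar>?s\<bar> = \<epsilon> / 8 * \<bar>\<mu> (q v) - \<mu> ?z\<bar>" unfolding \<rho>_def right_diff_distrib[symmetric] abs_mult using e by simp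
        also have "\<dots> \<le> 1 * dist ?z (q v)" using e mu_lip by (intro mult_mono) auto
        finally show ?thesis by (simp add: nd)
      qed
      \<comment> \<open>The scale is a Lipschitz function with constant at most 1, so on a step of
        length at most \<open>?r / 4\<close> neither centre nor radius moves by more than that. The
        radius stays above \<open>?r / 2\<close> and the moving balls stay inside
        \<open>cball ?z (2 * ?r)\<close>.\<close>
      have ts: "\<bar>t * ?s\<bar> \<le> ?r / 4" "norm (t *\<^sub>R ?d) \<le> ?r / 4" if "0 \<le> t" "t \<le> 1" for t
      proof -
        have "\<bar>t * ?s\<bar> \<le> 1 * \<bar>?s\<bar>" unfolding abs_mult using that by (intro mult_right_mono) auto
        then show "\<bar>t * ?s\<bar> \<le> ?r / 4" using s near nd by simp
        have "norm (t *\<^sub>R ?d) \<le> 1 * norm ?d" unfolding norm_scaleR using that by (intro mult_right_mono) auto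
        then show "norm (t *\<^sub>R ?d) \<le> ?r / 4" using near nd by simp
      qed
      have "\<bar>(LINT w|lebesgue. f w * bump (?r + ?s) (?z + ?d) w) - (LINT w|lebesgue. f w * bump ?r ?z w)\<bar>
         \<le> (norm ?d + \<bar>?s\<bar>) * (?k * (2 * \<mu> ?z) ^ ?n * m) / (?r / 2) ^ ?n"
      proof (rule bump_average_step[OF wg compact_cball sub])
        show "?r / 2 \<le> ?r + t * ?s" if "0 \<le> t" "t \<le> 1" for t using ts(1)[OF that] r by linarith
        show "cball (?z + t *\<^sub>R ?d) (?r + t * ?s) \<subseteq> cball ?z (2 * ?r)" if t: "0 \<le> t" "t \<le> 1" for t
        proof
          fix w assume "w \<in> cball (?z + t *\<^sub>R ?d) (?r + t * ?s)"
          then have "dist (?z + t *\<^sub>R ?d) w \<le> ?r + t * ?s" by simp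
          moreover have "dist ?z (?z + t *\<^sub>R ?d) = norm (t *\<^sub>R ?d)" by (simp add: dist_norm)
          ultimately show "w \<in> cball ?z (2 * ?r)"
            using dist_triangle[of ?z w "?z + t *\<^sub>R ?d"] ts[OF t] r by simp
        qed
        show "0 < ?r / 2" using r by simp
        show "0 \<le> ?k * (2 * \<mu> ?z) ^ ?n * m" using mu m0 k0 by (simp add: less_imp_le)
      qed (rule J)
      also have "(?k * (2 * \<mu> ?z) ^ ?n * m) / (?r / 2) ^ ?n = ?k * (32 / \<epsilon>) ^ ?n * m"
      proof -
        have "2 * \<mu> ?z / (?r / 2) = 32 / \<epsilon>" using mu e by (simp add: \<rho>_def field_simps)
        then have "(2 * \<mu> ?z) ^ ?n / (?r / 2) ^ ?n = (32 / \<epsilon>) ^ ?n" by (simp only: power_divide[symmetric])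
        moreover have "a * b * c' / d = a * (b / d) * c'" for a b c' d :: real by simp
        ultimately show ?thesis by metis
      qed
      then have "(norm ?d + \<bar>?s\<bar>) * (?k * (2 * \<mu> ?z) ^ ?n * m) / (?r / 2) ^ ?n = (norm ?d + \<bar>?s\<bar>) * (?k * (32 / \<epsilon>) ^ ?n * m)"
        by (simp only: times_divide_eq_right[symmetric])
      also have "\<dots> \<le> (norm ?d + norm ?d) * (?k * (32 / \<epsilon>) ^ ?n * m)"
        using s m0 e k0 by (intro mult_right_mono add_left_mono) (auto simp: less_imp_le)
      also have "\<dots> = c * dist ?z (q v)" by (simp add: c_def nd)
      finally show ?thesis by (simp add: A_def)
    qed
    have chain: "\<bar>A (q t) - A (q s)\<bar> \<le> c * ?X" if st: "a < s" "s \<le> t" "t < b" for s t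
    proof -
      \<comment> \<open>On a compact piece of the open arc the scale attains a positive minimum, as
        \<open>chain_along_curve\<close> requires. The resulting bound depends neither on that
        minimum nor on the piece.\<close>
      have "continuous_on {s..t} (\<lambda>u. \<rho> (q u))"
      proof -
        have "continuous_on {s..t} q"
          using q(1) ab st by (auto simp: path_def intro: continuous_on_subset)
        then show ?thesis unfolding \<rho>_def \<mu>_def by (intro continuous_intros)
      qed
      then obtain u0 where u0: "u0 \<in> {s..t}" "\<And>u. u \<in> {s..t} \<Longrightarrow> \<rho> (q u0) \<le> \<rho> (q u)"
        using continuous_attains_inf[of "{s..t}" "\<lambda>u. \<rho> (q u)"] st by auto
      show ?thesis
      proof (rule chain_along_curve[OF q(1) q(5), where r = \<rho> and rmin = "\<rho> (q u0)"])
        show "0 < \<rho> (q u0)" using inner(1)[of u0] u0(1) st e by (simp add: \<rho>_def)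
        show "\<bar>A (q v) - A (q u)\<bar> \<le> c * dist (q u) (q v)"
          if "s \<le> u" "u \<le> t" "s \<le> v" "v \<le> t" "dist (q u) (q v) \<le> \<rho> (q u) / 4" for u v
          by (rule step) (use that st in auto)
      qed (use ab st u0 c0 D e in auto)
    qed
    have near: "\<bar>A z - bump_mass TYPE('a) * f v\<bar> \<le> ?k * (16 / \<epsilon>) ^ ?n * k"
      if "0 \<le> k" "dist v z = \<mu> z" "0 < \<mu> z" "cball z (2 * \<rho> z) \<subseteq> \<Omega>"
        "(\<integral>\<^sup>+ w\<in>ball v (2 * \<mu> z). ennreal \<bar>f w - f v\<bar> \<partial>lebesgue) \<le> ennreal k * emeasure lebesgue (ball v (2 * \<mu> z))" for k v z
      unfolding A_def \<rho>_def
    proof (rule bump_average_near_lebesgue_point[OF lf _ e that(3,2,1,5)])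
      show "cball z (\<epsilon> / 8 * \<mu> z) \<subseteq> \<Omega>"
        using that(3) e that(4) subset_cball[of "\<rho> z" "2 * \<rho> z" z] by (auto simp: \<rho>_def)
    qed
    have qc: "continuous_on {0..1} q" using q(1) by (simp add: path_def)
    have "bump_mass TYPE('a) * \<bar>f x - f y\<bar> \<le> c * ?X"
    proof (rule field_le_epsilon)
      fix \<eta> :: real assume eta: "0 < \<eta>"
      \<comment> \<open>Chosen so that the errors at the two ends of the arc add up to
        \<open>\<eta>\<close>.\<close>
      define k where "k = \<eta> / (2 * (?k * (16 / \<epsilon>) ^ ?n))"
      have kp: "0 < ?k * (16 / \<epsilon>) ^ ?n" using e k0 by simp
      have "2 * (a * (\<eta> / (2 * a))) = \<eta>" "0 < \<eta> / (2 * a)" if "0 < a" for a :: real using that eta by auto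
      from this[OF kp] have k: "0 < k" "2 * (?k * (16 / \<epsilon>) ^ ?n * k) = \<eta>" by (simp_all only: k_def)
      obtain \<delta>1 where d1': "0 < \<delta>1 \<and> (\<forall>r. 0 < r \<and> r < \<delta>1 \<longrightarrow>
         (\<integral>\<^sup>+ w\<in>ball x r. ennreal \<bar>f w - f x\<bar> \<partial>lebesgue) \<le> ennreal k * emeasure lebesgue (ball x r))"
        using x(2)[unfolded lebesgue_point_def, rule_format, OF k(1)] by blast
      note d1 = d1'[THEN conjunct1] d1'[THEN conjunct2, rule_format, OF conjI]
      obtain \<delta>2 where d2': "0 < \<delta>2 \<and> (\<forall>r. 0 < r \<and> r < \<delta>2 \<longrightarrow>
         (\<integral>\<^sup>+ w\<in>ball y r. ennreal \<bar>f w - f y\<bar> \<partial>lebesgue) \<le> ennreal k * emeasure lebesgue (ball y r))"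
        using y(2)[unfolded lebesgue_point_def, rule_format, OF k(1)] by blast
      note d2 = d2'[THEN conjunct1] d2'[THEN conjunct2, rule_format, OF conjI]
      have "a \<in> {0..1}" "0 < min (\<delta>1 / 2) (dist x y / 2)" using ab d1(1) D by auto
      from qc[unfolded continuous_on_iff, rule_format, OF this]
      obtain h1 where h1': "0 < h1 \<and> (\<forall>u\<in>{0..1}. dist u a < h1 \<longrightarrow> dist (q u) (q a) < min (\<delta>1 / 2) (dist x y / 2))"
        by blast
      note h1 = h1'[THEN conjunct1] h1'[THEN conjunct2, rule_format]
      have "b \<in> {0..1}" "0 < min (\<delta>2 / 2) (dist x y / 2)" using ab d2(1) D by auto
      from qc[unfolded continuous_on_iff, rule_format, OF this]
      obtain h2 where h2': "0 < h2 \<and> (\<forall>u\<in>{0..1}. dist u b < h2 \<longrightarrow> dist (q u) (q b) < min (\<delta>2 / 2) (dist x y / 2))"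
        by blast
      note h2 = h2'[THEN conjunct1] h2'[THEN conjunct2, rule_format]
      \<comment> \<open>\<open>s\<close> and \<open>t\<close> stay in their own halves of the
        parameter interval, which ensures \<open>s \<le> t\<close>, and so near the ends that the
        closer endpoint of the curve is the expected one.\<close>
      define s where "s = a + min (h1 / 2) ((b - a) / 2)"
      define t where "t = b - min (h2 / 2) ((b - a) / 2)"
      have st: "a < s" "s \<le> (a + b) / 2" "(a + b) / 2 \<le> t" "t < b" "dist s a < h1" "dist t b < h2"
        using h1(1) h2(1) ab(2) by (auto simp: s_def t_def dist_real_def min_def field_simps)
      then have st2: "s \<le> t" "s < b" "a < t" "s \<in> {0..1}" "t \<in> {0..1}" using ab by auto
      have ds: "dist x (q s) < \<delta>1 / 2" "dist x (q s) < dist x y / 2"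
        using h1(2)[OF st2(4) st(5)] ab(4) by (auto simp: dist_commute)
      have dt: "dist y (q t) < \<delta>2 / 2" "dist y (q t) < dist x y / 2"
        using h2(2)[OF st2(5) st(6)] ab(5) by (auto simp: dist_commute)
      have mus: "\<mu> (q s) = dist x (q s)" using ds(2) dist_triangle[of x y "q s"] by (simp add: \<mu>_def dist_commute)
      have mut: "\<mu> (q t) = dist y (q t)" using dt(2) dist_triangle[of x y "q t"] by (simp add: \<mu>_def dist_commute)
      have 1: "\<bar>A (q s) - bump_mass TYPE('a) * f x\<bar> \<le> ?k * (16 / \<epsilon>) ^ ?n * k"
        using inner[OF st(1) st2(2)] ds mus k by (intro near d1(2)) auto
      have 2: "\<bar>A (q t) - bump_mass TYPE('a) * f y\<bar> \<le> ?k * (16 / \<epsilon>) ^ ?n * k"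
        using inner[OF st2(3) st(4)] dt mut k by (intro near d2(2)) auto
      have 3: "\<bar>A (q t) - A (q s)\<bar> \<le> c * ?X" by (rule chain) (use st st2 in auto)
      have "bump_mass TYPE('a) * \<bar>f x - f y\<bar> = \<bar>bump_mass TYPE('a) * f x - bump_mass TYPE('a) * f y\<bar>"
        using bump_mass_pos[where 'a='a] by (simp add: abs_mult flip: right_diff_distrib)
      then show "bump_mass TYPE('a) * \<bar>f x - f y\<bar> \<le> c * ?X + \<eta>"
        using 1 2 3 k(2) by linarith
    qed
    then have "\<bar>f x - f y\<bar> \<le> c * ?X / bump_mass TYPE('a)"
      by (simp only: pos_le_divide_eq[OF bump_mass_pos] mult.commute)
    also have "\<dots> = pointwise_const TYPE('a) \<epsilon> * dist x y * m"
      by (simp add: c_def pointwise_const_def mult_ac)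
    finally have "ennreal \<bar>f x - f y\<bar> \<le> ennreal (pointwise_const TYPE('a) \<epsilon> * dist x y * m)" by (rule ennreal_leI)
    also have "\<dots> = ennreal (pointwise_const TYPE('a) \<epsilon> * dist x y) * ennreal m" using m0 by (rule ennreal_mult'')
    finally show ?thesis by (simp add: M)
  qed
qed

subsection \<open>Annular mollifiers\<close>

lemma smooth_partial_compact_bound:
  assumes "smooth f" and 0: "\<And>x. x \<notin> cball z r \<Longrightarrow> f x = 0"
  obtains B where "0 < B" "\<And>x. \<bar>f x\<bar> \<le> B"
proof -
  have "compact (f ` cball z r)" using assms(1) by (intro compact_continuous_image smooth_continuous) auto
  then obtain B where B: "0 < B" "\<forall>y\<in>f ` cball z r. norm y \<le> B"
    using compact_imp_bounded bounded_pos by metis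
  then show thesis using 0 that[of B] by (metis abs_zero image_eqI less_imp_le real_norm_def)
qed

text \<open>A radial profile supported on the shell between the radii \<open>s / 2\<close> and
  \<open>s\<close>, where the length of the argument is comparable to the scale. Writing it through
  the square of the norm keeps it in the class \<open>smooth\<close>.\<close>

definition annular_bump :: "real \<Rightarrow> 'a::euclidean_space \<Rightarrow> real" where
  "annular_bump s h = flat 0 ((norm h / s)\<^sup>2 - 1/4) * flat 0 (1 - (norm h / s)\<^sup>2)"

lemma annular_bump_smooth: "smooth (annular_bump s)"
proof -
  have "smooth (\<lambda>h::'a. flat 0 ((1/s\<^sup>2) * (dist h 0)\<^sup>2 - 1/4) * flat 0 (1 - (1/s\<^sup>2) * (dist h 0)\<^sup>2))"
    by (intro smooth.mult smooth.flat smooth_diff smooth_cmult smooth.const smooth_dist_sq)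
  then show ?thesis by (simp add: annular_bump_def[abs_def] power_divide)
qed

lemma annular_bump_nonneg: "0 \<le> annular_bump s h"
  by (simp add: annular_bump_def flat_nonneg)

lemma annular_bump_nonzero: "0 < s \<Longrightarrow> annular_bump s h \<noteq> 0 \<longleftrightarrow> s / 2 < norm h \<and> norm h < s"
proof -
  assume s: "0 < s"
  let ?t = "norm h / s"
  have sq: "a\<^sup>2 < b\<^sup>2 \<longleftrightarrow> a < b" if "0 \<le> a" "0 \<le> b" for a b :: real
    using that by (simp flip: not_le)
  have "(1/2)\<^sup>2 < ?t\<^sup>2 \<longleftrightarrow> 1/2 < ?t" using s by (intro sq) auto
  moreover have "?t\<^sup>2 < 1\<^sup>2 \<longleftrightarrow> ?t < 1" using s by (intro sq) auto
  ultimately show ?thesis using s by (auto simp: annular_bump_def flat_eq_0_iff not_le field_simps power_divide)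
qed

lemma annular_bump_eq_0: "0 < s \<Longrightarrow> s \<le> norm h \<Longrightarrow> annular_bump s h = 0"
  using annular_bump_nonzero[of s h] by (meson not_le)

text \<open>Outside the open shell the nonnegative bump attains its minimum 0, so its derivative
  vanishes there, including on the two boundary spheres.\<close>

lemma annular_bump_derivative_support:
  assumes "0 < s" "\<not> (s / 2 < norm h \<and> norm h < s)"
  shows "frechet_derivative (annular_bump s) (at h) = (\<lambda>v. 0)"
proof -
  have "annular_bump s h = 0" using annular_bump_nonzero[OF assms(1), of h] assms(2) by blast
  then have "\<forall>y\<in>UNIV. annular_bump s h \<le> annular_bump s y" by (simp add: annular_bump_nonneg)
  then show ?thesis
    using differential_zero_maxmin[of h UNIV "annular_bump s" "frechet_derivative (annular_bump s) (at h)"]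
      smooth_has_derivative[OF annular_bump_smooth] by auto
qed

lemma annular_bump_scale_derivative:
  assumes s: "0 < s"
  shows "frechet_derivative (annular_bump s) (at h) i = frechet_derivative (annular_bump 1) (at ((1/s) *\<^sub>R h)) i / s"
proof -
  let ?X = "\<lambda>v. frechet_derivative (annular_bump 1) (at ((1/s) *\<^sub>R h)) ((1/s) *\<^sub>R v)"
  have eq: "annular_bump s = (\<lambda>h. annular_bump 1 ((1/s) *\<^sub>R h))"
    using s by (auto simp: annular_bump_def fun_eq_iff)
  have "((\<lambda>h. annular_bump 1 ((1/s) *\<^sub>R h)) has_derivative ?X) (at h)"
    by (rule has_derivative_compose[of "\<lambda>h. (1/s) *\<^sub>R h" "\<lambda>v. (1/s) *\<^sub>R v", OF _ smooth_has_derivative[OF annular_bump_smooth]])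
      (auto intro!: derivative_eq_intros)
  then have "frechet_derivative (annular_bump s) (at h) = ?X"
    unfolding eq[symmetric] by (metis frechet_derivative_at)
  then show ?thesis
    using linear_scale[OF has_derivative_linear[OF smooth_has_derivative[OF annular_bump_smooth]]]
    by (simp add: divide_inverse mult.commute)
qed

definition annular_mass :: "'a::euclidean_space itself \<Rightarrow> real" where
  "annular_mass _ = (LINT h|lebesgue. annular_bump 1 (h::'a))"

lemma annular_bump_measurable [measurable]: "annular_bump s \<in> borel_measurable borel"
  by (rule borel_measurable_continuous_onI[OF smooth_continuous[OF annular_bump_smooth]])

lemma annular_bump_integral:
  assumes s: "0 < s"
  shows "(LINT h|lebesgue. annular_bump s (h::'a::euclidean_space)) = annular_mass TYPE('a) * s ^ DIM('a)"
proof -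
  have "annular_bump s (0 + s *\<^sub>R x) = annular_bump 1 x" for x :: 'a using s by (simp add: annular_bump_def)
  then show ?thesis
    using lebesgue_integral_affine[OF annular_bump_measurable, of s s "0::'a"] s by (simp add: annular_mass_def)
qed

lemma smooth_compact_integrable:
  fixes f :: "'a::euclidean_space \<Rightarrow> real"
  assumes "smooth f" and "\<And>x. x \<notin> cball z r \<Longrightarrow> f x = 0"
  shows "integrable lebesgue f"
proof -
  have "integrable lborel (\<lambda>x. indicator (cball z r) x *\<^sub>R f x)"
    using borel_integrable_compact[OF compact_cball smooth_continuous[OF assms(1)]] by (simp add: mult.commute indicator_def if_distrib cong: if_cong)
  moreover have "(\<lambda>x. indicator (cball z r) x *\<^sub>R f x) = f" using assms(2) by (auto simp: indicator_def fun_eq_iff)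
  ultimately show ?thesis by (simp add: integrable_completion)
qed

lemma annular_bump_integrable: "0 < s \<Longrightarrow> integrable lebesgue (annular_bump s)"
  by (intro smooth_compact_integrable[OF annular_bump_smooth, of 0 s]) (auto simp: not_le intro!: annular_bump_eq_0)

lemma annular_mass_pos: "0 < annular_mass TYPE('a::euclidean_space)"
proof -
  have "0 \<le> annular_mass TYPE('a)" unfolding annular_mass_def by (intro integral_nonneg_AE) (simp add: annular_bump_nonneg)
  moreover have "annular_mass TYPE('a) \<noteq> 0"
  proof
    assume "annular_mass TYPE('a) = 0"
    then have "AE h in lebesgue. annular_bump 1 (h::'a) = 0" unfolding annular_mass_def
      by (subst (asm) integral_nonneg_eq_0_iff_AE) (auto simp: annular_bump_integrable annular_bump_nonneg)
    moreover obtain b :: 'a where b: "b \<in> Basis" using nonempty_Basis by blast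
    have "h \<in> ball ((3/4) *\<^sub>R b) (1/4) \<Longrightarrow> annular_bump 1 h \<noteq> 0" for h
    proof -
      assume "h \<in> ball ((3/4) *\<^sub>R b) (1/4)"
      then have "1/2 < norm h \<and> norm h < 1"
        using norm_triangle_ineq2[of "(3/4) *\<^sub>R b" h] norm_triangle_ineq3[of "(3/4) *\<^sub>R b" h] b by (simp add: dist_norm)
      then show ?thesis by (subst annular_bump_nonzero) auto
    qed
    ultimately have "AE h in lebesgue. h \<notin> ball ((3/4) *\<^sub>R b) (1/4)"
      by (auto elim!: eventually_mono)
    then show False
      using emeasure_ball_lebesgue_pos[of "1/4" "(3/4) *\<^sub>R b"] by (subst (asm) AE_iff_null_sets[symmetric]) auto
  qed
  ultimately show ?thesis by simp
qed

text \<open>The average of the annular mollifiers at the dyadic scales between \<open>(1/2) ^ (2 * K)\<close> and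
  \<open>(1/2) ^ K\<close>: its gradient is a factor \<open>K\<close> smaller than that of a single mollifier.\<close>
definition averaged_bump :: "nat \<Rightarrow> 'a::euclidean_space \<Rightarrow> real" where
  "averaged_bump K h = (\<Sum>m\<in>{K..<2*K}. 1 / (annular_mass TYPE('a) * real K * ((1/2)^m) ^ DIM('a)) * annular_bump ((1/2)^m) h)"

lemma averaged_bump_smooth: "smooth (averaged_bump K)"
  unfolding averaged_bump_def[abs_def] by (intro smooth_sum smooth_cmult annular_bump_smooth) auto

lemma averaged_bump_nonneg: "0 \<le> averaged_bump K (h::'a::euclidean_space)"
  unfolding averaged_bump_def using annular_mass_pos[where 'a='a] by (intro sum_nonneg mult_nonneg_nonneg annular_bump_nonneg) auto

lemma averaged_bump_eq_0: "(1/2)^K \<le> norm h \<Longrightarrow> averaged_bump K h = 0"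
proof -
  assume h: "(1/2)^K \<le> norm h"
  have "annular_bump ((1/2)^m) h = 0" if "m \<in> {K..<2*K}" for m
  proof -
    have "(1/2::real)^m \<le> (1/2)^K" using that by (intro power_decreasing) auto
    from order_trans[OF this h] show ?thesis by (intro annular_bump_eq_0) simp_all
  qed
  then show ?thesis by (simp add: averaged_bump_def)
qed

lemma averaged_bump_integral:
  assumes "1 \<le> K"
  shows "(LINT h|lebesgue. averaged_bump K (h::'a::euclidean_space)) = 1"
proof -
  have c: "annular_mass TYPE('a) \<noteq> 0" using annular_mass_pos[where 'a='a] by simp
  have "(LINT h|lebesgue. averaged_bump K (h::'a))
    = (\<Sum>m\<in>{K..<2*K}. 1 / (annular_mass TYPE('a) * real K * ((1/2)^m) ^ DIM('a)) * (annular_mass TYPE('a) * ((1/2)^m) ^ DIM('a)))"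
      unfolding averaged_bump_def
    by (subst Bochner_Integration.integral_sum) (auto simp: annular_bump_integrable annular_bump_integral)
  also have "\<dots> = (\<Sum>m\<in>{K..<2*K}. 1 / real K)" using c assms by (intro sum.cong) auto
  also have "\<dots> = 1" using assms by simp
  finally show ?thesis .
qed

lemma averaged_bump_partial:
  "frechet_derivative (averaged_bump K) (at (h::'a::euclidean_space)) i
    = (\<Sum>m\<in>{K..<2*K}. 1 / (annular_mass TYPE('a) * real K * ((1/2)^m) ^ DIM('a)) * frechet_derivative (annular_bump ((1/2)^m)) (at h) i)"
proof -
  have "(averaged_bump K has_derivative (\<lambda>v. \<Sum>m\<in>{K..<2*K}. 1 / (annular_mass TYPE('a) * real K * ((1/2)^m) ^ DIM('a)) * frechet_derivative (annular_bump ((1/2)^m)) (at h) v)) (at h)"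
    unfolding averaged_bump_def[abs_def]
    by (intro has_derivative_sum has_derivative_mult_right smooth_has_derivative annular_bump_smooth)
  from fun_cong[OF frechet_derivative_at[OF this], of i] show ?thesis by (rule sym)
qed

text \<open>At each point at most one summand has a nonzero derivative, since the open shells at
  distinct dyadic scales are disjoint; averaging thus gains the full factor
  \<open>1 / real K\<close>. On its shell the argument is shorter than the scale, so the power of
  the scale may be replaced by that of the norm.\<close>

lemma averaged_bump_partial_bound:
  obtains B :: real where "0 < B"
    "\<And>K (h::'a::euclidean_space) i. i \<in> Basis \<Longrightarrow> 1 \<le> K \<Longrightarrow> \<bar>frechet_derivative (averaged_bump K) (at h) i\<bar>
       \<le> B / real K * (norm h powr (- real DIM('a) - 1) * indicator {h. (1/2)^(2*K) < norm h \<and> norm h < (1/2)^K} h)"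
proof -
  let ?n = "DIM('a)" and ?c = "annular_mass TYPE('a)"
  have c: "0 < ?c" by (rule annular_mass_pos)
  have "\<exists>B>0. \<forall>h::'a. \<bar>frechet_derivative (annular_bump 1) (at h) i\<bar> \<le> B" for i
  proof -
    have "frechet_derivative (annular_bump 1) (at h) i = 0" if "h \<notin> cball 0 1" for h :: 'a
      using annular_bump_derivative_support[of 1 h] that by simp
    then show ?thesis using smooth_partial_compact_bound[OF smooth_frechet_derivative[OF annular_bump_smooth]] by metis
  qed
  then obtain B0 where B0: "\<And>i. 0 < B0 i" "\<And>i (h::'a). \<bar>frechet_derivative (annular_bump 1) (at h) i\<bar> \<le> B0 i" by metis
  define B where "B = (\<Sum>i\<in>Basis. B0 i)"
  have B: "0 < B" unfolding B_def using B0 by (intro sum_pos) auto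
  have B0B: "B0 i \<le> B" if "i \<in> Basis" for i
    unfolding B_def using B0(1) that by (intro member_le_sum) (auto intro: less_imp_le)
  show thesis
  proof (rule that[of "B / ?c"])
    show "0 < B / ?c" using B c by simp
    fix K :: nat and h i :: 'a
    assume i: "i \<in> Basis" and K: "1 \<le> K"
    let ?t = "\<lambda>m. 1 / (?c * real K * ((1/2)^m) ^ ?n) * frechet_derivative (annular_bump ((1/2)^m)) (at h) i"
    have term_le: "\<bar>?t m\<bar> \<le> B / ?c / real K * norm h powr (- real ?n - 1)" for m
    proof (cases "(1/2)^m / 2 < norm h \<and> norm h < (1/2)^m")
      case True
      let ?s = "(1/2::real)^m"
      have s: "0 < ?s" by simp
      have "norm h / ?s \<le> 1" using True by simp
      have "\<bar>?t m\<bar> \<le> 1 / (?c * real K * ?s ^ ?n) * (B / ?s)"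
        using B0(2)[of "(1/?s) *\<^sub>R h" i] B0B[OF i] s c K unfolding annular_bump_scale_derivative[OF s] abs_divide abs_mult by (simp add: divide_right_mono)
      also have "\<dots> = B / ?c / real K * (1 / ?s ^ Suc ?n)" using c K by (simp add: field_simps)
      also have "\<dots> \<le> B / ?c / real K * norm h powr (- real ?n - 1)"
      proof (intro mult_left_mono)
        have h0: "0 < norm h" using True s by (meson half_gt_zero less_trans)
        have "norm h ^ Suc ?n \<le> ?s ^ Suc ?n" using True by (intro power_mono) auto
        then have "1 / ?s ^ Suc ?n \<le> 1 / norm h ^ Suc ?n" using h0 s by (intro divide_left_mono mult_pos_pos) auto
        also have "\<dots> = norm h powr - real (Suc ?n)" using h0 by (simp only: powr_minus powr_realpow inverse_eq_divide)
        finally show "1 / ?s ^ Suc ?n \<le> norm h powr (- real ?n - 1)" by (simp only: of_nat_Suc minus_add_distrib diff_conv_add_uminus add.commute)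
      qed (use B c K in auto)
      finally show ?thesis .
    next
      case False
      then show ?thesis using annular_bump_derivative_support[of "(1/2)^m" h] B c K by simp
    qed
    have supp: "(1/2)^m / 2 < norm h \<and> norm h < (1/2)^m" if "?t m \<noteq> 0" for m
      using annular_bump_derivative_support[of "(1/2)^m" h] that by fastforce
    have uniq: "m = m'" if "?t m \<noteq> 0" "?t m' \<noteq> 0" for m m'
    proof -
      have *: False if "m < m'" "?t m \<noteq> 0" "?t m' \<noteq> 0" for m m'
      proof -
        have "(1/2::real)^m' \<le> (1/2)^Suc m" using that(1) by (intro power_decreasing) auto
        then show False using supp[OF that(2)] supp[OF that(3)] by simp
      qed
      show ?thesis using *[of m m'] *[of m' m] that by (meson linorder_neqE_nat)
    qed
    show "\<bar>frechet_derivative (averaged_bump K) (at h) i\<bar>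
       \<le> B / ?c / real K * (norm h powr (- real ?n - 1) * indicator {h. (1/2)^(2*K) < norm h \<and> norm h < (1/2)^K} h)"
    proof (cases "\<exists>m\<in>{K..<2*K}. ?t m \<noteq> 0")
      case True
      then obtain m where m: "m \<in> {K..<2*K}" "?t m \<noteq> 0" by blast
      have "frechet_derivative (averaged_bump K) (at h) i = (\<Sum>m\<in>{K..<2*K}. ?t m)" by (rule averaged_bump_partial)
      also have "\<dots> = (\<Sum>m\<in>{m}. ?t m)"
        using m uniq[OF m(2)] by (intro sum.mono_neutral_right) auto
      finally have "\<bar>frechet_derivative (averaged_bump K) (at h) i\<bar> \<le> B / ?c / real K * norm h powr (- real ?n - 1)"
        using term_le[of m] by simp
      moreover have "(1/2::real)^(2*K) \<le> (1/2)^Suc m" "(1/2::real)^m \<le> (1/2)^K"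
        using m(1) by (intro power_decreasing; simp)+
      then have "(1/2)^(2*K) < norm h \<and> norm h < (1/2)^K"
        using supp[OF m(2), THEN conjunct1] supp[OF m(2), THEN conjunct2] unfolding power_Suc by (intro conjI; linarith)
      ultimately show ?thesis by simp
    next
      case False
      then show ?thesis using B c K unfolding averaged_bump_partial by simp
    qed
  qed
qed

subsection \<open>Averaged difference quotients\<close>

text \<open>Jensen's inequality with an extra factor \<open>2 powr p\<close>. It comes from the
  elementary bound \<open>u \<le> a + a powr (1 - p) * u powr p\<close>; the value
  \<open>a powr p = t / V\<close> balances the two resulting terms.\<close>

lemma nn_integral_power_le:
  fixes F g :: "'b \<Rightarrow> real"
  assumes [measurable]: "F \<in> borel_measurable M" "g \<in> borel_measurable M"
    and F: "\<And>x. 0 \<le> F x" and g: "\<And>x. 0 \<le> g x" and V: "(\<integral>\<^sup>+ x. ennreal (g x) \<partial>M) \<le> ennreal V" "0 < V" and p: "1 \<le> p"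
  shows "enn_powr (\<integral>\<^sup>+ x. ennreal (F x * g x) \<partial>M) p \<le> ennreal (2 powr p * V powr (p - 1)) * (\<integral>\<^sup>+ x. ennreal (F x powr p * g x) \<partial>M)"
proof -
  let ?X = "\<integral>\<^sup>+ x. ennreal (F x * g x) \<partial>M"
  define T where "T = (\<integral>\<^sup>+ x. ennreal (F x powr p * g x) \<partial>M)"
  consider "T = top" | "T = 0" | t where "0 < t" "T = ennreal t"
    by (cases T) (auto simp: less_le ennreal_eq_0_iff)
  then show ?thesis
  proof cases
    case 1
    then show ?thesis using V by (simp add: T_def[symmetric] ennreal_mult_top)
  next
    case 2
    then have "AE x in M. ennreal (F x powr p * g x) = 0"
      unfolding T_def by (subst (asm) nn_integral_0_iff_AE) auto
    then have "AE x in M. ennreal (F x * g x) = 0"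
    proof eventually_elim
      fix x assume "ennreal (F x powr p * g x) = 0"
      then show "ennreal (F x * g x) = 0" using F g by auto
    qed
    then have "?X = (\<integral>\<^sup>+ x. 0 \<partial>M)" by (rule nn_integral_cong_AE)
    then show ?thesis by simp
  next
    case 3
    define a where "a = (t / V) powr (1 / p)"
    have a: "0 < a" "a powr p = t / V" using 3 V p by (auto simp: a_def powr_powr)
    have pt: "u \<le> a + a powr (1 - p) * u powr p" if "0 \<le> u" for u
    proof (cases "u \<le> a")
      case True
      then show ?thesis by (simp add: add_increasing2)
    next
      case False
      then have u: "0 < u" using a by simp
      have "u powr (1 - p) \<le> a powr (1 - p)" using False a p by (intro powr_mono2') auto
      then have "u powr (1 - p) * u powr p \<le> a powr (1 - p) * u powr p" by (rule mult_right_mono) simp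
      moreover have "u powr (1 - p) * u powr p = u" using u by (simp flip: powr_add)
      ultimately show ?thesis using a by simp
    qed
    have at: "a powr (1 - p) * t = a * V"
    proof -
      show ?thesis using a a(2) 3 V by (simp add: powr_diff)
    qed
    have "?X \<le> (\<integral>\<^sup>+ x. ennreal a * ennreal (g x) + ennreal (a powr (1 - p)) * ennreal (F x powr p * g x) \<partial>M)"
    proof (rule nn_integral_mono)
      fix x
      have "F x * g x \<le> a * g x + a powr (1 - p) * (F x powr p * g x)"
        using mult_right_mono[OF pt[OF F] g, of x x] by (simp add: algebra_simps)
      then show "ennreal (F x * g x) \<le> ennreal a * ennreal (g x) + ennreal (a powr (1 - p)) * ennreal (F x powr p * g x)"
        using a g by (simp add: ennreal_leI flip: ennreal_mult ennreal_plus)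
    qed
    also have "\<dots> = ennreal a * (\<integral>\<^sup>+ x. ennreal (g x) \<partial>M) + ennreal (a powr (1 - p)) * T"
      by (simp add: nn_integral_add nn_integral_cmult T_def)
    also have "\<dots> \<le> ennreal a * ennreal V + ennreal (a powr (1 - p)) * T"
      by (intro add_right_mono mult_left_mono V) simp
    also have "\<dots> = ennreal (2 * (a * V))"
      using a V 3 at by (simp flip: ennreal_mult ennreal_plus)
    finally have "enn_powr ?X p \<le> enn_powr (ennreal (2 * (a * V))) p"
      using p by (intro enn_powr_mono) auto
    also have "\<dots> = ennreal (2 powr p * V powr (p - 1) * t)"
    proof -
      have "(2 * (a * V)) powr p = 2 powr p * (a powr p * V powr p)"
        using a V by (simp add: powr_mult)
      also have "\<dots> = 2 powr p * V powr (p - 1) * t" using V by (simp add: a(2) powr_diff)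
      finally show ?thesis using a V by (simp add: enn_powr_ennreal)
    qed
    also have "\<dots> = ennreal (2 powr p * V powr (p - 1)) * T" using 3 by (simp add: ennreal_mult)
    finally show ?thesis by (simp add: T_def)
  qed
qed

text \<open>The kernel is scale invariant: each of the K dyadic shells contributes at most
  \<open>unit_ball_vol (real DIM('a)) * 4 ^ DIM('a)\<close>, and only their number enters.\<close>

lemma log_annulus_mass:
  fixes x :: "'a::euclidean_space"
  assumes K: "1 \<le> K"
  shows "(\<integral>\<^sup>+ y. ennreal (dist x y powr (- real DIM('a)) * indicator {y. (1/2)^(2*K) < dist x y \<and> dist x y < (1/2)^K} y) \<partial>lebesgue)
    \<le> ennreal (unit_ball_vol (real DIM('a)) * 4 ^ DIM('a) * real K)"
proof -
  let ?n = "DIM('a)" and ?k = "unit_ball_vol (real DIM('a))"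
  let ?B = "\<lambda>m. ball x (2 * (1/2)^m)"
  let ?X = "\<lambda>y. \<Sum>m\<in>{K..<2*K}. ennreal ((2 * 2^m) ^ ?n) * indicator (?B m) y"
  have cov: "ennreal (dist x y powr (- real ?n) * indicator {y. (1/2)^(2*K) < dist x y \<and> dist x y < (1/2)^K} y)
     \<le> (?X y)" for y
  proof (cases "(1/2)^(2*K) < dist x y \<and> dist x y < (1/2)^K")
    case True
    define m where "m = (LEAST m. (1/2::real)^m \<le> dist x y)"
    have "(1/2::real)^(2*K) \<le> dist x y" using True by simp
    then have m: "(1/2)^m \<le> dist x y" "m \<le> 2*K" unfolding m_def by (auto intro: LeastI Least_le)
    have mK: "K < m"
    proof (rule ccontr)
      assume "\<not> K < m"
      then have "(1/2::real)^K \<le> (1/2)^m" by (intro power_decreasing) auto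
      then show False using m(1) True[THEN conjunct2] by linarith
    qed
    then obtain j where j: "m = Suc j" by (cases m) auto
    have "\<not> (1/2)^j \<le> dist x y" using not_less_Least[of j "\<lambda>m. (1/2::real)^m \<le> dist x y"] j by (simp add: m_def)
    then have jd: "dist x y < 2 * (1/2)^j" "(1/2)^Suc j \<le> dist x y"
      using m(1) j zero_less_power[of "1/2::real" j] by auto
    have jK: "j \<in> {K..<2*K}" using mK m(2) j by auto
    have d0: "0 < dist x y" using jd(2) by (meson less_le_trans zero_less_power zero_less_divide_1_iff zero_less_numeral)
    have "dist x y powr (- real ?n) = 1 / dist x y ^ ?n" using d0 by (simp add: powr_minus powr_realpow inverse_eq_divide)
    also have "\<dots> \<le> 1 / ((1/2)^Suc j) ^ ?n" using jd(2) d0 by (intro divide_left_mono power_mono mult_pos_pos) auto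
    also have "\<dots> = (2 * 2^j) ^ ?n" by (simp add: power_one_over power_divide)
    finally have "ennreal (dist x y powr (- real ?n)) \<le> ennreal ((2 * 2^j) ^ ?n) * indicator (?B j) y"
      using jd(1) by (simp add: ennreal_leI)
    also have "\<dots> \<le> (?X y)" using jK by (intro member_le_sum) auto
    finally show ?thesis using True by simp
  qed simp
  have "(\<integral>\<^sup>+ y. ennreal (dist x y powr (- real ?n) * indicator {y. (1/2)^(2*K) < dist x y \<and> dist x y < (1/2)^K} y) \<partial>lebesgue)
    \<le> (\<integral>\<^sup>+ y. (?X y) \<partial>lebesgue)"
    by (intro nn_integral_mono cov)
  also have "\<dots> = (\<Sum>m\<in>{K..<2*K}. ennreal ((2 * 2^m) ^ ?n) * emeasure lebesgue (?B m))"
    by (subst nn_integral_sum) (auto simp: nn_integral_cmult_indicator)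
  also have "\<dots> = (\<Sum>m\<in>{K..<2*K}. ennreal (?k * 4 ^ ?n))"
  proof (rule sum.cong)
    fix m
    have "emeasure lebesgue (?B m) = ennreal (?k * (2 * (1/2)^m) ^ ?n)" by (intro emeasure_ball_lebesgue) simp
    then have "ennreal ((2 * 2^m) ^ ?n) * emeasure lebesgue (?B m) = ennreal ((2 * 2^m) ^ ?n * (?k * (2 * (1/2)^m) ^ ?n))"
      by (simp only:) (intro ennreal_mult[symmetric], auto)
    also have "(2 * 2^m) ^ ?n * (?k * (2 * (1/2)^m) ^ ?n) = ?k * ((2 * 2^m) * (2 * (1/2)^m)) ^ ?n"
      by (simp only: power_mult_distrib mult_ac)
    also have "(2 * 2^m) * (2 * (1/2)^m) = (4::real)" by (simp add: power_one_over)
    finally show "ennreal ((2 * 2^m) ^ ?n) * emeasure lebesgue (?B m) = ennreal (?k * 4 ^ ?n)" .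
  qed simp
  also have "\<dots> = ennreal (?k * 4 ^ ?n * real K)"
    by (simp add: ennreal_mult mult.commute ennreal_of_nat_eq_real_of_nat)
  finally show ?thesis .
qed

section \<open>Truncation and the dyadic heights that remain\<close>

text \<open>The height is coupled to the scale index: at distances above
  \<open>(1/2) ^ (2 * K)\<close> difference quotients of truncated values stay below
  \<open>2 ^ (3 * K + 1)\<close>.\<close>

definition truncate :: "nat \<Rightarrow> real \<Rightarrow> real" where
  "truncate K t = max (- (2 ^ K)) (min (2 ^ K) t)"

lemma truncate_bound: "\<bar>truncate K t\<bar> \<le> 2 ^ K" "\<bar>truncate K t\<bar> \<le> \<bar>t\<bar>"
proof -
  have "\<bar>max (- c) (min c t)\<bar> \<le> c" "\<bar>max (- c) (min c t)\<bar> \<le> \<bar>t\<bar>" if "0 < c" for c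
    using that by (auto simp: max_def min_def abs_if)
  from this[of "2 ^ K"] show "\<bar>truncate K t\<bar> \<le> 2 ^ K" "\<bar>truncate K t\<bar> \<le> \<bar>t\<bar>"
    by (simp_all add: truncate_def)
qed

lemma truncate_diff: "\<bar>truncate K s - truncate K t\<bar> \<le> \<bar>s - t\<bar>"
  by (auto simp: truncate_def max_def min_def)

lemma truncate_measurable [measurable]: "truncate K \<in> borel_measurable borel"
  unfolding truncate_def by measurable

lemma truncate_tendsto:
  assumes "filterlim r at_top sequentially"
  shows "(\<lambda>j. truncate (r j) t) \<longlonglongrightarrow> t"
proof -
  obtain m :: nat where m: "\<bar>t\<bar> < 2 ^ m" using real_arch_pow[of 2 "\<bar>t\<bar>"] by auto
  have "eventually (\<lambda>j. m \<le> r j) sequentially" using assms by (simp add: filterlim_at_top)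
  then have "eventually (\<lambda>j. truncate (r j) t = t) sequentially"
  proof eventually_elim
    fix j assume "m \<le> r j"
    then have "(2::real) ^ m \<le> 2 ^ r j" by (intro power_increasing) auto
    then show "truncate (r j) t = t" using m unfolding truncate_def by linarith
  qed
  then show ?thesis by (rule tendsto_eventually)
qed

lemma dyadic_exponent:
  fixes q :: real
  assumes "0 < q"
  obtains l :: int where "2 powr l < q" "q \<le> 2 powr (l + 1)" "log 2 q - 1 \<le> l" "l < log 2 q"
proof
  let ?l = "\<lceil>log 2 q\<rceil> - 1"
  have q: "q = 2 powr (log 2 q)" using assms by simp
  show "log 2 q - 1 \<le> ?l" "?l < log 2 q" by linarith+
  then show "2 powr ?l < q" by (subst q) (rule powr_less_mono, auto)
  show "q \<le> 2 powr (?l + 1)" by (subst q, rule powr_mono) (auto simp: le_of_int_ceiling)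
qed

context convexified_bbfs
begin

text \<open>The binary logarithm of a relevant quotient lies between \<open>- real K\<close> and
  \<open>3 * real K + 1\<close>. Dividing by \<open>dist x y powr (\<gamma> / p)\<close> shifts it
  by at most \<open>2 * real K * \<bar>\<gamma>\<bar>\<close>, and rounding costs one more; as
  \<open>1 \<le> K\<close>, the coefficient 5 absorbs the additive constants.\<close>

definition levels :: "real \<Rightarrow> nat \<Rightarrow> int set" where
  "levels \<gamma> K = {- (int K * (5 + 2 * \<lceil>\<bar>\<gamma>\<bar>\<rceil>)) .. int K * (5 + 2 * \<lceil>\<bar>\<gamma>\<bar>\<rceil>)}"

text \<open>Quotients of size at most \<open>2 powr (- real K)\<close> go into the first summand.
  For the others, \<open>D / dist x y powr (\<gamma> / p)\<close> lies between consecutive powers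
  \<open>2 powr l\<close> and \<open>2 powr (l + 1)\<close>, and since truncation does not increase
  differences the pair belongs to the level set at height \<open>2 powr l\<close>.\<close>

lemma difference_quotient_levels:
  fixes x y :: 'a
  assumes xy: "x \<in> \<Omega>" "y \<in> \<Omega>" and K: "1 \<le> K" and d: "(1/2)^(2*K) < dist x y" "dist x y < (1/2)^K"
  shows "(\<bar>truncate K (f y) - truncate K (f x)\<bar> / dist x y) powr p
     \<le> 2 powr (- (real K * p)) + (\<Sum>l\<in>levels \<gamma> K. 2 powr ((real_of_int l + 1) * p) * dist x y powr \<gamma> * indicator (E_set \<Omega> f (2 powr l) (\<gamma> / p)) (x, y))"
proof -
  let ?d = "dist x y"
  let ?X = "2 * real_of_int \<lceil>\<bar>\<gamma>\<bar>\<rceil>"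
  let ?Y = "int K * (5 + 2 * \<lceil>\<bar>\<gamma>\<bar>\<rceil>)"
  let ?Z = "\<lambda>l. E_set \<Omega> f (2 powr l) (\<gamma> / p)"
  define D where "D = \<bar>truncate K (f y) - truncate K (f x)\<bar> / ?d"
  have d0: "0 < ?d" using d(1) by (meson less_trans zero_less_power zero_less_divide_1_iff zero_less_numeral)
  have D0: "0 \<le> D" using d0 by (simp add: D_def)
  have S0: "0 \<le> (\<Sum>l\<in>levels \<gamma> K. 2 powr ((real_of_int l + 1) * p) * ?d powr \<gamma> * indicator (?Z l) (x, y) :: real)"
    by (intro sum_nonneg) (auto simp: indicator_def)
  show ?thesis
  proof (cases "D \<le> 2 powr (- real K)")
    case True
    then have "D powr p \<le> (2 powr (- real K)) powr p" using D0 p by (intro powr_mono2) auto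
    then show ?thesis using S0 by (simp add: D_def powr_powr)
  next
    case False
    moreover have "(0::real) < 2 powr (- real K)" by simp
    ultimately have Dpos: "0 < D" by linarith
    define q where "q = D / ?d powr (\<gamma> / p)"
    have q0: "0 < q" using Dpos d0 by (simp add: q_def)
    obtain l :: int where l: "2 powr l < q" "q \<le> 2 powr (l + 1)" "log 2 q - 1 \<le> l" "l < log 2 q"
      using dyadic_exponent[OF q0] by blast
    have logd: "\<bar>log 2 ?d\<bar> \<le> 2 * real K"
    proof -
      have "log 2 ((1/2)^(2*K)) < log 2 ?d" using d d0 by (subst log_less_cancel_iff) auto
      moreover have "log 2 ((1/2::real)^(2*K)) = - (2 * real K)" by (simp add: log_nat_power log_divide)
      moreover have "log 2 ?d \<le> 0"
      proof -
        show ?thesis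
          using d(2) power_le_one[of "1/2::real" K] d0 by (simp add: log_le_zero_cancel_iff)
      qed
      ultimately show ?thesis by simp
    qed
    have logq: "log 2 q = log 2 D - (\<gamma> / p) * log 2 ?d"
      unfolding q_def using Dpos d0 by (simp add: log_divide log_powr)
    have gd: "\<bar>(\<gamma> / p) * log 2 ?d\<bar> \<le> \<bar>\<gamma>\<bar> * (2 * real K)"
    proof -
      have "\<bar>\<gamma> / p\<bar> \<le> \<bar>\<gamma>\<bar>" using p by (simp add: abs_divide divide_le_eq mult_left_le_one_le)
        (metis abs_ge_zero mult.commute mult_le_cancel_right1 not_le)
      then show ?thesis unfolding abs_mult[of "\<gamma> / p"] using logd by (intro mult_mono) auto
    qed
    have logD1: "- real K \<le> log 2 D"
    proof -
      have "log 2 (2 powr (- real K)) \<le> log 2 D"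
        using False Dpos by (subst log_le_cancel_iff) auto
      then show ?thesis by simp
    qed
    have logD2: "log 2 D \<le> 3 * real K + 1"
    proof -
      have "log 2 D \<le> log 2 (2 * 2 ^ K / ?d)"
        using truncate_bound(1)[of K "f y"] truncate_bound(1)[of K "f x"] d0 Dpos unfolding D_def by (simp add: divide_right_mono)
      also have "\<dots> = 1 + real K - log 2 ?d" using d0 by (simp add: log_divide log_mult log_nat_power)
      finally show ?thesis using logd by linarith
    qed
    have lin: "l \<in> levels \<gamma> K"
    proof -
      have c: "\<bar>\<gamma>\<bar> * (2 * real K) \<le> real K * ?X"
        using mult_right_mono[OF le_of_int_ceiling[of "\<bar>\<gamma>\<bar>"], of "2 * real K"] by (simp add: mult_ac)
      have K1: "1 \<le> real K" using K by simp
      have ub: "real_of_int l \<le> real K * 5 + real K * ?X"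
        using l(4) logq abs_le_D2[OF gd] logD2 c K1 by linarith
      have lb: "- (real K * 5 + real K * ?X) \<le> real_of_int l"
        using l(3) logq abs_le_D1[OF gd] logD1 c K1 by linarith
      have "real K * 5 + real K * ?X = real_of_int ?Y" by (simp add: distrib_left)
      then have "real_of_int l \<le> real_of_int ?Y"
        "real_of_int (- ?Y) \<le> real_of_int l"
        using ub lb by simp_all
      then show ?thesis unfolding levels_def atLeastAtMost_iff of_int_le_iff by blast
    qed
    have E: "(x, y) \<in> E_set \<Omega> f (2 powr l) (\<gamma> / p)"
    proof -
      have "2 powr l * ?d powr (\<gamma> / p) * ?d < D * ?d"
        using l(1) d0 by (simp add: q_def field_simps)
      also have "D * ?d = \<bar>truncate K (f y) - truncate K (f x)\<bar>" using d0 by (simp add: D_def)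
      also have "\<dots> \<le> \<bar>f x - f y\<bar>" using truncate_diff[of K "f y" "f x"] by (simp add: abs_minus_commute)
      finally show ?thesis using xy d0 by (auto simp: E_set_def powr_add mult_ac)
    qed
    have "D \<le> 2 powr (l + 1) * ?d powr (\<gamma> / p)" using l(2) d0 by (simp add: q_def field_simps)
    then have "D powr p \<le> (2 powr (l + 1) * ?d powr (\<gamma> / p)) powr p" using D0 p by (intro powr_mono2) auto
    also have "\<dots> = 2 powr ((real_of_int l + 1) * p) * ?d powr \<gamma> * indicator (?Z l) (x, y)"
      using E p0 by (simp add: powr_mult powr_powr)
    also have "\<dots> \<le> (\<Sum>l\<in>levels \<gamma> K. 2 powr ((real_of_int l + 1) * p) * ?d powr \<gamma> * indicator (?Z l) (x, y))"
      using lin by (intro member_le_sum[of l "levels \<gamma> K" "\<lambda>l. 2 powr ((real_of_int l + 1) * p) * ?d powr \<gamma> * indicator (?Z l) (x, y)"])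
        (auto simp: levels_def indicator_def)
    finally show ?thesis unfolding D_def by (simp add: add_increasing)
  qed
qed

text \<open>The kernel without the difference quotient has mass of order K on the annulus
  (\<open>log_annulus_mass\<close>). With the prefactor, this is an average over K scales whose
  total mass is bounded independently of K.\<close>

definition quotient_average :: "('a \<Rightarrow> real) \<Rightarrow> nat \<Rightarrow> 'a \<Rightarrow> ennreal" where
  "quotient_average u K x = ennreal (1 / real K) * (\<integral>\<^sup>+ y. ennreal ((\<bar>u y - u x\<bar> / dist x y) *
     (dist x y powr (- real DIM('a)) * indicator {y. (1/2)^(2*K) < dist x y \<and> dist x y < (1/2)^K} y)) \<partial>lebesgue)"

lemma quotient_average_measurable:
  assumes [measurable]: "u \<in> borel_measurable lebesgue"
  shows "quotient_average u K \<in> borel_measurable lebesgue"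
proof -
  have "(\<lambda>z. ennreal ((\<bar>u (snd z) - u (fst z)\<bar> / dist (fst z) (snd z)) *
     (dist (fst z) (snd z) powr (- real DIM('a)) * (if (1/2)^(2*K) < dist (fst z) (snd z) \<and> dist (fst z) (snd z) < (1/2)^K then 1 else 0))))
     \<in> borel_measurable (lebesgue \<Otimes>\<^sub>M lebesgue)"
    by measurable
  from lebesgue.borel_measurable_nn_integral_fst[OF this]
  show ?thesis unfolding quotient_average_def[abs_def] by (simp add: indicator_def of_bool_def)
qed

text \<open>The power mean inequality leaves a factor \<open>1 / real K\<close>, while each of the
  at most \<open>3 * c3 * real K\<close> levels contributes at most
  \<open>2 powr p * S powr p\<close>; the two occurrences of K cancel. The summand 1 in
  \<open>1 + S\<close> comes from the small quotients, whose norm the assumption on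
  \<open>indicator A\<close> controls.\<close>

lemma quotient_average_bound:
  obtains C :: real where "0 < C"
    "\<And>\<Omega> f K A S. open \<Omega> \<Longrightarrow> (\<lambda>x. if x \<in> \<Omega> then f x else 0) \<in> borel_measurable lebesgue \<Longrightarrow> 1 \<le> K \<Longrightarrow>
      A \<in> sets lebesgue \<Longrightarrow> (\<And>x. x \<in> A \<Longrightarrow> ball x ((1/2)^K) \<subseteq> \<Omega>) \<Longrightarrow> ennreal ((1/2)^K) * N (indicator A) \<le> 1 \<Longrightarrow>
      level_sup N \<Omega> f p \<gamma> \<le> ennreal S \<Longrightarrow> 0 \<le> S \<Longrightarrow>
      enorm N (\<lambda>x. quotient_average (\<lambda>x. truncate K (if x \<in> \<Omega> then f x else 0)) K x * indicator A x) \<le> ennreal (C * (1 + S))"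
proof -
  let ?n = "real DIM('a)"
  let ?X = "\<lambda>l. 2 powr ((real_of_int l + 1) * p)"
  let ?U = "lebesgue \<Otimes>\<^sub>M lebesgue"
  let ?W = "\<lambda>l. (real_of_int l + 1) * p"
  define c2 where "c2 = unit_ball_vol ?n * 4 ^ DIM('a)"
  have c2: "0 < c2" by (simp add: c2_def)
  define c3 where "c3 = real_of_int (5 + 2 * \<lceil>\<bar>\<gamma>\<bar>\<rceil>)"
  have c3: "5 \<le> c3" unfolding c3_def by simp
  let ?H = "c2 + 3 * c3 * 2 powr p"
  define C0 where "C0 = 2 powr p * c2 powr (p - 1) * ?H"
  have C0: "0 < C0" using c2 c3 by (simp add: C0_def add_pos_pos)
  show thesis
  proof (rule that[of "(2 * C0) powr (1 / p)"])
    show "0 < (2 * C0) powr (1 / p)" using C0 by simp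
    fix \<Omega> :: "'a set" and f :: "'a \<Rightarrow> real" and K :: nat and A :: "'a set" and S :: real
    assume op: "open \<Omega>" and f: "(\<lambda>x. if x \<in> \<Omega> then f x else 0) \<in> borel_measurable lebesgue" and K: "1 \<le> K"
      and A[measurable]: "A \<in> sets lebesgue" and Asub: "\<And>x. x \<in> A \<Longrightarrow> ball x ((1/2)^K) \<subseteq> \<Omega>"
      and NA: "ennreal ((1/2)^K) * N (indicator A) \<le> 1" and S: "level_sup N \<Omega> f p \<gamma> \<le> ennreal S" "0 \<le> S"
    define f0 where "f0 x = (if x \<in> \<Omega> then f x else 0)" for x
    have [measurable]: "f0 \<in> borel_measurable lebesgue" using f unfolding f0_def .
    define u where "u x = truncate K (f0 x)" for x
    have um[measurable]: "u \<in> borel_measurable lebesgue" unfolding u_def by measurable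
    define I where "I l x = (\<integral>\<^sup>+ y. indicator (E_set \<Omega> f (2 powr real_of_int l) (\<gamma> / p)) (x, y)
       * ennreal (dist x y powr (\<gamma> - ?n)) * indicator \<Omega> y \<partial>lebesgue)" for l :: int and x
    have Im[measurable]: "I l \<in> borel_measurable lebesgue" for l
      unfolding I_def using lebesgue.borel_measurable_nn_integral_fst[OF level_integrand_measurable[OF op f]] by simp
    have NI: "ennreal (2 powr (real_of_int l * p)) * enorm NY (I l) \<le> ennreal (S powr p)" for l
    proof -
      have "ennreal (2 powr l) * enorm N (level_fun \<Omega> f p \<gamma> (2 powr l)) \<le> level_sup N \<Omega> f p \<gamma>"
        unfolding level_sup_def by (intro SUP_upper) auto
      also have "\<dots> \<le> ennreal S" by (rule S)
      finally have "enn_powr (ennreal (2 powr l) * enorm N (level_fun \<Omega> f p \<gamma> (2 powr l))) p \<le> enn_powr (ennreal S) p"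
        using p0 by (intro enn_powr_mono) auto
      moreover have "enorm N (level_fun \<Omega> f p \<gamma> (2 powr l)) = enn_powr (enorm NY (I l)) (1 / p)"
        unfolding level_fun_eq[abs_def] I_def[symmetric] by (rule enorm_root[OF Im])
      ultimately show ?thesis using p0 S by (simp add: enn_powr_cmult enn_powr_ennreal powr_powr)
    qed
    define R where "R x = {y. (1/2)^(2*K) < dist x y \<and> dist x y < (1/2)^K}" for x :: 'a
    have Rm[measurable]: "R x \<in> sets lebesgue" for x
    proof -
      show ?thesis unfolding R_def by simp
    qed
    define T where "T x = (\<integral>\<^sup>+ y. ennreal ((\<bar>u y - u x\<bar> / dist x y) powr p * (dist x y powr (- ?n) * indicator (R x) y)) \<partial>lebesgue)" for x
    \<comment> \<open>The prefactor gives K to the power -p and the mass of the kernel gives K to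
      the power p - 1, so exactly one factor \<open>1 / real K\<close> is left.\<close>
    have W: "enn_powr (quotient_average u K x) p \<le> ennreal (2 powr p * c2 powr (p - 1) / real K) * T x" for x
    proof -
      have "enn_powr (quotient_average u K x) p = ennreal ((1 / real K) powr p) * enn_powr (\<integral>\<^sup>+ y. ennreal ((\<bar>u y - u x\<bar> / dist x y) *
         (dist x y powr (- ?n) * indicator (R x) y)) \<partial>lebesgue) p"
        unfolding quotient_average_def R_def using p0 by (intro enn_powr_cmult) auto
      also have "\<dots> \<le> ennreal ((1 / real K) powr p) * (ennreal (2 powr p * (c2 * real K) powr (p - 1)) * T x)"
        unfolding T_def
      proof (intro mult_left_mono nn_integral_power_le)
        show "(\<integral>\<^sup>+ y. ennreal (dist x y powr (- ?n) * indicator (R x) y) \<partial>lebesgue) \<le> ennreal (c2 * real K)"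
          using log_annulus_mass[OF K, of x] by (simp add: c2_def R_def)
      qed (use c2 K p in auto)
      also have "\<dots> = ennreal ((1 / real K) powr p * (2 powr p * (c2 * real K) powr (p - 1))) * T x"
        by (simp add: ennreal_mult mult.assoc)
      also have "(1 / real K) powr p * (2 powr p * (c2 * real K) powr (p - 1)) = 2 powr p * c2 powr (p - 1) / real K"
        using K c2 by (simp add: powr_mult powr_divide powr_diff)
      finally show ?thesis .
    qed
    \<comment> \<open>Balls of radius \<open>(1/2)^K\<close> about points of \<open>A\<close> lie in
      \<open>\<Omega>\<close>, so on the annulus the extension of \<open>f\<close> by zero is never
      seen.\<close>
    have Tb: "T x * indicator A x \<le> ennreal (2 powr (- (real K * p)) * (c2 * real K)) * indicator A x
        + (\<Sum>l\<in>levels \<gamma> K. ennreal (?X l) * I l x)" for x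
    proof (cases "x \<in> A")
      case True
      have x: "x \<in> \<Omega>" using Asub[OF True] by auto
      have fm1: "(\<lambda>y. ennreal (dist x y powr (- ?n) * indicator (R x) y)) \<in> borel_measurable lebesgue" by measurable
      have fm2: "(\<lambda>y. indicator (E_set \<Omega> f (2 powr real_of_int l) (\<gamma> / p)) (x, y) * ennreal (dist x y powr (\<gamma> - ?n)) * indicator \<Omega> y) \<in> borel_measurable lebesgue" for l
        using measurable_Pair2[OF level_integrand_measurable[OF op f], of x] by (simp add: comp_def)
      have "T x \<le> (\<integral>\<^sup>+ y. ennreal (2 powr (- (real K * p))) * ennreal (dist x y powr (- ?n) * indicator (R x) y)
          + (\<Sum>l\<in>levels \<gamma> K. ennreal (?X l) *
             (indicator (E_set \<Omega> f (2 powr real_of_int l) (\<gamma> / p)) (x, y) * ennreal (dist x y powr (\<gamma> - ?n)) * indicator \<Omega> y)) \<partial>lebesgue)"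
        unfolding T_def
      proof (rule nn_integral_mono)
        fix y
        let ?d = "dist x y"
        show "ennreal ((\<bar>u y - u x\<bar> / ?d) powr p * (?d powr (- ?n) * indicator (R x) y))
          \<le> ennreal (2 powr (- (real K * p))) * ennreal (?d powr (- ?n) * indicator (R x) y)
          + (\<Sum>l\<in>levels \<gamma> K. ennreal (?X l) *
             (indicator (E_set \<Omega> f (2 powr real_of_int l) (\<gamma> / p)) (x, y) * ennreal (?d powr (\<gamma> - ?n)) * indicator \<Omega> y))"
        proof (cases "y \<in> R x")
          case yR: True
          have y: "y \<in> \<Omega>" using yR Asub[OF True] by (auto simp: R_def)
          have d0: "0 < ?d" using yR by (auto simp: R_def intro: less_trans[OF _ conjunct1])
          have uf: "u y = truncate K (f y)" "u x = truncate K (f x)" using x y by (auto simp: u_def f0_def)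
          let ?e = "\<lambda>l. indicator (E_set \<Omega> f (2 powr real_of_int l) (\<gamma> / p)) (x, y) :: real"
          have "(\<bar>u y - u x\<bar> / ?d) powr p * ?d powr (- ?n) \<le> (2 powr (- (real K * p)) + (\<Sum>l\<in>levels \<gamma> K. 2 powr (?W l) * ?d powr \<gamma> * ?e l)) * ?d powr (- ?n)"
            unfolding uf using difference_quotient_levels[OF x y K, of f \<gamma>] yR by (intro mult_right_mono) (auto simp: R_def)
          also have "\<dots> = 2 powr (- (real K * p)) * ?d powr (- ?n) + (\<Sum>l\<in>levels \<gamma> K. 2 powr (?W l) * (?e l * ?d powr (\<gamma> - ?n)))"
            using d0 by (simp add: distrib_left distrib_right sum_distrib_left sum_distrib_right powr_diff powr_minus divide_inverse mult_ac)
          finally have "ennreal ((\<bar>u y - u x\<bar> / ?d) powr p * ?d powr (- ?n))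
            \<le> ennreal (2 powr (- (real K * p)) * ?d powr (- ?n) + (\<Sum>l\<in>levels \<gamma> K. 2 powr (?W l) * (?e l * ?d powr (\<gamma> - ?n))))"
            by (rule ennreal_leI)
          also have "\<dots> = ennreal (2 powr (- (real K * p))) * ennreal (?d powr (- ?n))
             + (\<Sum>l\<in>levels \<gamma> K. ennreal (?X l) * (ennreal (?e l) * ennreal (?d powr (\<gamma> - ?n))))"
               by (subst ennreal_plus) (auto simp: ennreal_mult sum_nonneg simp flip: sum_ennreal)
          finally show ?thesis using yR y by (simp add: ennreal_indicator)
        qed simp
      qed
      also have "\<dots> = ennreal (2 powr (- (real K * p))) * (\<integral>\<^sup>+ y. ennreal (dist x y powr (- ?n) * indicator (R x) y) \<partial>lebesgue)
         + (\<Sum>l\<in>levels \<gamma> K. ennreal (?X l) * I l x)"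
           unfolding I_def using fm1 fm2 by (subst nn_integral_add) (auto simp: nn_integral_cmult nn_integral_sum)
      also have "\<dots> \<le> ennreal (2 powr (- (real K * p))) * ennreal (c2 * real K)
         + (\<Sum>l\<in>levels \<gamma> K. ennreal (?X l) * I l x)"
           using log_annulus_mass[OF K, of x] by (intro add_right_mono mult_left_mono) (auto simp: c2_def R_def)
      finally show ?thesis using True c2 by (simp add: ennreal_mult)
    qed simp
    \<comment> \<open>Powers of an indicator are the indicator itself, so its norm in the
      convexification is the p-th power of its norm in the space.\<close>
    have NYA: "ennreal (2 powr (- (real K * p))) * enorm NY (indicator A) \<le> 1"
    proof -
      have "enorm NY (\<lambda>x. enn_powr (indicator A x) p) = enn_powr (enorm N (indicator A)) p"
        by (rule enorm_NY_powr) measurable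
      moreover have "(\<lambda>x. enn_powr (indicator A x) p) = (indicator A :: 'a \<Rightarrow> ennreal)"
        using enn_powr_ennreal[of 1 p] by (auto simp: indicator_def fun_eq_iff)
      moreover have "enorm N (indicator A) = N (indicator A)"
        using X.enorm_ennreal[of "indicator A"] by (simp add: ennreal_indicator)
      ultimately have "enorm NY (indicator A) = enn_powr (N (indicator A)) p" by simp
      moreover have "enn_powr (ennreal ((1/2)^K) * N (indicator A)) p \<le> enn_powr 1 p"
        using p0 by (intro enn_powr_mono NA) auto
      moreover have "enn_powr (1::ennreal) p = 1" using enn_powr_ennreal[of 1 p] by simp
      moreover have "((1/2::real)^K) powr p = 2 powr (- (real K * p))"
      proof -
        have "(1/2::real)^K = 2 powr (- real K)" by (simp add: powr_minus powr_realpow power_one_over inverse_eq_divide)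
        then show ?thesis by (simp add: powr_powr)
      qed
      ultimately show ?thesis using p0 by (simp add: enn_powr_cmult)
    qed
    have card: "real (card (levels \<gamma> K)) \<le> 3 * c3 * real K"
    proof -
      have "real (card (levels \<gamma> K)) = 2 * (real K * c3) + 1"
        by (simp add: levels_def c3_def)
      also have "1 \<le> real K * c3" using K c3 mult_mono[of 1 "real K" 1 c3] by simp
      finally show ?thesis by (simp add: mult_ac)
    qed
    have NT: "enorm NY (\<lambda>x. T x * indicator A x) \<le> ennreal (?H * real K * (1 + S powr p))"
    proof -
      have Tm: "T \<in> borel_measurable lebesgue"
      proof -
        have "(\<lambda>z. ennreal ((\<bar>u (snd z) - u (fst z)\<bar> / dist (fst z) (snd z)) powr p *
           (dist (fst z) (snd z) powr (- ?n) * (if (1/2)^(2*K) < dist (fst z) (snd z) \<and> dist (fst z) (snd z) < (1/2)^K then 1 else 0))))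
           \<in> borel_measurable ?U"
          by measurable
        from lebesgue.borel_measurable_nn_integral_fst[OF this]
        show ?thesis unfolding T_def[abs_def] R_def by (simp add: indicator_def of_bool_def)
      qed
      have "enorm NY (\<lambda>x. T x * indicator A x) \<le> enorm NY (\<lambda>x. ennreal (2 powr (- (real K * p)) * (c2 * real K)) * indicator A x
        + (\<Sum>l\<in>levels \<gamma> K. ennreal (?X l) * I l x))" using Tm Tb by (intro Y.enorm_mono) auto
      also have "\<dots> \<le> enorm NY (\<lambda>x. ennreal (2 powr (- (real K * p)) * (c2 * real K)) * indicator A x)
         + enorm NY (\<lambda>x. \<Sum>l\<in>levels \<gamma> K. ennreal (?X l) * I l x)"
           by (intro Y.enorm_add) measurable
      also have "\<dots> \<le> ennreal (c2 * real K) + ennreal (3 * c3 * real K * (2 powr p * S powr p))"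
      proof (rule add_mono)
        have "enorm NY (\<lambda>x. ennreal (2 powr (- (real K * p)) * (c2 * real K)) * indicator A x)
           = ennreal (2 powr (- (real K * p)) * (c2 * real K)) * enorm NY (indicator A)"
             using c2 by (intro Y.enorm_cmult) auto
        also have "\<dots> = ennreal (c2 * real K) * (ennreal (2 powr (- (real K * p))) * enorm NY (indicator A))"
          using c2 by (simp add: ennreal_mult mult_ac)
        also have "\<dots> \<le> ennreal (c2 * real K) * 1" by (intro mult_left_mono NYA) simp
        finally show "enorm NY (\<lambda>x. ennreal (2 powr (- (real K * p)) * (c2 * real K)) * indicator A x) \<le> ennreal (c2 * real K)" by simp
        have "enorm NY (\<lambda>x. \<Sum>l\<in>levels \<gamma> K. ennreal (?X l) * I l x)
          \<le> (\<Sum>l\<in>levels \<gamma> K. enorm NY (\<lambda>x. ennreal (?X l) * I l x))"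
          by (intro Y.enorm_sum) (auto simp: levels_def)
        also have "\<dots> \<le> (\<Sum>l\<in>levels \<gamma> K. ennreal (2 powr p * S powr p))"
        proof (rule sum_mono)
          fix l
          have "enorm NY (\<lambda>x. ennreal (?X l) * I l x) = ennreal (?X l) * enorm NY (I l)"
            by (intro Y.enorm_cmult) auto
          also have "\<dots> = ennreal (2 powr p) * (ennreal (2 powr (real_of_int l * p)) * enorm NY (I l))"
          proof -
            have e: "2 powr (?W l) = 2 powr p * 2 powr (real_of_int l * p)"
              by (simp add: distrib_right powr_add)
            show ?thesis unfolding e by (simp add: ennreal_mult mult.assoc)
          qed
          also have "\<dots> \<le> ennreal (2 powr p) * ennreal (S powr p)" by (intro mult_left_mono NI) simp
          finally show "enorm NY (\<lambda>x. ennreal (?X l) * I l x) \<le> ennreal (2 powr p * S powr p)"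
            by (simp add: ennreal_mult)
        qed
        also have "\<dots> = ennreal (real (card (levels \<gamma> K)) * (2 powr p * S powr p))"
          by (simp add: ennreal_mult ennreal_of_nat_eq_real_of_nat)
        also have "\<dots> \<le> ennreal (3 * c3 * real K * (2 powr p * S powr p))"
          by (intro ennreal_leI mult_right_mono card) auto
        finally show "enorm NY (\<lambda>x. \<Sum>l\<in>levels \<gamma> K. ennreal (?X l) * I l x)
          \<le> ennreal (3 * c3 * real K * (2 powr p * S powr p))" .
      qed
      also have "\<dots> = ennreal (c2 * real K + 3 * c3 * real K * (2 powr p * S powr p))"
        using c2 c3 by (simp flip: ennreal_plus)
      also have "\<dots> \<le> ennreal (?H * real K * (1 + S powr p))"
        using c2 c3 by (intro ennreal_leI) (simp add: algebra_simps)
      finally show ?thesis .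
    qed
    have qm: "quotient_average u K \<in> borel_measurable lebesgue" by (rule quotient_average_measurable[OF um])
    have "enn_powr (enorm N (\<lambda>x. quotient_average u K x * indicator A x)) p = enorm NY (\<lambda>x. enn_powr (quotient_average u K x * indicator A x) p)"
      using qm by (intro enorm_NY_powr[symmetric]) auto
    also have "\<dots> \<le> enorm NY (\<lambda>x. ennreal (2 powr p * c2 powr (p - 1) / real K) * (T x * indicator A x))"
    proof (intro Y.enorm_mono AE_I2)
      show "enn_powr (quotient_average u K x * indicator A x) p \<le> ennreal (2 powr p * c2 powr (p - 1) / real K) * (T x * indicator A x)" for x
        using W[of x] by (auto simp: indicator_def)
      show "(\<lambda>x. enn_powr (quotient_average u K x * indicator A x) p) \<in> borel_measurable lebesgue" using qm by measurable
      have "(\<lambda>z. ennreal ((\<bar>u (snd z) - u (fst z)\<bar> / dist (fst z) (snd z)) powr p *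
           (dist (fst z) (snd z) powr (- ?n) * (if (1/2)^(2*K) < dist (fst z) (snd z) \<and> dist (fst z) (snd z) < (1/2)^K then 1 else 0))))
           \<in> borel_measurable ?U"
        by measurable
      from lebesgue.borel_measurable_nn_integral_fst[OF this]
      have [measurable]: "T \<in> borel_measurable lebesgue" unfolding T_def[abs_def] R_def by (simp add: indicator_def of_bool_def)
      show "(\<lambda>x. ennreal (2 powr p * c2 powr (p - 1) / real K) * (T x * indicator A x)) \<in> borel_measurable lebesgue" by measurable
    qed
    also have "\<dots> = ennreal (2 powr p * c2 powr (p - 1) / real K) * enorm NY (\<lambda>x. T x * indicator A x)"
    proof (rule Y.enorm_cmult)
      have "(\<lambda>z. ennreal ((\<bar>u (snd z) - u (fst z)\<bar> / dist (fst z) (snd z)) powr p *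
           (dist (fst z) (snd z) powr (- ?n) * (if (1/2)^(2*K) < dist (fst z) (snd z) \<and> dist (fst z) (snd z) < (1/2)^K then 1 else 0))))
           \<in> borel_measurable ?U"
        by measurable
      from lebesgue.borel_measurable_nn_integral_fst[OF this]
      have [measurable]: "T \<in> borel_measurable lebesgue" unfolding T_def[abs_def] R_def by (simp add: indicator_def of_bool_def)
      show "(\<lambda>x. T x * indicator A x) \<in> borel_measurable lebesgue" by measurable
    qed simp
    also have "\<dots> \<le> ennreal (2 powr p * c2 powr (p - 1) / real K) * ennreal (?H * real K * (1 + S powr p))"
      by (intro mult_left_mono NT) simp
    also have "\<dots> = ennreal (C0 * (1 + S powr p))"
      using K c2 c3 by (simp add: C0_def mult_ac flip: ennreal_mult'')
    also have "\<dots> \<le> ennreal (2 * C0 * (1 + S) powr p)"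
    proof (intro ennreal_leI)
      have "S powr p \<le> (1 + S) powr p" using S p by (intro powr_mono2) auto
      moreover have "1 \<le> (1 + S) powr p" using S p by (intro ge_one_powr_ge_zero) auto
      ultimately show "C0 * (1 + S powr p) \<le> 2 * C0 * (1 + S) powr p"
        using mult_left_mono[of _ _ C0] C0 by fastforce
    qed
    also have "\<dots> = enn_powr (ennreal ((2 * C0) powr (1 / p) * (1 + S))) p"
      using C0 S p0 by (simp add: enn_powr_ennreal powr_mult powr_powr)
    finally have "enorm N (\<lambda>x. quotient_average u K x * indicator A x) \<le> ennreal ((2 * C0) powr (1 / p) * (1 + S))"
      using p0 by (simp add: enn_powr_le_iff)
    then show "enorm N (\<lambda>x. quotient_average (\<lambda>x. truncate K (if x \<in> \<Omega> then f x else 0)) K x * indicator A x) \<le> ennreal ((2 * C0) powr (1 / p) * (1 + S))"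
      by (simp add: u_def[abs_def] f0_def)
  qed
qed

end

section \<open>Gradients of mollifications and their pairings with test functions\<close>

lemma continuous_compact_integrable:
  fixes f :: "'a::euclidean_space \<Rightarrow> real"
  assumes "continuous_on UNIV f" and "\<And>x. x \<notin> cball z r \<Longrightarrow> f x = 0"
  shows "integrable lebesgue f"
proof -
  have "integrable lborel (\<lambda>x. indicator (cball z r) x *\<^sub>R f x)"
    using borel_integrable_compact[OF compact_cball continuous_on_subset[OF assms(1) subset_UNIV]] by (simp add: mult.commute indicator_def if_distrib cong: if_cong)
  moreover have "(\<lambda>x. indicator (cball z r) x *\<^sub>R f x) = f" using assms(2) by (auto simp: indicator_def fun_eq_iff)
  ultimately show ?thesis by (simp add: integrable_completion)
qed

lemma lebesgue_integral_reflect: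
  fixes f :: "'a::euclidean_space \<Rightarrow> real"
  assumes "f \<in> borel_measurable borel"
  shows "(LINT x|lebesgue. f (y - x)) = (LINT x|lebesgue. f x)"
  using lebesgue_integral_affine[OF assms, of "-1" y] by simp

abbreviation "DA K i h \<equiv> frechet_derivative (averaged_bump K) (at h) i"

lemma DA_continuous: "continuous_on S (\<lambda>h. DA K i h)"
  by (intro smooth_continuous smooth_frechet_derivative averaged_bump_smooth)

lemma DA_measurable [measurable]: "(\<lambda>h. DA K i h) \<in> borel_measurable borel"
  by (intro borel_measurable_continuous_onI DA_continuous)

lemma averaged_bump_measurable [measurable]: "averaged_bump K \<in> borel_measurable borel"
  by (intro borel_measurable_continuous_onI smooth_continuous averaged_bump_smooth)

lemma averaged_bump_off_cball: "h \<notin> cball 0 1 \<Longrightarrow> averaged_bump K h = 0"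
  using power_le_one[of "1/2::real" K] by (intro averaged_bump_eq_0) simp

lemma DA_off_cball: "h \<notin> cball 0 1 \<Longrightarrow> DA K i h = 0"
  using derivative_zero_off_support[OF closed_cball averaged_bump_off_cball _ smooth_has_derivative[OF averaged_bump_smooth]]
  by (metis (no_types, lifting))

text \<open>The derivative kernel has mean zero. This permits replacing \<open>u y\<close> by
  \<open>u y - u x\<close> in the mollified gradient, which is how differences of \<open>u\<close>
  appear.\<close>

lemma DA_shift_integral: "(LINT y|lebesgue. DA K i (y - x)) = 0"
proof -
  have "((\<lambda>y. averaged_bump K (y - x)) has_derivative (\<lambda>v. DA K v (y - x))) (at y)" for y
    by (rule has_derivative_compose[of "\<lambda>y. y - x" "\<lambda>v. v", OF _ smooth_has_derivative[OF averaged_bump_smooth]])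
       (auto intro!: derivative_eq_intros)
  moreover have "continuous_on UNIV (\<lambda>y. DA K i (y - x))"
    by (rule continuous_on_compose2[OF DA_continuous[of UNIV]]) (auto intro!: continuous_intros)
  moreover have "averaged_bump K (y - x) = 0" if "y \<notin> cball x 1" for y
    using that by (intro averaged_bump_off_cball) (simp add: dist_norm norm_minus_commute)
  ultimately show ?thesis by (rule integral_derivative_compact_support[where z = x and r = 1])
qed

lemma DA_shift_integrable: "integrable lebesgue (\<lambda>y. DA K i (y - x))"
proof (rule continuous_compact_integrable)
  show "continuous_on UNIV (\<lambda>y. DA K i (y - x))"
    by (rule continuous_on_compose2[OF DA_continuous[of UNIV]]) (auto intro!: continuous_intros)
  show "DA K i (y - x) = 0" if "y \<notin> cball x 1" for y
    using that by (intro DA_off_cball) (simp add: dist_norm norm_minus_commute)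
qed

text \<open>The gradient of the convolution of \<open>u\<close> with \<open>averaged_bump K\<close> (reflected).\<close>
definition mollified_gradient :: "('a::euclidean_space \<Rightarrow> real) \<Rightarrow> nat \<Rightarrow> 'a \<Rightarrow> 'a" where
  "mollified_gradient u K x = (\<Sum>i\<in>Basis. (- (LINT y|lebesgue. u y * DA K i (y - x))) *\<^sub>R i)"

lemma mollified_gradient_inner:
  "i \<in> Basis \<Longrightarrow> mollified_gradient u K x \<bullet> i = - (LINT y|lebesgue. u y * DA K i (y - x))"
  unfolding mollified_gradient_def by (rule inner_sum_left_Basis)

lemma bounded_times_integrable:
  fixes u g :: "'b \<Rightarrow> real"
  assumes [measurable]: "u \<in> borel_measurable M" and b: "\<And>y. \<bar>u y\<bar> \<le> b" and g: "integrable M g"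
  shows "integrable M (\<lambda>y. u y * g y)"
proof (rule Bochner_Integration.integrable_bound)
  show "integrable M (\<lambda>y. b * g y)" using g by (rule integrable_mult_right)
  show "(\<lambda>y. u y * g y) \<in> borel_measurable M" using borel_measurable_integrable[OF g] by measurable
  show "AE y in M. norm (u y * g y) \<le> norm (b * g y)"
  proof (rule AE_I2)
    fix y
    show "norm (u y * g y) \<le> norm (b * g y)"
      using b[of y] by (simp add: abs_mult mult_right_mono)
  qed
qed

lemma mollified_gradient_measurable:
  fixes u :: "'a::euclidean_space \<Rightarrow> real"
  assumes [measurable]: "u \<in> borel_measurable lebesgue"
  shows "mollified_gradient u K \<in> borel_measurable lebesgue"
proof -
  have "(\<lambda>x. LINT y|lebesgue. u y * DA K i (y - x)) \<in> borel_measurable lebesgue" for i :: 'a by simp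
  then show ?thesis unfolding mollified_gradient_def[abs_def] by measurable
qed

text \<open>Fubini's theorem followed by integration by parts in \<open>x\<close>, which moves the
  derivative from the kernel to \<open>\<phi>\<close>. The double integral converges absolutely
  because \<open>u\<close> is bounded and the integrand lives where \<open>x\<close> is in the
  support ball of \<open>\<phi>\<close> and \<open>y\<close> within distance 1 of it.\<close>

lemma mollified_gradient_pairing:
  fixes u \<phi> :: "'a::euclidean_space \<Rightarrow> real"
  assumes u[measurable]: "u \<in> borel_measurable lebesgue" and b: "\<And>y. \<bar>u y\<bar> \<le> b"
    and tf: "test_function \<Omega> \<phi>" and i: "i \<in> Basis"
  shows "(LINT x|lebesgue. (mollified_gradient u K x \<bullet> i) * \<phi> x)
    = - (LINT y|lebesgue. u y * (LINT x|lebesgue. averaged_bump K (y - x) * frechet_derivative \<phi> (at x) i))"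
proof -
  let ?X = "lebesgue \<Otimes>\<^sub>M lebesgue"
  let ?Y = "\<lambda>x. LINT y|lebesgue. \<phi> x * (u y * DA K i (y - x))"
  let ?Z = "\<lambda>y. LINT x|lebesgue. \<phi> x * DA K i (y - x)"
  note td = test_function_frechet_derivative[OF tf]
  have [measurable]: "\<phi> \<in> borel_measurable borel" using td(3) by (rule borel_measurable_continuous_onI)
  have [measurable]: "\<phi> \<in> borel_measurable lebesgue" by (rule borel_imp_lebesgue_measurable) measurable
  obtain r where r: "closure {x. \<phi> x \<noteq> 0} \<subseteq> cball 0 r"
    using tf unfolding test_function_def by (meson bounded_subset_ballD ball_subset_cball compact_imp_bounded order_trans)
  then have p0: "\<phi> x = 0" if "x \<notin> cball 0 r" for x using that closure_subset[of "{x. \<phi> x \<noteq> 0}"] by blast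
  have ibp: "(?Z y) = (LINT x|lebesgue. averaged_bump K (y - x) * frechet_derivative \<phi> (at x) i)" for y
  proof -
    have c1: "continuous_on UNIV (\<lambda>x. DA K i (y - x))"
      by (rule continuous_on_compose2[OF DA_continuous[of UNIV]]) (auto intro!: continuous_intros)
    have c2: "continuous_on UNIV (\<lambda>x. averaged_bump K (y - x))"
      by (rule continuous_on_compose2[OF smooth_continuous[OF averaged_bump_smooth, of UNIV]]) (auto intro!: continuous_intros)
    have d1: "((\<lambda>x. averaged_bump K (y - x)) has_derivative (\<lambda>v. DA K (- v) (y - x))) (at x)" for x
      by (rule has_derivative_compose[of "\<lambda>x. y - x" "\<lambda>v. - v", OF _ smooth_has_derivative[OF averaged_bump_smooth]])
         (auto intro!: derivative_eq_intros)
    have neg: "DA K (- v) h = - DA K v h" for v h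
      using linear_neg[OF has_derivative_linear[OF smooth_has_derivative[OF averaged_bump_smooth]]] by blast
    have d: "((\<lambda>x. averaged_bump K (y - x) * \<phi> x) has_derivative
       (\<lambda>v. averaged_bump K (y - x) * frechet_derivative \<phi> (at x) v + DA K (- v) (y - x) * \<phi> x)) (at x)" for x
      by (rule has_derivative_mult[OF d1 td(1)])
    have cc: "continuous_on UNIV (\<lambda>x. averaged_bump K (y - x) * frechet_derivative \<phi> (at x) i + DA K (- i) (y - x) * \<phi> x)"
      unfolding neg by (intro continuous_intros c1 c2 td(2)[OF i] td(3))
    have "(LINT x|lebesgue. averaged_bump K (y - x) * frechet_derivative \<phi> (at x) i + DA K (- i) (y - x) * \<phi> x) = 0"
      by (rule integral_derivative_compact_support[OF d cc, where z = 0 and r = r]) (simp add: p0)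
    moreover have "integrable lebesgue (\<lambda>x. averaged_bump K (y - x) * frechet_derivative \<phi> (at x) i)"
    proof (rule continuous_compact_integrable)
      show "continuous_on UNIV (\<lambda>x. averaged_bump K (y - x) * frechet_derivative \<phi> (at x) i)"
        by (intro continuous_intros c2 td(2)[OF i])
      show "averaged_bump K (y - x) * frechet_derivative \<phi> (at x) i = 0" if "x \<notin> cball y 1" for x
        using that averaged_bump_off_cball[of "y - x" K] by (simp add: dist_norm norm_minus_commute)
    qed
    moreover have "integrable lebesgue (\<lambda>x. \<phi> x * DA K i (y - x))"
      by (rule continuous_compact_integrable[where z = 0 and r = r]) (auto simp: p0 intro!: continuous_intros c1 td(3))
    ultimately show ?thesis by (simp add: neg mult.commute)
  qed
  have int: "integrable ?X (\<lambda>(x, y). \<phi> x * (u y * DA K i (y - x)))"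
  proof -
    obtain B1 where B1: "0 < B1" "\<And>h. \<bar>DA K i h\<bar> \<le> B1"
      using smooth_partial_compact_bound[OF smooth_frechet_derivative[OF averaged_bump_smooth], of 0 1 K i] DA_off_cball by metis
    have "compact (\<phi> ` cball 0 r)" by (intro compact_continuous_image continuous_on_subset[OF td(3)]) auto
    then obtain B2 where B2: "0 < B2" "\<forall>y\<in>\<phi> ` cball 0 r. norm y \<le> B2"
      using compact_imp_bounded bounded_pos by metis
    then have B2': "\<bar>\<phi> x\<bar> \<le> B2" for x using p0[of x] by (cases "x \<in> cball 0 r") auto
    let ?S = "cball (0::'a) \<bar>r\<bar> \<times> cball (0::'a) (\<bar>r\<bar> + 1)"
    have fin: "emeasure ?X ?S < \<infinity>"
    proof -
      have "emeasure ?X ?S = emeasure lebesgue (cball (0::'a) \<bar>r\<bar>) * emeasure lebesgue (cball (0::'a) (\<bar>r\<bar> + 1))"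
        by (rule lebesgue.emeasure_pair_measure_Times) auto
      then show ?thesis
        using emeasure_lborel_cball_finite[of "0::'a" "\<bar>r\<bar>"] emeasure_lborel_cball_finite[of "0::'a" "\<bar>r\<bar> + 1"]
        by (simp add: ennreal_mult_less_top)
    qed
    show ?thesis
    proof (rule Bochner_Integration.integrable_bound[where f = "\<lambda>z. (B2 * (\<bar>b\<bar> * B1)) * indicator ?S z"])
      show "integrable ?X (\<lambda>z. (B2 * (\<bar>b\<bar> * B1)) * indicator ?S z :: real)"
        using fin by (intro integrable_mult_right integrable_real_indicator pair_measureI) auto
      show "(\<lambda>(x, y). \<phi> x * (u y * DA K i (y - x))) \<in> borel_measurable ?X"
        by (simp add: case_prod_beta)
      show "AE z in lebesgue \<Otimes>\<^sub>M lebesgue. norm (case z of (x, y) \<Rightarrow> \<phi> x * (u y * DA K i (y - x))) \<le> norm ((B2 * (\<bar>b\<bar> * B1)) * indicator ?S z :: real)"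
      proof (rule AE_I2)
        fix z :: "'a \<times> 'a"
        obtain x y where z: "z = (x, y)" by (cases z)
        show "norm (case z of (x, y) \<Rightarrow> \<phi> x * (u y * DA K i (y - x))) \<le> norm ((B2 * (\<bar>b\<bar> * B1)) * indicator ?S z :: real)"
        proof (cases "x \<in> cball 0 \<bar>r\<bar> \<and> y \<in> cball 0 (\<bar>r\<bar> + 1)")
          case True
          have "\<bar>\<phi> x\<bar> * (\<bar>u y\<bar> * \<bar>DA K i (y - x)\<bar>) \<le> B2 * (\<bar>b\<bar> * B1)"
            using b[of y] B1 B2 B2' by (intro mult_mono) auto
          then show ?thesis using True z B1(1) B2(1) by (simp add: abs_mult)
        next
          case False
          have "\<phi> x = 0 \<or> DA K i (y - x) = 0"
          proof (cases "x \<in> cball 0 \<bar>r\<bar>")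
            case True
            then show ?thesis using False norm_triangle_ineq2[of y x] by (intro disjI2 DA_off_cball) simp
          next
            case False
            then show ?thesis using p0 by auto
          qed
          then show ?thesis using z by auto
        qed
      qed
    qed
  qed
  have "(LINT x|lebesgue. (mollified_gradient u K x \<bullet> i) * \<phi> x) = (LINT x|lebesgue. - (?Y x))"
    unfolding mollified_gradient_inner[OF i] by (intro Bochner_Integration.integral_cong) (auto simp: mult.commute)
  also have "\<dots> = - (LINT x|lebesgue. (?Y x))" by simp
  also have "(LINT x|lebesgue. (?Y x)) = (LINT y|lebesgue. (LINT x|lebesgue. \<phi> x * (u y * DA K i (y - x))))"
    by (rule lebesgue_pair.Fubini_integral[OF int, symmetric])
  also have "\<dots> = (LINT y|lebesgue. u y * (?Z y))"
  proof (intro Bochner_Integration.integral_cong refl)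
    show "(LINT x|lebesgue. \<phi> x * (u y * DA K i (y - x))) = u y * (?Z y)" for y
      unfolding mult.left_commute[of _ "u y"] by (rule Bochner_Integration.integral_mult_right_zero)
  qed
  finally show ?thesis by (simp add: ibp)
qed

text \<open>\<open>averaged_bump K\<close> is a probability density concentrated within distance
  \<open>(1/2)^K\<close>, so its averages inherit every estimate that holds at this distance. The
  first claim is the second one with \<open>a = 0\<close>.\<close>

lemma mollify_bounds:
  fixes \<xi> :: "'a::euclidean_space \<Rightarrow> real"
  assumes c: "continuous_on UNIV \<xi>" and M: "\<And>x. \<bar>\<xi> x\<bar> \<le> M" and K: "1 \<le> K"
  shows "\<bar>LINT x|lebesgue. averaged_bump K (y - x) * \<xi> x\<bar> \<le> M"
    and "(\<And>x. dist y x < (1/2)^K \<Longrightarrow> \<bar>\<xi> x - a\<bar> \<le> e) \<Longrightarrow> \<bar>(LINT x|lebesgue. averaged_bump K (y - x) * \<xi> x) - a\<bar> \<le> e"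
proof -
  let ?X = "LINT x|lebesgue. averaged_bump K (y - x) * \<xi> x"
  have c2: "continuous_on UNIV (\<lambda>x. averaged_bump K (y - x))"
    by (rule continuous_on_compose2[OF smooth_continuous[OF averaged_bump_smooth, of UNIV]]) (auto intro!: continuous_intros)
  have off: "averaged_bump K (y - x) = 0" if "x \<notin> cball y 1" for x
    using that averaged_bump_off_cball[of "y - x" K] by (simp add: dist_norm norm_minus_commute)
  have i1: "integrable lebesgue (\<lambda>x. averaged_bump K (y - x))"
    by (rule continuous_compact_integrable[OF c2 off])
  have i2: "integrable lebesgue (\<lambda>x. averaged_bump K (y - x) * \<xi> x)"
    by (rule continuous_compact_integrable[of _ y 1]) (auto simp: off intro!: continuous_intros c c2)
  have one: "(LINT x|lebesgue. averaged_bump K (y - x)) = 1"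
    using lebesgue_integral_reflect[OF averaged_bump_measurable, of K y] averaged_bump_integral[OF K, where 'a='a] by simp
  have main: "\<bar>?X - a\<bar> \<le> e"
    if H: "\<And>x. dist y x < (1/2)^K \<Longrightarrow> \<bar>\<xi> x - a\<bar> \<le> e" for a e
  proof -
    have "?X - a = (LINT x|lebesgue. averaged_bump K (y - x) * \<xi> x - averaged_bump K (y - x) * a)"
      using i1 i2 one by simp
    also have "\<bar>\<dots>\<bar> \<le> (LINT x|lebesgue. \<bar>averaged_bump K (y - x) * \<xi> x - averaged_bump K (y - x) * a\<bar>)"
      by (rule integral_abs_bound)
    also have "\<dots> \<le> (LINT x|lebesgue. averaged_bump K (y - x) * e)"
    proof (rule integral_mono)
      show "integrable lebesgue (\<lambda>x. \<bar>averaged_bump K (y - x) * \<xi> x - averaged_bump K (y - x) * a\<bar>)" using i1 i2 by auto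
      show "integrable lebesgue (\<lambda>x. averaged_bump K (y - x) * e)" using i1 by auto
      fix x
      show "\<bar>averaged_bump K (y - x) * \<xi> x - averaged_bump K (y - x) * a\<bar> \<le> averaged_bump K (y - x) * e"
      proof (cases "dist y x < (1/2)^K")
        case True
        have "averaged_bump K (y - x) * \<bar>\<xi> x - a\<bar> \<le> averaged_bump K (y - x) * e"
          using H[OF True] by (intro mult_left_mono averaged_bump_nonneg)
        then show ?thesis using averaged_bump_nonneg[of K "y - x"] by (simp add: abs_mult flip: right_diff_distrib)
      next
        case False
        then have "averaged_bump K (y - x) = 0" by (intro averaged_bump_eq_0) (simp add: dist_norm)
        then show ?thesis by simp
      qed
    qed
    also have "\<dots> = e" using one by simp
    finally show ?thesis .
  qed
  show "\<bar>LINT x|lebesgue. averaged_bump K (y - x) * \<xi> x\<bar> \<le> M" using main[of 0 M] M by simp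
  show "(\<And>x. dist y x < (1/2)^K \<Longrightarrow> \<bar>\<xi> x - a\<bar> \<le> e) \<Longrightarrow> \<bar>?X - a\<bar> \<le> e"
    by (rule main)
qed

context convexified_bbfs
begin

text \<open>Subtracting \<open>u x\<close> under the integral and inserting
  \<open>averaged_bump_partial_bound\<close> gives each component. The power
  \<open>- real DIM('a) - 1\<close> splits into the denominator of the difference quotient and the
  logarithmic kernel.\<close>

lemma mollified_gradient_norm:
  obtains B :: real where "0 < B"
    "\<And>u b K x. u \<in> borel_measurable lebesgue \<Longrightarrow> (\<And>y. \<bar>u y\<bar> \<le> b) \<Longrightarrow> 1 \<le> K \<Longrightarrow>
       ennreal (norm (mollified_gradient u K x)) \<le> ennreal B * quotient_average u K x"
proof -
  obtain B :: real where B: "0 < B"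
    "\<And>K (h::'a) i. i \<in> Basis \<Longrightarrow> 1 \<le> K \<Longrightarrow> \<bar>DA K i h\<bar>
       \<le> B / real K * (norm h powr (- real DIM('a) - 1) * indicator {h. (1/2)^(2*K) < norm h \<and> norm h < (1/2)^K} h)"
    using averaged_bump_partial_bound by blast
  show thesis
  proof (rule that[of "real DIM('a) * B"])
    show "0 < real DIM('a) * B" using B by simp
    fix u :: "'a \<Rightarrow> real" and b :: real and K :: nat and x :: 'a
    assume u[measurable]: "u \<in> borel_measurable lebesgue" and b: "\<And>y. \<bar>u y\<bar> \<le> b" and K: "1 \<le> K"
    have comp: "ennreal \<bar>mollified_gradient u K x \<bullet> i\<bar> \<le> ennreal B * quotient_average u K x" if i: "i \<in> Basis" for i
    proof -
      have int: "integrable lebesgue (\<lambda>y. u y * DA K i (y - x))"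
        by (rule bounded_times_integrable[OF u b DA_shift_integrable])
      have int': "integrable lebesgue (\<lambda>y. u x * DA K i (y - x))"
        by (intro integrable_mult_right DA_shift_integrable)
      have int2: "integrable lebesgue (\<lambda>y. (u y - u x) * DA K i (y - x))"
        using int int' by (simp add: left_diff_distrib)
      have "ennreal \<bar>mollified_gradient u K x \<bullet> i\<bar> \<le> (\<integral>\<^sup>+ y. ennreal (norm ((u y - u x) * DA K i (y - x))) \<partial>lebesgue)"
        using integral_norm_bound_ennreal[OF int2] unfolding mollified_gradient_inner[OF i] by (simp add: left_diff_distrib Bochner_Integration.integral_diff[OF int int'] DA_shift_integral)
      also have "\<dots> \<le> (\<integral>\<^sup>+ y. ennreal (B / real K) * ennreal ((\<bar>u y - u x\<bar> / dist x y) *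
         (dist x y powr (- real DIM('a)) * indicator {y. (1/2)^(2*K) < dist x y \<and> dist x y < (1/2)^K} y)) \<partial>lebesgue)"
      proof (rule nn_integral_mono)
        fix y
        let ?d = "dist x y"
        have nd: "norm (y - x) = ?d" by (simp add: dist_norm norm_minus_commute)
        have "norm ((u y - u x) * DA K i (y - x)) \<le> \<bar>u y - u x\<bar> * (B / real K * (?d powr (- real DIM('a) - 1) * indicator {y. (1/2)^(2*K) < dist x y \<and> dist x y < (1/2)^K} y))"
          using B(2)[OF i K, of "y - x"] unfolding real_norm_def abs_mult nd by (intro mult_left_mono) (auto simp: indicator_def nd)
        also have "\<dots> = B / real K * ((\<bar>u y - u x\<bar> / ?d) * (?d powr (- real DIM('a)) * indicator {y. (1/2)^(2*K) < dist x y \<and> dist x y < (1/2)^K} y))"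
          by (cases "?d = 0") (auto simp: powr_diff)
        finally have "ennreal (norm ((u y - u x) * DA K i (y - x))) \<le> ennreal (B / real K * ((\<bar>u y - u x\<bar> / ?d) * (?d powr (- real DIM('a)) * indicator {y. (1/2)^(2*K) < dist x y \<and> dist x y < (1/2)^K} y)))"
          by (rule ennreal_leI)
        also have "\<dots> = ennreal (B / real K) * ennreal ((\<bar>u y - u x\<bar> / ?d) * (?d powr (- real DIM('a)) * indicator {y. (1/2)^(2*K) < dist x y \<and> dist x y < (1/2)^K} y))"
          using B(1) by (intro ennreal_mult) auto
        finally show "ennreal (norm ((u y - u x) * DA K i (y - x))) \<le> ennreal (B / real K) * ennreal ((\<bar>u y - u x\<bar> / ?d) * (?d powr (- real DIM('a)) * indicator {y. (1/2)^(2*K) < dist x y \<and> dist x y < (1/2)^K} y))" .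
      qed
      also have "\<dots> = ennreal (B / real K) * (\<integral>\<^sup>+ y. ennreal ((\<bar>u y - u x\<bar> / dist x y) *
         (dist x y powr (- real DIM('a)) * indicator {y. (1/2)^(2*K) < dist x y \<and> dist x y < (1/2)^K} y)) \<partial>lebesgue)"
      proof (rule nn_integral_cmult)
        have [measurable]: "{y. (1/2)^(2*K) < dist x y \<and> dist x y < (1/2)^K} \<in> sets lebesgue"
          by simp
        show "(\<lambda>y. ennreal ((\<bar>u y - u x\<bar> / dist x y) *
         (dist x y powr (- real DIM('a)) * indicator {y. (1/2)^(2*K) < dist x y \<and> dist x y < (1/2)^K} y))) \<in> borel_measurable lebesgue"
          by measurable
      qed
      also have "\<dots> = ennreal B * quotient_average u K x"
      proof -
        have "ennreal (B / real K) = ennreal B * ennreal (1 / real K)" using B(1) by (simp flip: ennreal_mult)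
        then show ?thesis by (simp add: quotient_average_def mult.assoc)
      qed
      finally show ?thesis .
    qed
    have "ennreal (norm (mollified_gradient u K x)) \<le> ennreal (\<Sum>i\<in>Basis. \<bar>mollified_gradient u K x \<bullet> i\<bar>)"
      by (intro ennreal_leI norm_le_l1)
    also have "\<dots> = (\<Sum>i\<in>Basis. ennreal \<bar>mollified_gradient u K x \<bullet> i\<bar>)" by (simp add: sum_ennreal)
    also have "\<dots> \<le> (\<Sum>i\<in>(Basis::'a set). ennreal B * quotient_average u K x)" by (intro sum_mono comp)
    also have "\<dots> = ennreal (real DIM('a) * B) * quotient_average u K x"
      using B(1) by (simp add: ennreal_mult mult.assoc ennreal_of_nat_eq_real_of_nat)
    finally show "ennreal (norm (mollified_gradient u K x)) \<le> ennreal (real DIM('a) * B) * quotient_average u K x" .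
  qed
qed

text \<open>Mollification is possible only at a distance from the boundary, so the gradients are cut
  off to an exhausting sequence of compact sets, each with its own scale. The norm bound survives
  the cut-off, and the cut-off is invisible to any given test function from some index on.\<close>

lemma approximating_fields:
  obtains C :: real where "0 < C"
    "\<And>\<Omega> f S. open \<Omega> \<Longrightarrow> locally_integrable_on f \<Omega> \<Longrightarrow> level_sup N \<Omega> f p \<gamma> \<le> ennreal S \<Longrightarrow> 0 \<le> S \<Longrightarrow>
      \<exists>v :: nat \<Rightarrow> 'a \<Rightarrow> 'a. (\<forall>j. v j \<in> borel_measurable lebesgue) \<and> (\<forall>j. N (\<lambda>x. norm (v j x)) \<le> ennreal (C * (1 + S))) \<and>
        (\<forall>\<phi> i. test_function \<Omega> \<phi> \<longrightarrow> i \<in> Basis \<longrightarrow>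
          (\<lambda>j. LINT x|lebesgue. (v j x \<bullet> i) * \<phi> x) \<longlonglongrightarrow> - (LINT x:\<Omega>|lebesgue. f x * frechet_derivative \<phi> (at x) i))"
proof -
  obtain B :: real where B: "0 < B"
    "\<And>u b K x. u \<in> borel_measurable lebesgue \<Longrightarrow> (\<And>y. \<bar>u y\<bar> \<le> b) \<Longrightarrow> 1 \<le> K \<Longrightarrow>
       ennreal (norm (mollified_gradient u K x)) \<le> ennreal B * quotient_average u K x"
         using mollified_gradient_norm by blast
  obtain C :: real where C: "0 < C"
    "\<And>\<Omega> f K A S. open \<Omega> \<Longrightarrow> (\<lambda>x. if x \<in> \<Omega> then f x else 0) \<in> borel_measurable lebesgue \<Longrightarrow> 1 \<le> K \<Longrightarrow>
      A \<in> sets lebesgue \<Longrightarrow> (\<And>x. x \<in> A \<Longrightarrow> ball x ((1/2)^K) \<subseteq> \<Omega>) \<Longrightarrow> ennreal ((1/2)^K) * N (indicator A) \<le> 1 \<Longrightarrow>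
      level_sup N \<Omega> f p \<gamma> \<le> ennreal S \<Longrightarrow> 0 \<le> S \<Longrightarrow>
      enorm N (\<lambda>x. quotient_average (\<lambda>x. truncate K (if x \<in> \<Omega> then f x else 0)) K x * indicator A x) \<le> ennreal (C * (1 + S))"
        using quotient_average_bound by blast
  show thesis
  proof (rule that[of "B * C"])
    show "0 < B * C" using B C by simp
    fix \<Omega> :: "'a set" and f :: "'a \<Rightarrow> real" and S :: real
    assume op: "open \<Omega>" and lf: "locally_integrable_on f \<Omega>" and S: "level_sup N \<Omega> f p \<gamma> \<le> ennreal S" "0 \<le> S"
    have fm: "(\<lambda>x. if x \<in> \<Omega> then f x else 0) \<in> borel_measurable lebesgue"
      by (rule locally_integrable_measurable[OF op lf])
    define f0 where "f0 x = (if x \<in> \<Omega> then f x else 0)" for x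
    have [measurable]: "f0 \<in> borel_measurable lebesgue" using fm unfolding f0_def .
    obtain Q where Q: "\<And>k::nat. compact (Q k)" "\<And>k. Q k \<subseteq> \<Omega>"
      "\<And>C. compact C \<Longrightarrow> C \<subseteq> \<Omega> \<Longrightarrow> \<exists>k. C \<subseteq> interior (Q k)" "\<And>k l. k \<le> l \<Longrightarrow> Q k \<subseteq> Q l"
      using open_compact_exhaustion[OF op] by blast
    have Qm[measurable]: "Q j \<in> sets lebesgue" for j using Q(1)[of j] by (simp add: borel_compact)
    \<comment> \<open>Three demands on the scale: it must tend to 0, leave room inside
      \<open>\<Omega>\<close>, and be small against the norm of the indicator of \<open>Q j\<close>,
      as \<open>quotient_average_bound\<close> requires.\<close>
    have "\<exists>K. 1 \<le> K \<and> j \<le> K \<and> (\<forall>x\<in>Q j. ball x ((1/2)^K) \<subseteq> \<Omega>) \<and> ennreal ((1/2)^K) * N (indicator (Q j)) \<le> 1" for j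
    proof -
      obtain e where e: "0 < e" "(\<Union>x\<in>Q j. ball x e) \<subseteq> \<Omega>"
        using compact_subset_open_imp_ball_epsilon_subset[OF Q(1) op Q(2)] by blast
      obtain r where "Q j \<subseteq> ball 0 r" using compact_imp_bounded[OF Q(1)] by (meson bounded_subset_ballD)
      then have "N (indicator (Q j)) \<le> N (indicator (ball 0 r))"
        by (intro X.mono AE_I2) (auto simp: indicator_def)
      then have "N (indicator (Q j)) < \<infinity>" using X.indicator_ball by (rule order_le_less_trans)
      then obtain t where t: "0 \<le> t" "N (indicator (Q j)) = ennreal t" by (cases "N (indicator (Q j))") auto
      obtain k1 where k1: "(1/2::real)^k1 < e" using real_arch_pow_inv[of e "1/2"] e by auto
      obtain k2 where k2: "(1/2::real)^k2 < 1 / (1 + t)" using real_arch_pow_inv[of "1/(1+t)" "1/2"] t by auto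
      define K where "K = Suc (max j (max k1 k2))"
      have "(1/2::real)^K \<le> (1/2)^k1" "(1/2::real)^K \<le> (1/2)^k2" unfolding K_def by (intro power_decreasing; simp)+
      then have K: "(1/2::real)^K < e" "(1/2::real)^K < 1 / (1 + t)" using k1 k2 by linarith+
      have "(1/2)^K * t \<le> 1"
      proof -
        have "(1/2)^K * t \<le> 1 / (1 + t) * t" using K t by (intro mult_right_mono) auto
        also have "\<dots> \<le> 1" using t by (simp add: field_simps)
        finally show ?thesis .
      qed
      then have "ennreal ((1/2)^K) * N (indicator (Q j)) \<le> 1"
        using t by (simp add: ennreal_mult[symmetric] ennreal_le_1)
      moreover have "ball x ((1/2)^K) \<subseteq> \<Omega>" if "x \<in> Q j" for x
        using e(2) that subset_ball[of "(1/2)^K" e x] K(1) by (meson SUP_upper less_imp_le order_trans)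
      ultimately show ?thesis by (intro exI[of _ K]) (auto simp: K_def)
    qed
    then obtain r where r: "\<And>j. 1 \<le> r j" "\<And>j. j \<le> r j" "\<And>j x. x \<in> Q j \<Longrightarrow> ball x ((1/2)^r j) \<subseteq> \<Omega>"
      "\<And>j. ennreal ((1/2)^r j) * N (indicator (Q j)) \<le> 1" by metis
    have r_lim: "filterlim r at_top sequentially"
      unfolding filterlim_at_top using r(2) by (meson eventually_sequentiallyI order_trans)
    define u where "u j x = truncate (r j) (f0 x)" for j x
    have um[measurable]: "u j \<in> borel_measurable lebesgue" for j unfolding u_def by measurable
    have ub: "\<bar>u j x\<bar> \<le> 2 ^ r j" "\<bar>u j x\<bar> \<le> \<bar>f0 x\<bar>" for j x unfolding u_def by (rule truncate_bound)+
    define v where "v j x = indicator (Q j) x *\<^sub>R mollified_gradient (u j) (r j) x" for j x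
    have gm[measurable]: "mollified_gradient (u j) (r j) \<in> borel_measurable lebesgue" for j
      by (rule mollified_gradient_measurable[OF um])
    have vm[measurable]: "v j \<in> borel_measurable lebesgue" for j unfolding v_def by measurable
    have Nv: "N (\<lambda>x. norm (v j x)) \<le> ennreal (B * C * (1 + S))" for j
    proof -
      have qm: "quotient_average (u j) (r j) \<in> borel_measurable lebesgue" by (rule quotient_average_measurable[OF um])
      have "N (\<lambda>x. norm (v j x)) = enorm N (\<lambda>x. ennreal (norm (v j x)))"
        using X.enorm_ennreal[of "\<lambda>x. norm (v j x)"] by simp
      also have "\<dots> \<le> enorm N (\<lambda>x. ennreal B * (quotient_average (u j) (r j) x * indicator (Q j) x))"
      proof (intro X.enorm_mono AE_I2)
        show "ennreal (norm (v j x)) \<le> ennreal B * (quotient_average (u j) (r j) x * indicator (Q j) x)" for x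
          using B(2)[OF um[of j] ub(1)[of j] r(1)[of j], of x] by (auto simp: v_def indicator_def)
        show "(\<lambda>x. ennreal B * (quotient_average (u j) (r j) x * indicator (Q j) x)) \<in> borel_measurable lebesgue"
          using qm by measurable
      qed measurable
      also have "\<dots> = ennreal B * enorm N (\<lambda>x. quotient_average (u j) (r j) x * indicator (Q j) x)"
        using B(1) qm by (intro X.enorm_cmult) auto
      also have "\<dots> \<le> ennreal B * ennreal (C * (1 + S))"
        using C(2)[OF op fm r(1) Qm r(3) r(4) S, of j] by (intro mult_left_mono) (auto simp: u_def[abs_def] f0_def)
      also have "\<dots> = ennreal (B * C * (1 + S))" using B C S by (simp add: ennreal_mult mult.assoc)
      finally show ?thesis .
    qed
    have lim: "(\<lambda>j. LINT x|lebesgue. (v j x \<bullet> i) * \<phi> x) \<longlonglongrightarrow> - (LINT x:\<Omega>|lebesgue. f x * frechet_derivative \<phi> (at x) i)"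
      if tf: "test_function \<Omega> \<phi>" and i: "i \<in> Basis" for \<phi> i
    proof -
      note td = test_function_frechet_derivative[OF tf]
      let ?C = "closure {x. \<phi> x \<noteq> 0}"
      have Cc: "compact ?C" "?C \<subseteq> \<Omega>" using tf by (auto simp: test_function_def)
      have p0: "\<phi> x = 0" if "x \<notin> ?C" for x using that closure_subset[of "{x. \<phi> x \<noteq> 0}"] by blast
      define \<xi> where "\<xi> x = frechet_derivative \<phi> (at x) i" for x
      have chi0: "\<xi> x = 0" if "x \<notin> ?C" for x
        using derivative_zero_off_support[OF closed_closure p0 that td(1)] by (simp add: \<xi>_def)
      have chic: "continuous_on UNIV \<xi>" unfolding \<xi>_def by (rule td(2)[OF i])
      have chim[measurable]: "\<xi> \<in> borel_measurable borel" using chic by (rule borel_measurable_continuous_onI)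
      have "compact (\<xi> ` ?C)" by (intro compact_continuous_image continuous_on_subset[OF chic] Cc) auto
      then obtain M where M0: "0 < M" and "\<forall>y\<in>\<xi> ` ?C. norm y \<le> M" using compact_imp_bounded bounded_pos by metis
      then have M: "\<bar>\<xi> x\<bar> \<le> M" for x using chi0[of x] by (cases "x \<in> ?C") auto
      obtain j0 where j0: "?C \<subseteq> interior (Q j0)" using Q(3)[OF Cc] by blast
      obtain e where e: "0 < e" "(\<Union>x\<in>?C. ball x e) \<subseteq> interior (Q j0)"
        using compact_subset_open_imp_ball_epsilon_subset[OF Cc(1) open_interior j0] by blast
      define \<theta> where "\<theta> j y = (LINT x|lebesgue. averaged_bump (r j) (y - x) * \<xi> x)" for j y
      have theta_M: "\<bar>\<theta> j y\<bar> \<le> M" for j y unfolding \<theta>_def by (rule mollify_bounds(1)[OF chic M r(1)])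
      have half_lim: "(\<lambda>j. (1/2::real)^r j) \<longlonglongrightarrow> 0"
        using filterlim_compose[OF LIMSEQ_realpow_zero r_lim, of "1/2"] by simp
      obtain j1 where j1: "\<And>j. j1 \<le> j \<Longrightarrow> (1/2::real)^r j < e"
        using order_tendstoD(2)[OF half_lim e(1)] by (auto simp: eventually_sequentially)
      have theta0: "\<theta> j y = 0" if j: "j1 \<le> j" and y: "y \<notin> Q j0" for j y
      proof -
        have "\<xi> x = 0" if "dist y x < (1/2)^r j" for x
        proof (rule ccontr)
          assume "\<xi> x \<noteq> 0"
          then have "x \<in> ?C" using chi0 by blast
          moreover have "y \<in> ball x e" using that j1[OF j] by (simp add: dist_commute)
          ultimately show False using e(2) y interior_subset by blast
        qed
        then have "\<bar>\<theta> j y - 0\<bar> \<le> 0" unfolding \<theta>_def by (intro mollify_bounds(2)[OF chic M r(1)]) simp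
        then show ?thesis by simp
      qed
      have theta_lim: "(\<lambda>j. \<theta> j y) \<longlonglongrightarrow> \<xi> y" for y
      proof (rule LIMSEQ_I)
        fix \<eta> :: real assume eta: "0 < \<eta>"
        then obtain d where d: "0 < d" "\<And>x. dist x y < d \<Longrightarrow> dist (\<xi> x) (\<xi> y) < \<eta> / 2"
          using chic unfolding continuous_on_iff by (metis UNIV_I half_gt_zero)
        obtain n0 where n0: "\<And>j. n0 \<le> j \<Longrightarrow> (1/2::real)^r j < d"
          using order_tendstoD(2)[OF half_lim d(1)] by (auto simp: eventually_sequentially)
        have "norm (\<theta> j y - \<xi> y) < \<eta>" if "n0 \<le> j" for j
        proof -
          have "\<bar>\<theta> j y - \<xi> y\<bar> \<le> \<eta> / 2" unfolding \<theta>_def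
          proof (rule mollify_bounds(2)[OF chic M r(1)])
            fix x assume "dist y x < (1/2)^r j"
            then have "dist x y < d" using n0[OF that] by (simp add: dist_commute)
            then show "\<bar>\<xi> x - \<xi> y\<bar> \<le> \<eta> / 2" using d(2)[of x] by (simp add: dist_real_def)
          qed
          then show ?thesis using eta by simp
        qed
        then show "\<exists>no. \<forall>n\<ge>no. norm (\<theta> n y - \<xi> y) < \<eta>" by blast
      qed
      \<comment> \<open>As soon as \<open>Q j\<close> contains the support of \<open>\<phi>\<close>,
        the cut-off drops out of the pairing and the mollifier falls on the derivative of
        \<open>\<phi>\<close>.\<close>
      have pair: "(LINT x|lebesgue. (v j x \<bullet> i) * \<phi> x) = - (LINT y|lebesgue. u j y * \<theta> j y)" if j: "j0 \<le> j" for j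
      proof -
        have "?C \<subseteq> Q j" using j0 interior_subset Q(4)[OF j] by blast
        then have eq: "(v j x \<bullet> i) * \<phi> x = (mollified_gradient (u j) (r j) x \<bullet> i) * \<phi> x" for x
          using p0[of x] by (cases "x \<in> ?C") (auto simp: v_def)
        have "(LINT x|lebesgue. (v j x \<bullet> i) * \<phi> x) = (LINT x|lebesgue. (mollified_gradient (u j) (r j) x \<bullet> i) * \<phi> x)"
          by (simp only: eq)
        also have "\<dots> = - (LINT y|lebesgue. u j y * \<theta> j y)"
          unfolding \<theta>_def \<xi>_def by (rule mollified_gradient_pairing[OF um ub(1) tf i])
        finally show ?thesis .
      qed
      define J where "J = max j0 j1"
      have fQ: "integrable lebesgue (\<lambda>x. indicator (Q j0) x *\<^sub>R f x)"
        by (intro locally_integrable_onD[OF lf] Q)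
      have "(\<lambda>j. LINT y|lebesgue. u (j + J) y * \<theta> (j + J) y) \<longlonglongrightarrow> (LINT y|lebesgue. f0 y * \<xi> y)"
      proof (rule integral_dominated_convergence[where w = "\<lambda>y. M * norm (indicator (Q j0) y *\<^sub>R f y)"])
        show "integrable lebesgue (\<lambda>y. M * norm (indicator (Q j0) y *\<^sub>R f y))"
          using fQ by (intro integrable_mult_right integrable_norm)
        show "AE y in lebesgue. (\<lambda>j. u (j + J) y * \<theta> (j + J) y) \<longlonglongrightarrow> f0 y * \<xi> y"
        proof (rule AE_I2)
          fix y
          have "(\<lambda>j. u j y) \<longlonglongrightarrow> f0 y" unfolding u_def by (rule truncate_tendsto[OF r_lim])
          then have "(\<lambda>j. u j y * \<theta> j y) \<longlonglongrightarrow> f0 y * \<xi> y" by (intro tendsto_mult theta_lim)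
          then show "(\<lambda>j. u (j + J) y * \<theta> (j + J) y) \<longlonglongrightarrow> f0 y * \<xi> y" by (rule LIMSEQ_ignore_initial_segment)
        qed
        show "AE y in lebesgue. norm (u (j + J) y * \<theta> (j + J) y) \<le> M * norm (indicator (Q j0) y *\<^sub>R f y)" for j
        proof (rule AE_I2)
          fix y
          show "norm (u (j + J) y * \<theta> (j + J) y) \<le> M * norm (indicator (Q j0) y *\<^sub>R f y)"
          proof (cases "y \<in> Q j0")
            case True
            then have "y \<in> \<Omega>" using Q(2) by blast
            have "\<bar>u (j + J) y\<bar> * \<bar>\<theta> (j + J) y\<bar> \<le> \<bar>f0 y\<bar> * M"
              using ub(2)[of "j + J" y] theta_M[of "j + J" y] by (intro mult_mono) auto
            then show ?thesis using True \<open>y \<in> \<Omega>\<close> by (simp add: abs_mult f0_def mult.commute)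
          next
            case False
            then have "\<theta> (j + J) y = 0" by (intro theta0) (auto simp: J_def)
            then show ?thesis using M0 by simp
          qed
        qed
        show "(\<lambda>y. f0 y * \<xi> y) \<in> borel_measurable lebesgue"
          using borel_imp_lebesgue_measurable[OF chim] by measurable
        have "\<theta> j \<in> borel_measurable lebesgue" for j unfolding \<theta>_def by simp
        then show "(\<lambda>y. u (j + J) y * \<theta> (j + J) y) \<in> borel_measurable lebesgue" for j by measurable
      qed
      then have "(\<lambda>j. - (LINT y|lebesgue. u (j + J) y * \<theta> (j + J) y)) \<longlonglongrightarrow> - (LINT y|lebesgue. f0 y * \<xi> y)"
        by (rule tendsto_minus)
      moreover have "- (LINT y|lebesgue. u (j + J) y * \<theta> (j + J) y) = (LINT x|lebesgue. (v (j + J) x \<bullet> i) * \<phi> x)" for j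
        by (rule pair[symmetric]) (simp add: J_def)
      moreover have "(LINT y|lebesgue. f0 y * \<xi> y) = (LINT x:\<Omega>|lebesgue. f x * frechet_derivative \<phi> (at x) i)"
        unfolding set_lebesgue_integral_def f0_def \<xi>_def by (intro Bochner_Integration.integral_cong) (auto simp: indicator_def)
      ultimately have "(\<lambda>j. LINT x|lebesgue. (v (j + J) x \<bullet> i) * \<phi> x) \<longlonglongrightarrow> - (LINT x:\<Omega>|lebesgue. f x * frechet_derivative \<phi> (at x) i)"
        by simp
      then show ?thesis by (rule LIMSEQ_offset)
    qed
    show "\<exists>v :: nat \<Rightarrow> 'a \<Rightarrow> 'a. (\<forall>j. v j \<in> borel_measurable lebesgue) \<and> (\<forall>j. N (\<lambda>x. norm (v j x)) \<le> ennreal (B * C * (1 + S))) \<and>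
        (\<forall>\<phi> i. test_function \<Omega> \<phi> \<longrightarrow> i \<in> Basis \<longrightarrow>
          (\<lambda>j. LINT x|lebesgue. (v j x \<bullet> i) * \<phi> x) \<longlonglongrightarrow> - (LINT x:\<Omega>|lebesgue. f x * frechet_derivative \<phi> (at x) i))"
      using vm Nv lim by (intro exI[of _ v]) blast
  qed
qed

end

subsection \<open>Weak compactness\<close>

context bbfs
begin

lemma pairing_bound:
  fixes h :: "'a \<Rightarrow> 'a"
  assumes h[measurable]: "h \<in> borel_measurable lebesgue" and R: "N (\<lambda>x. norm (h x)) \<le> ennreal R"
    and \<phi>[measurable]: "\<phi> \<in> borel_measurable lebesgue"
  shows "(\<integral>\<^sup>+ x. ennreal (norm (h x) * \<bar>\<phi> x\<bar>) \<partial>lebesgue) \<le> ennreal R * associate_norm N \<phi>"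
proof -
  have "N (\<lambda>x. norm (h x)) < \<infinity>" using R by (simp add: order_le_less_trans)
  then have "(\<integral>\<^sup>+ x. ennreal \<bar>norm (h x) * \<phi> x\<bar> \<partial>lebesgue) \<le> N (\<lambda>x. norm (h x)) * associate_norm N \<phi>"
    by (intro Hoelder) auto
  also have "\<dots> \<le> ennreal R * associate_norm N \<phi>" by (intro mult_right_mono R) simp
  finally show ?thesis by (simp add: abs_mult)
qed

lemma pairing_integrable:
  fixes h :: "'a \<Rightarrow> 'a"
  assumes h[measurable]: "h \<in> borel_measurable lebesgue" and R: "N (\<lambda>x. norm (h x)) \<le> ennreal R"
    and \<phi>[measurable]: "\<phi> \<in> borel_measurable lebesgue" and fin: "associate_norm N \<phi> < \<infinity>" and i: "i \<in> Basis"
  shows "integrable lebesgue (\<lambda>x. (h x \<bullet> i) * \<phi> x)"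
proof (rule integrableI_bounded)
  let ?X = "\<integral>\<^sup>+ x. ennreal (norm ((h x \<bullet> i) * \<phi> x)) \<partial>lebesgue"
  have "?X \<le> (\<integral>\<^sup>+ x. ennreal (norm (h x) * \<bar>\<phi> x\<bar>) \<partial>lebesgue)"
    using Basis_le_norm[OF i] by (intro nn_integral_mono ennreal_leI) (simp add: abs_mult mult_right_mono)
  also have "\<dots> \<le> ennreal R * associate_norm N \<phi>" by (rule pairing_bound[OF h R \<phi>])
  also have "\<dots> < \<infinity>" using fin by (simp add: ennreal_mult_less_top)
  finally show "?X < \<infinity>" .
qed measurable

text \<open>Here the absolutely continuous norm of the associate space enters. Where
  \<open>h k\<close> is within \<open>d\<close> of \<open>u\<close>, integrability of
  \<open>\<phi>\<close> suffices; the remaining sets \<open>E k\<close> have indicators tending to 0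
  almost everywhere, so \<open>\<phi>\<close> restricted to them is small in the associate norm and
  the Hoelder inequality applies with the uniform bound \<open>R\<close>.\<close>

lemma pairing_tendsto:
  fixes h :: "nat \<Rightarrow> 'a \<Rightarrow> 'a"
  assumes ac: "absolutely_continuous_norm (associate_norm N)"
    and h[measurable]: "\<And>k. h k \<in> borel_measurable lebesgue" and u[measurable]: "u \<in> borel_measurable lebesgue"
    and R: "\<And>k. N (\<lambda>x. norm (h k x)) \<le> ennreal R" "N (\<lambda>x. norm (u x)) \<le> ennreal R" and R0: "0 \<le> R"
    and lim: "AE x in lebesgue. (\<lambda>k. h k x) \<longlonglongrightarrow> u x"
    and \<phi>[measurable]: "\<phi> \<in> borel_measurable lebesgue" and fin: "associate_norm N \<phi> < \<infinity>"
    and int: "(\<integral>\<^sup>+ x. ennreal \<bar>\<phi> x\<bar> \<partial>lebesgue) < \<infinity>" and i: "i \<in> Basis"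
  shows "(\<lambda>k. LINT x|lebesgue. (h k x \<bullet> i) * \<phi> x) \<longlonglongrightarrow> (LINT x|lebesgue. (u x \<bullet> i) * \<phi> x)"
proof (rule LIMSEQ_I)
  let ?X = "\<integral>\<^sup>+ x. ennreal \<bar>\<phi> x\<bar> \<partial>lebesgue"
  let ?Y = "\<lambda>e. e / (4 * (R + 1))"
  let ?Z = "LINT x|lebesgue. (u x \<bullet> i) * \<phi> x"
  fix e :: real assume e: "0 < e"
  obtain P where P: "0 \<le> P" "?X = ennreal P"
    using int by (cases "\<integral>\<^sup>+ x. ennreal \<bar>\<phi> x\<bar> \<partial>lebesgue") auto
  \<comment> \<open>Half of \<open>e\<close> is spent where the two fields are close;
    \<open>?Y e\<close> leaves a quarter each for \<open>h k\<close> and for \<open>u\<close> on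
    \<open>E k\<close>.\<close>
  define d where "d = e / (2 * (P + 1))"
  have d: "0 < d" "d * P < e / 2"
  proof -
    show "0 < d" using e P by (simp add: d_def)
    show "d * P < e / 2" using e P by (simp add: d_def field_simps)
  qed
  define E where "E k = {x. d < norm (h k x - u x)}" for k
  have E[measurable]: "E k \<in> sets lebesgue" for k
  proof -
    have "{x \<in> space lebesgue. d < norm (h k x - u x)} \<in> sets lebesgue" by measurable
    then show ?thesis by (simp add: E_def)
  qed
  let ?U = "\<lambda>k x. \<phi> x * indicator (E k) x"
  have "(\<lambda>k. associate_norm N (?U k)) \<longlonglongrightarrow> 0"
  proof -
    have "AE x in lebesgue. (\<lambda>k. indicator (E k) x :: real) \<longlonglongrightarrow> 0"
      using lim
    proof eventually_elim
      fix x assume "(\<lambda>k. h k x) \<longlonglongrightarrow> u x"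
      then have "(\<lambda>k. norm (h k x - u x)) \<longlonglongrightarrow> 0" by (simp add: LIM_zero tendsto_norm_zero)
      then have "eventually (\<lambda>k. norm (h k x - u x) < d) sequentially" using d(1) by (rule order_tendstoD(2))
      then have "eventually (\<lambda>k. indicator (E k) x = (0::real)) sequentially"
        by eventually_elim (auto simp: E_def)
      then show "(\<lambda>k. indicator (E k) x :: real) \<longlonglongrightarrow> 0" by (rule tendsto_eventually)
    qed
    then show ?thesis using ac \<phi> fin E unfolding absolutely_continuous_norm_def by blast
  qed
  moreover have "0 < ennreal (?Y e)" using e R0 by simp
  ultimately have "eventually (\<lambda>k. associate_norm N (?U k) < ennreal (?Y e)) sequentially"
    by (rule order_tendstoD(2))
  then obtain k0 where k0: "\<And>k. k0 \<le> k \<Longrightarrow> associate_norm N (?U k) < ennreal (?Y e)"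
    by (auto simp: eventually_sequentially)
  let ?W = "\<lambda>k. \<integral>\<^sup>+ x. ennreal (norm (h k x) * \<bar>\<phi> x * indicator (E k) x\<bar>) \<partial>lebesgue"
  let ?H = "\<lambda>k. \<integral>\<^sup>+ x. ennreal (norm (u x) * \<bar>\<phi> x * indicator (E k) x\<bar>) \<partial>lebesgue"
  have "norm ((LINT x|lebesgue. (h k x \<bullet> i) * \<phi> x) - ?Z) < e" if k: "k0 \<le> k" for k
  proof -
    note i1 = pairing_integrable[OF h R(1) \<phi> fin i, of k] and i2 = pairing_integrable[OF u R(2) \<phi> fin i]
    have split: "ennreal (norm ((h k x \<bullet> i) * \<phi> x - (u x \<bullet> i) * \<phi> x))
      \<le> ennreal d * ennreal \<bar>\<phi> x\<bar> + (ennreal (norm (h k x) * \<bar>\<phi> x * indicator (E k) x\<bar>) + ennreal (norm (u x) * \<bar>\<phi> x * indicator (E k) x\<bar>))" for x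
    proof -
      have 1: "\<bar>(h k x \<bullet> i) * \<phi> x - (u x \<bullet> i) * \<phi> x\<bar> \<le> norm (h k x - u x) * \<bar>\<phi> x\<bar>"
        using Basis_le_norm[OF i, of "h k x - u x"]
        by (simp add: inner_diff_left abs_mult mult_right_mono flip: left_diff_distrib)
      have "norm (h k x - u x) * \<bar>\<phi> x\<bar> \<le> d * \<bar>\<phi> x\<bar> + (norm (h k x) * \<bar>\<phi> x * indicator (E k) x\<bar> + norm (u x) * \<bar>\<phi> x * indicator (E k) x\<bar>)"
      proof (cases "x \<in> E k")
        case True
        have "norm (h k x - u x) * \<bar>\<phi> x\<bar> \<le> (norm (h k x) + norm (u x)) * \<bar>\<phi> x\<bar>"
          by (intro mult_right_mono norm_triangle_ineq4) simp
        also have "\<dots> \<le> d * \<bar>\<phi> x\<bar> + (norm (h k x) + norm (u x)) * \<bar>\<phi> x\<bar>" using d(1) by simp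
        finally show ?thesis using True by (simp add: distrib_right)
      next
        case False
        then show ?thesis by (simp add: E_def mult_right_mono)
      qed
      with 1 have "ennreal (norm ((h k x \<bullet> i) * \<phi> x - (u x \<bullet> i) * \<phi> x))
        \<le> ennreal (d * \<bar>\<phi> x\<bar> + (norm (h k x) * \<bar>\<phi> x * indicator (E k) x\<bar> + norm (u x) * \<bar>\<phi> x * indicator (E k) x\<bar>))"
   by simp
      also have "\<dots> = ennreal d * ennreal \<bar>\<phi> x\<bar> + (ennreal (norm (h k x) * \<bar>\<phi> x * indicator (E k) x\<bar>) + ennreal (norm (u x) * \<bar>\<phi> x * indicator (E k) x\<bar>))"
        using d(1) by (simp add: ennreal_plus ennreal_mult del: ennreal_plus_if)
      finally show ?thesis .
    qed
    have "ennreal (norm ((LINT x|lebesgue. (h k x \<bullet> i) * \<phi> x) - ?Z))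
       = ennreal (norm (LINT x|lebesgue. (h k x \<bullet> i) * \<phi> x - (u x \<bullet> i) * \<phi> x))"
         using i1 i2 by simp
    also have "\<dots> \<le> (\<integral>\<^sup>+ x. ennreal (norm ((h k x \<bullet> i) * \<phi> x - (u x \<bullet> i) * \<phi> x)) \<partial>lebesgue)"
      by (rule integral_norm_bound_ennreal[OF Bochner_Integration.integrable_diff[OF i1 i2]])
    also have "\<dots> \<le> (\<integral>\<^sup>+ x. ennreal d * ennreal \<bar>\<phi> x\<bar> + (ennreal (norm (h k x) * \<bar>\<phi> x * indicator (E k) x\<bar>) + ennreal (norm (u x) * \<bar>\<phi> x * indicator (E k) x\<bar>)) \<partial>lebesgue)"
      by (intro nn_integral_mono split)
    also have "\<dots> = ennreal d * ?X
       + ((?W k) + (?H k))" by (simp add: nn_integral_add nn_integral_cmult)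
    also have "\<dots> \<le> ennreal d * ennreal P + (ennreal R * ennreal (?Y e) + ennreal R * ennreal (?Y e))"
    proof (intro add_mono)
      show "ennreal d * ?X \<le> ennreal d * ennreal P" by (simp add: P)
      have le: "ennreal R * associate_norm N (?U k) \<le> ennreal R * ennreal (?Y e)"
        using k0[OF k] by (intro mult_left_mono) auto
      show "(?W k) \<le> ennreal R * ennreal (?Y e)"
        by (rule order_trans[OF pairing_bound[OF h R(1)] le]) measurable
      show "(?H k) \<le> ennreal R * ennreal (?Y e)"
        by (rule order_trans[OF pairing_bound[OF u R(2)] le]) measurable
    qed
    also have "\<dots> = ennreal (d * P + (R * (?Y e) + R * (?Y e)))"
      using d P R0 e by (simp flip: ennreal_mult ennreal_plus)
    also have "\<dots> < ennreal e"
    proof (rule ennreal_lessI[OF e])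
      have "R * (?Y e) \<le> e / 4"
      proof -
        show ?thesis using e R0 by (simp add: field_simps)
      qed
      then show "d * P + (R * (?Y e) + R * (?Y e)) < e" using d(2) by linarith
    qed
    finally show ?thesis using e by (simp add: ennreal_less_iff)
  qed
  then show "\<exists>no. \<forall>n\<ge>no. norm ((LINT x|lebesgue. (h n x \<bullet> i) * \<phi> x) - ?Z) < e" by blast
qed

lemma test_function_associate:
  assumes tf: "test_function \<Omega> \<phi>"
  shows "\<phi> \<in> borel_measurable lebesgue" "associate_norm N \<phi> < \<infinity>" "(\<integral>\<^sup>+ x. ennreal \<bar>\<phi> x\<bar> \<partial>lebesgue) < \<infinity>"
proof -
  let ?X = "\<integral>\<^sup>+ x. ennreal \<bar>\<phi> x\<bar> \<partial>lebesgue"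
  have c: "continuous_on UNIV \<phi>" by (rule test_function_frechet_derivative(3)[OF tf])
  then show m: "\<phi> \<in> borel_measurable lebesgue"
    by (intro borel_imp_lebesgue_measurable borel_measurable_continuous_onI)
  obtain r where r: "closure {x. \<phi> x \<noteq> 0} \<subseteq> ball 0 r"
    using tf unfolding test_function_def by (meson bounded_subset_ballD compact_imp_bounded)
  then have p0: "\<phi> x = 0" if "x \<notin> ball 0 r" for x using that closure_subset[of "{x. \<phi> x \<noteq> 0}"] by blast
  have "compact (\<phi> ` cball 0 r)" by (intro compact_continuous_image continuous_on_subset[OF c]) auto
  then obtain B where B: "0 < B" "\<forall>y\<in>\<phi> ` cball 0 r. norm y \<le> B" using compact_imp_bounded bounded_pos by metis
  then have b: "\<bar>\<phi> x\<bar> \<le> B * indicator (ball 0 r) x" for x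
    using p0[of x] by (auto simp: indicator_def)
  show "associate_norm N \<phi> < \<infinity>" by (rule associate_norm_bounded[OF m b])
  let ?Y = "\<integral>\<^sup>+ x. ennreal B * indicator (ball (0::'a) r) x \<partial>lebesgue"
  have 1: "?X \<le> ?Y"
  proof (rule nn_integral_mono)
    fix x show "ennreal \<bar>\<phi> x\<bar> \<le> ennreal B * indicator (ball 0 r) x"
      using b[of x] by (auto simp: indicator_def intro: ennreal_leI)
  qed
  have "?Y = ennreal B * emeasure lebesgue (ball (0::'a) r)"
    by (rule nn_integral_cmult_indicator) simp
  also have "\<dots> < \<infinity>" using emeasure_ball_lebesgue_finite[of "0::'a" r] by (simp add: ennreal_mult_less_top)
  finally show "?X < \<infinity>" using 1 by (rule order_le_less_trans[rotated])
qed

text \<open>A sequence from the decreasing sets \<open>C k\<close> converges almost everywhere by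
  \<open>midpoint_convex_AE_convergent\<close>. The pairings pass to the limit by
  \<open>pairing_tendsto\<close> and the norm bound by the Fatou property. The limits
  \<open>L\<close> are arbitrary here; later they are the pairings of \<open>f\<close> with
  derivatives of test functions.\<close>

lemma bounded_fields_weak_limit:
  fixes v :: "nat \<Rightarrow> 'a \<Rightarrow> 'a" and L :: "('a \<Rightarrow> real) \<Rightarrow> 'a \<Rightarrow> real"
  assumes ac: "absolutely_continuous_norm (associate_norm N)"
    and v: "\<And>j. v j \<in> borel_measurable lebesgue" "\<And>j. N (\<lambda>x. norm (v j x)) \<le> ennreal R" and R0: "0 \<le> R"
    and lim: "\<And>\<phi> i. test_function \<Omega> \<phi> \<Longrightarrow> i \<in> Basis \<Longrightarrow> (\<lambda>j. LINT x|lebesgue. (v j x \<bullet> i) * \<phi> x) \<longlonglongrightarrow> L \<phi> i"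
  shows "\<exists>G \<in> borel_measurable lebesgue. N (\<lambda>x. norm (G x)) \<le> ennreal R \<and>
     (\<forall>\<phi> i. test_function \<Omega> \<phi> \<longrightarrow> i \<in> Basis \<longrightarrow> (LINT x|lebesgue. (G x \<bullet> i) * \<phi> x) = L \<phi> i)"
proof -
  obtain w0 where w0[measurable]: "w0 \<in> borel_measurable lebesgue" and w0p: "\<And>x. 0 < w0 x"
    and w0fin: "(\<integral>\<^sup>+ x. ennreal (w0 x) \<partial>lebesgue) < \<infinity>"
    and w0N: "\<And>h. h \<in> borel_measurable lebesgue \<Longrightarrow> (\<integral>\<^sup>+ x. ennreal (\<bar>h x\<bar> * w0 x) \<partial>lebesgue) \<le> N h"
    using positive_weight by blast
  obtain W where W: "0 \<le> W" "(\<integral>\<^sup>+ x. ennreal (w0 x) \<partial>lebesgue) = ennreal W"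
    using w0fin by (cases "\<integral>\<^sup>+ x. ennreal (w0 x) \<partial>lebesgue") auto
  define \<mu> where "\<mu> = density lebesgue (\<lambda>x. ennreal (w0 x))"
  have sets_mu[measurable_cong, simp]: "sets \<mu> = sets lebesgue" by (simp add: \<mu>_def)
  have AE_mu: "(AE x in \<mu>. P x) \<longleftrightarrow> (AE x in lebesgue. P x)" for P
    unfolding \<mu>_def by (subst AE_density) (use w0p in auto)
  define pair where "pair h \<phi> i = (LINT x|lebesgue. (h x \<bullet> i) * \<phi> x)" for h :: "'a \<Rightarrow> 'a" and \<phi> i
  \<comment> \<open>Describes what convex combinations of the tail have in common, without forming
    them: no pairing deviates from its limit by more than any bound valid for all \<open>v j\<close>
    with \<open>j \<ge> k\<close>. Such conditions are closed under midpoints, hold for the tail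
    itself and become stronger with \<open>k\<close>.\<close>
  define C where "C k = {h \<in> borel_measurable lebesgue. N (\<lambda>x. norm (h x)) \<le> ennreal R \<and>
     (\<forall>\<phi> i e. test_function \<Omega> \<phi> \<longrightarrow> i \<in> Basis \<longrightarrow> (\<forall>j\<ge>k. \<bar>pair (v j) \<phi> i - L \<phi> i\<bar> \<le> e) \<longrightarrow> \<bar>pair h \<phi> i - L \<phi> i\<bar> \<le> e)}" for k
  let ?X = "\<lambda>h. \<integral>\<^sup>+ x. ennreal (smooth_norm (h x)) \<partial>\<mu>"
  let ?Y = "\<lambda>h. \<integral>x. smooth_norm (h x) \<partial>\<mu>"
  have Cint: "integrable \<mu> (\<lambda>x. smooth_norm (h x))" "(?Y h) \<le> W + R" if "h \<in> C k" for h k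
  proof -
    have h[measurable]: "h \<in> borel_measurable lebesgue" and hR: "N (\<lambda>x. norm (h x)) \<le> ennreal R" using that by (auto simp: C_def)
    have "(?X h) = (\<integral>\<^sup>+ x. ennreal (w0 x) * ennreal (smooth_norm (h x)) \<partial>lebesgue)"
      unfolding \<mu>_def by (rule nn_integral_density) measurable
    also have "\<dots> \<le> (\<integral>\<^sup>+ x. ennreal (w0 x) + ennreal (\<bar>norm (h x)\<bar> * w0 x) \<partial>lebesgue)"
    proof (rule nn_integral_mono)
      fix x
      have "w0 x * smooth_norm (h x) \<le> w0 x * (1 + norm (h x))"
        using w0p[of x] by (intro mult_left_mono smooth_norm_le) auto
      then have "w0 x * smooth_norm (h x) \<le> w0 x + \<bar>norm (h x)\<bar> * w0 x" by (simp add: algebra_simps)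
      then have "ennreal (w0 x * smooth_norm (h x)) \<le> ennreal (w0 x + \<bar>norm (h x)\<bar> * w0 x)" by (rule ennreal_leI)
      then show "ennreal (w0 x) * ennreal (smooth_norm (h x)) \<le> ennreal (w0 x) + ennreal (\<bar>norm (h x)\<bar> * w0 x)"
        using w0p[of x] smooth_norm_ge(3)[of "h x"] by (simp add: ennreal_mult)
    qed
    also have "\<dots> = ennreal W + (\<integral>\<^sup>+ x. ennreal (\<bar>norm (h x)\<bar> * w0 x) \<partial>lebesgue)"
      by (subst nn_integral_add) (auto simp: W)
    also have "\<dots> \<le> ennreal W + ennreal R"
      by (intro add_left_mono order_trans[OF w0N hR]) measurable
    also have "\<dots> = ennreal (W + R)" using W R0 by simp
    finally have le: "(?X h) \<le> ennreal (W + R)" .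
    show i: "integrable \<mu> (\<lambda>x. smooth_norm (h x))"
    proof (rule integrableI_bounded)
      have "(\<integral>\<^sup>+ x. ennreal (norm (smooth_norm (h x))) \<partial>\<mu>) = (?X h)"
        by (simp add: smooth_norm_ge)
      then show "(\<integral>\<^sup>+ x. ennreal (norm (smooth_norm (h x))) \<partial>\<mu>) < \<infinity>" using le by (simp add: order_le_less_trans)
    qed measurable
    have "ennreal (?Y h) = (?X h)"
      by (rule nn_integral_eq_integral[OF i, symmetric]) (simp add: smooth_norm_ge)
    then have "ennreal (?Y h) \<le> ennreal (W + R)" using le by simp
    then show "(?Y h) \<le> W + R" using W R0 by (subst (asm) ennreal_le_iff) auto
  qed
  obtain h u where h: "\<And>k. h k \<in> C k" and u: "u \<in> borel_measurable \<mu>" and hu: "AE x in \<mu>. (\<lambda>k. h k x) \<longlonglongrightarrow> u x"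
  proof (rule midpoint_convex_AE_convergent[of C \<mu> "W + R"])
    show "h \<in> borel_measurable \<mu>" if "h \<in> C k" for k h using that by (auto simp: C_def)
    show "C k \<noteq> {}" for k using v by (auto simp: C_def)
    show "C l \<subseteq> C k" if "k \<le> l" for k l
    proof
      fix h assume h: "h \<in> C l"
      have "\<bar>pair h \<phi> i - L \<phi> i\<bar> \<le> e" if "test_function \<Omega> \<phi>" "i \<in> Basis" "\<forall>j\<ge>k. \<bar>pair (v j) \<phi> i - L \<phi> i\<bar> \<le> e" for \<phi> i e
      proof -
        show ?thesis using that(3) \<open>k \<le> l\<close> h that by (auto simp: C_def)
      qed
      then show "h \<in> C k" using h by (auto simp: C_def)
    qed
    show "(\<lambda>x. (1/2) *\<^sub>R (g x + h x)) \<in> C k" if gh: "g \<in> C k" "h \<in> C k" for k g h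
    proof -
      have gm[measurable]: "g \<in> borel_measurable lebesgue" and gR: "N (\<lambda>x. norm (g x)) \<le> ennreal R"
        and hm[measurable]: "h \<in> borel_measurable lebesgue" and hR: "N (\<lambda>x. norm (h x)) \<le> ennreal R"
        using gh by (auto simp: C_def)
      have "N (\<lambda>x. norm ((1/2) *\<^sub>R (g x + h x))) \<le> N (\<lambda>x. (1/2) * norm (g x) + (1/2) * norm (h x))"
      proof (intro mono AE_I2)
        fix x show "\<bar>norm ((1/2) *\<^sub>R (g x + h x))\<bar> \<le> \<bar>(1/2) * norm (g x) + (1/2) * norm (h x)\<bar>"
          using norm_triangle_ineq[of "g x" "h x"] by simp
      qed measurable
      also have "\<dots> \<le> N (\<lambda>x. (1/2) * norm (g x)) + N (\<lambda>x. (1/2) * norm (h x))" by (intro triangle) measurable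
      also have "\<dots> = ennreal (1/2) * N (\<lambda>x. norm (g x)) + ennreal (1/2) * N (\<lambda>x. norm (h x))"
        using cmult[of "\<lambda>x. norm (g x)" "1/2"] cmult[of "\<lambda>x. norm (h x)" "1/2"] by simp
      also have "\<dots> \<le> ennreal (1/2) * ennreal R + ennreal (1/2) * ennreal R"
        by (intro add_mono mult_left_mono gR hR) auto
      also have "\<dots> = ennreal (1/2 * R + 1/2 * R)"
        using R0 by (simp only: ennreal_plus ennreal_mult mult_nonneg_nonneg zero_le_divide_1_iff zero_le_numeral)
      also have "\<dots> = ennreal R" by simp
      finally have "N (\<lambda>x. norm ((1/2) *\<^sub>R (g x + h x))) \<le> ennreal R" .
      moreover have "\<bar>pair (\<lambda>x. (1/2) *\<^sub>R (g x + h x)) \<phi> i - L \<phi> i\<bar> \<le> e"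
        if tf: "test_function \<Omega> \<phi>" and i: "i \<in> Basis" and H: "\<forall>j\<ge>k. \<bar>pair (v j) \<phi> i - L \<phi> i\<bar> \<le> e" for \<phi> i e
      proof -
        note t = test_function_associate[OF tf]
        have i1: "integrable lebesgue (\<lambda>x. (g x \<bullet> i) * \<phi> x)" and i2: "integrable lebesgue (\<lambda>x. (h x \<bullet> i) * \<phi> x)"
          by (rule pairing_integrable[OF gm gR t(1,2) i], rule pairing_integrable[OF hm hR t(1,2) i])
        have "pair (\<lambda>x. (1/2) *\<^sub>R (g x + h x)) \<phi> i = (LINT x|lebesgue. ((g x \<bullet> i) * \<phi> x + (h x \<bullet> i) * \<phi> x) / 2)"
          unfolding pair_def by (intro Bochner_Integration.integral_cong) (auto simp: inner_add_left field_simps)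
        also have "\<dots> = (pair g \<phi> i + pair h \<phi> i) / 2" unfolding pair_def using i1 i2 by simp
        finally have "pair (\<lambda>x. (1/2) *\<^sub>R (g x + h x)) \<phi> i = (pair g \<phi> i + pair h \<phi> i) / 2" .
        moreover have "\<bar>pair g \<phi> i - L \<phi> i\<bar> \<le> e" "\<bar>pair h \<phi> i - L \<phi> i\<bar> \<le> e"
          using gh tf i H by (auto simp: C_def)
        ultimately show ?thesis by (auto simp: abs_le_iff)
      qed
      ultimately show ?thesis by (auto simp: C_def)
    qed
  qed (use Cint in blast)+
  have hm: "h k \<in> borel_measurable lebesgue" "N (\<lambda>x. norm (h k x)) \<le> ennreal R" for k using h[of k] by (auto simp: C_def)
  have um: "u \<in> borel_measurable lebesgue" using u by simp
  have hu': "AE x in lebesgue. (\<lambda>k. h k x) \<longlonglongrightarrow> u x" using hu by (simp add: AE_mu)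
  have uR: "N (\<lambda>x. norm (u x)) \<le> ennreal R"
  proof (rule Fatou_AE[of "\<lambda>k x. norm (h k x)"])
    show "AE x in lebesgue. (\<lambda>k. norm (h k x)) \<longlonglongrightarrow> norm (u x)"
      using hu' by eventually_elim (rule tendsto_norm)
  qed (use hm um in auto)
  have "(LINT x|lebesgue. (u x \<bullet> i) * \<phi> x) = L \<phi> i" if tf: "test_function \<Omega> \<phi>" and i: "i \<in> Basis" for \<phi> i
  proof -
    note t = test_function_associate[OF tf]
    have "(\<lambda>k. pair (h k) \<phi> i) \<longlonglongrightarrow> pair u \<phi> i"
      unfolding pair_def by (rule pairing_tendsto[OF ac hm(1) um hm(2) uR R0 hu' t i])
    moreover have "(\<lambda>k. pair (h k) \<phi> i) \<longlonglongrightarrow> L \<phi> i"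
    proof (rule LIMSEQ_I)
      fix e :: real assume e: "0 < e"
      have "(\<lambda>j. pair (v j) \<phi> i) \<longlonglongrightarrow> L \<phi> i" unfolding pair_def by (rule lim[OF tf i])
      then obtain k0 where k0: "\<And>j. k0 \<le> j \<Longrightarrow> \<bar>pair (v j) \<phi> i - L \<phi> i\<bar> < e / 2"
        using e unfolding lim_sequentially dist_real_def by (meson half_gt_zero)
      have "norm (pair (h k) \<phi> i - L \<phi> i) < e" if "k0 \<le> k" for k
      proof -
        have "\<forall>j\<ge>k. \<bar>pair (v j) \<phi> i - L \<phi> i\<bar> \<le> e / 2" using k0 that by (meson less_imp_le order_trans)
        then have "\<bar>pair (h k) \<phi> i - L \<phi> i\<bar> \<le> e / 2" using h[of k] tf i unfolding C_def by blast
        then show ?thesis using e by simp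
      qed
      then show "\<exists>no. \<forall>n\<ge>no. norm (pair (h n) \<phi> i - L \<phi> i) < e" by blast
    qed
    ultimately have "pair u \<phi> i = L \<phi> i" by (rule LIMSEQ_unique)
    then show ?thesis by (simp add: pair_def)
  qed
  then show ?thesis using um uR by blast
qed

lemma finite_norm_imp_locally_integrable:
  fixes G :: "'a \<Rightarrow> 'a"
  assumes [measurable]: "G \<in> borel_measurable lebesgue" and fin: "N (\<lambda>x. norm (G x)) < \<infinity>" and i: "i \<in> Basis"
  shows "locally_integrable_on (\<lambda>x. G x \<bullet> i) \<Omega>"
  unfolding locally_integrable_on_def
proof (intro allI impI)
  fix K assume "compact K \<and> K \<subseteq> \<Omega>"
  then have K: "compact K" by simp
  have [measurable]: "K \<in> sets lebesgue" using K by (simp add: borel_compact)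
  obtain r where r: "K \<subseteq> ball 0 r" using compact_imp_bounded[OF K] by (meson bounded_subset_ballD)
  obtain C where C: "0 \<le> C" "\<And>f. f \<in> borel_measurable lebesgue \<Longrightarrow> (\<integral>\<^sup>+ x\<in>ball 0 r. ennreal \<bar>f x\<bar> \<partial>lebesgue) \<le> ennreal C * N f"
    using local_integral[of 0 r] by blast
  let ?X = "\<integral>\<^sup>+ x. ennreal (norm (indicator K x *\<^sub>R (G x \<bullet> i))) \<partial>lebesgue"
  show "set_integrable lebesgue K (\<lambda>x. G x \<bullet> i)" unfolding set_integrable_def
  proof (rule integrableI_bounded)
    have "?X \<le> (\<integral>\<^sup>+ x\<in>ball 0 r. ennreal \<bar>norm (G x)\<bar> \<partial>lebesgue)"
      using r Basis_le_norm[OF i] by (intro nn_integral_mono) (auto simp: indicator_def intro!: ennreal_leI)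
    also have "\<dots> \<le> ennreal C * N (\<lambda>x. norm (G x))" by (rule C) measurable
    also have "\<dots> < \<infinity>" using fin by (simp add: ennreal_mult_less_top)
    finally show "?X < \<infinity>" .
  qed measurable
qed

end

subsection \<open>Uniqueness of weak gradients\<close>

lemma locally_integrable_on_diff:
  assumes "locally_integrable_on f \<Omega>" "locally_integrable_on g \<Omega>"
  shows "locally_integrable_on (\<lambda>x. f x - g x) \<Omega>"
  using assms unfolding locally_integrable_on_def by (auto intro!: set_integral_diff(1))

text \<open>Bumps are test functions, so all averages of \<open>h\<close> over small bumps vanish,
  while near a Lebesgue point they tend to \<open>bump_mass\<close> times the value of
  \<open>h\<close>.\<close>

lemma locally_integrable_zero_pairing:
  fixes h :: "'a::euclidean_space \<Rightarrow> real"
  assumes op: "open \<Omega>" and lh: "locally_integrable_on h \<Omega>"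
    and zero: "\<And>\<phi>. test_function \<Omega> \<phi> \<Longrightarrow> (LINT x:\<Omega>|lebesgue. h x * \<phi> x) = 0"
  shows "AE x in lebesgue. x \<in> \<Omega> \<longrightarrow> h x = 0"
  using AE_lebesgue_point_locally[OF op lh]
proof eventually_elim
  fix x assume lp: "x \<in> \<Omega> \<longrightarrow> lebesgue_point h x"
  show "x \<in> \<Omega> \<longrightarrow> h x = 0"
  proof
    assume x: "x \<in> \<Omega>"
    obtain d where d: "0 < d" "ball x d \<subseteq> \<Omega>" using op x openE by blast
    obtain b :: 'a where b: "b \<in> Basis" using nonempty_Basis by blast
    let ?k = "unit_ball_vol (real DIM('a)) * 16 ^ DIM('a)"
    have k: "0 < ?k" by simp
    have "bump_mass TYPE('a) * \<bar>h x\<bar> \<le> 0"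
    proof (rule field_le_epsilon)
      fix e :: real assume e: "0 < e"
      then have ek: "0 < e / ?k" using k by (rule divide_pos_pos)
      obtain d2 where d2: "0 < d2" "\<And>r. 0 < r \<Longrightarrow> r < d2 \<Longrightarrow>
         (\<integral>\<^sup>+ y\<in>ball x r. ennreal \<bar>h y - h x\<bar> \<partial>lebesgue) \<le> ennreal (e / ?k) * emeasure lebesgue (ball x r)"
        using lp x ek unfolding lebesgue_point_def by blast
      define m where "m = min d d2 / 4"
      have m: "0 < m" "2 * m < d2" "2 * m < d" using d d2 by (auto simp: m_def min_def)
      \<comment> \<open>The bump is placed off centre, at distance exactly \<open>m\<close> from
        \<open>x\<close>, to match \<open>bump_average_near_lebesgue_point\<close>, which is then
        applied with \<open>\<epsilon> = 1\<close>.\<close>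
      define z where "z = x + m *\<^sub>R b"
      have z: "dist x z = m" using m b by (simp add: z_def dist_norm)
      have sub: "cball z (1 / 8 * m) \<subseteq> \<Omega>"
      proof
        fix w assume "w \<in> cball z (1 / 8 * m)"
        then have "dist x w < d" using dist_triangle[of x w z] z m by simp
        then show "w \<in> \<Omega>" using d(2) by auto
      qed
      have "test_function \<Omega> (bump (1 / 8 * m) z)"
        using m bump_eq_0[of "1/8 * m" _ z] by (intro smooth_test_function[OF bump_smooth _ sub]) auto
      then have "(LINT w:\<Omega>|lebesgue. h w * bump (1 / 8 * m) z w) = 0" by (rule zero)
      moreover have "(LINT w:\<Omega>|lebesgue. h w * bump (1 / 8 * m) z w) = (LINT w|lebesgue. h w * bump (1 / 8 * m) z w)"
      proof (rule integrable_bounded_mult(2)[OF lh compact_cball sub bump_lebesgue_measurable])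
        have r: "0 < 1 / 8 * m" using m by simp
        show "\<bar>bump (1 / 8 * m) z w\<bar> \<le> 1 / (1 / 8 * m) ^ DIM('a)" for w by (rule bump_abs_le[OF r])
        show "bump (1 / 8 * m) z w = 0" if "w \<notin> cball z (1 / 8 * m)" for w
          using bump_eq_0[OF r] that ball_subset_cball by blast
      qed
      ultimately have 0: "(LINT w|lebesgue. h w * bump (1 / 8 * m) z w) = 0" by simp
      have "\<bar>(LINT w|lebesgue. h w * bump (1 / 8 * m) z w) - bump_mass TYPE('a) * h x\<bar>
        \<le> unit_ball_vol (real DIM('a)) * (16 / 1) ^ DIM('a) * (e / ?k)"
        by (rule bump_average_near_lebesgue_point[OF lh sub]) (use m z ek d2(2)[of "2 * m"] in auto)
      also have "\<dots> = e" using less_imp_neq[OF k] by simp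
      finally show "bump_mass TYPE('a) * \<bar>h x\<bar> \<le> 0 + e"
        unfolding 0 using bump_mass_pos[where 'a='a] by (simp add: abs_mult)
    qed
    then show "h x = 0" using bump_mass_pos[where 'a='a] by (simp add: mult_le_0_iff)
  qed
qed

text \<open>The lower bound produces some weak gradient with a norm estimate; uniqueness transfers
  that estimate to every given one.\<close>

lemma weak_gradient_unique:
  fixes \<Omega> :: "'a::euclidean_space set"
  assumes op: "open \<Omega>" and G: "weak_gradient \<Omega> f G" and H: "weak_gradient \<Omega> f H"
  shows "AE x in lebesgue. x \<in> \<Omega> \<longrightarrow> G x = H x"
proof -
  have "AE x in lebesgue. \<forall>i\<in>Basis. x \<in> \<Omega> \<longrightarrow> G x \<bullet> i - H x \<bullet> i = 0"
  proof (rule AE_finite_allI)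
    fix i :: 'a assume i: "i \<in> Basis"
    have lG: "locally_integrable_on (\<lambda>x. G x \<bullet> i) \<Omega>" and lH: "locally_integrable_on (\<lambda>x. H x \<bullet> i) \<Omega>"
      using G H i by (auto simp: weak_gradient_def)
    show "AE x in lebesgue. x \<in> \<Omega> \<longrightarrow> G x \<bullet> i - H x \<bullet> i = 0"
    proof (rule locally_integrable_zero_pairing[OF op locally_integrable_on_diff[OF lG lH]])
      fix \<phi> assume tf: "test_function \<Omega> \<phi>"
      let ?C = "closure {x. \<phi> x \<noteq> 0}"
      have C: "compact ?C" "?C \<subseteq> \<Omega>" using tf by (auto simp: test_function_def)
      have c: "continuous_on UNIV \<phi>" by (rule test_function_frechet_derivative(3)[OF tf])
      have m: "\<phi> \<in> borel_measurable lebesgue"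
        by (intro borel_imp_lebesgue_measurable borel_measurable_continuous_onI c)
      have 0: "\<phi> x = 0" if "x \<notin> ?C" for x using that closure_subset[of "{x. \<phi> x \<noteq> 0}"] by blast
      have "compact (\<phi> ` ?C)" by (intro compact_continuous_image continuous_on_subset[OF c] C) auto
      then obtain B where B: "0 < B" "\<forall>y\<in>\<phi> ` ?C. norm y \<le> B" using compact_imp_bounded bounded_pos by metis
      then have b: "\<bar>\<phi> x\<bar> \<le> B" for x using 0[of x] by (cases "x \<in> ?C") auto
      note ib = integrable_bounded_mult[OF _ C m b 0]
      have "(LINT x:\<Omega>|lebesgue. (G x \<bullet> i) * \<phi> x) = (LINT x:\<Omega>|lebesgue. (H x \<bullet> i) * \<phi> x)"
        using G[unfolded weak_gradient_def, THEN conjunct2, THEN conjunct2, rule_format, OF tf i]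
          H[unfolded weak_gradient_def, THEN conjunct2, THEN conjunct2, rule_format, OF tf i] by simp
      moreover have "(LINT x:\<Omega>|lebesgue. (G x \<bullet> i) * \<phi> x) = (LINT x|lebesgue. (G x \<bullet> i) * \<phi> x)"
        by (rule ib(2)[OF lG])
      moreover have "(LINT x:\<Omega>|lebesgue. (H x \<bullet> i) * \<phi> x) = (LINT x|lebesgue. (H x \<bullet> i) * \<phi> x)"
        by (rule ib(2)[OF lH])
      ultimately have "(LINT x|lebesgue. (G x \<bullet> i - H x \<bullet> i) * \<phi> x) = 0"
        using ib(1)[OF lG] ib(1)[OF lH] by (simp add: left_diff_distrib)
      moreover have "(LINT x:\<Omega>|lebesgue. (G x \<bullet> i - H x \<bullet> i) * \<phi> x) = (LINT x|lebesgue. (G x \<bullet> i - H x \<bullet> i) * \<phi> x)"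
        by (rule ib(2)[OF locally_integrable_on_diff[OF lG lH]])
      ultimately show "(LINT x:\<Omega>|lebesgue. (G x \<bullet> i - H x \<bullet> i) * \<phi> x) = 0" by argo
    qed
  qed simp
  then show ?thesis by eventually_elim (auto intro: euclidean_eqI)
qed

subsection \<open>The characterization\<close>

lemma weak_gradient_scale:
  assumes "weak_gradient \<Omega> f G"
  shows "weak_gradient \<Omega> (\<lambda>x. t * f x) (\<lambda>x. t *\<^sub>R G x)"
proof -
  have li: "locally_integrable_on (\<lambda>x. t * g x) \<Omega>" if "locally_integrable_on g \<Omega>" for g
    using that unfolding locally_integrable_on_def by (auto intro!: set_integrable_mult_right)
  have sc: "(LINT x:\<Omega>|lebesgue. (t * g x) * k x) = t * (LINT x:\<Omega>|lebesgue. g x * k x)" for g k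
    by (simp add: mult.assoc)
  show ?thesis using assms unfolding weak_gradient_def by (auto simp: li sc)
qed

text \<open>Multiplying \<open>f\<close> by \<open>t\<close> divides the height of the level set by
  \<open>t\<close>, and the supremum over all heights is invariant under this rescaling.\<close>

lemma level_sup_scale:
  assumes t: "0 < t"
  shows "level_sup N \<Omega> (\<lambda>x. t * f x) p \<gamma> = ennreal t * level_sup N \<Omega> f p \<gamma>"
proof -
  have E: "E_set \<Omega> (\<lambda>x. t * f x) lam \<beta> = E_set \<Omega> f (lam / t) \<beta>" for lam \<beta>
  proof -
    have "lam * d < \<bar>t * a - t * b\<bar> \<longleftrightarrow> lam / t * d < \<bar>a - b\<bar>" for a b d
    proof -
      have "\<bar>t * a - t * b\<bar> = t * \<bar>a - b\<bar>" using t by (simp add: abs_mult flip: right_diff_distrib)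
      then show ?thesis using t by (simp add: field_simps)
    qed
    then show ?thesis by (simp add: E_set_def)
  qed
  have L: "level_fun \<Omega> (\<lambda>x. t * f x) p \<gamma> lam = level_fun \<Omega> f p \<gamma> (lam / t)" for lam
    unfolding level_fun_def[abs_def] E ..
  have "level_sup N \<Omega> (\<lambda>x. t * f x) p \<gamma> = (SUP lam\<in>{0<..}. ennreal t * (ennreal (lam / t) * enorm N (level_fun \<Omega> f p \<gamma> (lam / t))))"
    unfolding level_sup_def L using t by (intro SUP_cong) (auto simp: mult.assoc[symmetric] simp flip: ennreal_mult)
  also have "\<dots> = (SUP lam\<in>(\<lambda>lam. lam / t) ` {0<..}. ennreal t * (ennreal lam * enorm N (level_fun \<Omega> f p \<gamma> lam)))"
    by (simp add: image_image)
  also have "(\<lambda>lam. lam / t) ` {0<..} = {0<..}"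
    using t by (auto simp: image_iff intro!: bexI[of _ "_ * t"])
  also have "(SUP lam\<in>{0<..}. ennreal t * (ennreal lam * enorm N (level_fun \<Omega> f p \<gamma> lam))) = ennreal t * level_sup N \<Omega> f p \<gamma>"
    unfolding level_sup_def by (rule SUP_mult_left_ennreal[symmetric])
  finally show ?thesis .
qed

context convexified_bbfs
begin

lemma restricted_gradient_measurable:
  assumes "open \<Omega>" "weak_gradient \<Omega> f G"
  shows "(\<lambda>x. if x \<in> \<Omega> then norm (G x) else 0) \<in> borel_measurable lebesgue"
proof -
  have "(\<lambda>x. if x \<in> \<Omega> then G x \<bullet> i else 0) \<in> borel_measurable lebesgue" if "i \<in> Basis" for i
    using assms that by (intro locally_integrable_measurable) (auto simp: weak_gradient_def)
  then have "(\<lambda>x. (if x \<in> \<Omega> then G x else 0) \<bullet> i) \<in> borel_measurable lebesgue" if "i \<in> Basis" for i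
    using that by (simp add: if_distrib[of "\<lambda>v. v \<bullet> i"] cong: if_cong)
  then have "(\<lambda>x. if x \<in> \<Omega> then G x else 0) \<in> borel_measurable lebesgue"
    by (intro borel_measurable_euclidean_space[THEN iffD2]) auto
  then have "(\<lambda>x. norm (if x \<in> \<Omega> then G x else 0)) \<in> borel_measurable lebesgue" by measurable
  then show ?thesis by (simp add: if_distrib[of norm] cong: if_cong)
qed

lemma upper_bound:
  assumes dom: "eps_infty_domain \<epsilon> \<Omega>" and eps: "0 < \<epsilon>" "\<epsilon> \<le> 1" and g: "\<gamma> \<noteq> 0"
  obtains C :: real where "0 < C"
    "\<And>f G. weak_gradient \<Omega> f G \<Longrightarrow> restr_norm N \<Omega> (\<lambda>x. norm (G x)) < \<infinity> \<Longrightarrow>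
      level_sup N \<Omega> f p \<gamma> \<le> ennreal C * restr_norm N \<Omega> (\<lambda>x. norm (G x))"
proof -
  have op: "open \<Omega>" using dom by (simp add: eps_infty_domain_def)
  obtain A :: real where A: "0 \<le> A"
    "\<And>f g lam c. (\<lambda>x. if x \<in> \<Omega> then f x else 0) \<in> borel_measurable lebesgue \<Longrightarrow> g \<in> borel_measurable lebesgue \<Longrightarrow>
       N g < \<infinity> \<Longrightarrow> 0 < c \<Longrightarrow> 0 < lam \<Longrightarrow>
       (\<exists>Z. (AE x in lebesgue. x \<in> Z) \<and> (\<forall>x\<in>Z\<inter>\<Omega>. \<forall>y\<in>Z\<inter>\<Omega>.
           ennreal \<bar>f x - f y\<bar> \<le> ennreal (c * dist x y) * (maximal_op g x + maximal_op g y))) \<Longrightarrow>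
       ennreal lam * enorm N (level_fun \<Omega> f p \<gamma> lam) \<le> ennreal (A * c) * N g"
         using level_fun_upper_bound[OF g op] by blast
  let ?c = "pointwise_const TYPE('a) \<epsilon>"
  have c: "0 < ?c" by (rule pointwise_const_pos[OF eps(1)])
  show thesis
  \<comment> \<open>\<open>A\<close> is only known to be nonnegative; adding 1 makes the constant
    positive.\<close>
  proof (rule that[of "A * ?c + 1"])
    show "0 < A * ?c + 1" using A c by (simp add: add_nonneg_pos)
    fix f G assume wg: "weak_gradient \<Omega> f G" and fin: "restr_norm N \<Omega> (\<lambda>x. norm (G x)) < \<infinity>"
    define gr where "gr x = (if x \<in> \<Omega> then norm (G x) else 0)" for x
    have grm: "gr \<in> borel_measurable lebesgue" unfolding gr_def by (rule restricted_gradient_measurable[OF op wg])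
    have Ngr: "restr_norm N \<Omega> (\<lambda>x. norm (G x)) = N gr" by (simp add: restr_norm_def gr_def[abs_def])
    have lf: "locally_integrable_on f \<Omega>" using wg by (simp add: weak_gradient_def)
    have fm: "(\<lambda>x. if x \<in> \<Omega> then f x else 0) \<in> borel_measurable lebesgue" by (rule locally_integrable_measurable[OF op lf])
    define Z where "Z = {x. x \<in> \<Omega> \<longrightarrow> lebesgue_point f x}"
    have ZZ: "\<exists>Z. (AE x in lebesgue. x \<in> Z) \<and> (\<forall>x\<in>Z\<inter>\<Omega>. \<forall>y\<in>Z\<inter>\<Omega>.
           ennreal \<bar>f x - f y\<bar> \<le> ennreal (?c * dist x y) * (maximal_op gr x + maximal_op gr y))"
    proof (intro exI[of _ Z] conjI ballI)
      show "AE x in lebesgue. x \<in> Z" using AE_lebesgue_point_locally[OF op lf] by (simp add: Z_def)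
      fix x y assume "x \<in> Z \<inter> \<Omega>" "y \<in> Z \<inter> \<Omega>"
      then show "ennreal \<bar>f x - f y\<bar> \<le> ennreal (?c * dist x y) * (maximal_op gr x + maximal_op gr y)"
        unfolding gr_def[abs_def] by (intro pointwise_estimate[OF dom eps wg]) (auto simp: Z_def)
    qed
    have "level_sup N \<Omega> f p \<gamma> \<le> ennreal (A * ?c) * N gr" unfolding level_sup_def
      by (rule SUP_least) (use A(2)[OF fm grm _ c _ ZZ] fin in \<open>auto simp: Ngr\<close>)
    also have "\<dots> \<le> ennreal (A * ?c + 1) * N gr" by (intro mult_right_mono ennreal_leI) auto
    finally show "level_sup N \<Omega> f p \<gamma> \<le> ennreal (A * ?c + 1) * restr_norm N \<Omega> (\<lambda>x. norm (G x))" by (simp add: Ngr)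
  qed
qed

text \<open>The estimate is not homogeneous in \<open>f\<close>. It already settles membership in
  the Sobolev space, and since \<open>C\<close> depends on neither \<open>f\<close> nor
  \<open>S\<close>, it can later be applied to all multiples of \<open>f\<close>.\<close>

lemma lower_bound:
  assumes ac: "absolutely_continuous_norm (associate_norm N)"
  obtains C :: real where "0 < C"
    "\<And>\<Omega> f S. open \<Omega> \<Longrightarrow> locally_integrable_on f \<Omega> \<Longrightarrow> level_sup N \<Omega> f p \<gamma> \<le> ennreal S \<Longrightarrow> 0 \<le> S \<Longrightarrow>
      \<exists>G. weak_gradient \<Omega> f G \<and> restr_norm N \<Omega> (\<lambda>x. norm (G x)) \<le> ennreal (C * (1 + S))"
proof -
  obtain C :: real where C: "0 < C"
    "\<And>\<Omega> f S. open \<Omega> \<Longrightarrow> locally_integrable_on f \<Omega> \<Longrightarrow> level_sup N \<Omega> f p \<gamma> \<le> ennreal S \<Longrightarrow> 0 \<le> S \<Longrightarrow>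
      \<exists>v :: nat \<Rightarrow> 'a \<Rightarrow> 'a. (\<forall>j. v j \<in> borel_measurable lebesgue) \<and> (\<forall>j. N (\<lambda>x. norm (v j x)) \<le> ennreal (C * (1 + S))) \<and>
        (\<forall>\<phi> i. test_function \<Omega> \<phi> \<longrightarrow> i \<in> Basis \<longrightarrow>
          (\<lambda>j. LINT x|lebesgue. (v j x \<bullet> i) * \<phi> x) \<longlonglongrightarrow> - (LINT x:\<Omega>|lebesgue. f x * frechet_derivative \<phi> (at x) i))"
    using approximating_fields by blast
  show thesis
  proof (rule that[OF C(1)])
    fix \<Omega> :: "'a set" and f :: "'a \<Rightarrow> real" and S :: real
    assume op: "open \<Omega>" and lf: "locally_integrable_on f \<Omega>" and S: "level_sup N \<Omega> f p \<gamma> \<le> ennreal S" "0 \<le> S"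
    obtain v :: "nat \<Rightarrow> 'a \<Rightarrow> 'a" where v: "\<And>j. v j \<in> borel_measurable lebesgue"
      "\<And>j. N (\<lambda>x. norm (v j x)) \<le> ennreal (C * (1 + S))"
      "\<And>\<phi> i. test_function \<Omega> \<phi> \<Longrightarrow> i \<in> Basis \<Longrightarrow>
          (\<lambda>j. LINT x|lebesgue. (v j x \<bullet> i) * \<phi> x) \<longlonglongrightarrow> - (LINT x:\<Omega>|lebesgue. f x * frechet_derivative \<phi> (at x) i)"
      using C(2)[OF op lf S] by blast
    have R0: "0 \<le> C * (1 + S)" using C S by simp
    obtain G where G[measurable]: "G \<in> borel_measurable lebesgue" and GN: "N (\<lambda>x. norm (G x)) \<le> ennreal (C * (1 + S))"
      and GL: "\<And>\<phi> i. test_function \<Omega> \<phi> \<Longrightarrow> i \<in> Basis \<Longrightarrow>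
        (LINT x|lebesgue. (G x \<bullet> i) * \<phi> x) = - (LINT x:\<Omega>|lebesgue. f x * frechet_derivative \<phi> (at x) i)"
      using X.bounded_fields_weak_limit[where L = "\<lambda>\<phi> i. - (LINT x:\<Omega>|lebesgue. f x * frechet_derivative \<phi> (at x) i)", OF ac v(1,2) R0 v(3)]
      by blast
    have fin: "N (\<lambda>x. norm (G x)) < \<infinity>" using GN by (simp add: order_le_less_trans)
    have "weak_gradient \<Omega> f G" unfolding weak_gradient_def
    proof (intro conjI ballI allI impI lf X.finite_norm_imp_locally_integrable[OF G fin])
      fix \<phi> i assume tf: "test_function \<Omega> \<phi>" and i: "i \<in> (Basis :: 'a set)"
      have "\<phi> x = 0" if "x \<notin> \<Omega>" for x
        using tf that closure_subset[of "{x. \<phi> x \<noteq> 0}"] by (auto simp: test_function_def)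
      then have "(LINT x:\<Omega>|lebesgue. (G x \<bullet> i) * \<phi> x) = (LINT x|lebesgue. (G x \<bullet> i) * \<phi> x)"
        unfolding set_lebesgue_integral_def by (intro Bochner_Integration.integral_cong) (auto simp: indicator_def)
      then show "(LINT x:\<Omega>|lebesgue. f x * frechet_derivative \<phi> (at x) i) = - (LINT x:\<Omega>|lebesgue. (G x \<bullet> i) * \<phi> x)"
        using GL[OF tf i] by simp
    qed
    moreover have "restr_norm N \<Omega> (\<lambda>x. norm (G x)) \<le> ennreal (C * (1 + S))"
    proof -
      have [measurable]: "\<Omega> \<in> sets lebesgue" using op by simp
      have "restr_norm N \<Omega> (\<lambda>x. norm (G x)) \<le> N (\<lambda>x. norm (G x))"
        unfolding restr_norm_def by (intro X.mono AE_I2) auto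
      then show ?thesis using GN by (rule order_trans)
    qed
    ultimately show "\<exists>G. weak_gradient \<Omega> f G \<and> restr_norm N \<Omega> (\<lambda>x. norm (G x)) \<le> ennreal (C * (1 + S))" by blast
  qed
qed

end

theorem theorem3p12:
  fixes \<Omega> :: "'a::euclidean_space set" and N :: "('a \<Rightarrow> real) \<Rightarrow> ennreal"
    and \<epsilon> p \<gamma> :: real
  assumes dom: "eps_infty_domain \<epsilon> \<Omega>" and eps: "0 < \<epsilon>" "\<epsilon> \<le> 1"
    and p: "1 \<le> p" and gamma: "\<gamma> \<noteq> 0"
    and X: "ball_Banach_function_space N"
    and i: "ball_Banach_function_space (convexification p N)"
    and ii: "absolutely_continuous_norm N" "absolutely_continuous_norm (associate_norm N)"
    and iii: "maximal_bounded_on (associate_norm (convexification p N))"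
    and iv: "p = 1 \<Longrightarrow> maximal_bounded_on N"
  shows "\<exists>C1 C2::real. 0 < C1 \<and> 0 < C2 \<and>
    (\<forall>f. (in_homogeneous_Sobolev N \<Omega> f \<longleftrightarrow>
           locally_integrable_on f \<Omega> \<and> level_sup N \<Omega> f p \<gamma> < \<infinity>) \<and>
         (\<forall>G. weak_gradient \<Omega> f G \<and> restr_norm N \<Omega> (\<lambda>x. norm (G x)) < \<infinity> \<longrightarrow>
            ennreal C1 * restr_norm N \<Omega> (\<lambda>x. norm (G x)) \<le> level_sup N \<Omega> f p \<gamma> \<and>
            level_sup N \<Omega> f p \<gamma> \<le> ennreal C2 * restr_norm N \<Omega> (\<lambda>x. norm (G x))))"
proof -
  interpret convexified_bbfs N p
    by (intro convexified_bbfs.intro bbfs.intro convexified_bbfs_axioms.intro X i p iii iv)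
  have op: "open \<Omega>" using dom by (simp add: eps_infty_domain_def)
  obtain C2 :: real where C2: "0 < C2"
    "\<And>f G. weak_gradient \<Omega> f G \<Longrightarrow> restr_norm N \<Omega> (\<lambda>x. norm (G x)) < \<infinity> \<Longrightarrow>
      level_sup N \<Omega> f p \<gamma> \<le> ennreal C2 * restr_norm N \<Omega> (\<lambda>x. norm (G x))"
        using upper_bound[OF dom eps gamma] by blast
  obtain C :: real where C: "0 < C"
    "\<And>\<Omega> f S. open \<Omega> \<Longrightarrow> locally_integrable_on f \<Omega> \<Longrightarrow> level_sup N \<Omega> f p \<gamma> \<le> ennreal S \<Longrightarrow> 0 \<le> S \<Longrightarrow>
      \<exists>G. weak_gradient \<Omega> f G \<and> restr_norm N \<Omega> (\<lambda>x. norm (G x)) \<le> ennreal (C * (1 + S))"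
    using lower_bound[OF ii(2)] by blast
  have iff: "in_homogeneous_Sobolev N \<Omega> f \<longleftrightarrow> locally_integrable_on f \<Omega> \<and> level_sup N \<Omega> f p \<gamma> < \<infinity>" for f
  proof
    assume "in_homogeneous_Sobolev N \<Omega> f"
    then obtain G where G: "weak_gradient \<Omega> f G" "restr_norm N \<Omega> (\<lambda>x. norm (G x)) < \<infinity>"
      unfolding in_homogeneous_Sobolev_def by blast
    have "ennreal C2 * restr_norm N \<Omega> (\<lambda>x. norm (G x)) < \<infinity>" using G(2) by (simp add: ennreal_mult_less_top)
    then show "locally_integrable_on f \<Omega> \<and> level_sup N \<Omega> f p \<gamma> < \<infinity>"
      using C2(2)[OF G] G by (simp add: weak_gradient_def)
  next
    assume f: "locally_integrable_on f \<Omega> \<and> level_sup N \<Omega> f p \<gamma> < \<infinity>"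
    then obtain s where s: "0 \<le> s" "level_sup N \<Omega> f p \<gamma> = ennreal s" by (cases "level_sup N \<Omega> f p \<gamma>") auto
    then obtain G where "weak_gradient \<Omega> f G" "restr_norm N \<Omega> (\<lambda>x. norm (G x)) \<le> ennreal (C * (1 + s))"
      using C(2)[OF op, of f s] f by auto
    moreover from this have "restr_norm N \<Omega> (\<lambda>x. norm (G x)) < \<infinity>" by (simp add: order_le_less_trans)
    ultimately show "in_homogeneous_Sobolev N \<Omega> f" unfolding in_homogeneous_Sobolev_def by blast
  qed
  have lower: "ennreal (1 / C) * restr_norm N \<Omega> (\<lambda>x. norm (G x)) \<le> level_sup N \<Omega> f p \<gamma>"
    if G: "weak_gradient \<Omega> f G" and fin: "restr_norm N \<Omega> (\<lambda>x. norm (G x)) < \<infinity>" for f G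
  proof (cases "level_sup N \<Omega> f p \<gamma>")
    case (real s)
    let ?n = "\<lambda>G. restr_norm N \<Omega> (\<lambda>x. norm (G x))"
    obtain m where m: "0 \<le> m" "?n G = ennreal m" using fin by (cases "?n G") auto
    have gm: "(\<lambda>x. if x \<in> \<Omega> then norm (G x) else 0) \<in> borel_measurable lebesgue"
      by (rule restricted_gradient_measurable[OF op G])
    have bound: "m \<le> C / t + C * s" if t: "0 < t" for t
    proof -
      have wt: "weak_gradient \<Omega> (\<lambda>x. t * f x) (\<lambda>x. t *\<^sub>R G x)" by (rule weak_gradient_scale[OF G])
      then have lt: "locally_integrable_on (\<lambda>x. t * f x) \<Omega>" by (simp add: weak_gradient_def)
      have "level_sup N \<Omega> (\<lambda>x. t * f x) p \<gamma> \<le> ennreal (t * s)"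
        using t real by (simp add: level_sup_scale ennreal_mult)
      then obtain H where H: "weak_gradient \<Omega> (\<lambda>x. t * f x) H" "?n H \<le> ennreal (C * (1 + t * s))"
        using C(2)[OF op lt, of "t * s"] t real by auto
      \<comment> \<open>\<open>H\<close> is merely some weak gradient of the scaled function; it
        agrees with \<open>t *\<^sub>R G x\<close> almost everywhere on \<open>\<Omega>\<close>, so
        the restricted norms coincide.\<close>
      have "?n (\<lambda>x. t *\<^sub>R G x) = ?n H" unfolding restr_norm_def
      proof (rule X.cong_AE)
        show "AE x in lebesgue. \<bar>if x \<in> \<Omega> then norm (t *\<^sub>R G x) else 0\<bar> = \<bar>if x \<in> \<Omega> then norm (H x) else 0\<bar>"
          using weak_gradient_unique[OF op wt H(1)] by eventually_elim auto
      qed (rule restricted_gradient_measurable[OF op H(1)] restricted_gradient_measurable[OF op wt])+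
      moreover have "?n (\<lambda>x. t *\<^sub>R G x) = ennreal t * ?n G"
      proof -
        have "?n (\<lambda>x. t *\<^sub>R G x) = N (\<lambda>x. t * (if x \<in> \<Omega> then norm (G x) else 0))"
          unfolding restr_norm_def using t by (intro arg_cong[of _ _ N]) (auto simp: fun_eq_iff)
        also have "\<dots> = ennreal \<bar>t\<bar> * N (\<lambda>x. if x \<in> \<Omega> then norm (G x) else 0)" by (rule X.cmult[OF gm])
        finally show ?thesis using t by (simp add: restr_norm_def)
      qed
      ultimately have "ennreal (t * m) \<le> ennreal (C * (1 + t * s))" using H(2) m t by (simp add: ennreal_mult)
      then have "t * m \<le> C * (1 + t * s)" using C(1) t real by (subst (asm) ennreal_le_iff) auto
      then show ?thesis using t by (simp add: field_simps)
    qed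
    have "m \<le> C * s"
    proof (rule field_le_epsilon)
      fix e :: real assume e: "0 < e"
      \<comment> \<open>With \<open>t = C / e\<close> the additive term \<open>C / t\<close> equals
        \<open>e\<close>.\<close>
      show "m \<le> C * s + e" using bound[of "C / e"] C(1) e by (simp add: add.commute)
    qed
    then have "1 / C * m \<le> s" using C(1) by (simp add: field_simps)
    then show ?thesis using m real C(1) by (simp add: ennreal_leI flip: ennreal_mult)
  qed simp
  have "0 < 1 / C" using C(1) by simp
  then show ?thesis using C2 iff lower by blast
qed

end
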